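(* The following algorithms for $k$-Subset Edge Separator exist: (a) for every $\varepsilon>0$, a $(2+\varepsilon)$-approximation algorithm running in time $2^{O(k\log(k/\varepsilon))}n^{O(1)}$ for the case $R=V(G)$; (b) a $2$-approximation algorithm running in time $n^{k+O(1)}$; (c) for every $\varepsilon>0$, a $(2+\varepsilon)$-approximation algorithm running in time $2^{O(k^2\deg(G)/\varepsilon)}n^{O(1)}$.
   Context: $k$-Subset Edge Separator: given a graph $G$, a terminal set $R\subseteq V(G)$ and an integer $k$, find a minimum-size set of edges whose deletion leaves every connected component with at most $k$ vertices of $R$. $n=|V(G)|$, $\deg(G)$ is the maximum degree of $G$. Constants in $O(\cdot)$ are absolute.
   Formalization: In (a), log(k/ε) is read as max(1, log₂(k/ε)), because log(k/ε) is zero or negative for ε ≥ k and the stated running time would then tend to 0 as ε grows. *)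

theory Defs
  imports Complex_Main
begin

section \<open>Edge separators\<close>

text \<open>Graphs are finite, simple, undirected and nonempty; an edge is a two-element vertex set.\<close>

definition fin_graph :: "'a set \<Rightarrow> 'a set set \<Rightarrow> bool" where
  "fin_graph V E \<longleftrightarrow> finite V \<and> V \<noteq> {} \<and> (\<forall>e\<in>E. e \<subseteq> V \<and> card e = 2)"

definition components :: "'a set \<Rightarrow> 'a set set \<Rightarrow> 'a set set" where
  "components V E = (\<lambda>v. {u \<in> V. (v, u) \<in> {(x, y). {x, y} \<in> E}\<^sup>*}) ` V"

definition max_degree :: "'a set \<Rightarrow> 'a set set \<Rightarrow> nat" where
  "max_degree V E = Max ((\<lambda>v. card {e \<in> E. v \<in> e}) ` V)"

definition edge_separator ::
    "'a set \<Rightarrow> 'a set set \<Rightarrow> 'a set \<Rightarrow> nat \<Rightarrow> 'a set set \<Rightarrow> bool" where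
  "edge_separator V E R k F \<longleftrightarrow>
     F \<subseteq> E \<and> (\<forall>C \<in> components V (E - F). card (C \<inter> R) \<le> k)"

text \<open>For \<open>k \<ge> 1\<close> the minimum is over a nonempty finite set, since \<open>E\<close> itself is a separator.\<close>

definition opt_separator :: "'a set \<Rightarrow> 'a set set \<Rightarrow> 'a set \<Rightarrow> nat \<Rightarrow> nat" where
  "opt_separator V E R k = Min (card ` {F. edge_separator V E R k F})"


section \<open>Model of computation\<close>

text \<open>
  Deterministic structured programs on a successor RAM: registers and a memory, both holding
  natural numbers, with indirect addressing of the memory. Every instruction and every
  evaluation of a test takes one time unit. The only arithmetic is increment and decrement, so
  after \<open>t\<close> steps every value and address exceeds the largest input value or program constant
  by at most \<open>t\<close>. This makes unit cost legitimate: no information can be packed into huge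
  numbers, and the model agrees with the logarithmic-cost RAM up to polylogarithmic factors in
  the running time. In the constructors, register indices come in the order target, source.
\<close>

datatype com =
    Skip
  | Const nat nat
  | Copy nat nat
  | Inc nat
  | Dec nat
  | Load nat nat     \<comment> \<open>\<open>Load x a\<close>: register \<open>x\<close> receives the memory cell addressed by register \<open>a\<close>\<close>
  | Store nat nat    \<comment> \<open>\<open>Store a x\<close>: the memory cell addressed by register \<open>a\<close> receives register \<open>x\<close>\<close>
  | Seq com com
  | IfLess nat nat com com
  | WhileLess nat nat com

type_synonym state = "(nat \<Rightarrow> nat) \<times> (nat \<Rightarrow> nat)"  \<comment> \<open>registers, memory\<close>

text \<open>\<open>exec A s t s'\<close>: program \<open>A\<close> started in \<open>s\<close> halts in \<open>s'\<close> after exactly \<open>t\<close> time units.\<close>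

inductive exec :: "com \<Rightarrow> state \<Rightarrow> nat \<Rightarrow> state \<Rightarrow> bool" where
  Skip: "exec Skip s 1 s"
| Const: "exec (Const x c) (r, m) 1 (r(x := c), m)"
| Copy: "exec (Copy x y) (r, m) 1 (r(x := r y), m)"
| Inc: "exec (Inc x) (r, m) 1 (r(x := r x + 1), m)"
| Dec: "exec (Dec x) (r, m) 1 (r(x := r x - 1), m)"
| Load: "exec (Load x a) (r, m) 1 (r(x := m (r a)), m)"
| Store: "exec (Store a x) (r, m) 1 (r, m(r a := r x))"
| Seq: "exec A s t s' \<Longrightarrow> exec B s' t' s'' \<Longrightarrow> exec (Seq A B) s (t + t') s''"
| IfTrue: "fst s x < fst s y \<Longrightarrow> exec A s t s' \<Longrightarrow> exec (IfLess x y A B) s (1 + t) s'"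
| IfFalse: "\<not> fst s x < fst s y \<Longrightarrow> exec B s t s' \<Longrightarrow> exec (IfLess x y A B) s (1 + t) s'"
| WhileFalse: "\<not> fst s x < fst s y \<Longrightarrow> exec (WhileLess x y A) s 1 s"
| WhileTrue: "fst s x < fst s y \<Longrightarrow> exec A s t s' \<Longrightarrow> exec (WhileLess x y A) s' t' s'' \<Longrightarrow>
    exec (WhileLess x y A) s (1 + t + t') s''"

inductive_cases exec_elims:
  "exec Skip s t s'" "exec (Const x c) s t s'" "exec (Copy x y) s t s'" "exec (Inc x) s t s'"
  "exec (Dec x) s t s'" "exec (Load x a) s t s'" "exec (Store a x) s t s'"
  "exec (Seq A B) s t s'" "exec (IfLess x y A B) s t s'" "exec (WhileLess x y A) s t s'"

lemma exec_deterministic: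
  "exec A s t s' \<Longrightarrow> exec A s u s'' \<Longrightarrow> t = u \<and> s' = s''"
proof (induction arbitrary: u s'' rule: exec.induct)
  case (WhileTrue s x y A t s' t' s3)
  from WhileTrue.prems WhileTrue.hyps(1) obtain t1 s1 t2
    where "exec A s t1 s1" "exec (WhileLess x y A) s1 t2 s''" "u = 1 + t1 + t2"
    by (auto elim: exec.cases)
  with WhileTrue.IH show ?case by blast
qed (erule exec_elims; fastforce)+


section \<open>Approximation algorithms\<close>

text \<open>
  An instance \<open>(G, R, k)\<close> has \<open>V(G) = {0, \<dots>, n - 1}\<close>. Initially registers 0 and 1 contain \<open>n\<close>
  and \<open>k\<close>, memory cells \<open>0, \<dots>, n - 1\<close> the characteristic vector of \<open>R\<close> and the next \<open>n\<^sup>2\<close> cells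
  the adjacency matrix of \<open>G\<close>, row by row; everything else is 0. On halting, the nonzero entries
  of that \<open>n \<times> n\<close> block are the edges of the solution.
\<close>

definition input_state :: "nat \<Rightarrow> nat set set \<Rightarrow> nat set \<Rightarrow> nat \<Rightarrow> state" where
  "input_state n E R k =
     ((\<lambda>_. 0)(0 := n, 1 := k),
      (\<lambda>i. if i < n then of_bool (i \<in> R)
           else if i < n + n * n then of_bool ({(i - n) div n, (i - n) mod n} \<in> E)
           else 0))"

definition output_edges :: "nat \<Rightarrow> state \<Rightarrow> nat set set" where
  "output_edges n s = {{u, v} | u v. u < n \<and> v < n \<and> snd s (n + u * n + v) \<noteq> 0}"

text \<open>
  \<open>A\<close> is an \<open>\<alpha>\<close>-approximation algorithm for \<open>k\<close>-Subset Edge Separator on the instances that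
  satisfy \<open>P\<close>, with running time at most \<open>T\<close>. The arguments of \<open>P\<close> and \<open>T\<close> are \<open>n\<close>, \<open>E(G)\<close>,
  \<open>R\<close>, \<open>k\<close>.
\<close>

definition approx_algorithm ::
    "com \<Rightarrow> real \<Rightarrow> (nat \<Rightarrow> nat set set \<Rightarrow> nat set \<Rightarrow> nat \<Rightarrow> bool) \<Rightarrow>
     (nat \<Rightarrow> nat set set \<Rightarrow> nat set \<Rightarrow> nat \<Rightarrow> real) \<Rightarrow> bool" where
  "approx_algorithm A \<alpha> P T \<longleftrightarrow>
     (\<forall>n E R k. fin_graph {..<n} E \<and> R \<subseteq> {..<n} \<and> 1 \<le> k \<and> P n E R k \<longrightarrow>
        (\<exists>t s. exec A (input_state n E R k) t s \<and> real t \<le> T n E R k \<and>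
           edge_separator {..<n} E R k (output_edges n s) \<and>
           real (card (output_edges n s)) \<le> \<alpha> * real (opt_separator {..<n} E R k)))"

end

theory Submission
  imports Defs
begin

text \<open>
  The algorithms are local search. A move of a separator \<open>F\<close> by a vertex set \<open>S\<close> with at most \<open>k\<close>
  terminals replaces the edges of \<open>F\<close> that meet \<open>S\<close> by the boundary of \<open>S\<close>, which again is a separator. If
  no move by a component \<open>C\<close> of an optimal solution \<open>O\<close> improves \<open>F\<close>, then summing over all \<open>C\<close> gives
  \<open>|F| \<le> 2|O|\<close>, since every edge of \<open>O\<close> is in two boundaries and every edge of \<open>F\<close> meets a component.
  For a prescribed terminal set \<open>T\<close> of \<open>S\<close> the best move is a minimum cut, so it remains to enumerate the
  sets \<open>T\<close>: at most \<open>n\<^sup>k\<close> in (b). In (a) and (c) it is enough to enumerate the terminal sets of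
  components with boundary at most \<open>B\<close>, for a threshold \<open>B\<close> proportional to \<open>k\<^sup>2/\<epsilon>\<close> in (a) and
  \<open>k \<cdot> deg(G)/\<epsilon>\<close> in (c): for a component with a larger boundary, the at most \<open>k\<^sup>2\<close> edges inside it in (a), or
  the at most \<open>k \<cdot> deg(G)\<close> edges at its terminals in (c), are a negligible part of the boundary. The terminal sets
  of components with small boundary are found by branching on the vertices that have to be included or excluded,
  where each branch increases a bounded potential built from a minimum cut value and the number of included
  terminals; the branch to follow is read from a string of digits, and the algorithm runs through all strings.
\<close>

section \<open>Bounded-loop programs\<close>

text \<open>The number of strings decides the running time. In (a) a component has at most k
  vertices but a boundary of up to B edges, so its branch may contain about B exclusions and only k
  inclusions; one bit per answer would cost time exponential in k^2/\<epsilon>. A digit therefore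
  encodes a whole run of exclusions, in a base proportional to k/\<epsilon>, and 2k digits suffice.
  In (c) the obstacle is the inclusion of nonterminals, whose number is not bounded by k: those that
  leave the minimum cut to the other terminals unchanged are made without advice, each of the others
  is paid for by the potential. The thresholds come from the loss on a component with a large
  boundary, which may be at most \<epsilon>/2 times that boundary. In (c) the loss is 2k deg(G),
  once for the edges at the terminals and once for the boundary of the rest of the component, whence
  a factor 4/\<epsilon>; (a) uses the same factor. The parameter \<epsilon> enters the program only
  through two natural constants of the setup phase, so the size of the main program and the
  constants in the time bounds do not depend on it.\<close>

text \<open>
  A total language on registers, matrices \<open>ar\<close> and the raw memory \<open>io\<close> of the machine. Array indices are
  clipped to the content of \<open>rMM\<close>, and raw addresses have to be below the content of \<open>rOFF\<close>. The bound of a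
  loop is read once, on entry.
\<close>

datatype exp =
    Num nat
  | Reg nat
  | Plus1 exp
  | Minus1 exp
  | Arr nat exp exp
  | Io exp

datatype prog =
    Nop
  | Asg nat exp
  | Wr nat exp exp exp
  | Out exp exp
  | Sq prog prog  (infixr ";;" 60)
  | Cond exp exp prog prog
  | For nat nat prog

record hstate =
  rg :: "nat \<Rightarrow> nat"
  ar :: "nat \<Rightarrow> nat \<Rightarrow> nat \<Rightarrow> nat"
  io :: "nat \<Rightarrow> nat"

abbreviation (input) "rMM \<equiv> (2::nat)"
abbreviation (input) "rOFF \<equiv> (3::nat)"

primrec ev :: "exp \<Rightarrow> hstate \<Rightarrow> nat" where
  "ev (Num c) s = c"
| "ev (Reg x) s = rg s x"
| "ev (Plus1 e) s = Suc (ev e s)"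
| "ev (Minus1 e) s = ev e s - 1"
| "ev (Arr A e1 e2) s = ar s A (min (ev e1 s) (rg s rMM)) (min (ev e2 s) (rg s rMM))"
| "ev (Io e) s = (if ev e s < rg s rOFF then io s (ev e s) else 0)"

primrec iter :: "(nat \<Rightarrow> 's \<Rightarrow> 's) \<Rightarrow> nat \<Rightarrow> 's \<Rightarrow> 's" where
  "iter f 0 s = s"
| "iter f (Suc j) s = f j (iter f j s)"

definition setr :: "nat \<Rightarrow> nat \<Rightarrow> hstate \<Rightarrow> hstate" where
  "setr x v s = s\<lparr>rg := (rg s)(x := v)\<rparr>"

definition seta :: "nat \<Rightarrow> nat \<Rightarrow> nat \<Rightarrow> nat \<Rightarrow> hstate \<Rightarrow> hstate" where
  "seta A i j v s = s\<lparr>ar := (ar s)(A := (ar s A)(i := (ar s A i)(j := v)))\<rparr>"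

lemma setr_simps [simp]:
  "rg (setr x v s) = (rg s)(x := v)" "ar (setr x v s) = ar s" "io (setr x v s) = io s"
  by (simp_all add: setr_def)

lemma seta_simps [simp]:
  "rg (seta A i j v s) = rg s" "io (seta A i j v s) = io s"
  "ar (seta A i j v s) = (ar s)(A := (ar s A)(i := (ar s A i)(j := v)))"
  by (simp_all add: seta_def)

text \<open>A loop leaves its bound in the counter register, exactly as the compiled
  \<open>WhileLess\<close> does. This allows \<open>sim\<close> to demand equality on all program
  registers.\<close>

primrec run :: "prog \<Rightarrow> hstate \<Rightarrow> hstate" where
  "run Nop s = s"
| "run (Asg x e) s = setr x (ev e s) s"
| "run (Wr A e1 e2 e3) s = seta A (min (ev e1 s) (rg s rMM)) (min (ev e2 s) (rg s rMM)) (ev e3 s) s"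
| "run (Out e1 e2) s =
     (if ev e1 s < rg s rOFF then s\<lparr>io := (io s)(ev e1 s := ev e2 s)\<rparr> else s)"
| "run (p ;; q) s = run q (run p s)"
| "run (Cond e1 e2 p q) s = (if ev e1 s < ev e2 s then run p s else run q s)"
| "run (For i b p) s =
     setr i (rg s b) (iter (\<lambda>j t. run p (setr i j t)) (rg s b) s)"

text \<open>An upper bound for the time of the compiled expression, with \<open>w\<close> the
  content of \<open>rMM\<close>. An array access pays \<open>50 * (w + 1)\<^sup>2\<close> for
  counting up the address and the rest for the access itself.\<close>

primrec ecost :: "exp \<Rightarrow> nat \<Rightarrow> nat" where
  "ecost (Num c) w = 1"
| "ecost (Reg x) w = 1"
| "ecost (Plus1 e) w = ecost e w + 1"
| "ecost (Minus1 e) w = ecost e w + 1"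
| "ecost (Arr A e1 e2) w = ecost e1 w + ecost e2 w + 51 * (w + 1)\<^sup>2"
| "ecost (Io e) w = ecost e w + 2"

text \<open>In a loop, the 2 outside the sum pays for clearing the counter and for the last test,
  the 2 inside for the test and the increment of each round.\<close>

primrec cost :: "prog \<Rightarrow> hstate \<Rightarrow> nat" where
  "cost Nop s = 1"
| "cost (Asg x e) s = ecost e (rg s rMM) + 1"
| "cost (Wr A e1 e2 e3) s =
     ecost e1 (rg s rMM) + ecost e2 (rg s rMM) + ecost e3 (rg s rMM) + 51 * (rg s rMM + 1)\<^sup>2"
| "cost (Out e1 e2) s = ecost e1 (rg s rMM) + ecost e2 (rg s rMM) + 2"
| "cost (p ;; q) s = cost p s + cost q (run p s)"
| "cost (Cond e1 e2 p q) s = ecost e1 (rg s rMM) + ecost e2 (rg s rMM) + 1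
     + (if ev e1 s < ev e2 s then cost p s else cost q s)"
| "cost (For i b p) s =
     2 + (\<Sum>j<rg s b. cost p (setr i j (iter (\<lambda>j t. run p (setr i j t)) j s)) + 2)"

primrec writes :: "prog \<Rightarrow> nat set" where
  "writes Nop = {}"
| "writes (Asg x e) = {x}"
| "writes (Wr A e1 e2 e3) = {}"
| "writes (Out e1 e2) = {}"
| "writes (p ;; q) = writes p \<union> writes q"
| "writes (Cond e1 e2 p q) = writes p \<union> writes q"
| "writes (For i b p) = insert i (writes p)"

primrec awrites :: "prog \<Rightarrow> nat set" where
  "awrites Nop = {}"
| "awrites (Asg x e) = {}"
| "awrites (Wr A e1 e2 e3) = {A}"
| "awrites (Out e1 e2) = {}"
| "awrites (p ;; q) = awrites p \<union> awrites q"
| "awrites (Cond e1 e2 p q) = awrites p \<union> awrites q"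
| "awrites (For i b p) = awrites p"

primrec no_out :: "prog \<Rightarrow> bool" where
  "no_out Nop = True"
| "no_out (Asg x e) = True"
| "no_out (Wr A e1 e2 e3) = True"
| "no_out (Out e1 e2) = False"
| "no_out (p ;; q) = (no_out p \<and> no_out q)"
| "no_out (Cond e1 e2 p q) = (no_out p \<and> no_out q)"
| "no_out (For i b p) = no_out p"

section \<open>Invariants and frame properties of loops\<close>

lemma iter_invariant:
  assumes "P 0 s" "\<And>j t. j < n \<Longrightarrow> P j t \<Longrightarrow> P (Suc j) (f j t)"
  shows "P n (iter f n s)"
proof -
  have "j \<le> n \<Longrightarrow> P j (iter f j s)" for j
    by (induction j) (use assms in auto)
  then show ?thesis by simp
qed

lemma rg_frame: "x \<notin> writes p \<Longrightarrow> rg (run p s) x = rg s x"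
proof (induction p arbitrary: s)
  case (For i b p)
  have "rg (iter (\<lambda>j t. run p (setr i j t)) n s) x = rg s x" for n
    by (induction n) (use For in auto)
  then show ?case using For.prems by simp
qed auto

lemma ar_frame: "A \<notin> awrites p \<Longrightarrow> ar (run p s) A = ar s A"
proof (induction p arbitrary: s)
  case (For i b p)
  have "ar (iter (\<lambda>j t. run p (setr i j t)) n s) A = ar s A" for n
    by (induction n) (use For in auto)
  then show ?case using For.prems by simp
qed auto

lemma io_frame: "no_out p \<Longrightarrow> io (run p s) = io s"
proof (induction p arbitrary: s)
  case (For i b p)
  have "io (iter (\<lambda>j t. run p (setr i j t)) n s) = io s" for n
    by (induction n) (use For in auto)
  then show ?case using For.prems by simp
qed auto

text \<open>In every round the registers outside \<open>writes\<close> and the arrays outside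
  \<open>awrites\<close> are available unchanged, so an invariant \<open>P\<close> only has to speak
  about what the body modifies.\<close>

lemma For_rule:
  assumes "P 0 s"
    and "\<And>j t. \<lbrakk>j < rg s b; P j t; \<And>x. x \<notin> insert i (writes p) \<Longrightarrow> rg t x = rg s x;
               \<And>A. A \<notin> awrites p \<Longrightarrow> ar t A = ar s A\<rbrakk> \<Longrightarrow> P (Suc j) (run p (setr i j t))"
    and "\<And>t. \<lbrakk>P (rg s b) t; \<And>x. x \<notin> insert i (writes p) \<Longrightarrow> rg t x = rg s x;
               \<And>A. A \<notin> awrites p \<Longrightarrow> ar t A = ar s A\<rbrakk> \<Longrightarrow> Q (setr i (rg s b) t)"
  shows "Q (run (For i b p) s)"
proof -
  have "P (rg s b) (iter (\<lambda>j t. run p (setr i j t)) (rg s b) s) \<and>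
     (\<forall>x. x \<notin> insert i (writes p) \<longrightarrow> rg (iter (\<lambda>j t. run p (setr i j t)) (rg s b) s) x = rg s x) \<and>
     (\<forall>A. A \<notin> awrites p \<longrightarrow> ar (iter (\<lambda>j t. run p (setr i j t)) (rg s b) s) A = ar s A)"
    (is "?I (rg s b) (iter ?f (rg s b) s)")
    by (rule iter_invariant[where P = "\<lambda>j t. P j t \<and> (\<forall>x. x \<notin> insert i (writes p) \<longrightarrow> rg t x = rg s x) \<and>
          (\<forall>A. A \<notin> awrites p \<longrightarrow> ar t A = ar s A)"])
      (use assms(1,2) in \<open>auto simp: rg_frame ar_frame\<close>)
  then show ?thesis using assms(3) by auto
qed

section \<open>Compilation\<close>

text \<open>Program registers are below 100, the registers from 100 on are scratch.\<close>

primrec incs :: "nat \<Rightarrow> nat \<Rightarrow> com" where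
  "incs x 0 = Skip"
| "incs x (Suc k) = Seq (Inc x) (incs x k)"

definition cfor :: "nat \<Rightarrow> nat \<Rightarrow> com \<Rightarrow> com" where
  "cfor i b A = Seq (Const i 0) (WhileLess i b (Seq A (Inc i)))"

text \<open>The machine cannot add or multiply, so the address is counted up. The loops run up to
  the content of \<open>rMM\<close> and compare the counter with the index, which clips the index on
  the way. The sixteen arrays are interleaved, hence steps of 16; one row amounts to
  \<open>rMM + 1\<close> such steps.\<close>

definition address :: "nat \<Rightarrow> nat \<Rightarrow> com" where
  "address d A =
     Seq (Copy (d + 2) rOFF) (Seq (incs (d + 2) A)
     (Seq (cfor (d + 3) rMM (IfLess (d + 3) d
        (Seq (incs (d + 2) 16) (cfor (d + 4) rMM (incs (d + 2) 16))) Skip))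
     (cfor (d + 3) rMM (IfLess (d + 3) (d + 1) (incs (d + 2) 16) Skip))))"

primrec ecomp :: "exp \<Rightarrow> nat \<Rightarrow> com" where
  "ecomp (Num c) d = Const d c"
| "ecomp (Reg x) d = Copy d x"
| "ecomp (Plus1 e) d = Seq (ecomp e d) (Inc d)"
| "ecomp (Minus1 e) d = Seq (ecomp e d) (Dec d)"
| "ecomp (Arr A e1 e2) d =
     Seq (ecomp e1 d) (Seq (ecomp e2 (d + 1)) (Seq (address d A) (Load d (d + 2))))"
| "ecomp (Io e) d = Seq (ecomp e d) (IfLess d rOFF (Load d d) (Const d 0))"

primrec compile :: "prog \<Rightarrow> com" where
  "compile Nop = Skip"
| "compile (Asg x e) = Seq (ecomp e 100) (Copy x 100)"
| "compile (Wr A e1 e2 e3) = Seq (ecomp e1 100) (Seq (ecomp e2 101) (Seq (address 100 A)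
     (Seq (ecomp e3 103) (Store 102 103))))"
| "compile (Out e1 e2) = Seq (ecomp e1 100) (Seq (ecomp e2 101)
     (IfLess 100 rOFF (Store 100 101) Skip))"
| "compile (p ;; q) = Seq (compile p) (compile q)"
| "compile (Cond e1 e2 p q) = Seq (ecomp e1 100) (Seq (ecomp e2 101)
     (IfLess 100 101 (compile p) (compile q)))"
| "compile (For i b p) = cfor i b (compile p)"

section \<open>Timed correctness of machine programs\<close>

definition halts :: "com \<Rightarrow> state \<Rightarrow> nat \<Rightarrow> (state \<Rightarrow> bool) \<Rightarrow> bool" where
  "halts A st T Q \<longleftrightarrow> (\<exists>t st'. exec A st t st' \<and> t \<le> T \<and> Q st')"

lemma halts_Seq:
  "\<lbrakk>halts A st T P; \<And>st'. P st' \<Longrightarrow> halts B st' T' Q; T + T' \<le> U\<rbrakk> \<Longrightarrow> halts (Seq A B) st U Q"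
  unfolding halts_def by (meson exec.Seq add_mono le_trans)

lemma halts_weaken:
  "\<lbrakk>halts A st T P; \<And>st'. P st' \<Longrightarrow> Q st'; T \<le> U\<rbrakk> \<Longrightarrow> halts A st U Q"
  unfolding halts_def by (meson le_trans)

lemma halts_basic:
  "1 \<le> T \<Longrightarrow> Q s \<Longrightarrow> halts Skip s T Q"
  "1 \<le> T \<Longrightarrow> Q (r(x := c), m) \<Longrightarrow> halts (Const x c) (r, m) T Q"
  "1 \<le> T \<Longrightarrow> Q (r(x := r y), m) \<Longrightarrow> halts (Copy x y) (r, m) T Q"
  "1 \<le> T \<Longrightarrow> Q (r(x := r x + 1), m) \<Longrightarrow> halts (Inc x) (r, m) T Q"
  "1 \<le> T \<Longrightarrow> Q (r(x := r x - 1), m) \<Longrightarrow> halts (Dec x) (r, m) T Q"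
  "1 \<le> T \<Longrightarrow> Q (r(x := m (r a)), m) \<Longrightarrow> halts (Load x a) (r, m) T Q"
  "1 \<le> T \<Longrightarrow> Q (r, m(r a := r x)) \<Longrightarrow> halts (Store a x) (r, m) T Q"
  unfolding halts_def by (meson exec.intros)+

lemma halts_IfLess:
  assumes "fst st x < fst st y \<Longrightarrow> halts A st T Q" "\<not> fst st x < fst st y \<Longrightarrow> halts B st T Q"
    "T + 1 \<le> U"
  shows "halts (IfLess x y A B) st U Q"
proof (cases "fst st x < fst st y")
  case True
  then obtain t st' where "exec A st t st'" "t \<le> T" "Q st'" using assms(1) by (auto simp: halts_def)
  then have "exec (IfLess x y A B) st (1 + t) st' \<and> 1 + t \<le> U \<and> Q st'"
    using True assms(3) exec.IfTrue[of st x y A t st' B] by simp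
  then show ?thesis unfolding halts_def by blast
next
  case False
  then obtain t st' where "exec B st t st'" "t \<le> T" "Q st'" using assms(2) by (auto simp: halts_def)
  then have "exec (IfLess x y A B) st (1 + t) st' \<and> 1 + t \<le> U \<and> Q st'"
    using False assms(3) exec.IfFalse[of st x y B t st' A] by simp
  then show ?thesis unfolding halts_def by blast
qed

text \<open>The time allowance \<open>T j\<close> may differ from round to round, because the cost
  of a loop body depends on the state in which the round starts.\<close>

lemma halts_cfor:
  assumes init: "P 0 (r(i := 0), m)"
    and inv: "\<And>j r m. j \<le> N \<Longrightarrow> P j (r, m) \<Longrightarrow> r i = j \<and> r b = N"
    and step: "\<And>j r m. j < N \<Longrightarrow> P j (r, m) \<Longrightarrow>
        halts A (r, m) (T j) (\<lambda>(r', m'). P (Suc j) (r'(i := r' i + 1), m'))"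
    and U: "2 + (\<Sum>j<N. T j + 2) \<le> U"
  shows "halts (cfor i b A) (r, m) U (P N)"
proof -
  \<comment> \<open>The induction is on the number \<open>d\<close> of remaining rounds, since a
    while loop unfolds from its first round.\<close>
  have loop: "halts (WhileLess i b (Seq A (Inc i))) st (1 + (\<Sum>j=N-d..<N. T j + 2)) (P N)"
    if "P (N - d) st" "d \<le> N" for d st
    using that
  proof (induction d arbitrary: st)
    case 0
    obtain r m where st: "st = (r, m)" by force
    have "r i = N" "r b = N" using inv[of N r m] 0 st by auto
    then have "exec (WhileLess i b (Seq A (Inc i))) st 1 st" by (intro exec.WhileFalse) (simp add: st)
    then show ?case using 0 unfolding halts_def by (intro exI[of _ 1] exI[of _ st]) auto
  next
    case (Suc d)
    obtain r m where st: "st = (r, m)" by force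
    let ?j = "N - Suc d"
    have j: "?j < N" "Suc ?j = N - d" using Suc.prems by auto
    have rb: "r i = ?j" "r b = N" using inv[of ?j r m] Suc.prems st by auto
    obtain t r' m' where e: "exec A (r, m) t (r', m')" "t \<le> T ?j" "P (N - d) (r'(i := r' i + 1), m')"
      using step[OF j(1), of r m] Suc.prems st unfolding halts_def j(2) by auto
    obtain t2 s2 where e2: "exec (WhileLess i b (Seq A (Inc i))) (r'(i := r' i + 1), m') t2 s2"
      "t2 \<le> 1 + (\<Sum>j=N-d..<N. T j + 2)" "P N s2"
      using Suc.IH[OF e(3)] Suc.prems by (auto simp: halts_def)
    have "exec (WhileLess i b (Seq A (Inc i))) st (1 + (t + 1) + t2) s2"
      by (rule exec.WhileTrue[OF _ exec.Seq[OF e(1)[folded st] exec.Inc] e2(1)]) (use rb j st in auto)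
    moreover have "(\<Sum>j=?j..<N. T j + 2) = T ?j + 2 + (\<Sum>j=N-d..<N. T j + 2)"
      using j by (simp add: sum.atLeast_Suc_lessThan)
    ultimately show ?case using e2(2,3) e(2) unfolding halts_def
      by (intro exI[of _ "1 + (t + 1) + t2"] exI[of _ s2]) auto
  qed
  have "halts (WhileLess i b (Seq A (Inc i))) (r(i := 0), m) (1 + (\<Sum>j<N. T j + 2)) (P N)"
    using loop[of N] init by (simp add: atLeast0LessThan)
  then show ?thesis unfolding cfor_def
    using U by (intro halts_Seq[where T = 1 and P = "\<lambda>st. st = (r(i := 0), m)"]) (auto intro: halts_basic)
qed

lemma halts_incs:
  "k + 1 \<le> T \<Longrightarrow> Q (r(x := r x + k), m) \<Longrightarrow> halts (incs x k) (r, m) T Q"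
proof (induction k arbitrary: r T)
  case 0
  then show ?case by (auto intro: halts_basic)
next
  case (Suc k)
  have eq: "(r(x := r x + 1))(x := (r(x := r x + 1)) x + k) = r(x := r x + Suc k)"
    by (simp add: fun_eq_iff)
  have "halts (incs x k) (r(x := r x + 1), m) (T - 1) Q"
  proof (rule Suc.IH)
    show "Q ((r(x := r x + 1))(x := (r(x := r x + 1)) x + k), m)"
      unfolding eq by (rule Suc.prems(2))
  qed (use Suc.prems in auto)
  then show ?case unfolding incs.simps
    by (intro halts_Seq[where T = 1 and T' = "T - 1" and P = "\<lambda>st. st = (r(x := r x + 1), m)"])
      (use Suc.prems in \<open>auto intro: halts_basic\<close>)
qed

definition cell :: "nat \<Rightarrow> nat \<Rightarrow> nat \<Rightarrow> nat \<Rightarrow> nat \<Rightarrow> nat" where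
  "cell off w A u v = off + A + 16 * ((w + 1) * u + v)"

text \<open>The residue modulo 16 identifies the array. The quotient is a row-major index with rows
  of length \<open>w + 1\<close>, from which row and column are recovered because columns are at
  most \<open>w\<close>.\<close>

lemma cell_inject:
  assumes "A < 16" "B < 16" "v \<le> w" "y \<le> w"
  shows "cell off w A u v = cell off w B x y \<longleftrightarrow> A = B \<and> u = x \<and> v = y"
proof -
  have "A = B \<and> (w + 1) * u + v = (w + 1) * x + y" if "A + 16 * ((w + 1) * u + v) = B + 16 * ((w + 1) * x + y)"
  proof -
    have "(A + 16 * z) mod 16 = A" "(B + 16 * z) mod 16 = B" for z
      using assms by simp_all
    then have "A = B" using that by metis
    then show ?thesis using that by simp
  qed
  moreover have "u = x \<and> v = y" if "(w + 1) * u + v = (w + 1) * x + y"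
  proof -
    have "(c * a + b) div c = a" "(c * a + b) mod c = b" if "b < c" for a b c :: nat
      using that by simp_all
    then show ?thesis using that assms by (metis less_Suc_eq_le Suc_eq_plus1)
  qed
  ultimately show ?thesis by (auto simp: cell_def)
qed

lemma halts_address:
  assumes d: "d \<ge> 100" and A: "A < 16" and off: "r rOFF = off" "r rMM = w"
    and T: "50 * (w + 1)\<^sup>2 \<le> T"
  shows "halts (address d A) (r, m) T
     (\<lambda>(r', m'). m' = m \<and> r' (d + 2) = cell off w A (min (r d) w) (min (r (d + 1)) w) \<and>
        (\<forall>x<d + 2. r' x = r x))"
proof -
  let ?u = "min (r d) w" and ?v = "min (r (d + 1)) w"
  \<comment> \<open>Both loops go through all \<open>w\<close> rounds but advance only while the
    counter is below the index, so after \<open>j\<close> rounds the address has moved by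
    \<open>min (r d) j\<close> rows, respectively by \<open>min (r (d + 1)) j\<close>
    columns.\<close>
  define P1 where "P1 = (\<lambda>j (r', m'). m' = m \<and> (\<forall>x<d + 2. r' x = r x) \<and> r' (d + 3) = j \<and>
     r' (d + 2) = off + A + 16 * ((w + 1) * min (r d) j))"
  define P2 where "P2 = (\<lambda>j (r', m'). m' = m \<and> (\<forall>x<d + 2. r' x = r x) \<and> r' (d + 3) = j \<and>
     r' (d + 2) = off + A + 16 * ((w + 1) * ?u) + 16 * min (r (d + 1)) j)"
  have rw: "rMM < d + 2" "rOFF < d + 2" "d < d + 2" "d + 1 < d + 2" using d by auto
  have inner: "halts (Seq (incs (d + 2) 16) (cfor (d + 4) rMM (incs (d + 2) 16))) (r1, m) (19 * w + 19)
     (\<lambda>(r', m'). m' = m \<and> (\<forall>x<d + 2. r' x = r1 x) \<and> r' (d + 3) = r1 (d + 3) \<and>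
        r' (d + 2) = r1 (d + 2) + 16 * (w + 1))" if "r1 rMM = w" for r1
  proof (rule halts_Seq[where T = 17 and T' = "19 * w + 2" and P = "\<lambda>st. st = (r1(d + 2 := r1 (d + 2) + 16), m)"])
    show "halts (incs (d + 2) 16) (r1, m) 17 (\<lambda>st. st = (r1(d + 2 := r1 (d + 2) + 16), m))"
      by (rule halts_incs) auto
    define P where "P = (\<lambda>j (r', m'). m' = m \<and> (\<forall>x<d + 2. r' x = r1 x) \<and> r' (d + 3) = r1 (d + 3) \<and> r' (d + 4) = j \<and>
        r' (d + 2) = r1 (d + 2) + 16 * (j + 1))"
    have "halts (cfor (d + 4) rMM (incs (d + 2) 16)) (r1(d + 2 := r1 (d + 2) + 16), m) (19 * w + 2) (P w)"
    proof (rule halts_cfor[where T = "\<lambda>_. 17"])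
      fix j r' m' assume "P j (r', m')"
      then show "r' (d + 4) = j \<and> r' rMM = w" using rw that by (auto simp: P_def)
    next
      fix j r' m' assume "P j (r', m')"
      then show "halts (incs (d + 2) 16) (r', m') 17
            (\<lambda>(r', m'). P (Suc j) (r'(d + 4 := r' (d + 4) + 1), m'))"
        by (intro halts_incs) (auto simp: P_def)
    qed (auto simp: P_def)
    then show "halts (cfor (d + 4) rMM (incs (d + 2) 16)) st (19 * w + 2)
          (\<lambda>(r', m'). m' = m \<and> (\<forall>x<d + 2. r' x = r1 x) \<and> r' (d + 3) = r1 (d + 3) \<and>
        r' (d + 2) = r1 (d + 2) + 16 * (w + 1))" if "st = (r1(d + 2 := r1 (d + 2) + 16), m)" for st
      using that by (auto elim!: halts_weaken simp: P_def)
  qed simp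
  have l1: "halts (cfor (d + 3) rMM (IfLess (d + 3) d
        (Seq (incs (d + 2) 16) (cfor (d + 4) rMM (incs (d + 2) 16))) Skip)) (r1, m) (2 + w * (19 * w + 22)) (P1 w)"
    if "\<forall>x<d + 2. r1 x = r x" "r1 (d + 2) = off + A" for r1
  proof (rule halts_cfor[where T = "\<lambda>_. 19 * w + 20"])
    show "P1 0 (r1(d + 3 := 0), m)" using that by (auto simp: P1_def)
  next
    fix j r' m' assume "P1 j (r', m')"
    then show "r' (d + 3) = j \<and> r' rMM = w" using rw off by (auto simp: P1_def)
  next
    fix j r' m' assume P: "P1 j (r', m')"
    have rd: "r' d = r d" "r' (d + 3) = j" "r' rMM = w" "m' = m" using P rw off by (auto simp: P1_def)
    show "halts (IfLess (d + 3) d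
        (Seq (incs (d + 2) 16) (cfor (d + 4) rMM (incs (d + 2) 16))) Skip) (r', m') (19 * w + 20)
        (\<lambda>(r', m'). P1 (Suc j) (r'(d + 3 := r' (d + 3) + 1), m'))"
    proof (rule halts_IfLess[where T = "19 * w + 19"])
      assume "fst (r', m') (d + 3) < fst (r', m') d"
      then have "j < r d" using rd by simp
      then have mn: "min (r d) j = j" "min (r d) (Suc j) = Suc j" by auto
      then show "halts (Seq (incs (d + 2) 16) (cfor (d + 4) rMM (incs (d + 2) 16))) (r', m') (19 * w + 19)
        (\<lambda>(r', m'). P1 (Suc j) (r'(d + 3 := r' (d + 3) + 1), m'))"
        using inner[of r', OF rd(3)] P rd
        by (auto elim!: halts_weaken simp: P1_def mn algebra_simps)
    next
      assume "\<not> fst (r', m') (d + 3) < fst (r', m') d"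
      then have "\<not> j < r d" using rd by simp
      then show "halts Skip (r', m') (19 * w + 19)
         (\<lambda>(r', m'). P1 (Suc j) (r'(d + 3 := r' (d + 3) + 1), m'))"
        using P by (intro halts_basic) (auto simp: P1_def min_def)
    qed simp
  qed (simp add: algebra_simps)
  have l2: "halts (cfor (d + 3) rMM (IfLess (d + 3) (d + 1) (incs (d + 2) 16) Skip)) (r1, m) (2 + w * 20) (P2 w)"
    if "P1 w (r1, m)" for r1
  proof (rule halts_cfor[where T = "\<lambda>_. 18"])
    show "P2 0 (r1(d + 3 := 0), m)" using that by (auto simp: P1_def P2_def)
  next
    fix j r' m' assume "P2 j (r', m')"
    then show "r' (d + 3) = j \<and> r' rMM = w" using rw off by (auto simp: P2_def)
  next
    fix j r' m' assume P: "P2 j (r', m')"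
    have rd: "r' (d + 1) = r (d + 1)" "r' (d + 3) = j" using P by (auto simp: P2_def)
    show "halts (IfLess (d + 3) (d + 1) (incs (d + 2) 16) Skip) (r', m') 18
        (\<lambda>(r', m'). P2 (Suc j) (r'(d + 3 := r' (d + 3) + 1), m'))"
      by (rule halts_IfLess[where T = 17])
        (use P rd in \<open>auto intro!: halts_incs halts_basic simp: P2_def min_def\<close>)
  qed (simp add: algebra_simps)
  \<comment> \<open>The sum is 19 w^2 + 42 w + 22, which the constant 50 covers generously.\<close>
  have T2: "1 + (17 + ((2 + w * (19 * w + 22)) + (2 + w * 20))) \<le> T"
    using T by (simp add: power2_eq_square algebra_simps)
  show ?thesis unfolding address_def
  proof (rule halts_Seq[where T = 1 and T' = "17 + ((2 + w * (19 * w + 22)) + (2 + w * 20))"])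
    show "halts (Copy (d + 2) rOFF) (r, m) 1 (\<lambda>st. st = (r(d + 2 := r rOFF), m))"
      by (rule halts_basic) simp_all
    fix st :: state assume st: "st = (r(d + 2 := r rOFF), m)"
    show "halts (Seq (incs (d + 2) A) (Seq (cfor (d + 3) rMM (IfLess (d + 3) d
        (Seq (incs (d + 2) 16) (cfor (d + 4) rMM (incs (d + 2) 16))) Skip))
        (cfor (d + 3) rMM (IfLess (d + 3) (d + 1) (incs (d + 2) 16) Skip)))) st
      (17 + ((2 + w * (19 * w + 22)) + (2 + w * 20))) (\<lambda>(r', m'). m' = m \<and> 
         r' (d + 2) = cell off w A ?u ?v \<and> (\<forall>x<d + 2. r' x = r x))"
    proof (rule halts_Seq[where T = 17])
      show "halts (incs (d + 2) A) st 17 (\<lambda>st. st = (r(d + 2 := off + A), m))"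
        unfolding st by (rule halts_incs) (use A off in auto)
      fix st1 :: state assume st1: "st1 = (r(d + 2 := off + A), m)"
      show "halts (Seq (cfor (d + 3) rMM (IfLess (d + 3) d
          (Seq (incs (d + 2) 16) (cfor (d + 4) rMM (incs (d + 2) 16))) Skip))
          (cfor (d + 3) rMM (IfLess (d + 3) (d + 1) (incs (d + 2) 16) Skip))) st1
        ((2 + w * (19 * w + 22)) + (2 + w * 20)) (\<lambda>(r', m'). m' = m \<and> 
           r' (d + 2) = cell off w A ?u ?v \<and> (\<forall>x<d + 2. r' x = r x))"
      proof (rule halts_Seq)
        show "halts (cfor (d + 3) rMM (IfLess (d + 3) d
          (Seq (incs (d + 2) 16) (cfor (d + 4) rMM (incs (d + 2) 16))) Skip)) st1
          (2 + w * (19 * w + 22)) (P1 w)"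
          unfolding st1 by (rule l1) auto
        fix st2 assume P: "P1 w st2"
        moreover obtain r1 m1 where st2: "st2 = (r1, m1)" by force
        ultimately have "m1 = m" "P1 w (r1, m)" by (auto simp: P1_def)
        then show "halts (cfor (d + 3) rMM (IfLess (d + 3) (d + 1) (incs (d + 2) 16) Skip)) st2
          (2 + w * 20) (\<lambda>(r', m'). m' = m \<and> 
           r' (d + 2) = cell off w A ?u ?v \<and> (\<forall>x<d + 2. r' x = r x))"
          using l2[of r1] off st2
          by (auto elim!: halts_weaken simp: P2_def cell_def algebra_simps)
      qed simp
    qed simp
  qed (use T2 in simp)
qed

primrec eregs :: "exp \<Rightarrow> nat set" where
  "eregs (Num c) = {}"
| "eregs (Reg x) = {x}"
| "eregs (Plus1 e) = eregs e"
| "eregs (Minus1 e) = eregs e"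
| "eregs (Arr A e1 e2) = eregs e1 \<union> eregs e2"
| "eregs (Io e) = eregs e"

primrec earrs :: "exp \<Rightarrow> nat set" where
  "earrs (Num c) = {}"
| "earrs (Reg x) = {}"
| "earrs (Plus1 e) = earrs e"
| "earrs (Minus1 e) = earrs e"
| "earrs (Arr A e1 e2) = insert A (earrs e1 \<union> earrs e2)"
| "earrs (Io e) = earrs e"

text \<open>Without arrays (\<open>b = False\<close>) the whole memory is visible as raw memory; with arrays only the
  cells below the content of \<open>rOFF\<close> are.\<close>

definition ewf :: "bool \<Rightarrow> exp \<Rightarrow> bool" where
  "ewf b e \<longleftrightarrow> eregs e \<subseteq> {..<100} \<and> earrs e \<subseteq> (if b then {..<16} else {})"

lemma ewf_simps [simp]:
  "ewf b (Num c)" "ewf b (Reg x) \<longleftrightarrow> x < 100" "ewf b (Plus1 e) \<longleftrightarrow> ewf b e"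
  "ewf b (Minus1 e) \<longleftrightarrow> ewf b e" "ewf b (Io e) \<longleftrightarrow> ewf b e"
  "ewf b (Arr A e1 e2) \<longleftrightarrow> b \<and> A < 16 \<and> ewf b e1 \<and> ewf b e2"
  by (auto simp: ewf_def)

text \<open>With arrays, \<open>rMM\<close> and \<open>rOFF\<close> must stay fixed because the
  layout of the memory depends on them. A loop body writes neither its counter nor its bound, so
  that the while loop makes as many rounds as the iteration in \<open>run\<close>.\<close>

primrec wf :: "bool \<Rightarrow> prog \<Rightarrow> bool" where
  "wf b Nop \<longleftrightarrow> True"
| "wf b (Asg x e) \<longleftrightarrow> x < 100 \<and> ewf b e \<and> (b \<longrightarrow> x \<noteq> rMM \<and> x \<noteq> rOFF)"
| "wf b (Wr A e1 e2 e3) \<longleftrightarrow> b \<and> A < 16 \<and> ewf b e1 \<and> ewf b e2 \<and> ewf b e3"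
| "wf b (Out e1 e2) \<longleftrightarrow> ewf b e1 \<and> ewf b e2"
| "wf b (p ;; q) \<longleftrightarrow> wf b p \<and> wf b q"
| "wf b (Cond e1 e2 p q) \<longleftrightarrow> ewf b e1 \<and> ewf b e2 \<and> wf b p \<and> wf b q"
| "wf b (For i c p) \<longleftrightarrow> i < 100 \<and> c < 100 \<and> i \<noteq> c \<and> i \<notin> writes p \<and> c \<notin> writes p
     \<and> wf b p \<and> (b \<longrightarrow> i \<noteq> rMM \<and> i \<noteq> rOFF)"

definition sim :: "bool \<Rightarrow> hstate \<Rightarrow> state \<Rightarrow> bool" where
  "sim b s = (\<lambda>(r, m). (\<forall>x<100. r x = rg s x) \<and> (\<forall>i. (b \<longrightarrow> i < rg s rOFF) \<longrightarrow> m i = io s i) \<and>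
     (b \<longrightarrow> (\<forall>A<16. \<forall>u\<le>rg s rMM. \<forall>v\<le>rg s rMM. m (cell (rg s rOFF) (rg s rMM) A u v) = ar s A u v)))"

text \<open>The scratch registers form a stack: the value goes to register \<open>d\<close> and
  everything below \<open>d\<close> survives, so operands can be evaluated into \<open>d\<close>,
  \<open>d + 1\<close> in turn. The registers \<open>r\<close> are kept apart from \<open>r0\<close>
  because scratch registers have changed since \<open>sim\<close> was established.\<close>

lemma halts_ecomp:
  assumes "ewf b e" "sim b s (r0, m)" "100 \<le> d" "\<forall>x<100. r x = r0 x"
  shows "halts (ecomp e d) (r, m) (ecost e (rg s rMM))
     (\<lambda>(r', m'). m' = m \<and> r' d = ev e s \<and> (\<forall>x<d. r' x = r x))"
  using assms
proof (induction e arbitrary: d r)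
  case (Num c)
  then show ?case by (auto intro!: halts_basic)
next
  case (Reg x)
  then show ?case by (auto intro!: halts_basic simp: sim_def)
next
  case (Plus1 e)
  have "halts (ecomp e d) (r, m) (ecost e (rg s rMM))
     (\<lambda>(r', m'). m' = m \<and> r' d = ev e s \<and> (\<forall>x<d. r' x = r x))"
    using Plus1 by auto
  then show ?case unfolding ecomp.simps
    by (rule halts_Seq[where T' = 1]) (auto intro!: halts_basic)
next
  case (Minus1 e)
  have "halts (ecomp e d) (r, m) (ecost e (rg s rMM))
     (\<lambda>(r', m'). m' = m \<and> r' d = ev e s \<and> (\<forall>x<d. r' x = r x))"
    using Minus1 by auto
  then show ?case unfolding ecomp.simps
    by (rule halts_Seq[where T' = 1]) (auto intro!: halts_basic)
next
  case (Io e)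
  have "halts (ecomp e d) (r, m) (ecost e (rg s rMM))
     (\<lambda>(r', m'). m' = m \<and> r' d = ev e s \<and> (\<forall>x<d. r' x = r x))"
    using Io by auto
  then show ?case unfolding ecomp.simps
  proof (rule halts_Seq[where T' = 2])
    fix st :: state assume "case st of (r', m') \<Rightarrow> m' = m \<and> r' d = ev e s \<and> (\<forall>x<d. r' x = r x)"
    then obtain r' where st: "st = (r', m)" "r' d = ev e s" "\<forall>x<d. r' x = r x" by (cases st) auto
    have off: "r' rOFF = rg s rOFF" using st Io.prems by (auto simp: sim_def)
    have "m i = io s i" if "i < rg s rOFF" for i using that Io.prems by (auto simp: sim_def)
    then show "halts (IfLess d rOFF (Load d d) (Const d 0)) st 2
       (\<lambda>(r', m'). m' = m \<and> r' d = ev (Io e) s \<and> (\<forall>x<d. r' x = r x))"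
      unfolding st(1) by (intro halts_IfLess[where T = 1] halts_basic) (use off st in auto)
  qed simp
next
  case (Arr A e1 e2)
  let ?W = "rg s rMM"
  have b: "b" "A < 16" using Arr.prems by auto
  have sim: "m (cell (rg s rOFF) ?W A (min x ?W) (min y ?W)) = ar s A (min x ?W) (min y ?W)" for x y
    using Arr.prems(2) b by (auto simp: sim_def)
  show ?case unfolding ecomp.simps
  proof (rule halts_Seq[where T' = "ecost e2 ?W + 51 * (?W + 1)\<^sup>2"])
    show "halts (ecomp e1 d) (r, m) (ecost e1 ?W)
     (\<lambda>(r', m'). m' = m \<and> r' d = ev e1 s \<and> (\<forall>x<d. r' x = r x))"
      using Arr by auto
    fix st1 :: state assume "case st1 of (r', m') \<Rightarrow> m' = m \<and> r' d = ev e1 s \<and> (\<forall>x<d. r' x = r x)"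
    then obtain r1 where st1: "st1 = (r1, m)" "r1 d = ev e1 s" "\<forall>x<d. r1 x = r x" by (cases st1) auto
    show "halts (Seq (ecomp e2 (d + 1)) (Seq (address d A) (Load d (d + 2)))) st1 (ecost e2 ?W + 51 * (?W + 1)\<^sup>2)
        (\<lambda>(r', m'). m' = m \<and> r' d = ev (Arr A e1 e2) s \<and> (\<forall>x<d. r' x = r x))"
      unfolding st1(1)
    proof (rule halts_Seq[where T' = "51 * (?W + 1)\<^sup>2"])
      show "halts (ecomp e2 (d + 1)) (r1, m) (ecost e2 ?W)
         (\<lambda>(r', m'). m' = m \<and> r' (d + 1) = ev e2 s \<and> (\<forall>x<d + 1. r' x = r1 x))"
        using Arr st1 by auto
      fix st2 :: state assume "case st2 of (r', m') \<Rightarrow> m' = m \<and> r' (d + 1) = ev e2 s \<and> (\<forall>x<d + 1. r' x = r1 x)"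
      then obtain r2 where st2: "st2 = (r2, m)" "r2 (d + 1) = ev e2 s" "\<forall>x<d + 1. r2 x = r1 x" by (cases st2) auto
      have rr: "r2 rOFF = rg s rOFF" "r2 rMM = ?W"
        using st1 st2 Arr.prems by (auto simp: sim_def)
      show "halts (Seq (address d A) (Load d (d + 2))) st2 (51 * (?W + 1)\<^sup>2)
        (\<lambda>(r', m'). m' = m \<and> r' d = ev (Arr A e1 e2) s \<and> (\<forall>x<d. r' x = r x))"
        unfolding st2(1)
      proof (rule halts_Seq[where T' = 1])
        show "halts (address d A) (r2, m) (50 * (?W + 1)\<^sup>2) 
          (\<lambda>(r', m'). m' = m \<and> r' (d + 2) = cell (rg s rOFF) ?W A (min (r2 d) ?W) (min (r2 (d + 1)) ?W) \<and>
        (\<forall>x<d + 2. r' x = r2 x))"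
          by (rule halts_address) (use rr b Arr.prems in auto)
        fix st3 :: state assume "case st3 of (r', m') \<Rightarrow> m' = m \<and> r' (d + 2) = cell (rg s rOFF) ?W A (min (r2 d) ?W) (min (r2 (d + 1)) ?W) \<and>
            (\<forall>x<d + 2. r' x = r2 x)"
        then obtain r3 where st3: "st3 = (r3, m)" "r3 (d + 2) = cell (rg s rOFF) ?W A (min (r2 d) ?W) (min (r2 (d + 1)) ?W)"
            "\<forall>x<d + 2. r3 x = r2 x" by (cases st3) auto
        show "halts (Load d (d + 2)) st3 1 (\<lambda>(r', m'). m' = m \<and> r' d = ev (Arr A e1 e2) s \<and> (\<forall>x<d. r' x = r x))"
          unfolding st3(1) using st1 st2 st3 sim by (intro halts_basic) auto
      qed (simp add: power2_eq_square)
    qed simp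
  qed simp
qed

lemma cell_ge: "off \<le> cell off w A u v"
  by (simp add: cell_def)

lemma halts_compile:
  assumes "wf b p" "sim b s st"
  shows "halts (compile p) st (cost p s) (sim b (run p s))"
  using assms
proof (induction p arbitrary: s st)
  case Nop
  then show ?case by (auto intro: halts_basic)
next
  case (Asg x e)
  obtain r m where st: "st = (r, m)" by force
  have e: "halts (ecomp e 100) (r, m) (ecost e (rg s rMM))
     (\<lambda>(r', m'). m' = m \<and> r' 100 = ev e s \<and> (\<forall>x<100. r' x = r x))"
    by (rule halts_ecomp) (use Asg st in auto)
  show ?case unfolding compile.simps st
    by (rule halts_Seq[OF e, where T' = 1])
      (use Asg st in \<open>auto intro!: halts_basic simp: sim_def\<close>)
next
  case (Wr A e1 e2 e3)
  let ?W = "rg s rMM"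
  obtain r m where st: "st = (r, m)" by force
  have b: "b" "A < 16" and r: "\<forall>x<100. r x = rg s x" using Wr st by (auto simp: sim_def)
  have sim: "sim b s (r, m)" using Wr st by simp
  show ?case unfolding compile.simps st
  proof (rule halts_Seq[where T' = "ecost e2 ?W + 50 * (?W + 1)\<^sup>2 + ecost e3 ?W + 1"])
    show "halts (ecomp e1 100) (r, m) (ecost e1 ?W)
     (\<lambda>(r', m'). m' = m \<and> r' 100 = ev e1 s \<and> (\<forall>x<100. r' x = r x))"
      by (rule halts_ecomp) (use Wr sim in auto)
    fix st1 :: state assume "case st1 of (r', m') \<Rightarrow> m' = m \<and> r' 100 = ev e1 s \<and> (\<forall>x<100. r' x = r x)"
    then obtain r1 where st1: "st1 = (r1, m)" "r1 100 = ev e1 s" "\<forall>x<100. r1 x = r x" by (cases st1) auto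
    show "halts (Seq (ecomp e2 101) (Seq (address 100 A) (Seq (ecomp e3 103) (Store 102 103)))) st1
        (ecost e2 ?W + 50 * (?W + 1)\<^sup>2 + ecost e3 ?W + 1) (sim b (run (Wr A e1 e2 e3) s))"
      unfolding st1(1)
    proof (rule halts_Seq[where T' = "50 * (?W + 1)\<^sup>2 + ecost e3 ?W + 1"])
      show "halts (ecomp e2 101) (r1, m) (ecost e2 ?W)
         (\<lambda>(r', m'). m' = m \<and> r' 101 = ev e2 s \<and> (\<forall>x<101. r' x = r1 x))"
        by (rule halts_ecomp) (use Wr sim st1 in auto)
      fix st2 :: state assume "case st2 of (r', m') \<Rightarrow> m' = m \<and> r' 101 = ev e2 s \<and> (\<forall>x<101. r' x = r1 x)"
      then obtain r2 where st2: "st2 = (r2, m)" "r2 101 = ev e2 s" "\<forall>x<101. r2 x = r1 x" by (cases st2) auto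
      have rr: "r2 rOFF = rg s rOFF" "r2 rMM = ?W" using st1 st2 r by auto
      show "halts (Seq (address 100 A) (Seq (ecomp e3 103) (Store 102 103))) st2
        (50 * (?W + 1)\<^sup>2 + ecost e3 ?W + 1) (sim b (run (Wr A e1 e2 e3) s))"
        unfolding st2(1)
      proof (rule halts_Seq[where T' = "ecost e3 ?W + 1"])
        show "halts (address 100 A) (r2, m) (50 * (?W + 1)\<^sup>2) 
          (\<lambda>(r', m'). m' = m \<and> r' 102 = cell (rg s rOFF) ?W A (min (r2 100) ?W) (min (r2 101) ?W) \<and>
          (\<forall>x<102. r' x = r2 x))"
          using halts_address[of 100 A r2 "rg s rOFF" ?W "50 * (?W + 1)\<^sup>2" m] rr b by simp
        fix st3 :: state assume "case st3 of (r', m') \<Rightarrow> m' = m \<and> r' 102 = cell (rg s rOFF) ?W A (min (r2 100) ?W) (min (r2 101) ?W) \<and>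
            (\<forall>x<102. r' x = r2 x)"
        then obtain r3 where st3: "st3 = (r3, m)" "r3 102 = cell (rg s rOFF) ?W A (min (ev e1 s) ?W) (min (ev e2 s) ?W)"
            "\<forall>x<102. r3 x = r2 x" using st1 st2 by (cases st3) auto
        show "halts (Seq (ecomp e3 103) (Store 102 103)) st3 (ecost e3 ?W + 1) (sim b (run (Wr A e1 e2 e3) s))"
          unfolding st3(1)
        proof (rule halts_Seq[where T' = 1])
          show "halts (ecomp e3 103) (r3, m) (ecost e3 ?W)
            (\<lambda>(r', m'). m' = m \<and> r' 103 = ev e3 s \<and> (\<forall>x<103. r' x = r3 x))"
            by (rule halts_ecomp) (use Wr sim st1 st2 st3 in auto)
          fix st4 :: state assume "case st4 of (r', m') \<Rightarrow> m' = m \<and> r' 103 = ev e3 s \<and> (\<forall>x<103. r' x = r3 x)"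
          then obtain r4 where st4: "st4 = (r4, m)" "r4 103 = ev e3 s" "\<forall>x<103. r4 x = r3 x" by (cases st4) auto
          have "sim b (run (Wr A e1 e2 e3) s) (r4, m(r4 102 := r4 103))"
            using sim b st1 st2 st3 st4 r cell_ge
            by (auto simp: sim_def cell_inject not_less[symmetric])
          then show "halts (Store 102 103) st4 1 (sim b (run (Wr A e1 e2 e3) s))"
            unfolding st4(1) by (intro halts_basic) auto
        qed simp
      qed simp
    qed simp
  qed (simp add: power2_eq_square)
next
  case (Out e1 e2)
  obtain r m where st: "st = (r, m)" by force
  have r: "\<forall>x<100. r x = rg s x" using Out st by (auto simp: sim_def)
  have sim: "sim b s (r, m)" using Out st by simp
  show ?case unfolding compile.simps st
  proof (rule halts_Seq[where T' = "ecost e2 (rg s rMM) + 2"])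
    show "halts (ecomp e1 100) (r, m) (ecost e1 (rg s rMM))
     (\<lambda>(r', m'). m' = m \<and> r' 100 = ev e1 s \<and> (\<forall>x<100. r' x = r x))"
      by (rule halts_ecomp) (use Out sim in auto)
    fix st1 :: state assume "case st1 of (r', m') \<Rightarrow> m' = m \<and> r' 100 = ev e1 s \<and> (\<forall>x<100. r' x = r x)"
    then obtain r1 where st1: "st1 = (r1, m)" "r1 100 = ev e1 s" "\<forall>x<100. r1 x = r x" by (cases st1) auto
    show "halts (Seq (ecomp e2 101) (IfLess 100 rOFF (Store 100 101) Skip)) st1
        (ecost e2 (rg s rMM) + 2) (sim b (run (Out e1 e2) s))"
      unfolding st1(1)
    proof (rule halts_Seq[where T' = 2])
      show "halts (ecomp e2 101) (r1, m) (ecost e2 (rg s rMM))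
         (\<lambda>(r', m'). m' = m \<and> r' 101 = ev e2 s \<and> (\<forall>x<101. r' x = r1 x))"
        by (rule halts_ecomp) (use Out sim st1 in auto)
      fix st2 :: state assume "case st2 of (r', m') \<Rightarrow> m' = m \<and> r' 101 = ev e2 s \<and> (\<forall>x<101. r' x = r1 x)"
      then obtain r2 where st2: "st2 = (r2, m)" "r2 101 = ev e2 s" "\<forall>x<101. r2 x = r1 x" by (cases st2) auto
      have rr: "r2 rOFF = rg s rOFF" "r2 100 = ev e1 s" using st1 st2 r by auto
      have cl: "cell (rg s rOFF) w A u v \<noteq> i" if "i < rg s rOFF" for w A u v i
        using that cell_ge[of "rg s rOFF" w A u v] by auto
      show "halts (IfLess 100 rOFF (Store 100 101) Skip) st2 2 (sim b (run (Out e1 e2) s))"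
        unfolding st2(1)
        by (intro halts_IfLess[where T = 1] halts_basic)
          (use rr st1 st2 sim cl in \<open>auto simp: sim_def\<close>)
    qed simp
  qed simp
next
  case (Sq p q)
  show ?case unfolding compile.simps
    by (rule halts_Seq[OF Sq.IH(1)]) (use Sq in auto)
next
  case (Cond e1 e2 p q)
  obtain r m where st: "st = (r, m)" by force
  have r: "\<forall>x<100. r x = rg s x" using Cond st by (auto simp: sim_def)
  have sim: "sim b s (r, m)" using Cond st by simp
  let ?c = "if ev e1 s < ev e2 s then cost p s else cost q s"
  show ?case unfolding compile.simps st
  proof (rule halts_Seq[where T' = "ecost e2 (rg s rMM) + 1 + ?c"])
    show "halts (ecomp e1 100) (r, m) (ecost e1 (rg s rMM))
     (\<lambda>(r', m'). m' = m \<and> r' 100 = ev e1 s \<and> (\<forall>x<100. r' x = r x))"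
      by (rule halts_ecomp) (use Cond sim in auto)
    fix st1 :: state assume "case st1 of (r', m') \<Rightarrow> m' = m \<and> r' 100 = ev e1 s \<and> (\<forall>x<100. r' x = r x)"
    then obtain r1 where st1: "st1 = (r1, m)" "r1 100 = ev e1 s" "\<forall>x<100. r1 x = r x" by (cases st1) auto
    show "halts (Seq (ecomp e2 101) (IfLess 100 101 (compile p) (compile q))) st1
        (ecost e2 (rg s rMM) + 1 + ?c) (sim b (run (Cond e1 e2 p q) s))"
      unfolding st1(1)
    proof (rule halts_Seq[where T' = "1 + ?c"])
      show "halts (ecomp e2 101) (r1, m) (ecost e2 (rg s rMM))
         (\<lambda>(r', m'). m' = m \<and> r' 101 = ev e2 s \<and> (\<forall>x<101. r' x = r1 x))"
        by (rule halts_ecomp) (use Cond sim st1 in auto)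
      fix st2 :: state assume "case st2 of (r', m') \<Rightarrow> m' = m \<and> r' 101 = ev e2 s \<and> (\<forall>x<101. r' x = r1 x)"
      then obtain r2 where st2: "st2 = (r2, m)" "r2 101 = ev e2 s" "\<forall>x<101. r2 x = r1 x" by (cases st2) auto
      have "sim b s st2" using sim st1 st2 by (auto simp: sim_def)
      then show "halts (IfLess 100 101 (compile p) (compile q)) st2 (1 + ?c) (sim b (run (Cond e1 e2 p q) s))"
        using Cond.IH(1)[of s st2] Cond.IH(2)[of s st2] Cond.prems st1 st2
        by (intro halts_IfLess[where T = ?c]) auto
    qed simp
  qed simp
next
  case (For i c p)
  obtain r m where st: "st = (r, m)" by force
  let ?f = "\<lambda>j t. run p (setr i j t)" and ?N = "rg s c"
  \<comment> \<open>The machine increments the counter at the end of a round, \<open>run\<close>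
    sets it at the beginning. Hence the invariant compares with the state after \<open>j\<close>
    rounds in which the counter is already set to \<open>j\<close>.\<close>
  define P where "P = (\<lambda>j. sim b (setr i j (iter ?f j s)))"
  have fr: "rg (iter ?f j s) x = rg s x" if "x \<notin> insert i (writes p)" for x j
    by (induction j) (use that in \<open>auto simp: rg_frame\<close>)
  have off: "x \<noteq> i" "x \<notin> writes p" if "b" "x = rMM \<or> x = rOFF" for x
  proof -
    have "wf b p \<Longrightarrow> x \<notin> writes p"
      using that by (induction p) auto
    then show "x \<noteq> i" "x \<notin> writes p" using For.prems that by auto
  qed
  have setr_sim: "sim b (setr i j t) (r'(i := j), m')" if "sim b t (r', m')" for j t r' m'
    using that off by (auto simp: sim_def)
  have "halts (cfor i c (compile p)) (r, m) (cost (For i c p) s) (P ?N)"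
  proof (rule halts_cfor[where T = "\<lambda>j. cost p (setr i j (iter ?f j s))"])
    show "P 0 (r(i := 0), m)" using For.prems st by (auto simp: P_def setr_sim)
  next
    fix j r' m' assume "P j (r', m')"
    then show "r' i = j \<and> r' c = ?N" using For.prems fr[of c j] by (auto simp: P_def sim_def)
  next
    fix j r' m' assume "P j (r', m')"
    then have "halts (compile p) (r', m') (cost p (setr i j (iter ?f j s))) (sim b (iter ?f (Suc j) s))"
      using For.IH[of "setr i j (iter ?f j s)" "(r', m')"] For.prems by (auto simp: P_def)
    then show "halts (compile p) (r', m') (cost p (setr i j (iter ?f j s)))
       (\<lambda>(r', m'). P (Suc j) (r'(i := r' i + 1), m'))"
    proof (rule halts_weaken)
      fix st' :: state assume a: "sim b (iter ?f (Suc j) s) st'"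
      obtain r2 m2 where st': "st' = (r2, m2)" by force
      have "rg (iter ?f (Suc j) s) i = j" using For.prems by (simp add: rg_frame)
      then have "r2 i = j" using a st' For.prems by (auto simp: sim_def)
      then show "case st' of (r', m') \<Rightarrow> P (Suc j) (r'(i := r' i + 1), m')"
        using setr_sim[of "iter ?f (Suc j) s" r2 m2 "Suc j"] a st' by (simp add: P_def)
    qed simp
  qed simp
  then show ?case by (simp add: P_def st)
qed

section \<open>Edge separators and local moves\<close>

definition bd :: "'a set set \<Rightarrow> 'a set \<Rightarrow> 'a set set" where
  "bd E S = {e \<in> E. e \<inter> S \<noteq> {} \<and> \<not> e \<subseteq> S}"

definition touch :: "'a set set \<Rightarrow> 'a set \<Rightarrow> 'a set set" where
  "touch E S = {e \<in> E. e \<inter> S \<noteq> {}}"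

definition move :: "'a set set \<Rightarrow> 'a set set \<Rightarrow> 'a set \<Rightarrow> 'a set set" where
  "move E F S = {e \<in> F. e \<inter> S = {}} \<union> bd E S"

definition comp_of :: "'a set \<Rightarrow> 'a set set \<Rightarrow> 'a \<Rightarrow> 'a set" where
  "comp_of V E v = {u \<in> V. (v, u) \<in> {(x, y). {x, y} \<in> E}\<^sup>*}"

lemma components_eq: "components V E = comp_of V E ` V"
  by (simp add: components_def comp_of_def)

lemma adj_sym: "sym ({(x, y). {x, y} \<in> E}\<^sup>*)"
  by (rule sym_rtrancl) (auto simp: sym_def insert_commute)

lemma comp_of_eq: "u \<in> comp_of V E v \<Longrightarrow> comp_of V E u = comp_of V E v"
proof -
  assume u: "u \<in> comp_of V E v"
  let ?A = "{(x, y). {x, y} \<in> E}\<^sup>*"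
  have uv: "(v, u) \<in> ?A" using u by (simp add: comp_of_def)
  then have "(u, v) \<in> ?A" by (rule symD[OF adj_sym])
  with uv have "(u, x) \<in> ?A \<longleftrightarrow> (v, x) \<in> ?A" for x by (meson rtrancl_trans)
  then show ?thesis by (simp add: comp_of_def)
qed

lemma components_subset: "C \<in> components V E \<Longrightarrow> C \<subseteq> V"
  by (auto simp: components_eq comp_of_def)

lemma components_closed:
  "C \<in> components V E \<Longrightarrow> x \<in> C \<Longrightarrow> y \<in> V \<Longrightarrow> {x, y} \<in> E \<Longrightarrow> y \<in> C"
  by (auto simp: components_eq comp_of_def intro: rtrancl_into_rtrancl)

locale fgraph =
  fixes V :: "nat set" and E :: "nat set set" and R :: "nat set"
  assumes graph: "fin_graph V E" and terminals: "R \<subseteq> V"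
begin

lemma finite_V: "finite V" and edge_subset: "e \<in> E \<Longrightarrow> e \<subseteq> V" and edge_card: "e \<in> E \<Longrightarrow> card e = 2"
  using graph by (auto simp: fin_graph_def)

lemma finite_E: "finite E"
  by (rule finite_subset[of E "Pow V"]) (use finite_V edge_subset in auto)

lemma edgeE:
  assumes "e \<in> E" obtains a b where "e = {a, b}" "a \<noteq> b" "a \<in> V" "b \<in> V"
  using edge_card[OF assms] edge_subset[OF assms] by (auto simp: card_2_iff)

lemma move_subset: "F \<subseteq> E \<Longrightarrow> move E F S \<subseteq> E"
  by (auto simp: move_def bd_def)

lemma card_touch:
  assumes "F \<subseteq> E" shows "card F = card {e \<in> F. e \<inter> S = {}} + card (touch F S)"
proof -
  have "finite F" using assms finite_E finite_subset by blast
  then have "card ({e \<in> F. e \<inter> S = {}} \<union> touch F S) = card {e \<in> F. e \<inter> S = {}} + card (touch F S)"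
    by (intro card_Un_disjoint) (auto simp: touch_def)
  moreover have "{e \<in> F. e \<inter> S = {}} \<union> touch F S = F" by (auto simp: touch_def)
  ultimately show ?thesis by simp
qed

lemma card_move:
  assumes "F \<subseteq> E" shows "card (move E F S) = card {e \<in> F. e \<inter> S = {}} + card (bd E S)"
proof -
  have "finite F" using assms finite_E finite_subset by blast
  then show ?thesis unfolding move_def
    by (intro card_Un_disjoint) (use finite_E in \<open>auto simp: bd_def\<close>)
qed

text \<open>No surviving edge crosses the boundary of \<open>S\<close>. A new component therefore
  lies inside \<open>S\<close>, which has at most \<open>k\<close> terminals, or avoids
  \<open>S\<close>; in the latter case its edges are outside \<open>F\<close>, and it is contained
  in a component left by \<open>F\<close>.\<close>

lemma separator_move:
  assumes F: "edge_separator V E R k F" and S: "card (S \<inter> R) \<le> k"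
  shows "edge_separator V E R k (move E F S)"
  unfolding edge_separator_def
proof (intro conjI ballI)
  show "move E F S \<subseteq> E" using F move_subset by (auto simp: edge_separator_def)
  fix C assume "C \<in> components V (E - move E F S)"
  then obtain v where v: "v \<in> V" "C = comp_of V (E - move E F S) v" by (auto simp: components_eq)
  let ?A = "{(x, y). {x, y} \<in> E - move E F S}" and ?B = "{(x, y). {x, y} \<in> E - F}"
  have edge: "(x \<in> S \<longleftrightarrow> y \<in> S) \<and> (x \<notin> S \<longrightarrow> (x, y) \<in> ?B)" if "(x, y) \<in> ?A" for x y
    using that by (auto simp: move_def bd_def)
  have path: "(v \<in> S \<longleftrightarrow> y \<in> S) \<and> (v \<notin> S \<longrightarrow> (v, y) \<in> ?B\<^sup>*)" if "(v, y) \<in> ?A\<^sup>*" for y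
    using that
  proof induction
    case (step y z)
    have "(y \<in> S \<longleftrightarrow> z \<in> S) \<and> (y \<notin> S \<longrightarrow> (y, z) \<in> ?B)" using step.hyps(2) by (rule edge)
    then show ?case using step.IH by (meson rtrancl.rtrancl_into_rtrancl)
  qed simp
  have fR: "finite R" using terminals finite_V finite_subset by blast
  show "card (C \<inter> R) \<le> k"
  proof (cases "v \<in> S")
    case True
    then have "C \<subseteq> S" using path v by (auto simp: comp_of_def)
    then have "card (C \<inter> R) \<le> card (S \<inter> R)" using fR by (intro card_mono) auto
    then show ?thesis using S by simp
  next
    case False
    then have "C \<subseteq> comp_of V (E - F) v" using path v by (auto simp: comp_of_def)
    then have "card (C \<inter> R) \<le> card (comp_of V (E - F) v \<inter> R)" using fR by (intro card_mono) auto
    also have "\<dots> \<le> k" using F v by (auto simp: edge_separator_def components_eq)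
    finally show ?thesis .
  qed
qed

lemma bd_component: "C \<in> components V (E - Q) \<Longrightarrow> bd E C \<subseteq> Q"
proof
  fix e assume C: "C \<in> components V (E - Q)" and e: "e \<in> bd E C"
  from e have eE: "e \<in> E" by (simp add: bd_def)
  then obtain x y where xy: "e = {x, y}" "x \<in> V" "y \<in> V" using edgeE by metis
  then have "x \<in> C \<and> y \<notin> C \<or> y \<in> C \<and> x \<notin> C" using e by (auto simp: bd_def)
  with xy eE obtain a b where ab: "e = {a, b}" "a \<in> C" "b \<notin> C" "e \<in> E" "b \<in> V"
    by (metis insert_commute)
  then show "e \<in> Q" using components_closed[OF C ab(2) ab(5)] by auto
qed

lemma sum_bd_components:
  assumes "Q \<subseteq> E"
  shows "(\<Sum>C\<in>components V (E - Q). card (bd E C)) \<le> 2 * card Q"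
proof -
  let ?P = "components V (E - Q)"
  have fP: "finite ?P" using finite_V by (simp add: components_eq)
  have fQ: "finite Q" using assms finite_E finite_subset by blast
  have "(\<Sum>C\<in>?P. card (bd E C)) = (\<Sum>C\<in>?P. card {e \<in> Q. e \<in> bd E C})"
  proof (intro sum.cong refl)
    fix C assume "C \<in> ?P"
    then have "bd E C \<subseteq> Q" by (rule bd_component)
    then have "bd E C = {e \<in> Q. e \<in> bd E C}" by auto
    then show "card (bd E C) = card {e \<in> Q. e \<in> bd E C}" by simp
  qed
  also have "\<dots> = (\<Sum>C\<in>?P. \<Sum>e\<in>Q. if e \<in> bd E C then 1 else 0)"
    using fQ by (intro sum.cong refl) (simp flip: sum.inter_filter)
  also have "\<dots> = (\<Sum>e\<in>Q. \<Sum>C\<in>?P. if e \<in> bd E C then 1 else 0)"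
    by (rule sum.swap)
  also have "\<dots> = (\<Sum>e\<in>Q. card {C \<in> ?P. e \<in> bd E C})"
    using fP by (intro sum.cong refl) (simp flip: sum.inter_filter)
  also have "\<dots> \<le> (\<Sum>e\<in>Q. 2)"
  proof (intro sum_mono)
    fix e assume "e \<in> Q"
    then have "e \<in> E" using assms by auto
    then obtain a b where ab: "e = {a, b}" by (rule edgeE)
    \<comment> \<open>A component whose boundary contains \<open>e\<close> contains an end of
      \<open>e\<close>, and a component is determined by any of its vertices.\<close>
    have "{C \<in> ?P. e \<in> bd E C} \<subseteq> {comp_of V (E - Q) a, comp_of V (E - Q) b}"
    proof
      fix C assume C: "C \<in> {C \<in> ?P. e \<in> bd E C}"
      then obtain x where x: "x \<in> e" "x \<in> C" by (auto simp: bd_def)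
      have "C = comp_of V (E - Q) x" using C x(2) comp_of_eq[of x V "E - Q"] by (auto simp: components_eq)
      then show "C \<in> {comp_of V (E - Q) a, comp_of V (E - Q) b}" using x ab by auto
    qed
    then have "card {C \<in> ?P. e \<in> bd E C} \<le> card {comp_of V (E - Q) a, comp_of V (E - Q) b}"
      by (intro card_mono) auto
    also have "\<dots> \<le> 2" by (simp add: card_insert_if)
    finally show "card {C \<in> ?P. e \<in> bd E C} \<le> 2" .
  qed
  finally show ?thesis by (simp add: mult.commute)
qed

lemma card_le_sum_touch:
  assumes "F \<subseteq> E"
  shows "card F \<le> (\<Sum>C\<in>components V Q. card (touch F C))"
proof -
  have "F \<subseteq> (\<Union>C\<in>components V Q. touch F C)"
  proof
    fix e assume e: "e \<in> F"
    then have "e \<in> E" using assms by auto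
    then obtain a b where ab: "e = {a, b}" "a \<in> V" by (rule edgeE)
    have "a \<in> comp_of V Q a" using ab by (auto simp: comp_of_def)
    then show "e \<in> (\<Union>C\<in>components V Q. touch F C)"
      using ab e by (auto simp: touch_def components_eq)
  qed
  moreover have "finite (components V Q)" using finite_V by (simp add: components_eq)
  moreover have "finite F" using assms finite_E finite_subset by blast
  then have "finite (touch F C)" for C by (simp add: touch_def)
  ultimately have "card F \<le> card (\<Union>C\<in>components V Q. touch F C)"
    by (intro card_mono finite_UN_I) auto
  also have "\<dots> \<le> (\<Sum>C\<in>components V Q. card (touch F C))"
    using finite_V by (intro card_UN_le) (simp add: components_eq)
  finally show ?thesis .
qed

text \<open>The slack of \<open>\<epsilon> / 2\<close> per boundary edge turns into
  \<open>\<epsilon>\<close> because the boundaries of the components together have size at most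
  \<open>2 * card Q\<close>.\<close>

lemma local_search_ratio:
  assumes F: "F \<subseteq> E" and Q: "Q \<subseteq> E"
    and loc: "\<And>C. C \<in> components V (E - Q) \<Longrightarrow>
       real (card (touch F C)) \<le> (1 + \<epsilon> / 2) * real (card (bd E C))" and eps: "\<epsilon> \<ge> 0"
  shows "real (card F) \<le> (2 + \<epsilon>) * real (card Q)"
proof -
  have "real (card F) \<le> (\<Sum>C\<in>components V (E - Q). real (card (touch F C)))"
    using card_le_sum_touch[OF F, of "E - Q"] by (simp flip: of_nat_sum)
  also have "\<dots> \<le> (\<Sum>C\<in>components V (E - Q). (1 + \<epsilon> / 2) * real (card (bd E C)))"
    by (intro sum_mono loc)
  also have "\<dots> = (1 + \<epsilon> / 2) * real (\<Sum>C\<in>components V (E - Q). card (bd E C))"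
    by (simp add: sum_distrib_left)
  also have "\<dots> \<le> (1 + \<epsilon> / 2) * real (2 * card Q)"
    using sum_bd_components[OF Q] eps by (intro mult_left_mono of_nat_mono) auto
  finally show ?thesis by (simp add: algebra_simps)
qed

subsection \<open>Branching towards a hidden vertex set\<close>

definition d :: "nat set \<Rightarrow> nat" where "d S = card (bd E S)"

text \<open>Both sides are sums over the edges, and the inequality already holds for each single
  edge, by inspection of the positions of its two ends.\<close>

lemma d_submodular: "d (S \<inter> A) + d (S \<union> A) \<le> d S + d A"
proof -
  have *: "d S = (\<Sum>e\<in>E. of_bool (e \<inter> S \<noteq> {} \<and> \<not> e \<subseteq> S))" for S
    using finite_E unfolding d_def bd_def of_bool_def by (simp flip: sum.inter_filter)
  show ?thesis unfolding * sum.distrib[symmetric]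
  proof (intro sum_mono)
    fix e assume "e \<in> E"
    then obtain a b where "e = {a, b}" by (rule edgeE)
    then show "of_bool (e \<inter> (S \<inter> A) \<noteq> {} \<and> \<not> e \<subseteq> S \<inter> A) + of_bool (e \<inter> (S \<union> A) \<noteq> {} \<and> \<not> e \<subseteq> S \<union> A)
      \<le> of_bool (e \<inter> S \<noteq> {} \<and> \<not> e \<subseteq> S) + (of_bool (e \<inter> A \<noteq> {} \<and> \<not> e \<subseteq> A) :: nat)"
      by (cases "a \<in> S"; cases "b \<in> S"; cases "a \<in> A"; cases "b \<in> A") auto
  qed
qed

text \<open>The minimum cut between \<open>S\<close> and \<open>X\<close>, with \<open>S\<close> on
  the counted side. For \<open>S\<close> inside \<open>V\<close> and empty \<open>X\<close> it is 0,
  as \<open>V\<close> itself has no boundary.\<close>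

definition mval :: "nat set \<Rightarrow> nat set \<Rightarrow> nat" where
  "mval S X = Min (d ` {A. S \<subseteq> A \<and> A \<subseteq> V - X})"

lemma finite_cuts: "finite {A. S \<subseteq> A \<and> A \<subseteq> V - X}"
  by (rule finite_subset[of _ "Pow V"]) (use finite_V in auto)

lemma mval_le: "S \<subseteq> A \<Longrightarrow> A \<subseteq> V - X \<Longrightarrow> mval S X \<le> d A"
  unfolding mval_def by (intro Min_le finite_imageI finite_cuts imageI) simp

lemma mval_attained:
  assumes "S \<subseteq> V - X" obtains A where "S \<subseteq> A" "A \<subseteq> V - X" "d A = mval S X"
proof -
  have "mval S X \<in> d ` {A. S \<subseteq> A \<and> A \<subseteq> V - X}"
    unfolding mval_def
  proof (rule Min_in)
    show "finite (d ` {A. S \<subseteq> A \<and> A \<subseteq> V - X})" by (intro finite_imageI finite_cuts)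
    have "S \<in> {A. S \<subseteq> A \<and> A \<subseteq> V - X}" using assms by simp
    then show "d ` {A. S \<subseteq> A \<and> A \<subseteq> V - X} \<noteq> {}" by fast
  qed
  then obtain A where "A \<in> {A. S \<subseteq> A \<and> A \<subseteq> V - X}" "mval S X = d A" by (rule imageE)
  then show ?thesis using that[of A] by simp
qed

lemma mval_mono: "S \<subseteq> S' \<Longrightarrow> X \<subseteq> X' \<Longrightarrow> S' \<subseteq> V - X' \<Longrightarrow> mval S X \<le> mval S' X'"
proof -
  assume *: "S \<subseteq> S'" "X \<subseteq> X'" "S' \<subseteq> V - X'"
  obtain A where "S' \<subseteq> A" "A \<subseteq> V - X'" "d A = mval S' X'" using mval_attained[OF *(3)] .
  then have "mval S X \<le> d A" using * by (intro mval_le) (meson subset_trans, meson Diff_mono subset_refl subset_trans)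
  then show ?thesis using \<open>d A = mval S' X'\<close> by simp
qed

text \<open>A branching step with included vertices \<open>S\<close> and excluded vertices \<open>X\<close> first tries to isolate terminals:
  excluding \<open>t\<close> must increase the minimum cut. Otherwise it takes a neighbour of \<open>S\<close>, which is included
  without branching if this does not increase the minimum cut between \<open>S\<close> and the other terminals.\<close>

definition rule1 :: "nat set \<Rightarrow> nat set \<Rightarrow> nat \<Rightarrow> bool" where
  "rule1 S X t \<longleftrightarrow> t \<in> R \<and> t \<notin> S \<and> t \<notin> X \<and> mval S X < mval S (insert t X)"

definition nbr :: "nat set \<Rightarrow> nat set \<Rightarrow> nat \<Rightarrow> bool" where
  "nbr S X u \<longleftrightarrow> u \<notin> S \<and> u \<notin> X \<and> (\<exists>w\<in>S. {w, u} \<in> E)"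

definition free :: "nat set \<Rightarrow> nat set \<Rightarrow> nat \<Rightarrow> bool" where
  "free S X u \<longleftrightarrow> u \<notin> R \<and> mval (insert u S) (X \<union> (R - S)) \<le> mval S (X \<union> (R - S))"

text \<open>The first component is 0 if there is nothing to do, 1 for a branch and 2 for a free inclusion.\<close>

definition pick :: "nat set \<Rightarrow> nat set \<Rightarrow> nat \<times> nat" where
  "pick S X = (if \<exists>t. rule1 S X t then (1, LEAST t. rule1 S X t)
     else if \<exists>u. nbr S X u then (if free S X (LEAST u. nbr S X u) then 2 else 1, LEAST u. nbr S X u)
     else (0, 0))"

definition bstep1 :: "bool \<Rightarrow> nat set \<times> nat set \<times> bool \<Rightarrow> nat set \<times> nat set \<times> bool" where
  "bstep1 b = (\<lambda>(S, X, dn). if dn then (S, X, dn) else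
     let (k, u) = pick S X in
     if k = 1 then (if b then (insert u S, X, True) else (S, insert u X, True))
     else if k = 2 then (insert u S, X, False) else (S, X, False))"

definition bstep :: "bool \<Rightarrow> nat set \<times> nat set \<Rightarrow> nat set \<times> nat set" where
  "bstep b = (\<lambda>(S, X). case (bstep1 b ^^ (card V + 1)) (S, X, False) of (S', X', _) \<Rightarrow> (S', X'))"

text \<open>The hidden set \<open>D\<close> is consistent with the choices so far, and its terminals can be reached from \<open>S\<close>
  inside \<open>D\<close>. Free inclusions may enlarge \<open>D\<close>, but do not change its terminals.\<close>

definition good :: "nat set \<Rightarrow> nat set \<Rightarrow> nat set \<Rightarrow> bool" where
  "good D S X \<longleftrightarrow> S \<subseteq> D \<and> D \<subseteq> V - X \<and>
     (\<forall>A. S \<subseteq> A \<longrightarrow> A \<subseteq> D \<longrightarrow> A \<inter> R \<noteq> D \<inter> R \<longrightarrow> (\<exists>a\<in>A. \<exists>b\<in>D - A. {a, b} \<in> E))"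

lemma nbr_in_V:
  assumes "nbr S X u" shows "u \<in> V"
proof -
  obtain w where "{w, u} \<in> E" using assms by (auto simp: nbr_def)
  then have "{w, u} \<subseteq> V" by (rule edge_subset)
  then show ?thesis by simp
qed

lemma goodD:
  assumes "good D S X"
  shows "S \<subseteq> D" "D \<subseteq> V - X"
    "\<And>A. S \<subseteq> A \<Longrightarrow> A \<subseteq> D \<Longrightarrow> A \<inter> R \<noteq> D \<inter> R \<Longrightarrow> \<exists>a\<in>A. \<exists>b\<in>D - A. {a, b} \<in> E"
  using assms unfolding good_def by simp_all

text \<open>Uncrossing. Let \<open>A\<close> be a minimum cut that contains \<open>u\<close> and
  \<open>S\<close> and avoids \<open>X\<close> and the terminals outside \<open>S\<close>. As
  \<open>u\<close> is free, \<open>d A \<le> d (D \<inter> A)\<close>, and submodularity gives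
  \<open>d (D \<union> A) \<le> d D\<close>. So the hidden set may be replaced by
  \<open>D \<union> A\<close>, which contains \<open>u\<close> and has the same terminals. This is
  why a free inclusion needs no advice.\<close>

lemma good_free:
  assumes g: "good D S X" and u: "nbr S X u" "free S X u"
  obtains D' where "good D' (insert u S) X" "D' \<inter> R = D \<inter> R" "d D' \<le> d D"
proof -
  let ?X = "X \<union> (R - S)"
  note S = goodD(1,2)[OF g]
  have "insert u S \<subseteq> V - ?X" using S u nbr_in_V[OF u(1)] by (auto simp: nbr_def free_def)
  then obtain A where A: "insert u S \<subseteq> A" "A \<subseteq> V - ?X" "d A = mval (insert u S) ?X"
    by (rule mval_attained)
  have "mval S ?X \<le> d (D \<inter> A)" by (rule mval_le) (use A S in auto)
  then have "d A \<le> d (D \<inter> A)" using A u by (auto simp: free_def)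
  then have 1: "d (D \<union> A) \<le> d D" using d_submodular[of D A] by linarith
  have 2: "(D \<union> A) \<inter> R = D \<inter> R" using A S by auto
  have "\<exists>a\<in>B. \<exists>b\<in>D \<union> A - B. {a, b} \<in> E"
    if B: "insert u S \<subseteq> B" "B \<subseteq> D \<union> A" "B \<inter> R \<noteq> (D \<union> A) \<inter> R" for B
  proof -
    \<comment> \<open>The cut \<open>A\<close> brings in no new terminal, so the terminal missing
      from \<open>B\<close> is missing inside \<open>D\<close>, where \<open>good\<close> supplies
      an edge that leaves \<open>B \<inter> D\<close>.\<close>
    have "(B \<inter> D) \<inter> R \<noteq> D \<inter> R" using B 2 by auto
    moreover have "S \<subseteq> B \<inter> D" "B \<inter> D \<subseteq> D" using B S by auto
    ultimately have "\<exists>a\<in>B \<inter> D. \<exists>b\<in>D - B \<inter> D. {a, b} \<in> E" by (intro goodD(3)[OF g])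
    then obtain a b where ab: "a \<in> B \<inter> D" "b \<in> D - B \<inter> D" "{a, b} \<in> E" by (elim bexE)
    show ?thesis by (rule bexI[of _ a], rule bexI[of _ b]) (use ab in auto)
  qed
  moreover have "insert u S \<subseteq> D \<union> A" "D \<union> A \<subseteq> V - X" using S A by auto
  ultimately have "good (D \<union> A) (insert u S) X" unfolding good_def by simp
  then show ?thesis by (rule that) (use 1 2 in simp_all)
qed

text \<open>Take a minimum cut \<open>A\<close> with the fewest vertices. If it contained a terminal
  \<open>t\<close> outside \<open>S\<close>, then, as excluding \<open>t\<close> does not raise the
  value, some minimum cut \<open>B\<close> would avoid \<open>t\<close>, and by submodularity
  \<open>A \<inter> B\<close> would be a smaller minimum cut. So some minimum cut avoids all
  terminals outside \<open>S\<close>.\<close>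

lemma no_rule1:
  assumes S: "S \<subseteq> V - X" and no: "\<not> (\<exists>t. rule1 S X t)"
  shows "mval S (X \<union> (R - S)) \<le> mval S X"
proof -
  define M where "M = {A. S \<subseteq> A \<and> A \<subseteq> V - X \<and> d A = mval S X}"
  obtain A0 where "S \<subseteq> A0" "A0 \<subseteq> V - X" "d A0 = mval S X" using mval_attained[OF S] .
  then have "A0 \<in> M" by (simp add: M_def)
  from ex_has_least_nat[of "\<lambda>A. A \<in> M" A0 card, OF this]
  obtain A where A: "A \<in> M" and least: "\<And>B. B \<in> M \<Longrightarrow> card A \<le> card B" by auto
  have AM: "S \<subseteq> A" "A \<subseteq> V - X" "d A = mval S X" using A by (simp_all add: M_def)
  have "A \<inter> R \<subseteq> S"
  proof
    fix t assume t: "t \<in> A \<inter> R"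
    show "t \<in> S"
    proof (rule ccontr)
      assume tS: "t \<notin> S"
      have "t \<notin> X" using t AM by auto
      then have le: "mval S (insert t X) \<le> mval S X" using no t tS by (auto simp: rule1_def not_less)
      have "S \<subseteq> V - insert t X" using S tS by auto
      then obtain B where B: "S \<subseteq> B" "B \<subseteq> V - insert t X" "d B = mval S (insert t X)"
        by (rule mval_attained)
      have "mval S X \<le> d (A \<union> B)" by (rule mval_le) (use AM B in auto)
      moreover have "mval S X \<le> d (A \<inter> B)" by (rule mval_le) (use AM B in auto)
      ultimately have "d (A \<inter> B) = mval S X" using d_submodular[of A B] AM B le by linarith
      then have "A \<inter> B \<in> M" using AM B by (auto simp: M_def)
      then have "card A \<le> card (A \<inter> B)" by (rule least)
      moreover have "card (A \<inter> B) < card A"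
      proof (rule psubset_card_mono)
        show "finite A" using AM finite_V finite_subset[of A V] by blast
        show "A \<inter> B \<subset> A" using t B by auto
      qed
      ultimately show False by simp
    qed
  qed
  then have "mval S (X \<union> (R - S)) \<le> d A" by (intro mval_le) (use AM in auto)
  then show ?thesis using AM by simp
qed

definition cedges :: "nat set \<Rightarrow> nat set \<Rightarrow> nat" where
  "cedges S X = card {e \<in> E. e \<inter> S \<noteq> {} \<and> e \<inter> X \<noteq> {}}"

text \<open>Both summands are lower bounds for the boundary of any set that contains
  \<open>S\<close> and avoids \<open>X\<close>. An exclusion raises \<open>mval\<close> if it comes
  from \<open>rule1\<close>, and \<open>cedges\<close> if it concerns a neighbour of
  \<open>S\<close>. So \<open>psi\<close> counts the exclusions, of which there are at most
  \<open>2 * d D\<close>.\<close>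

definition psi :: "nat set \<Rightarrow> nat set \<Rightarrow> nat" where
  "psi S X = mval S X + cedges S X"

text \<open>If the inclusion of a neighbour leaves \<open>mval\<close> unchanged, then a terminal can be isolated
  afterwards, which the last summand of \<open>phi\<close> rewards. So every branch increases \<open>phi\<close>.\<close>

definition phi :: "nat set \<Rightarrow> nat set \<Rightarrow> nat" where
  "phi S X = 2 * (card (S \<inter> R) + psi S X) + of_bool (\<exists>t. rule1 S X t)"

lemma cedges_mono: "S \<subseteq> S' \<Longrightarrow> X \<subseteq> X' \<Longrightarrow> cedges S X \<le> cedges S' X'"
  unfolding cedges_def using finite_E by (intro card_mono) auto

lemma psi_mono: "S \<subseteq> S' \<Longrightarrow> X \<subseteq> X' \<Longrightarrow> S' \<subseteq> V - X' \<Longrightarrow> psi S X \<le> psi S' X'"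
  unfolding psi_def by (intro add_mono mval_mono cedges_mono)

lemma psi_le: "good D S X \<Longrightarrow> psi S X \<le> 2 * d D"
proof -
  assume g: "good D S X"
  have "mval S X \<le> d D" by (rule mval_le) (use goodD(1,2)[OF g] in auto)
  moreover have "cedges S X \<le> d D"
    unfolding cedges_def d_def using finite_E goodD(1,2)[OF g]
    by (intro card_mono) (auto simp: bd_def)
  ultimately show ?thesis by (simp add: psi_def)
qed

lemma finite_R: "finite R"
  using terminals finite_V finite_subset by blast

lemma phi_le: "good D S X \<Longrightarrow> phi S X \<le> 2 * (card (D \<inter> R) + 2 * d D) + 1"
proof -
  assume g: "good D S X"
  have "card (S \<inter> R) \<le> card (D \<inter> R)" using finite_R goodD(1)[OF g] by (intro card_mono) auto
  then show ?thesis using psi_le[OF g] by (auto simp: phi_def of_bool_def)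
qed

lemma bstep1_simps:
  "bstep1 b (S, X, True) = (S, X, True)"
  "pick S X = (1, u) \<Longrightarrow> bstep1 b (S, X, False) = (if b then (insert u S, X, True) else (S, insert u X, True))"
  "pick S X = (2, u) \<Longrightarrow> bstep1 b (S, X, False) = (insert u S, X, False)"
  "fst (pick S X) = 0 \<Longrightarrow> bstep1 b (S, X, False) = (S, X, False)"
  by (auto simp: bstep1_def split: prod.splits)

lemma bstep1_funpow_done: "(bstep1 b ^^ m) (S, X, True) = (S, X, True)"
  by (induction m) (auto simp: bstep1_simps)

lemma bstep1_funpow_stuck: "fst (pick S X) = 0 \<Longrightarrow> (bstep1 b ^^ m) (S, X, False) = (S, X, False)"
  by (induction m) (auto simp: bstep1_simps)

lemma pick_cases:
  obtains "fst (pick S X) = 0" "\<not> (\<exists>t. rule1 S X t)" "\<not> (\<exists>u. nbr S X u)"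
  | u where "pick S X = (1, u)" "rule1 S X u"
  | u where "pick S X = (1, u)" "\<not> (\<exists>t. rule1 S X t)" "nbr S X u" "\<not> free S X u"
  | u where "pick S X = (2, u)" "\<not> (\<exists>t. rule1 S X t)" "nbr S X u" "free S X u"
proof (cases "\<exists>t. rule1 S X t")
  case True
  then show ?thesis using that(2)[of "LEAST t. rule1 S X t"] by (auto simp: pick_def intro: LeastI)
next
  case no: False
  show ?thesis
  proof (cases "\<exists>u. nbr S X u")
    case True
    then have "nbr S X (LEAST u. nbr S X u)" by (auto intro: LeastI)
    then show ?thesis using that(3,4)[of "LEAST u. nbr S X u"] no True by (auto simp: pick_def)
  next
    case False
    then show ?thesis using that(1) no by (auto simp: pick_def)
  qed
qed

text \<open>Each free inclusion adds a vertex to \<open>S\<close>. With more than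
  \<open>card (V - S)\<close> elementary steps available, the free inclusions come to an end while
  at least one step is left, which is what \<open>Suc m'\<close> records; they do not depend on the
  bit \<open>b\<close>. The hidden set may grow to \<open>D'\<close> on the way.\<close>

lemma free_steps:
  assumes "good D S X" "m > card (V - S)"
  shows "\<exists>S' D'. good D' S' X \<and> D' \<inter> R = D \<inter> R \<and> d D' \<le> d D \<and> S' \<inter> R = S \<inter> R \<and>
     psi S X \<le> psi S' X \<and> phi S X \<le> phi S' X \<and> fst (pick S' X) \<noteq> 2 \<and>
     (\<forall>b. \<exists>m'. (bstep1 b ^^ m) (S, X, False) = (bstep1 b ^^ Suc m') (S', X, False))"
  using assms
proof (induction m arbitrary: S D)
  case (Suc m)
  have stop: ?case if "fst (pick S X) \<noteq> 2"
    by (rule exI[of _ S], rule exI[of _ D], intro conjI allI exI[of _ m] Suc.prems(1) that refl order_refl)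
  show ?case
  proof (cases rule: pick_cases[of S X])
    case (4 u)
    obtain D1 where D1: "good D1 (insert u S) X" "D1 \<inter> R = D \<inter> R" "d D1 \<le> d D"
      using good_free[OF Suc.prems(1) 4(3,4)] .
    have uV: "u \<in> V" "u \<notin> S" "u \<notin> R"
      using nbr_in_V[OF 4(3)] 4(3,4) unfolding nbr_def free_def by blast+
    have "finite (V - S)" "u \<in> V - S" using finite_V uV(1,2) by simp_all
    from card_Suc_Diff1[OF this] have "card (V - S) = Suc (card (V - insert u S))"
      unfolding Diff_insert[of V u S] by (rule sym)
    then have "m > card (V - insert u S)" using Suc.prems(2) by simp
    from Suc.IH[OF D1(1) this] obtain S' D' where S': "good D' S' X" "D' \<inter> R = D1 \<inter> R" "d D' \<le> d D1"
      "S' \<inter> R = insert u S \<inter> R" "psi (insert u S) X \<le> psi S' X" "phi (insert u S) X \<le> phi S' X" "fst (pick S' X) \<noteq> 2"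
      "\<forall>b. \<exists>m'. (bstep1 b ^^ m) (insert u S, X, False) = (bstep1 b ^^ Suc m') (S', X, False)"
      by (elim exE conjE)
    have psi: "psi S X \<le> psi (insert u S) X"
      by (rule psi_mono) (use goodD(1,2)[OF D1(1)] in auto)
    have uR: "insert u S \<inter> R = S \<inter> R" using uV by auto
    have phi: "phi S X \<le> phi S' X"
      using S'(6) psi uR 4(2) by (simp add: phi_def)
    have *: "\<exists>m'. (bstep1 b ^^ Suc m) (S, X, False) = (bstep1 b ^^ Suc m') (S', X, False)" for b
      unfolding funpow_Suc_right[of m] o_apply bstep1_simps(3)[OF 4(1)] by (rule S'(8)[rule_format])
    show ?thesis
      by (rule exI[of _ S'], rule exI[of _ D'], intro conjI allI * S'(1,7) phi
          order_trans[OF psi S'(5)] trans[OF S'(2) D1(2)] order_trans[OF S'(3) D1(3)] trans[OF S'(4) uR])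
  qed (rule stop, simp)+
qed simp

text \<open>The normal form of a step: free inclusions, the same for both bits, lead from
  \<open>S\<close> to \<open>S'\<close>; then either nothing remains to be done or the bit decides
  about one vertex \<open>u\<close>.\<close>

lemma bstep_good:
  assumes "good D S X"
  obtains S' D' where "good D' S' X" "D' \<inter> R = D \<inter> R" "d D' \<le> d D" "S' \<inter> R = S \<inter> R"
     "psi S X \<le> psi S' X" "phi S X \<le> phi S' X" "fst (pick S' X) \<noteq> 2"
     "\<And>b. fst (pick S' X) = 0 \<Longrightarrow> bstep b (S, X) = (S', X)"
     "\<And>u b. pick S' X = (1, u) \<Longrightarrow> bstep b (S, X) = (if b then (insert u S', X) else (S', insert u X))"
proof -
  have "card (V - S) \<le> card V" using finite_V by (intro card_mono) auto
  then have "card (V - S) < card V + 1" by simp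
  from free_steps[OF assms this] obtain S' D' where S': "good D' S' X" "D' \<inter> R = D \<inter> R" "d D' \<le> d D"
      "S' \<inter> R = S \<inter> R" "psi S X \<le> psi S' X" "phi S X \<le> phi S' X" "fst (pick S' X) \<noteq> 2"
     and ex: "\<forall>b. \<exists>m'. (bstep1 b ^^ (card V + 1)) (S, X, False) = (bstep1 b ^^ Suc m') (S', X, False)"
    by (elim exE conjE)
  have 0: "bstep b (S, X) = (S', X)" if "fst (pick S' X) = 0" for b
  proof -
    obtain m' where m': "(bstep1 b ^^ (card V + 1)) (S, X, False) = (bstep1 b ^^ Suc m') (S', X, False)"
      using ex[rule_format, of b] by (elim exE)
    show ?thesis unfolding bstep_def prod.case m' bstep1_funpow_stuck[OF that] by simp
  qed
  have 1: "bstep b (S, X) = (if b then (insert u S', X) else (S', insert u X))" if "pick S' X = (1, u)" for u b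
  proof -
    obtain m' where m': "(bstep1 b ^^ (card V + 1)) (S, X, False) = (bstep1 b ^^ Suc m') (S', X, False)"
      using ex[rule_format, of b] by (elim exE)
    show ?thesis unfolding bstep_def prod.case m' funpow_Suc_right o_apply bstep1_simps(2)[OF that]
      by (simp add: bstep1_funpow_done)
  qed
  show ?thesis by (rule that[OF S']) (simp_all add: 0 1)
qed

text \<open>The branch that agrees with the hidden set keeps \<open>good\<close> and increases
  \<open>phi\<close>. An exclusion increases \<open>psi\<close> and the inclusion of a terminal
  increases \<open>card (S \<inter> R)\<close>. The inclusion of a nonterminal that is not free
  either increases \<open>mval\<close>, or leaves it unchanged and makes \<open>rule1\<close>
  applicable.\<close>

lemma advance:
  assumes g: "good D S X" and p: "pick S X = (1, u)"
  shows "u \<in> D \<Longrightarrow> good D (insert u S) X" "u \<notin> D \<Longrightarrow> good D S (insert u X)"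
    "u \<in> D \<Longrightarrow> phi S X < phi (insert u S) X" "u \<notin> D \<Longrightarrow> phi S X < phi S (insert u X)"
    "u \<in> D \<Longrightarrow> psi S X \<le> psi (insert u S) X" "u \<notin> D \<Longrightarrow> psi S X < psi S (insert u X)"
    "u \<notin> S"
proof -
  note D = goodD(1,2)[OF g]
  have rule_or: "rule1 S X u \<or> (\<not> (\<exists>t. rule1 S X t)) \<and> nbr S X u \<and> \<not> free S X u"
    using p by (cases rule: pick_cases[of S X]) simp_all
  then show uS: "u \<notin> S" unfolding rule1_def nbr_def by blast
  have uX: "u \<notin> X" using rule_or unfolding rule1_def nbr_def by blast
  show "good D (insert u S) X" if u: "u \<in> D"
    unfolding good_def using D u goodD(3)[OF g] by (intro conjI allI impI) simp_all
  show "good D S (insert u X)" if u: "u \<notin> D"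
  proof -
    have "D \<subseteq> V - insert u X" using D u by auto
    then show ?thesis unfolding good_def using D(1) goodD(3)[OF g] by (intro conjI allI impI) simp_all
  qed
  have fSR: "finite (S \<inter> R)" using finite_R by simp
  show psi_in: "psi S X \<le> psi (insert u S) X" if u: "u \<in> D"
    by (rule psi_mono) (use D u in auto)
  show psi_out: "psi S X < psi S (insert u X)" if u: "u \<notin> D"
  proof -
    have sub: "S \<subseteq> V - insert u X" using D uS by auto
    have m: "mval S X \<le> mval S (insert u X)" by (rule mval_mono) (use sub in auto)
    have c: "cedges S X \<le> cedges S (insert u X)" by (rule cedges_mono) auto
    from rule_or show ?thesis
    proof
      assume "rule1 S X u" then show ?thesis using c by (simp add: psi_def rule1_def)
    next
      assume "(\<not> (\<exists>t. rule1 S X t)) \<and> nbr S X u \<and> \<not> free S X u"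
      then obtain w where w: "w \<in> S" "{w, u} \<in> E" by (auto simp: nbr_def)
      have "cedges S X < cedges S (insert u X)"
        unfolding cedges_def
      proof (rule psubset_card_mono)
        show "finite {e \<in> E. e \<inter> S \<noteq> {} \<and> e \<inter> insert u X \<noteq> {}}" using finite_E by simp
        have 1: "{e \<in> E. e \<inter> S \<noteq> {} \<and> e \<inter> X \<noteq> {}} \<subseteq> {e \<in> E. e \<inter> S \<noteq> {} \<and> e \<inter> insert u X \<noteq> {}}" by auto
        have 2: "{w, u} \<in> {e \<in> E. e \<inter> S \<noteq> {} \<and> e \<inter> insert u X \<noteq> {}}" using w by auto
        have "w \<notin> X" using w D by auto
        then have 3: "{w, u} \<notin> {e \<in> E. e \<inter> S \<noteq> {} \<and> e \<inter> X \<noteq> {}}" using uX by auto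
        show "{e \<in> E. e \<inter> S \<noteq> {} \<and> e \<inter> X \<noteq> {}} \<subset> {e \<in> E. e \<inter> S \<noteq> {} \<and> e \<inter> insert u X \<noteq> {}}" (is "?A \<subset> ?B")
        proof (rule psubsetI[OF 1])
          show "?A \<noteq> ?B"
          proof
            assume "?A = ?B"
            with 2 have "{w, u} \<in> ?A" by (simp only:)
            with 3 show False by (rule notE)
          qed
        qed
      qed
      then show ?thesis using m by (simp add: psi_def)
    qed
  qed
  show "phi S X < phi S (insert u X)" if u: "u \<notin> D"
    using psi_out[OF u] by (simp add: phi_def)
  show "phi S X < phi (insert u S) X" if u: "u \<in> D"
  proof (cases "u \<in> R")
    case True
    then have "card (insert u S \<inter> R) = Suc (card (S \<inter> R))" using fSR uS by simp
    then show ?thesis using psi_in[OF u] by (simp add: phi_def)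
  next
    case False
    then have uR: "insert u S \<inter> R = S \<inter> R" "R - insert u S = R - S" by auto
    have nr: "\<not> (\<exists>t. rule1 S X t)" "\<not> free S X u" using rule_or False by (auto simp: rule1_def)
    then have less: "mval S (X \<union> (R - S)) < mval (insert u S) (X \<union> (R - S))"
      using False by (simp add: free_def)
    have "mval S X \<le> mval S (X \<union> (R - S))" by (rule mval_mono) (use D in auto)
    with less have less': "mval S X < mval (insert u S) (X \<union> (R - S))" by simp
    have mono: "mval S X \<le> mval (insert u S) X" by (rule mval_mono) (use D u in auto)
    have c: "cedges S X \<le> cedges (insert u S) X" by (rule cedges_mono) auto
    show ?thesis
    proof (cases "mval S X < mval (insert u S) X")
      case True
      then show ?thesis using c nr uR by (simp add: phi_def psi_def)
    next
      case eq: False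
      \<comment> \<open>Otherwise \<open>no_rule1\<close> for \<open>insert u S\<close> would bound
        its cut value against \<open>X \<union> (R - S)\<close> by
        \<open>mval (insert u S) X\<close>, which here is at most \<open>mval S X\<close>; this
        contradicts \<open>less'\<close>.\<close>
      have "\<exists>t. rule1 (insert u S) X t"
      proof (rule ccontr)
        assume no: "\<not> ?thesis"
        have "insert u S \<subseteq> V - X" using D u by auto
        from no_rule1[OF this no] show False using less' eq uR by simp
      qed
      then show ?thesis using c mono nr uR by (simp add: phi_def psi_def)
    qed
  qed
qed

section \<open>Bit strings and digit strings that steer the branching\<close>

definition run_bits :: "bool list \<Rightarrow> nat set \<times> nat set \<Rightarrow> nat set \<times> nat set" where
  "run_bits bs st = foldl (\<lambda>st b. bstep b st) st bs"

lemma run_bits_simps [simp]: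
  "run_bits [] st = st" "run_bits (b # bs) st = run_bits bs (bstep b st)"
  by (simp_all add: run_bits_def)

lemma run_bits_append: "run_bits (xs @ ys) st = run_bits ys (run_bits xs st)"
  by (simp add: run_bits_def)

lemma run_bits_stuck: "fst (pick S X) = 0 \<Longrightarrow> run_bits bs (S, X) = (S, X)"
  by (induction bs) (simp_all only: run_bits_simps bstep_def bstep1_funpow_stuck prod.case)

text \<open>The bits answer, at each branch, whether the vertex belongs to the current hidden set.
  Exclusions are charged to \<open>psi\<close>, all bits together to \<open>phi\<close>, and if
  every vertex is a terminal then inclusions are charged to the terminals of \<open>S\<close>. The
  suffix \<open>pad\<close> is arbitrary because a finished branching ignores further bits; this
  makes it possible to enumerate strings of one fixed length.\<close>

lemma bits_exist:
  assumes "good D S X" "d D \<le> b" "D \<inter> R = T"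
  shows "\<exists>bs. (\<forall>pad. fst (run_bits (bs @ pad) (S, X)) \<inter> R = T) \<and>
     length (filter Not bs) + psi S X \<le> 2 * b \<and> length bs + phi S X \<le> 2 * (card T + 2 * b) + 1 \<and>
     (V \<subseteq> R \<longrightarrow> length (filter id bs) + card (S \<inter> R) \<le> card T)"
  using assms
proof (induction "2 * (card T + 2 * b) + 1 - phi S X" arbitrary: S X D rule: less_induct)
  case less
  obtain D' S' where S': "good D' S' X" "D' \<inter> R = D \<inter> R" "d D' \<le> d D" "S' \<inter> R = S \<inter> R"
     "psi S X \<le> psi S' X" "phi S X \<le> phi S' X" "fst (pick S' X) \<noteq> 2"
     and stuck: "\<And>b. fst (pick S' X) = 0 \<Longrightarrow> bstep b (S, X) = (S', X)"
     and br: "\<And>u b. pick S' X = (1, u) \<Longrightarrow> bstep b (S, X) = (if b then (insert u S', X) else (S', insert u X))"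
    by (rule bstep_good[OF less.prems(1)]) (rule that; assumption)
  have T: "D' \<inter> R = T" "d D' \<le> b" using S' less.prems by simp_all
  have phi': "phi S' X \<le> 2 * (card T + 2 * b) + 1" using phi_le[OF S'(1)] T by simp
  have psi': "psi S' X \<le> 2 * b" using psi_le[OF S'(1)] T by simp
  have cR: "card (S \<inter> R) \<le> card T"
    using finite_R goodD(1)[OF less.prems(1)] less.prems(3) by (metis Int_mono card_mono finite_Int order_refl)
  have one: ?case if u: "pick S' X = (1, u)" for u
  proof (cases "u \<in> D'")
    case True
    note a = advance[OF S'(1) u]
    have "2 * (card T + 2 * b) + 1 - phi (insert u S') X < 2 * (card T + 2 * b) + 1 - phi S X"
      using a(3)[OF True] S'(6) phi_le[OF a(1)[OF True]] T by (intro diff_less_mono2) simp_all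
    from less.hyps[OF this a(1)[OF True] T(2,1)] obtain bs where bs:
      "\<forall>pad. fst (run_bits (bs @ pad) (insert u S', X)) \<inter> R = T"
      "length (filter Not bs) + psi (insert u S') X \<le> 2 * b"
      "length bs + phi (insert u S') X \<le> 2 * (card T + 2 * b) + 1"
      "V \<subseteq> R \<longrightarrow> length (filter id bs) + card (insert u S' \<inter> R) \<le> card T" by (elim exE conjE)
    have c: "card (insert u S' \<inter> R) = Suc (card (S \<inter> R))" if "V \<subseteq> R"
    proof -
      have "u \<in> R" using that True goodD(2)[OF S'(1)] by auto
      moreover have "u \<notin> S \<inter> R" using a(7) S'(4) by blast
      ultimately show ?thesis using finite_R S'(4) by simp
    qed
    show ?thesis
    proof (rule exI[of _ "True # bs"], intro conjI allI impI)
      fix pad show "fst (run_bits ((True # bs) @ pad) (S, X)) \<inter> R = T"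
        using bs(1) by (simp add: br[OF u])
      show "length (filter Not (True # bs)) + psi S X \<le> 2 * b"
        using bs(2) a(5)[OF True] S'(5) by simp
      show "length (True # bs) + phi S X \<le> 2 * (card T + 2 * b) + 1"
        using bs(3) a(3)[OF True] S'(6) by simp
      assume "V \<subseteq> R" then show "length (filter id (True # bs)) + card (S \<inter> R) \<le> card T"
        using bs(4) c by simp
    qed
  next
    case False
    note a = advance[OF S'(1) u]
    have "2 * (card T + 2 * b) + 1 - phi S' (insert u X) < 2 * (card T + 2 * b) + 1 - phi S X"
      using a(4)[OF False] S'(6) phi_le[OF a(2)[OF False]] T by (intro diff_less_mono2) simp_all
    from less.hyps[OF this a(2)[OF False] T(2,1)] obtain bs where bs:
      "\<forall>pad. fst (run_bits (bs @ pad) (S', insert u X)) \<inter> R = T"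
      "length (filter Not bs) + psi S' (insert u X) \<le> 2 * b"
      "length bs + phi S' (insert u X) \<le> 2 * (card T + 2 * b) + 1"
      "V \<subseteq> R \<longrightarrow> length (filter id bs) + card (S' \<inter> R) \<le> card T" by (elim exE conjE)
    show ?thesis
    proof (rule exI[of _ "False # bs"], intro conjI allI impI)
      fix pad show "fst (run_bits ((False # bs) @ pad) (S, X)) \<inter> R = T"
        using bs(1) by (simp add: br[OF u])
      show "length (filter Not (False # bs)) + psi S X \<le> 2 * b"
        using bs(2) a(6)[OF False] S'(5) by simp
      show "length (False # bs) + phi S X \<le> 2 * (card T + 2 * b) + 1"
        using bs(3) a(4)[OF False] S'(6) by simp
      assume "V \<subseteq> R" then show "length (filter id (False # bs)) + card (S \<inter> R) \<le> card T"
        using bs(4) S'(4) by simp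
    qed
  qed
  show ?case
  proof (cases rule: pick_cases[of S' X])
    case 1
    \<comment> \<open>If a terminal of the hidden set were missing, \<open>good\<close> would
      provide an edge leaving \<open>S'\<close> inside \<open>D'\<close>, and hence a neighbour to
      branch on.\<close>
    have S'T: "S' \<inter> R = T"
    proof (rule ccontr)
      assume "S' \<inter> R \<noteq> T"
      then have "\<exists>a\<in>S'. \<exists>b\<in>D' - S'. {a, b} \<in> E"
        using goodD(3)[OF S'(1) order_refl goodD(1)[OF S'(1)]] T by simp
      then obtain a b where ab: "a \<in> S'" "b \<in> D' - S'" "{a, b} \<in> E" by (elim bexE)
      then have "nbr S' X b" using goodD(2)[OF S'(1)] by (auto simp: nbr_def)
      then show False using 1 by simp
    qed
    show ?thesis
    proof (rule exI[of _ "[]"], intro conjI allI impI)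
      fix pad show "fst (run_bits ([] @ pad) (S, X)) \<inter> R = T"
      proof (cases pad)
        case Nil
        then show ?thesis using S'T S'(4) by simp
      next
        case (Cons b bs)
        then show ?thesis using S'T run_bits_stuck[OF 1(1)] by (simp add: stuck[OF 1(1)])
      qed
    qed (use psi' phi' S'(5,6) cR in simp_all)
  qed (rule one, assumption | (use S'(7) in simp))+
qed

end

text \<open>A digit \<open>w < q\<close> stands for \<open>w\<close> exclusions followed by an inclusion; the inclusion is omitted for
  the largest digit, so that long runs of exclusions can be encoded.\<close>

definition expand :: "nat \<Rightarrow> nat \<Rightarrow> bool list" where
  "expand q w = replicate w False @ (if w = 0 \<or> Suc w < q then [True] else [])"

text \<open>Cut \<open>bs\<close> greedily into digits. A largest digit consumes
  \<open>q - 1\<close> exclusions, so at most \<open>c\<close> of them occur; every other digit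
  contains an inclusion. The base \<open>q = 1\<close> is legitimate when there are no exclusions,
  because its only digit 0 keeps its inclusion.\<close>

lemma digits_exist:
  assumes "q \<ge> 1" "length (filter Not bs) \<le> (q - 1) * c" "length (filter id bs) + c \<le> L"
  shows "\<exists>ws pad. length ws = L \<and> (\<forall>w\<in>set ws. w < q) \<and> concat (map (expand q) ws) = bs @ pad"
  using assms(2,3)
proof (induction "length bs" arbitrary: bs c L rule: less_induct)
  case less
  \<comment> \<open>The leading run of \<open>a\<close> exclusions is split off, so the rest
    \<open>t\<close> is empty or starts with an inclusion.\<close>
  obtain a t where bs: "bs = replicate a False @ t" and t: "t = [] \<or> hd t"
  proof
    have "takeWhile Not bs = replicate (length (takeWhile Not bs)) False"
      by (rule replicate_eqI) (auto dest: set_takeWhileD)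
    then show "bs = replicate (length (takeWhile Not bs)) False @ dropWhile Not bs"
      by (metis takeWhile_dropWhile_id)
    show "dropWhile Not bs = [] \<or> hd (dropWhile Not bs)" using hd_dropWhile[of Not bs] by blast
  qed
  have cons: ?case
    if w: "w < q" and split: "bs = expand q w @ rest" and len: "length rest < length bs"
      and c': "length (filter Not rest) \<le> (q - 1) * c'" and L': "length (filter id rest) + c' \<le> L - 1" and L: "L \<ge> 1"
    for w rest c'
  proof -
    from less.hyps[OF len c' L'] obtain ws pad where ws: "length ws = L - 1" "\<forall>w\<in>set ws. w < q"
      "concat (map (expand q) ws) = rest @ pad" by (elim exE conjE)
    show ?thesis
      by (rule exI[of _ "w # ws"], rule exI[of _ pad]) (use ws w L split in auto)
  qed
  show ?case
  proof (cases "a \<ge> q - 1 \<and> q > 1")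
    case True
    obtain e where e: "a = q - 1 + e" using True le_Suc_ex by blast
    have ex: "expand q (q - 1) = replicate (q - 1) False" using True by (auto simp: expand_def)
    have rest: "bs = expand q (q - 1) @ (replicate e False @ t)"
      unfolding bs ex e by (simp add: replicate_add)
    let ?rest = "replicate e False @ t"
    have f: "length (filter Not bs) = q - 1 + length (filter Not ?rest)"
      "length (filter id bs) = length (filter id ?rest)" "length bs = q - 1 + length ?rest"
      unfolding rest by (simp_all add: ex[unfolded One_nat_def])
    have "c \<noteq> 0" using less.prems(1) f(1) True by (intro notI) simp
    then obtain c' where c': "c = Suc c'" by (cases c) auto
    show ?thesis
    proof (rule cons[OF _ rest, of c'])
      show "length (filter Not ?rest) \<le> (q - 1) * c'" using less.prems(1) f(1) c' by simp
      show "length (filter id ?rest) + c' \<le> L - 1" "L \<ge> 1" using less.prems(2) f(2) c' by linarith+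
    qed (use True f(3) in linarith)+
  next
    case False
    have small: "a = 0 \<or> Suc a < q" using False assms(1) less.prems(1)
    proof (cases "q = 1")
      case True
      then have "filter Not bs = []" using less.prems(1) by simp
      moreover have "filter Not bs = replicate a False @ filter Not (t)"
        by (simp add: bs)
      ultimately show ?thesis by simp
    qed auto
    then have ex: "expand q a = replicate a False @ [True]" by (simp add: expand_def)
    have aq: "a < q" using small assms(1) by auto
    show ?thesis
    proof (cases "t")
      case Nil
      then have bsa: "bs = replicate a False" using bs by simp
      show ?thesis
      proof (cases "a = 0")
        case True
        then show ?thesis using bsa assms(1)
          by (intro exI[of _ "replicate L 0"] exI[of _ "concat (map (expand q) (replicate L 0))"]) auto
      next
        case a: False
        have "c \<noteq> 0" using less.prems(1) a bsa by (intro notI) simp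
        then have L: "L = Suc (L - 1)" using less.prems(2) by simp
        \<comment> \<open>The last run of exclusions has no inclusion behind it. The one that its
          digit adds is put into \<open>pad\<close>, and zeros fill up the remaining digits. A digit
          is available because a remaining exclusion forces \<open>c\<close> to be positive.\<close>
        show ?thesis
          by (intro exI[of _ "a # replicate (L - 1) 0"] exI[of _ "True # concat (map (expand q) (replicate (L - 1) 0))"])
            (use L aq bsa ex assms(1) in auto)
      qed
    next
      case (Cons x rest)
      have "x"
        using t Cons by simp
      then have split: "bs = expand q a @ rest" using bs Cons ex by simp
      have f: "length (filter Not bs) = a + length (filter Not rest)"
        "length (filter id bs) = Suc (length (filter id rest))" "length bs = Suc (a + length rest)"
        unfolding split by (simp_all add: ex)
      show ?thesis
        by (rule cons[OF aq split, of c]) (use f less.prems in linarith)+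
    qed
  qed
qed

context fgraph begin

text \<open>A path from \<open>r\<close> inside the component to a vertex outside \<open>A\<close>
  has to leave \<open>A\<close> along an edge; this is all that \<open>good\<close> asks for at the
  start of the branching.\<close>

lemma component_good:
  assumes C: "C \<in> components V Q" and Q: "Q \<subseteq> E" and r: "r \<in> C"
  shows "good C {r} {}"
  unfolding good_def
proof (intro conjI allI impI)
  show "{r} \<subseteq> C" using r by simp
  show "C \<subseteq> V - {}" using components_subset[OF C] by simp
  fix A assume A: "{r} \<subseteq> A" "A \<subseteq> C" "A \<inter> R \<noteq> C \<inter> R"
  have "A \<noteq> C" using A(3) by blast
  then obtain y where y: "y \<in> C" "y \<notin> A" using A(2) by blast
  obtain v where v: "C = comp_of V Q v" using C by (auto simp: components_eq)
  have "C = comp_of V Q r" using comp_of_eq[of r V Q v] r v by simp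
  then have path: "(r, y) \<in> {(x, y). {x, y} \<in> Q}\<^sup>*" using y by (simp add: comp_of_def)
  have "y \<in> A \<or> (\<exists>a\<in>A. \<exists>b\<in>C - A. {a, b} \<in> E)"
    using path
  proof induction
    case base
    then show ?case using A(1) by simp
  next
    case (step x z)
    show ?case
    proof (cases "x \<in> A \<and> z \<notin> A")
      case True
      have xz: "{x, z} \<in> Q" using step by simp
      then have "{x, z} \<in> E" using Q by blast
      then have "z \<in> V" using edge_subset[of "{x, z}"] by simp
      then have "z \<in> C" using components_closed[OF C _ _ xz] True A(2) by blast
      then have "z \<in> C - A" using True by simp
      then show ?thesis using True \<open>{x, z} \<in> E\<close> by blast
    next
      case False
      then show ?thesis using step.IH by blast
    qed
  qed
  then show "\<exists>a\<in>A. \<exists>b\<in>C - A. {a, b} \<in> E" using y by blast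
qed

text \<open>Of the \<open>L\<close> digits, \<open>c\<close> are reserved for long runs of
  exclusions. The others are paid for by inclusions: at most one per terminal of \<open>C\<close> if
  every vertex is a terminal, and otherwise at most the total number of bits.\<close>

lemma advice_complete:
  assumes C: "C \<in> components V Q" and Q: "Q \<subseteq> E" and r: "r \<in> C"
    and b: "d C \<le> b" and q: "q \<ge> 1" "2 * b \<le> (q - 1) * c"
    and L: "(if V \<subseteq> R then card (C \<inter> R) else 2 * (card (C \<inter> R) + 2 * b) + 1) + c \<le> L"
  obtains ws where "length ws = L" "\<forall>w\<in>set ws. w < q"
    "fst (run_bits (concat (map (expand q) ws)) ({r}, {})) \<inter> R = C \<inter> R"
proof -
  obtain bs where bs: "\<forall>pad. fst (run_bits (bs @ pad) ({r}, {})) \<inter> R = C \<inter> R"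
     "length (filter Not bs) + psi {r} {} \<le> 2 * b" "length bs + phi {r} {} \<le> 2 * (card (C \<inter> R) + 2 * b) + 1"
     "V \<subseteq> R \<longrightarrow> length (filter id bs) + card ({r} \<inter> R) \<le> card (C \<inter> R)"
    using bits_exist[OF component_good[OF C Q r] b refl] by (elim exE conjE)
  have "length (filter id bs) \<le> length bs" by simp
  then have "length (filter id bs) + c \<le> L"
    using L bs(3,4) by (cases "V \<subseteq> R") (simp_all del: length_filter_le)
  moreover have "length (filter Not bs) \<le> (q - 1) * c" using bs(2) q(2) by simp
  ultimately obtain ws pad where ws: "length ws = L" "\<forall>w\<in>set ws. w < q" "concat (map (expand q) ws) = bs @ pad"
    using digits_exist[OF q(1)] by metis
  show ?thesis using that[OF ws(1,2)] bs(1) by (simp add: ws(3))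
qed

end

section \<open>Maximum flow\<close>

declare run.simps(7) [simp del]

text \<open>Registers below \<open>rVAL\<close> are constant during the main program.
  \<open>rK\<close> holds the terminal bound, \<open>rL\<close> the number of digits,
  \<open>rQ\<close> their base, \<open>rBQ\<close> the number of digit strings and
  \<open>rOFF\<close> the end of the input area. \<open>rVAL\<close> receives the value of the
  latest minimum cut.\<close>

abbreviation (input) "rN \<equiv> (0::nat)"
abbreviation (input) "rN1 \<equiv> (4::nat)"
abbreviation (input) "rK \<equiv> (5::nat)"
abbreviation (input) "rL \<equiv> (6::nat)"
abbreviation (input) "rQ \<equiv> (7::nat)"
abbreviation (input) "rBQ \<equiv> (8::nat)"
abbreviation (input) "rVAL \<equiv> (9::nat)"

text \<open>\<open>aC\<close> holds residual capacities; \<open>aSRC\<close>, \<open>aSNK\<close>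
  mark sources and sinks; \<open>aRCH\<close>, \<open>aPAR\<close> are the labels and parents of the
  search; \<open>aADJ\<close> is the graph, \<open>aR\<close> the terminals, \<open>aF\<close> the
  current separator and \<open>aZ\<close> the zero matrix; \<open>aS\<close>, \<open>aX\<close> are
  the included and excluded vertices; \<open>aDG\<close> holds the digits. Vectors are stored in
  column 0.\<close>

abbreviation (input) "aC \<equiv> (0::nat)"
abbreviation (input) "aSRC \<equiv> (12::nat)"
abbreviation (input) "aSNK \<equiv> (2::nat)"
abbreviation (input) "aRCH \<equiv> (3::nat)"
abbreviation (input) "aPAR \<equiv> (4::nat)"
abbreviation (input) "aADJ \<equiv> (5::nat)"
abbreviation (input) "aR \<equiv> (6::nat)"
abbreviation (input) "aF \<equiv> (7::nat)"
abbreviation (input) "aZ \<equiv> (8::nat)"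
abbreviation (input) "aS \<equiv> (9::nat)"
abbreviation (input) "aX \<equiv> (10::nat)"
abbreviation (input) "aDG \<equiv> (11::nat)"

abbreviation (input) at1 :: "nat \<Rightarrow> nat \<Rightarrow> exp" where "at1 A x \<equiv> Arr A (Reg x) (Num 0)"
abbreviation (input) at2 :: "nat \<Rightarrow> nat \<Rightarrow> nat \<Rightarrow> exp" where "at2 A x y \<equiv> Arr A (Reg x) (Reg y)"
abbreviation (input) wr1 :: "nat \<Rightarrow> nat \<Rightarrow> exp \<Rightarrow> prog" where "wr1 A x e \<equiv> Wr A (Reg x) (Num 0) e"
abbreviation (input) wr2 :: "nat \<Rightarrow> nat \<Rightarrow> nat \<Rightarrow> exp \<Rightarrow> prog" where "wr2 A x y e \<equiv> Wr A (Reg x) (Reg y) e"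
abbreviation (input) less_then :: "exp \<Rightarrow> exp \<Rightarrow> prog \<Rightarrow> prog" where "less_then e1 e2 p \<equiv> Cond e1 e2 p Nop"
abbreviation (input) nz :: "exp \<Rightarrow> prog \<Rightarrow> prog" where "nz e p \<equiv> Cond (Num 0) e p Nop"
abbreviation (input) iszero :: "exp \<Rightarrow> prog \<Rightarrow> prog" where "iszero e p \<equiv> Cond e (Num 1) p Nop"

section \<open>Cuts of a capacity matrix\<close>

definition cut :: "nat \<Rightarrow> (nat \<Rightarrow> nat \<Rightarrow> nat) \<Rightarrow> nat set \<Rightarrow> nat" where
  "cut n C S = (\<Sum>p\<in>{..n} \<times> {..n}. if fst p \<in> S \<and> snd p \<notin> S then C (fst p) (snd p) else 0)"

lemma cut_upd:
  assumes "p \<le> n" "c \<le> n"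
  shows "int (cut n (C(p := (C p)(c := x))) S) =
     int (cut n C S) + (if p \<in> S \<and> c \<notin> S then int x - int (C p c) else 0)"
proof -
  let ?f = "\<lambda>C p. if fst p \<in> S \<and> snd p \<notin> S then C (fst p) (snd p) else 0"
  let ?C = "C(p := (C p)(c := x))"
  have rem: "cut n D S = ?f D (p, c) + sum (?f D) ({..n} \<times> {..n} - {(p, c)})" for D
    unfolding cut_def using assms by (subst sum.remove[of _ "(p, c)"]) auto
  have "sum (?f ?C) ({..n} \<times> {..n} - {(p, c)}) = sum (?f C) ({..n} \<times> {..n} - {(p, c)})"
    by (rule sum.cong) auto
  then show ?thesis using rem[of ?C] rem[of C] by simp
qed

text \<open>Pushing one unit along an arc changes every cut by the difference of the membership of
  its two ends. Along a path these changes telescope, so an augmentation can be analysed for all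
  cuts at once and without speaking of flows.\<close>

lemma cut_push:
  assumes "p \<le> n" "c \<le> n" "p \<noteq> c" "0 < C p c"
  shows "int (cut n (C(p := (C p)(c := C p c - 1), c := (C c)(p := C c p + 1))) S) =
     int (cut n C S) - of_bool (p \<in> S) + of_bool (c \<in> S)"
proof -
  let ?C = "C(p := (C p)(c := C p c - 1))"
  have "C(p := (C p)(c := C p c - 1), c := (C c)(p := C c p + 1)) = ?C(c := (?C c)(p := C c p + 1))"
    using assms by (simp add: fun_eq_iff)
  then have "int (cut n (C(p := (C p)(c := C p c - 1), c := (C c)(p := C c p + 1))) S) =
      int (cut n ?C S) + (if c \<in> S \<and> p \<notin> S then int (C c p + 1) - int (?C c p) else 0)"
    using cut_upd[OF assms(2,1), of ?C "C c p + 1" S] by simp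
  also have "\<dots> = int (cut n C S) - of_bool (p \<in> S) + of_bool (c \<in> S)"
    using cut_upd[OF assms(1,2), of C "C p c - 1" S] assms by auto
  finally show ?thesis .
qed

section \<open>Breadth-first search in the residual network\<close>

definition dims :: "nat \<Rightarrow> hstate \<Rightarrow> bool" where
  "dims n s \<longleftrightarrow> rg s rN = n \<and> rg s rN1 = Suc n \<and> n < rg s rMM"

lemma dimsD: "dims n s \<Longrightarrow> rg s rN = n" "dims n s \<Longrightarrow> rg s rN1 = Suc n" "dims n s \<Longrightarrow> n < rg s rMM"
  by (auto simp: dims_def)

lemma min_dims: "dims n s \<Longrightarrow> v \<le> n \<Longrightarrow> min v (rg s rMM) = v"
  by (auto simp: dims_def)

lemma dims_run: "dims n s \<Longrightarrow> rN \<notin> writes p \<Longrightarrow> rN1 \<notin> writes p \<Longrightarrow> rMM \<notin> writes p \<Longrightarrow> dims n (run p s)"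
  by (simp add: dims_def rg_frame)

text \<open>In \<open>aRCH\<close>, 0 means not reached, sources carry 1, and vertices found in
  round \<open>i\<close> get \<open>i + 2\<close>. The test against \<open>i + 2\<close> admits only
  vertices from earlier rounds as parents, so that labels strictly decrease from a vertex to its
  parent.\<close>

definition round_body :: prog where
  "round_body = iszero (at1 aRCH 11) (nz (at1 aRCH 12)
     (less_then (at1 aRCH 12) (Plus1 (Plus1 (Reg 10))) (nz (at2 aC 12 11)
       (wr1 aRCH 11 (Plus1 (Plus1 (Reg 10))) ;; wr1 aPAR 11 (Reg 12)))))"

definition round_row :: prog where "round_row = For 12 rN1 round_body"

definition round :: prog where "round = For 11 rN1 round_row"

definition search :: prog where
  "search = For 11 rN1 (wr1 aRCH 11 (at1 aSRC 11)) ;; For 10 rN1 round"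

lemma round_frame:
  "writes round_body = {}" "awrites round_body = {aRCH, aPAR}"
  "writes round_row = {12}" "awrites round_row = {aRCH, aPAR}"
  "writes round = {11, 12}" "awrites round = {aRCH, aPAR}"
  by (auto simp: round_body_def round_row_def round_def)

lemma search_frame: "writes search = {10, 11, 12}" "awrites search = {aRCH, aPAR}"
  by (auto simp: search_def round_frame)

lemma run_round:
  assumes s: "dims n s" and i: "rg s 10 = i" and old: "\<And>v. v \<le> n \<Longrightarrow> ar s aRCH v 0 \<le> i + 1"
  shows "(\<forall>v\<le>n. ar (run round s) aRCH v 0 = ar s aRCH v 0 \<and> ar (run round s) aPAR v 0 = ar s aPAR v 0 \<or>
       ar s aRCH v 0 = 0 \<and> ar (run round s) aRCH v 0 = i + 2 \<and> ar (run round s) aPAR v 0 \<le> n \<and>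
       0 < ar s aRCH (ar (run round s) aPAR v 0) 0 \<and> 0 < ar s aC (ar (run round s) aPAR v 0) v)
     \<and> (\<forall>v\<le>n. \<forall>u\<le>n. 0 < ar s aRCH u 0 \<longrightarrow> 0 < ar s aC u v \<longrightarrow> 0 < ar (run round s) aRCH v 0)"
proof -
  define I where "I = (\<lambda>t::hstate. \<forall>v\<le>n. ar t aRCH v 0 = ar s aRCH v 0 \<and> ar t aPAR v 0 = ar s aPAR v 0 \<or>
       ar s aRCH v 0 = 0 \<and> ar t aRCH v 0 = i + 2 \<and> ar t aPAR v 0 \<le> n \<and>
       0 < ar s aRCH (ar t aPAR v 0) 0 \<and> 0 < ar s aC (ar t aPAR v 0) v)"
  define J where "J = (\<lambda>(t::hstate) v k. \<forall>u<k. 0 < ar s aRCH u 0 \<longrightarrow> 0 < ar s aC u v \<longrightarrow> 0 < ar t aRCH v 0)"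
  \<comment> \<open>Marks are never erased, so \<open>J\<close>, once established for a vertex,
    survives the rows of the later vertices.\<close>
  define M where "M = (\<lambda>(t::hstate) (t'::hstate). \<forall>w\<le>n. 0 < ar t aRCH w 0 \<longrightarrow> 0 < ar t' aRCH w (0::nat))"
  have row: "I (run round_row t) \<and> J (run round_row t) v (Suc n) \<and> M t (run round_row t)"
    if t: "dims n t" "rg t 10 = i" "ar t aC = ar s aC" "I t" "rg t 11 = v" "v \<le> n" for t v
    unfolding round_row_def
  proof (rule For_rule[where P = "\<lambda>k t'. I t' \<and> J t' v k \<and> M t t'"], goal_cases)
    case 1
    then show ?case using t by (simp add: J_def M_def)
  next
    case (2 u t1)
    have un: "u \<le> n" using 2(1) t(1) by (simp add: dims_def)
    have P: "I t1" "J t1 v u" "M t t1" using 2(2) by simp_all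
    have C: "ar t1 aC = ar s aC" using 2(4)[of aC] t(3) by (simp add: round_frame)
    have r: "rg t1 10 = i" "rg t1 11 = v" "rg t1 rMM = rg t rMM"
      using 2(3)[of 10] 2(3)[of 11] 2(3)[of rMM] t by (simp_all add: round_frame)
    have m: "min u (rg t rMM) = u" "min v (rg t rMM) = v" using t(1,6) un by (simp_all add: min_dims)
    have "ar t1 aRCH u 0 = ar s aRCH u 0 \<or> ar s aRCH u 0 = 0 \<and> ar t1 aRCH u 0 = i + 2"
      using P(1) un unfolding I_def by blast
    then have oldu: "0 < ar t1 aRCH u 0 \<and> ar t1 aRCH u 0 < i + 2 \<longleftrightarrow> 0 < ar s aRCH u 0"
      using old[OF un] by auto
    have Iv: "ar s aRCH v 0 = 0" if "ar t1 aRCH v 0 = 0"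
      using P(1) that t(6) unfolding I_def by (metis add_2_eq_Suc' nat.distinct(1))
    show ?case
    proof (cases "ar t1 aRCH v 0 = 0 \<and> 0 < ar s aRCH u 0 \<and> 0 < ar s aC u v")
      case True
      then have "0 < ar t1 aRCH u 0" "ar t1 aRCH u 0 < i + 2" using oldu by auto
      then have run: "run round_body (setr 12 u t1) = seta aPAR v 0 u (seta aRCH v 0 (i + 2) (setr 12 u t1))"
        using True by (simp add: round_body_def m r C)
      have "I (run round_body (setr 12 u t1))"
        using P(1) True un Iv unfolding I_def run by simp
      moreover have "J (run round_body (setr 12 u t1)) v (Suc u)" "M t (run round_body (setr 12 u t1))"
        using P(3) unfolding J_def M_def run by simp_all
      ultimately show ?thesis by blast
    next
      case False
      have "J t1 v (Suc u)" using False P(2) unfolding J_def less_Suc_eq by auto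
      have "\<not> (ar t1 aRCH v 0 = 0 \<and> (0 < ar t1 aRCH u 0 \<and> ar t1 aRCH u 0 < i + 2) \<and> 0 < ar s aC u v)"
        unfolding oldu using False by simp
      then have "run round_body (setr 12 u t1) = setr 12 u t1"
        by (auto simp: round_body_def m r C)
      then show ?thesis using \<open>J t1 v (Suc u)\<close> P by (simp add: I_def J_def M_def)
    qed
  next
    case (3 t1)
    then show ?case using dimsD(2)[OF t(1)] by (simp add: I_def J_def M_def)
  qed
  have "I (run round s) \<and> (\<forall>v\<le>n. J (run round s) v (Suc n))"
    unfolding round_def
  proof (rule For_rule[where P = "\<lambda>k t. I t \<and> (\<forall>v<k. J t v (Suc n))"], goal_cases)
    case 1
    show ?case by (simp add: I_def)
  next
    case (2 v t)
    have t: "dims n (setr 11 v t)"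
      using s 2(3)[of rN] 2(3)[of rN1] 2(3)[of rMM] by (simp add: dims_def round_frame)
    have v': "v \<le> n" using 2(1) s by (simp add: dims_def)
    have "rg (setr 11 v t) 10 = i" "ar (setr 11 v t) aC = ar s aC" "I (setr 11 v t)" "rg (setr 11 v t) 11 = v"
      using 2(2) 2(3)[of 10] 2(4)[of aC] i by (simp_all add: I_def round_frame)
    note r = row[OF t this v']
    have "J (run round_row (setr 11 v t)) w (Suc n)" if w: "w < Suc v" for w
    proof (cases "w = v")
      case False
      then have "J t w (Suc n)" "w \<le> n" using 2(2) w v' by auto
      then show ?thesis using r unfolding J_def M_def setr_simps by blast
    qed (use r in simp)
    then show ?case using r by blast
  next
    case (3 t)
    then show ?case using dimsD(2)[OF s] by (simp add: I_def J_def)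
  qed
  then show ?thesis unfolding I_def J_def less_Suc_eq_le by blast
qed

definition reached :: "nat \<Rightarrow> hstate \<Rightarrow> nat set" where
  "reached n t = {v. v \<le> n \<and> 0 < ar t aRCH v 0}"

definition closed_reach :: "nat \<Rightarrow> hstate \<Rightarrow> bool" where
  "closed_reach n t \<longleftrightarrow> (\<forall>u\<le>n. \<forall>v\<le>n. 0 < ar t aRCH u 0 \<longrightarrow> 0 < ar t aC u v \<longrightarrow> 0 < ar t aRCH v 0)"

text \<open>Following \<open>aPAR\<close> from any reached vertex, the labels decrease until a
  source with label 1 is met; the arcs on the way have positive residual capacity.\<close>

definition tree :: "nat \<Rightarrow> nat \<Rightarrow> hstate \<Rightarrow> bool" where
  "tree n i t \<longleftrightarrow> (\<forall>v\<le>n. ar t aSRC v 0 = 1 \<longleftrightarrow> ar t aRCH v 0 = 1) \<and> (\<forall>v\<le>n. ar t aRCH v 0 \<le> i + 1) \<and>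
     (\<forall>v\<le>n. 2 \<le> ar t aRCH v 0 \<longrightarrow> ar t aPAR v 0 \<le> n \<and> 0 < ar t aRCH (ar t aPAR v 0) 0 \<and>
        ar t aRCH (ar t aPAR v 0) 0 < ar t aRCH v 0 \<and> 0 < ar t aC (ar t aPAR v 0) v)"

lemma reach_setr [simp]:
  "tree n i (setr x v t) = tree n i t" "closed_reach n (setr x v t) = closed_reach n t"
  "reached n (setr x v t) = reached n t"
  by (simp_all add: tree_def closed_reach_def reached_def)

lemma finite_reached: "finite (reached n t)"
  by (simp add: reached_def)

lemma tree_round:
  assumes s: "dims n s" and i: "rg s 10 = i" and tr: "tree n i s"
  shows "tree n (Suc i) (run round s)" and "closed_reach n s \<Longrightarrow> closed_reach n (run round s)"
    and "\<not> closed_reach n s \<Longrightarrow> card (reached n s) < card (reached n (run round s))"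
proof -
  let ?t = "run round s"
  have fr: "ar ?t aSRC = ar s aSRC" "ar ?t aC = ar s aC" by (simp_all add: ar_frame round_frame)
  have old: "\<And>v. v \<le> n \<Longrightarrow> ar s aRCH v 0 \<le> i + 1" using tr by (simp add: tree_def)
  note R = run_round[OF s i old]
  have c: "ar ?t aRCH v 0 = ar s aRCH v 0 \<and> ar ?t aPAR v 0 = ar s aPAR v 0 \<or>
       ar s aRCH v 0 = 0 \<and> ar ?t aRCH v 0 = i + 2 \<and> ar ?t aPAR v 0 \<le> n \<and>
       0 < ar s aRCH (ar ?t aPAR v 0) 0 \<and> 0 < ar s aC (ar ?t aPAR v 0) v" if "v \<le> n" for v
    using R that by blast
  have keep: "ar ?t aRCH v 0 = ar s aRCH v 0" if "v \<le> n" "0 < ar s aRCH v 0" for v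
    using c[OF that(1)] that(2) by linarith
  show "tree n (Suc i) ?t"
    unfolding tree_def fr
  proof (intro conjI allI impI)
    fix v assume v: "v \<le> n"
    show "ar s aSRC v 0 = 1 \<longleftrightarrow> ar ?t aRCH v 0 = 1" using c[OF v] tr v unfolding tree_def by auto
    show "ar ?t aRCH v 0 \<le> Suc i + 1" using c[OF v] old[OF v] by linarith
    assume r: "2 \<le> ar ?t aRCH v 0"
    have "ar ?t aPAR v 0 \<le> n \<and> 0 < ar s aRCH (ar ?t aPAR v 0) 0 \<and>
        ar s aRCH (ar ?t aPAR v 0) 0 < ar ?t aRCH v 0 \<and> 0 < ar s aC (ar ?t aPAR v 0) v"
      using c[OF v]
    proof
      assume "ar ?t aRCH v 0 = ar s aRCH v 0 \<and> ar ?t aPAR v 0 = ar s aPAR v 0"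
      then show ?thesis using r tr v unfolding tree_def by simp
    next
      assume a: "ar s aRCH v 0 = 0 \<and> ar ?t aRCH v 0 = i + 2 \<and> ar ?t aPAR v 0 \<le> n \<and>
       0 < ar s aRCH (ar ?t aPAR v 0) 0 \<and> 0 < ar s aC (ar ?t aPAR v 0) v"
      then show ?thesis using old[of "ar ?t aPAR v 0"] by simp
    qed
    then show "ar ?t aPAR v 0 \<le> n" "0 < ar ?t aRCH (ar ?t aPAR v 0) 0"
        "ar ?t aRCH (ar ?t aPAR v 0) 0 < ar ?t aRCH v 0" "0 < ar s aC (ar ?t aPAR v 0) v"
      using keep by simp_all
  qed
  show "closed_reach n ?t" if cl: "closed_reach n s"
  proof -
    have eq: "0 < ar ?t aRCH v 0 \<longleftrightarrow> 0 < ar s aRCH v 0" if v: "v \<le> n" for v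
      using c[OF v]
    proof
      assume a: "ar s aRCH v 0 = 0 \<and> ar ?t aRCH v 0 = i + 2 \<and> ar ?t aPAR v 0 \<le> n \<and>
       0 < ar s aRCH (ar ?t aPAR v 0) 0 \<and> 0 < ar s aC (ar ?t aPAR v 0) v"
      then have "0 < ar s aRCH v 0" using cl v unfolding closed_reach_def by blast
      then show ?thesis using a by simp
    qed simp
    show ?thesis unfolding closed_reach_def fr
    proof (intro allI impI)
      fix u v assume uv: "u \<le> n" "v \<le> n" "0 < ar ?t aRCH u 0" "0 < ar s aC u v"
      then have "0 < ar s aRCH u 0" using eq[OF uv(1)] by blast
      then have "0 < ar s aRCH v 0" using cl uv(1,2,4) unfolding closed_reach_def by blast
      then show "0 < ar ?t aRCH v 0" using eq[OF uv(2)] by blast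
    qed
  qed
  assume "\<not> closed_reach n s"
  then obtain u v where uv: "u \<le> n" "v \<le> n" "0 < ar s aRCH u 0" "0 < ar s aC u v" "ar s aRCH v 0 = 0"
    unfolding closed_reach_def by auto
  then have "0 < ar ?t aRCH v 0" using R by blast
  then have "v \<in> reached n ?t" "v \<notin> reached n s" using uv by (simp_all add: reached_def)
  moreover have "reached n s \<subseteq> reached n ?t" using keep by (auto simp: reached_def)
  ultimately show "card (reached n s) < card (reached n ?t)"
    by (intro psubset_card_mono finite_reached) auto
qed

text \<open>A round that starts before the reached set is closed reaches at least one new vertex. As
  there are \<open>n + 1\<close> vertices, \<open>n + 1\<close> rounds suffice.\<close>

lemma run_search:
  assumes s: "dims n s" and src: "\<And>v. v \<le> n \<Longrightarrow> ar s aSRC v 0 \<le> 1"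
  shows "tree n (Suc n) (run search s) \<and> closed_reach n (run search s)"
proof -
  define s1 where "s1 = run (For 11 rN1 (wr1 aRCH 11 (at1 aSRC 11))) s"
  have "\<forall>v<Suc n. ar s1 aRCH v 0 = ar s aSRC v 0"
    unfolding s1_def
  proof (rule For_rule[where P = "\<lambda>k t. \<forall>v<k. ar t aRCH v 0 = ar s aSRC v 0"], goal_cases)
    case (2 v t)
    have "rg t rMM = rg s rMM" "ar t aSRC = ar s aSRC" using 2(3)[of rMM] 2(4)[of aSRC] by simp_all
    moreover have "min v (rg s rMM) = v" using s 2(1) by (simp add: dims_def)
    ultimately show ?case using 2(2) by (simp add: less_Suc_eq)
  next
    case (3 t)
    then show ?case using dimsD(2)[OF s] by simp
  qed simp
  then have R1: "ar s1 aRCH v 0 = ar s1 aSRC v 0" "ar s1 aSRC v 0 = ar s aSRC v 0" if "v \<le> n" for v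
    using that by (simp_all add: s1_def ar_frame)
  have d1: "dims n s1" unfolding s1_def by (rule dims_run[OF s]) simp_all
  have t0: "tree n 0 s1"
  proof -
    have "\<not> 2 \<le> ar s aSRC v 0" if "v \<le> n" for v using src[OF that] by simp
    then show ?thesis unfolding tree_def using R1 src by auto
  qed
  have "tree n (Suc n) (run (For 10 rN1 round) s1) \<and> closed_reach n (run (For 10 rN1 round) s1)"
  proof (rule For_rule[where P = "\<lambda>i t. tree n i t \<and> (closed_reach n t \<or> i \<le> card (reached n t))"], goal_cases)
    case 1
    then show ?case using t0 by simp
  next
    case (2 i t)
    have d: "dims n (setr 10 i t)"
      using d1 2(3)[of rN] 2(3)[of rN1] 2(3)[of rMM] by (simp add: dims_def round_frame)
    have "tree n i (setr 10 i t)" using 2(2) by simp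
    note r = tree_round[OF d _ this]
    note eq = reach_setr(2,3)[of n 10 i t]
    have i: "rg (setr 10 i t) 10 = i" by simp
    show ?case
    proof (cases "closed_reach n t")
      case True
      then show ?thesis using r(1,2)[OF i] eq by blast
    next
      case False
      then have "Suc i \<le> card (reached n (run round (setr 10 i t)))"
        using r(3)[OF i] eq 2(2) by simp
      then show ?thesis using r(1)[OF i] by blast
    qed
  next
    case (3 t)
    have "closed_reach n t"
    proof (rule ccontr)
      assume "\<not> closed_reach n t"
      then have "Suc n \<le> card (reached n t)" using 3(1) dimsD(2)[OF d1] by simp
      moreover have "reached n t \<subseteq> {..n}" by (auto simp: reached_def)
      ultimately have "reached n t = {..n}" by (intro card_seteq) simp_all
      then have "\<forall>v\<le>n. 0 < ar t aRCH v 0" unfolding reached_def by auto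
      then have "closed_reach n t" unfolding closed_reach_def by blast
      then show False using \<open>\<not> closed_reach n t\<close> by blast
    qed
    then show ?case using 3(1) dimsD(2)[OF d1] by simp
  qed
  then show ?thesis by (simp add: search_def s1_def)
qed

section \<open>Augmentation and maximum flow\<close>

definition find_sink :: prog where
  "find_sink = Asg 14 (Num 0) ;; Asg 15 (Num 0) ;;
     For 13 rN1 (nz (at1 aSNK 13) (nz (at1 aRCH 13) (Asg 15 (Num 1) ;; Asg 14 (Reg 13))))"

lemma find_sink_frame: "writes find_sink = {13, 14, 15}" "awrites find_sink = {}"
  by (auto simp: find_sink_def)

lemma run_find_sink:
  assumes s: "dims n s"
  shows "let t = run find_sink s in
     rg t 15 = 1 \<and> rg t 14 \<le> n \<and> 0 < ar s aSNK (rg t 14) 0 \<and> 0 < ar s aRCH (rg t 14) 0 \<or>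
     rg t 15 = 0 \<and> (\<forall>v\<le>n. 0 < ar s aSNK v 0 \<longrightarrow> ar s aRCH v 0 = 0)"
proof -
  define s1 where "s1 = run (Asg 14 (Num 0) ;; Asg 15 (Num 0)) s"
  have s1: "dims n s1" "ar s1 = ar s" "rg s1 15 = 0" using s by (simp_all add: s1_def dims_def)
  let ?p = "nz (at1 aSNK 13) (nz (at1 aRCH 13) (Asg 15 (Num 1) ;; Asg 14 (Reg 13)))"
  define Q where "Q = (\<lambda>k (t::hstate). rg t 15 = 1 \<and> rg t 14 \<le> n \<and> 0 < ar s aSNK (rg t 14) 0 \<and> 0 < ar s aRCH (rg t 14) 0 \<or>
     rg t 15 = 0 \<and> (\<forall>v<k. 0 < ar s aSNK v 0 \<longrightarrow> ar s aRCH v 0 = 0))"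
  have "Q (Suc n) (run (For 13 rN1 ?p) s1)"
  proof (rule For_rule[where P = Q], goal_cases)
    case 1
    show ?case using s1 by (simp add: Q_def)
  next
    case (2 v t)
    have "rg t rMM = rg s1 rMM" "ar t = ar s" using 2(3)[of rMM] 2(4) s1(2) by (auto simp: fun_eq_iff)
    moreover have "min v (rg s1 rMM) = v" "v \<le> n" using s1(1) 2(1) by (simp_all add: dims_def)
    ultimately show ?case using 2(2) by (auto simp: Q_def less_Suc_eq)
  next
    case (3 t)
    then show ?case using dimsD(2)[OF s1(1)] by (simp add: Q_def)
  qed
  moreover have "run find_sink s = run (For 13 rN1 ?p) s1" by (simp add: find_sink_def s1_def)
  ultimately show ?thesis by (simp add: Q_def less_Suc_eq_le)
qed

definition augment_body :: prog where
  "augment_body = less_then (Num 1) (at1 aRCH 16) (Asg 17 (at1 aPAR 16) ;;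
     wr2 aC 17 16 (Minus1 (at2 aC 17 16)) ;; wr2 aC 16 17 (Plus1 (at2 aC 16 17)) ;; Asg 16 (Reg 17))"

definition augment :: prog where
  "augment = Asg 16 (Reg 14) ;; For 18 rN1 augment_body"

lemma augment_frame:
  "writes augment_body = {16, 17}" "awrites augment_body = {aC}"
  "writes augment = {16, 17, 18}" "awrites augment = {aC}"
  by (auto simp: augment_def augment_body_def)

text \<open>The walk back from the sink ends in a source, hence in \<open>S\<close>. Telescoping
  \<open>cut_push\<close> over the walk leaves a loss of 1, which is compensated if the sink lies in
  \<open>S\<close>.\<close>

lemma run_augment:
  assumes s: "dims n s" and tr: "tree n (Suc n) s" and sink: "rg s 14 \<le> n" "0 < ar s aRCH (rg s 14) 0"
    and S: "\<And>v. v \<le> n \<Longrightarrow> ar s aSRC v 0 = 1 \<Longrightarrow> v \<in> S"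
  shows "int (cut n (ar (run augment s) aC) S) = int (cut n (ar s aC) S) - 1 + of_bool (rg s 14 \<in> S)"
proof -
  let ?R = "\<lambda>v. ar s aRCH v 0" and ?P = "\<lambda>v. ar s aPAR v 0"
  define s1 where "s1 = setr 16 (rg s 14) s"
  \<comment> \<open>Labels are at most \<open>n + 2\<close> and decrease along the walk, so
    \<open>n + 1\<close> rounds reach label 1. The last clause says that arcs still ahead, which
    lead into vertices with labels up to the current one, have kept their capacities; hence they can
    still carry a unit.\<close>
  define I where "I = (\<lambda>i (t::hstate). rg t 16 \<le> n \<and> 0 < ?R (rg t 16) \<and> (?R (rg t 16) = 1 \<or> ?R (rg t 16) + i \<le> n + 2) \<and>
     int (cut n (ar t aC) S) = int (cut n (ar s aC) S) - of_bool (rg t 16 \<in> S) + of_bool (rg s 14 \<in> S) \<and>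
     (\<forall>v\<le>n. 2 \<le> ?R v \<longrightarrow> ?R v \<le> ?R (rg t 16) \<longrightarrow> ar t aC (?P v) v = ar s aC (?P v) v))"
  have "int (cut n (ar (run (For 18 rN1 augment_body) s1) aC) S) = int (cut n (ar s aC) S) - 1 + of_bool (rg s 14 \<in> S)"
  proof (rule For_rule[where P = I], goal_cases)
    case 1
    have "?R (rg s 14) \<le> n + 2" using tr sink(1) unfolding tree_def by (metis Suc_eq_plus1 add_Suc_right one_add_one add.assoc)
    then show ?case using sink by (simp add: I_def s1_def)
  next
    case (2 i t)
    have I: "rg t 16 \<le> n" "0 < ?R (rg t 16)" "?R (rg t 16) = 1 \<or> ?R (rg t 16) + i \<le> n + 2"
       "int (cut n (ar t aC) S) = int (cut n (ar s aC) S) - of_bool (rg t 16 \<in> S) + of_bool (rg s 14 \<in> S)"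
       "\<And>v. v \<le> n \<Longrightarrow> 2 \<le> ?R v \<Longrightarrow> ?R v \<le> ?R (rg t 16) \<Longrightarrow> ar t aC (?P v) v = ar s aC (?P v) v"
      using 2(2) unfolding I_def by blast+
    have fa: "ar t aRCH = ar s aRCH" "ar t aPAR = ar s aPAR" 
      using 2(4)[of aRCH] 2(4)[of aPAR] by (simp_all add: augment_frame s1_def)
    have MM: "rg t rMM = rg s rMM" using 2(3)[of rMM] by (simp add: augment_frame s1_def)
    let ?c = "rg t 16"
    have mc: "min ?c (rg s rMM) = ?c" using I(1) s by (simp add: min_dims)
    show ?case
    proof (cases "1 < ?R ?c")
      case False
      then have "run augment_body (setr 18 i t) = setr 18 i t"
        by (simp add: augment_body_def fa MM mc)
      moreover have "?R ?c = 1" using False I(2) by simp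
      ultimately show ?thesis using I by (simp add: I_def)
    next
      case True
      let ?p = "?P ?c"
      have p: "?p \<le> n" "0 < ?R ?p" "?R ?p < ?R ?c" "0 < ar s aC ?p ?c"
        using tr I(1) True unfolding tree_def by simp_all
      have mp: "min ?p (rg s rMM) = ?p" using p(1) s by (simp add: min_dims)
      have pc: "?p \<noteq> ?c" using p(3) by auto
      have Cpc: "ar t aC ?p ?c = ar s aC ?p ?c" using I(5)[OF I(1)] True by simp
      let ?C = "ar t aC"
      let ?C' = "?C(?p := (?C ?p)(?c := ?C ?p ?c - 1), ?c := (?C ?c)(?p := ?C ?c ?p + 1))"
      have run: "ar (run augment_body (setr 18 i t)) aC = ?C'" "rg (run augment_body (setr 18 i t)) 16 = ?p"
        using True pc by (simp_all add: augment_body_def fa MM mc mp)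
      have "int (cut n ?C' S) = int (cut n ?C S) - of_bool (?p \<in> S) + of_bool (?c \<in> S)"
        by (rule cut_push) (use p I(1) pc Cpc in simp_all)
      then have "int (cut n ?C' S) = int (cut n (ar s aC) S) - of_bool (?p \<in> S) + of_bool (rg s 14 \<in> S)"
        using I(4) by simp
      moreover have "?C' (?P v) v = ar s aC (?P v) v" if v: "v \<le> n" "2 \<le> ?R v" "?R v \<le> ?R ?p" for v
      proof -
        have "v \<noteq> ?c" using v(3) p(3) by auto
        moreover have "?P v \<noteq> ?c"
        proof
          assume "?P v = ?c"
          then have "?R ?c < ?R v" using tr v(1,2) unfolding tree_def by metis
          then show False using v(3) p(3) by simp
        qed
        ultimately have "?C' (?P v) v = ?C (?P v) v" by simp
        then show ?thesis using I(5)[OF v(1,2)] v(3) p(3) by simp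
      qed
      moreover have "?R ?p = 1 \<or> ?R ?p + Suc i \<le> n + 2" using I(3) p(3) True by linarith
      ultimately show ?thesis using p unfolding I_def run by blast
    qed
  next
    case (3 t)
    have "rg s1 rN1 = Suc n" using s by (simp add: s1_def dims_def)
    then have I: "rg t 16 \<le> n" "0 < ?R (rg t 16)" "?R (rg t 16) = 1 \<or> ?R (rg t 16) + Suc n \<le> n + 2"
       "int (cut n (ar t aC) S) = int (cut n (ar s aC) S) - of_bool (rg t 16 \<in> S) + of_bool (rg s 14 \<in> S)"
      using 3(1) unfolding I_def by simp_all
    have "?R (rg t 16) = 1" using I(2,3) by linarith
    then have "rg t 16 \<in> S" using tr I(1) S unfolding tree_def by blast
    then show ?case using I(4) by simp
  qed
  then show ?thesis by (simp add: augment_def s1_def)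
qed

definition flow_body :: prog where
  "flow_body = search ;; find_sink ;; nz (Reg 15) (Asg rVAL (Plus1 (Reg rVAL)) ;; augment)"

definition flow :: prog where
  "flow = Asg rVAL (Num 0) ;; For 19 rOFF flow_body"

lemma flow_frame:
  "writes flow_body = {9, 10, 11, 12, 13, 14, 15, 16, 17, 18}" "awrites flow_body = {aC, aRCH, aPAR}"
  "writes flow = {9, 10, 11, 12, 13, 14, 15, 16, 17, 18, 19}" "awrites flow = {aC, aRCH, aPAR}"
  by (auto simp: flow_def flow_body_def search_frame find_sink_frame augment_frame)

definition feasible :: "nat \<Rightarrow> hstate \<Rightarrow> nat set \<Rightarrow> bool" where
  "feasible n s S \<longleftrightarrow> (\<forall>v\<le>n. 0 < ar s aSRC v 0 \<longrightarrow> v \<in> S) \<and> (\<forall>v\<le>n. 0 < ar s aSNK v 0 \<longrightarrow> v \<notin> S)"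

text \<open>No flow is stored. The invariant is that each feasible cut has lost exactly
  \<open>rVAL\<close> of its original value. Once no sink is reachable, the reached set has residual
  value 0, so its original value is \<open>rVAL\<close>; every other feasible cut still has a
  nonnegative residual value, so it is no smaller. \<open>rOFF\<close> rounds suffice since some
  feasible cut is smaller than \<open>rOFF\<close>, and rounds after the last augmentation leave the
  value and the capacities alone.\<close>

lemma run_flow:
  assumes s: "dims n s" and src: "\<And>v. v \<le> n \<Longrightarrow> ar s aSRC v 0 \<le> 1"
    and S0: "feasible n s S0" "cut n (ar s aC) S0 < rg s rOFF"
  shows "let t = run flow s in feasible n s (reached n t) \<and> cut n (ar s aC) (reached n t) = rg t rVAL \<and>
    (\<forall>S. feasible n s S \<longrightarrow> rg t rVAL \<le> cut n (ar s aC) S)"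
proof -
  define s1 where "s1 = setr rVAL 0 s"
  define stuck where "stuck = (\<lambda>t. feasible n s (reached n t) \<and> cut n (ar t aC) (reached n t) = 0)"
  define I where "I = (\<lambda>a (t::hstate). (\<forall>S. feasible n s S \<longrightarrow> int (cut n (ar t aC) S) = int (cut n (ar s aC) S) - int (rg t rVAL)) \<and>
     (rg t rVAL = a \<or> stuck t))"
  have "let t = run (For 19 rOFF flow_body) s1 in feasible n s (reached n t) \<and> cut n (ar s aC) (reached n t) = rg t rVAL \<and>
    (\<forall>S. feasible n s S \<longrightarrow> rg t rVAL \<le> cut n (ar s aC) S)"
  proof (rule For_rule[where P = I], goal_cases)
    case 1
    show ?case by (simp add: I_def s1_def)
  next
    case (2 a t)
    have I: "\<And>S. feasible n s S \<Longrightarrow> int (cut n (ar t aC) S) = int (cut n (ar s aC) S) - int (rg t rVAL)"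
      "rg t rVAL = a \<or> stuck t" using 2(2) unfolding I_def by blast+
    define t0 where "t0 = setr 19 a t"
    have t0: "ar t0 = ar t" "rg t0 rVAL = rg t rVAL" by (simp_all add: t0_def)
    have d0: "dims n t0"
      using s 2(3)[of rN] 2(3)[of rN1] 2(3)[of rMM] by (simp add: dims_def flow_frame t0_def s1_def)
    have a0: "ar t0 aSRC = ar s aSRC" "ar t0 aSNK = ar s aSNK"
      using 2(4)[of aSRC] 2(4)[of aSNK] by (simp_all add: flow_frame t0_def s1_def)
    define t1 where "t1 = run search t0"
    have d1: "dims n t1" unfolding t1_def by (rule dims_run[OF d0]) (simp_all add: search_frame)
    have tr: "tree n (Suc n) t1" "closed_reach n t1"
      using run_search[OF d0] src a0 by (simp_all add: t1_def)
    have a1: "ar t1 aSRC = ar s aSRC" "ar t1 aSNK = ar s aSNK" "ar t1 aC = ar t aC" "rg t1 rVAL = rg t rVAL"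
      using a0 t0 by (simp_all add: t1_def ar_frame rg_frame search_frame)
    define t2 where "t2 = run find_sink t1"
    have d2: "dims n t2" unfolding t2_def by (rule dims_run[OF d1]) (simp_all add: find_sink_frame)
    have a2: "ar t2 = ar t1" by (rule ext) (simp add: t2_def ar_frame find_sink_frame)
    have v2: "rg t2 rVAL = rg t rVAL" using a1 by (simp add: t2_def rg_frame find_sink_frame)
    have fs: "rg t2 15 = 1 \<and> rg t2 14 \<le> n \<and> 0 < ar s aSNK (rg t2 14) 0 \<and> 0 < ar t1 aRCH (rg t2 14) 0 \<or>
       rg t2 15 = 0 \<and> (\<forall>v\<le>n. 0 < ar s aSNK v 0 \<longrightarrow> ar t1 aRCH v 0 = 0)"
      using run_find_sink[OF d1] a1 unfolding t2_def Let_def by simp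
    have src1: "v \<in> S" if "feasible n s S" "v \<le> n" "ar t1 aSRC v 0 = 1" for S v
      using that a1(1) unfolding feasible_def by simp
    have run: "run flow_body (setr 19 a t) = (if 0 < rg t2 15 then run augment (setr rVAL (Suc (rg t2 rVAL)) t2) else t2)"
      by (simp add: flow_body_def t2_def t1_def t0_def)
    from fs show ?case
    proof
      assume f: "rg t2 15 = 1 \<and> rg t2 14 \<le> n \<and> 0 < ar s aSNK (rg t2 14) 0 \<and> 0 < ar t1 aRCH (rg t2 14) 0"
      define t3 where "t3 = setr rVAL (Suc (rg t2 rVAL)) t2"
      have d3: "dims n t3" using d2 by (simp add: t3_def dims_def)
      have a3: "ar t3 = ar t1" "rg t3 14 = rg t2 14" by (simp_all add: t3_def a2)
      have tr3: "tree n (Suc n) t3" using tr(1) by (simp add: tree_def a3)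
      have cut3: "int (cut n (ar (run augment t3) aC) S) = int (cut n (ar t aC) S) - 1" if S: "feasible n s S" for S
      proof -
        have "rg t3 14 \<notin> S" using f S a3 unfolding feasible_def by simp
        then show ?thesis using run_augment[OF d3 tr3, of S] f src1[OF S] by (simp add: a3 a1)
      qed
      have val: "rg (run augment t3) rVAL = Suc (rg t rVAL)" by (simp add: rg_frame augment_frame t3_def v2)
      \<comment> \<open>A further augmentation would push a cut of residual value 0 below 0.\<close>
      have "\<not> stuck t"
      proof
        assume st: "stuck t"
        then have "int (cut n (ar (run augment t3) aC) (reached n t)) = - 1"
          using cut3[of "reached n t"] by (simp add: stuck_def)
        then show False by simp
      qed
      then have "rg t rVAL = a" using I(2) by blast
      then show ?thesis using f cut3 I(1) val unfolding run by (simp add: I_def t3_def[symmetric])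
    next
      assume f: "rg t2 15 = 0 \<and> (\<forall>v\<le>n. 0 < ar s aSNK v 0 \<longrightarrow> ar t1 aRCH v 0 = 0)"
      have fe: "feasible n s (reached n t2)"
        unfolding feasible_def reached_def
      proof (intro conjI allI impI)
        fix v assume v: "v \<le> n" "0 < ar s aSRC v 0"
        then have "ar s aSRC v 0 = 1" using src[OF v(1)] by simp
        then have "ar t1 aRCH v 0 = 1" using tr(1) v(1) a1(1) unfolding tree_def by simp
        then show "v \<in> {v. v \<le> n \<and> 0 < ar t2 aRCH v 0}" using v by (simp add: a2)
      next
        fix v assume "v \<le> n" "0 < ar s aSNK v 0"
        then show "v \<notin> {v. v \<le> n \<and> 0 < ar t2 aRCH v 0}" using f by (simp add: a2)
      qed
      have "cut n (ar t1 aC) (reached n t1) = 0"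
        unfolding cut_def
      proof (rule sum.neutral, intro ballI)
        fix p assume "p \<in> {..n} \<times> {..n}"
        then show "(if fst p \<in> reached n t1 \<and> snd p \<notin> reached n t1 then ar t1 aC (fst p) (snd p) else 0) = 0"
          using tr(2)[unfolded closed_reach_def, rule_format, of "fst p" "snd p"]
          by (cases "ar t1 aC (fst p) (snd p) = 0") (auto simp: reached_def)
      qed
      then have "stuck t2" using fe by (simp add: stuck_def a2 reached_def)
      then show ?thesis using f I(1) a1 v2 unfolding run by (simp add: I_def a2)
    qed
  next
    case (3 t)
    have I: "\<And>S. feasible n s S \<Longrightarrow> int (cut n (ar t aC) S) = int (cut n (ar s aC) S) - int (rg t rVAL)"
      "rg t rVAL = rg s rOFF \<or> stuck t" using 3(1) unfolding I_def s1_def by simp_all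
    have le: "rg t rVAL \<le> cut n (ar s aC) S" if "feasible n s S" for S
      using I(1)[OF that] by linarith
    have st: "stuck t" using I(2) le[OF S0(1)] S0(2) by linarith
    then have "cut n (ar s aC) (reached n t) = rg t rVAL"
      using I(1)[of "reached n t"] unfolding stuck_def by simp
    then show ?case using st le by (simp add: stuck_def reached_def)
  qed
  then show ?thesis by (simp add: flow_def s1_def)
qed

section \<open>The best move for a terminal set\<close>

definition vset :: "nat \<Rightarrow> hstate \<Rightarrow> nat \<Rightarrow> nat set" where
  "vset n t A = {v. v < n \<and> 0 < ar t A v 0}"

definition matrix :: "nat \<Rightarrow> hstate \<Rightarrow> nat \<Rightarrow> nat set set \<Rightarrow> bool" where
  "matrix n t A M \<longleftrightarrow> (\<forall>u<n. \<forall>v<n. 0 < ar t A u v \<longleftrightarrow> {u, v} \<in> M)"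

lemma vset_setr [simp]: "vset n (setr x c t) A = vset n t A"
  by (simp add: vset_def)

lemma matrix_setr [simp]: "matrix n (setr x c t) A M = matrix n t A M"
  by (simp add: matrix_def)

lemma vset_cong: "ar t A = ar t' A \<Longrightarrow> vset n t A = vset n t' A"
  by (simp add: vset_def)

lemma matrix_cong: "ar t A = ar t' A \<Longrightarrow> matrix n t A M = matrix n t' A M"
  by (simp add: matrix_def)

lemma vset_seta: "v < n \<Longrightarrow> vset n (seta A v 0 c t) B =
   (if A = B then (if 0 < c then insert v (vset n t A) else vset n t A - {v}) else vset n t B)"
  by (auto simp: vset_def)

lemma vset_frame: "A \<notin> awrites p \<Longrightarrow> vset n (run p t) A = vset n t A"
  by (rule vset_cong) (rule ar_frame)

lemma matrix_frame: "A \<notin> awrites p \<Longrightarrow> matrix n (run p t) A M = matrix n t A M"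
  by (rule matrix_cong) (rule ar_frame)

lemma matrixD: "matrix n t A M \<Longrightarrow> u < n \<Longrightarrow> v < n \<Longrightarrow> 0 < ar t A u v \<longleftrightarrow> {u, v} \<in> M"
  by (simp add: matrix_def)

lemma dims_setr [simp]: "x \<noteq> 0 \<Longrightarrow> x \<noteq> 4 \<Longrightarrow> x \<noteq> 2 \<Longrightarrow> dims n (setr x c t) = dims n t"
  by (auto simp: dims_def)

definition load_cell :: "nat \<Rightarrow> prog" where
  "load_cell A = nz (at2 aADJ 20 21) (Cond (Num 0) (at2 A 20 21)
     (less_then (Reg 20) (Reg 21) (wr2 aC 20 21 (Num 1) ;; wr2 aC rN 20 (Plus1 (at2 aC rN 20))))
     (wr2 aC 20 21 (Num 1)))"

definition load_row :: "nat \<Rightarrow> prog" where "load_row A = For 21 rN (load_cell A)"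

definition load :: "nat \<Rightarrow> prog" where
  "load A = For 20 rN1 (For 21 rN1 (wr2 aC 20 21 (Num 0))) ;; For 20 rN (load_row A)"

lemma load_frame:
  "writes (load_cell A) = {}" "awrites (load_cell A) = {aC}"
  "writes (load_row A) = {21}" "awrites (load_row A) = {aC}"
  "writes (load A) = {20, 21}" "awrites (load A) = {aC}"
  by (auto simp: load_cell_def load_row_def load_def)

text \<open>The capacity matrix after the cells before \<open>(k, j)\<close> have been processed row
  by row: the invariant of the loading loops, which ends in \<open>cap\<close>.\<close>

definition pcap :: "nat \<Rightarrow> nat set set \<Rightarrow> nat set set \<Rightarrow> nat \<Rightarrow> nat \<Rightarrow> nat \<Rightarrow> nat \<Rightarrow> nat" where
  "pcap n E F k j u v =
     (if u < n \<and> v < n then of_bool ((u < k \<or> u = k \<and> v < j) \<and> {u, v} \<in> E \<and> ({u, v} \<in> F \<longrightarrow> u < v))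
      else if u = n \<and> v < n then card {w. w < n \<and> v < w \<and> {v, w} \<in> F \<and> (v < k \<or> v = k \<and> w < j)} else 0)"

text \<open>The network for a move: an edge outside \<open>F\<close> has capacity 1 in both directions, an edge \<open>{u, v}\<close> of \<open>F\<close>
  with \<open>u < v\<close> costs 1 unless both ends are on the source side, via the arcs from the source \<open>n\<close>
  to \<open>u\<close> and from \<open>u\<close> to \<open>v\<close>.\<close>

definition cap :: "nat \<Rightarrow> nat set set \<Rightarrow> nat set set \<Rightarrow> nat \<Rightarrow> nat \<Rightarrow> nat" where
  "cap n E F = pcap n E F n 0"

lemma run_load_row:
  assumes t: "dims n t" "rg t 20 = k" "k < n" "matrix n t aADJ E" "matrix n t A F" "A \<noteq> aC" "F \<subseteq> E"
    and C: "\<forall>u\<le>n. \<forall>v\<le>n. ar t aC u v = pcap n E F k 0 u v"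
  shows "\<forall>u\<le>n. \<forall>v\<le>n. ar (run (load_row A) t) aC u v = pcap n E F (Suc k) 0 u v"
  unfolding load_row_def
proof (rule For_rule[where P = "\<lambda>j t'. \<forall>u\<le>n. \<forall>v\<le>n. ar t' aC u v = pcap n E F k j u v"], goal_cases)
  case 1
  show ?case by (rule C)
next
  case (2 j t1)
  have j: "j < n" using 2(1) t(1) by (simp add: dims_def)
  have C1: "ar t1 aC u v = pcap n E F k j u v" if "u \<le> n" "v \<le> n" for u v using 2(2) that by blast
  have r: "rg t1 rMM = rg t rMM" "rg t1 20 = k" "rg t1 rN = n"
    using 2(3)[of rMM] 2(3)[of 20] 2(3)[of rN] t by (simp_all add: load_frame dims_def)
  have a: "ar t1 aADJ = ar t aADJ" "ar t1 A = ar t A" using 2(4)[of aADJ] 2(4)[of A] t(6) by (simp_all add: load_frame)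
  have m: "min j (rg t rMM) = j" "min k (rg t rMM) = k" "min n (rg t rMM) = n"
    using t(1,3) j by (simp_all add: min_dims)
  have e: "0 < ar t aADJ k j \<longleftrightarrow> {k, j} \<in> E" "0 < ar t A k j \<longleftrightarrow> {k, j} \<in> F"
    using t(3-5) j by (simp_all add: matrixD)
  have set_eq: "{w. w < n \<and> v < w \<and> {v, w} \<in> F \<and> (v < k \<or> v = k \<and> w < Suc j)} =
     (if v = k \<and> k < j \<and> {k, j} \<in> F then insert j {w. w < n \<and> v < w \<and> {v, w} \<in> F \<and> (v < k \<or> v = k \<and> w < j)}
      else {w. w < n \<and> v < w \<and> {v, w} \<in> F \<and> (v < k \<or> v = k \<and> w < j)})" for v
    using j by (auto simp: less_Suc_eq)
  have card_eq: "card {w. w < n \<and> v < w \<and> {v, w} \<in> F \<and> (v < k \<or> v = k \<and> w < Suc j)} =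
     card {w. w < n \<and> v < w \<and> {v, w} \<in> F \<and> (v < k \<or> v = k \<and> w < j)} + of_bool (v = k \<and> k < j \<and> {k, j} \<in> F)" for v
    unfolding set_eq by simp
  have P: "pcap n E F k (Suc j) u v = (if u = k \<and> v = j then of_bool ({k, j} \<in> E \<and> ({k, j} \<in> F \<longrightarrow> k < j))
     else if u = n \<and> v = k then pcap n E F k j n k + of_bool (k < j \<and> {k, j} \<in> F) else pcap n E F k j u v)" 
    for u v
    using j t(3) unfolding pcap_def card_eq by (auto simp: less_Suc_eq)
  have run: "ar (run (load_cell A) (setr 21 j t1)) aC u v = (if u = k \<and> v = j then (if {k, j} \<in> E \<and> ({k, j} \<in> F \<longrightarrow> k < j) then 1 else ar t1 aC k j)
     else if u = n \<and> v = k then ar t1 aC n k + of_bool (k < j \<and> {k, j} \<in> F) else ar t1 aC u v)" for u v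
    using e t(3,7) by (auto simp: load_cell_def r m a)
  show ?case
  proof (intro allI impI)
    fix u v assume "u \<le> n" "v \<le> n"
    moreover have "pcap n E F k j k j = 0" using t(3) j by (simp add: pcap_def)
    ultimately show "ar (run (load_cell A) (setr 21 j t1)) aC u v = pcap n E F k (Suc j) u v"
      unfolding run P using C1 t(3) j by simp
  qed
next
  case (3 t1)
  have "{w. w < n \<and> v < w \<and> {v, w} \<in> F \<and> (v < k \<or> v = k \<and> w < n)} =
    {w. w < n \<and> v < w \<and> {v, w} \<in> F \<and> (v < Suc k \<or> v = Suc k \<and> w < 0)}" for v
    by (auto simp: less_Suc_eq)
  then have "pcap n E F k n u v = pcap n E F (Suc k) 0 u v" for u v
    unfolding pcap_def by (auto simp: less_Suc_eq)
  then show ?case using 3(1) t(1) by (simp add: dims_def)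
qed

lemma run_load:
  assumes t: "dims n t" "matrix n t aADJ E" "matrix n t A F" "A \<noteq> aC" "F \<subseteq> E"
  shows "\<forall>u\<le>n. \<forall>v\<le>n. ar (run (load A) t) aC u v = cap n E F u v"
proof -
  define t0 where "t0 = run (For 20 rN1 (For 21 rN1 (wr2 aC 20 21 (Num 0)))) t"
  have "\<forall>u<Suc n. \<forall>v\<le>n. ar t0 aC u v = 0"
    unfolding t0_def
  proof (rule For_rule[where P = "\<lambda>k t'. \<forall>u<k. \<forall>v\<le>n. ar t' aC u v = 0"], goal_cases)
    case (2 k t1)
    have kn: "k \<le> n" using 2(1) t(1) by (simp add: dims_def)
    have r: "rg t1 rMM = rg t rMM" "rg t1 rN1 = Suc n"
      using 2(3)[of rMM] 2(3)[of rN1] t by (simp_all add: dims_def)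
    have "(\<forall>u<k. \<forall>v\<le>n. ar (run (For 21 rN1 (wr2 aC 20 21 (Num 0))) (setr 20 k t1)) aC u v = 0) \<and>
       (\<forall>v<Suc n. ar (run (For 21 rN1 (wr2 aC 20 21 (Num 0))) (setr 20 k t1)) aC k v = 0)"
    proof (rule For_rule[where P = "\<lambda>j t'. (\<forall>u<k. \<forall>v\<le>n. ar t' aC u v = 0) \<and> (\<forall>v<j. ar t' aC k v = 0)"], goal_cases)
      case 1
      then show ?case using 2(2) by simp
    next
      case (2 j t2)
      have "rg t2 rMM = rg t rMM" "rg t2 20 = k" using 2(3)[of rMM] 2(3)[of 20] r by simp_all
      moreover have "min j (rg t rMM) = j" "min k (rg t rMM) = k"
        using 2(1) r kn t(1) by (simp_all add: min_dims)
      ultimately show ?case using 2(2) by (simp add: less_Suc_eq)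
    next
      case (3 t2)
      then show ?case using r by simp
    qed
    then show ?case by (metis less_Suc_eq less_Suc_eq_le)
  next
    case (3 t1)
    then show ?case using dimsD(2)[OF t(1)] by simp
  qed simp
  then have C0: "\<forall>u\<le>n. \<forall>v\<le>n. ar t0 aC u v = pcap n E F 0 0 u v"
    by (auto simp: pcap_def less_Suc_eq_le)
  have d0: "dims n t0" "matrix n t0 aADJ E" "matrix n t0 A F"
    unfolding t0_def using t dims_run[OF t(1)] by (simp_all add: matrix_frame)
  have "\<forall>u\<le>n. \<forall>v\<le>n. ar (run (For 20 rN (load_row A)) t0) aC u v = pcap n E F n 0 u v"
  proof (rule For_rule[where P = "\<lambda>k t'. \<forall>u\<le>n. \<forall>v\<le>n. ar t' aC u v = pcap n E F k 0 u v"], goal_cases)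
    case 1
    show ?case by (rule C0)
  next
    case (2 k t1)
    have "dims n (setr 20 k t1)" using d0(1) 2(3)[of rN] 2(3)[of rN1] 2(3)[of rMM] by (simp add: dims_def load_frame)
    moreover have "matrix n (setr 20 k t1) aADJ E" "matrix n (setr 20 k t1) A F"
      using d0 2(4)[of aADJ] 2(4)[of A] t(4) by (simp_all add: load_frame matrix_def)
    moreover have "k < n" using 2(1) d0(1) by (simp add: dims_def)
    moreover have "\<forall>u\<le>n. \<forall>v\<le>n. ar (setr 20 k t1) aC u v = pcap n E F k 0 u v" using 2(2) by (simp only: setr_simps)
    ultimately show ?case using run_load_row[of n "setr 20 k t1" k E A F] t(4,5) by simp
  next
    case (3 t1)
    then show ?case using d0(1) by (simp add: dims_def)
  qed
  then show ?thesis by (simp add: load_def t0_def cap_def)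
qed

definition mincut :: "nat \<Rightarrow> prog" where
  "mincut A = load A ;; wr1 aSRC rN (Num 1) ;; wr1 aSNK rN (Num 0) ;; flow"

lemma mincut_frame:
  "writes (mincut A) = {9, 10, 11, 12, 13, 14, 15, 16, 17, 18, 19, 20, 21}"
  "awrites (mincut A) = {aC, aSRC, aSNK, aRCH, aPAR}"
  by (auto simp: mincut_def load_frame flow_frame)

definition copy_sx :: prog where
  "copy_sx = For 22 rN (wr1 aSRC 22 (Num 0) ;; nz (at1 aS 22) (wr1 aSRC 22 (Num 1)) ;;
     wr1 aSNK 22 (at1 aX 22))"

definition add_r :: prog where
  "add_r = For 23 rN (nz (at1 aR 23) (iszero (at1 aS 23) (wr1 aSNK 23 (Num 1))))"

lemma copy_frame:
  "writes copy_sx = {22}" "awrites copy_sx = {aSRC, aSNK}"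
  "writes add_r = {23}" "awrites add_r = {aSNK}"
  by (auto simp: copy_sx_def add_r_def)

lemma run_copy_sx:
  assumes "dims n t"
  shows "vset n (run copy_sx t) aSRC = vset n t aS \<and> vset n (run copy_sx t) aSNK = vset n t aX \<and>
    (\<forall>v<n. ar (run copy_sx t) aSRC v 0 \<le> 1)"
  unfolding copy_sx_def
proof (rule For_rule[where P = "\<lambda>k t'. \<forall>v<k. ar t' aSRC v 0 \<le> 1 \<and>
   (0 < ar t' aSRC v 0 \<longleftrightarrow> 0 < ar t aS v 0) \<and> ar t' aSNK v 0 = ar t aX v 0"], goal_cases)
  case (2 k t1)
  have "min k (rg t1 rMM) = k" using 2(1) 2(3)[of rMM] assms by (simp add: dims_def)
  moreover have "ar t1 aS = ar t aS" "ar t1 aX = ar t aX" using 2(4)[of aS] 2(4)[of aX] by simp_all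
  ultimately show ?case using 2(2) by (simp add: less_Suc_eq)
next
  case (3 t1)
  then show ?case using dimsD(1)[OF assms] by (auto simp: vset_def)
qed simp

lemma run_add_r:
  assumes "dims n t"
  shows "vset n (run add_r t) aSNK = vset n t aSNK \<union> (vset n t aR - vset n t aS)"
  unfolding add_r_def
proof (rule For_rule[where P = "\<lambda>k t'. \<forall>v<n. 0 < ar t' aSNK v 0 \<longleftrightarrow>
   (0 < ar t aSNK v 0 \<or> v < k \<and> 0 < ar t aR v 0 \<and> ar t aS v 0 = 0)"], goal_cases)
  case (2 k t1)
  have "min k (rg t1 rMM) = k" using 2(1) 2(3)[of rMM] assms by (simp add: dims_def)
  moreover have "ar t1 aS = ar t aS" "ar t1 aR = ar t aR" using 2(4)[of aS] 2(4)[of aR] by simp_all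
  ultimately show ?case using 2(2) by (auto simp: less_Suc_eq)
next
  case (3 t1)
  then show ?case using dimsD(1)[OF assms] by (auto simp: vset_def)
qed simp

section \<open>Minimum cuts of the network and best moves\<close>

locale graph_n = fgraph "{..<n}" E R for n E R
begin

text \<open>Every edge of the move is counted exactly once. \<open>P1\<close> collects cut arcs
  between two vertices. \<open>P2\<close> collects the edges of \<open>F\<close> whose smaller end
  is outside \<open>A\<close>, which together make up the cut arcs from \<open>n\<close>; the arc of
  such an edge to its larger end then starts on the sink side. So an edge of \<open>F\<close> is
  counted unless both its ends are in \<open>A\<close>, and an edge outside \<open>F\<close> exactly
  if it is in the boundary of \<open>A\<close>.\<close>

lemma cut_cap:
  assumes F: "F \<subseteq> E" and A: "A \<subseteq> {..<n}"
  shows "cut n (cap n E F) (insert n A) = card (move E F A)"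
proof -
  define P1 where "P1 = {(u, v). u < n \<and> v < n \<and> u \<in> A \<and> v \<notin> A \<and> {u, v} \<in> E \<and> ({u, v} \<in> F \<longrightarrow> u < v)}"
  define P2 where "P2 = {(v, w). v < n \<and> w < n \<and> v < w \<and> v \<notin> A \<and> {v, w} \<in> F}"
  have fin: "finite P1" "finite P2"
    by (rule finite_subset[of _ "{..<n} \<times> {..<n}"]; auto simp: P1_def P2_def)+
  have "cut n (cap n E F) (insert n A) = (\<Sum>p\<in>({..<n} \<times> {..<n}) \<union> ({n} \<times> {..<n}). 
      if fst p \<in> insert n A \<and> snd p \<notin> A then cap n E F (fst p) (snd p) else 0)"
    unfolding cut_def by (rule sum.mono_neutral_cong_right) auto
  also have "\<dots> = (\<Sum>p\<in>{..<n} \<times> {..<n}. if fst p \<in> insert n A \<and> snd p \<notin> A then cap n E F (fst p) (snd p) else 0) +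
      (\<Sum>p\<in>{n} \<times> {..<n}. if fst p \<in> insert n A \<and> snd p \<notin> A then cap n E F (fst p) (snd p) else 0)"
    by (rule sum.union_disjoint) auto
  also have "(\<Sum>p\<in>{..<n} \<times> {..<n}. if fst p \<in> insert n A \<and> snd p \<notin> A then cap n E F (fst p) (snd p) else 0) =
      (\<Sum>p\<in>{..<n} \<times> {..<n}. if p \<in> P1 then 1 else 0)"
    by (rule sum.cong) (auto simp: P1_def cap_def pcap_def)
  also have "\<dots> = card P1"
  proof -
    have "{p \<in> {..<n} \<times> {..<n}. p \<in> P1} = P1" by (auto simp: P1_def)
    then show ?thesis by (simp flip: sum.inter_filter)
  qed
  also have "(\<Sum>p\<in>{n} \<times> {..<n}. if fst p \<in> insert n A \<and> snd p \<notin> A then cap n E F (fst p) (snd p) else 0) =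
      (\<Sum>v\<in>{..<n}. card {w. (v, w) \<in> P2})"
  proof -
    have "(if v \<notin> A then cap n E F n v else 0) = card {w. (v, w) \<in> P2}" if "v < n" for v
      using that by (auto simp: cap_def pcap_def P2_def intro!: arg_cong[where f = card])
    then have "(\<Sum>v\<in>{..<n}. if v \<notin> A then cap n E F n v else 0) = (\<Sum>v\<in>{..<n}. card {w. (v, w) \<in> P2})"
      by (intro sum.cong) auto
    moreover have "{n} \<times> {..<n} = Pair n ` {..<n}" by auto
    ultimately show ?thesis by (simp add: sum.reindex inj_on_def cong: if_cong)
  qed
  also have "\<dots> = card (SIGMA v:{..<n}. {w. (v, w) \<in> P2})"
  proof (rule card_SigmaI[symmetric])
    show "\<forall>v\<in>{..<n}. finite {w. (v, w) \<in> P2}" by (auto simp: P2_def)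
  qed simp
  also have "(SIGMA v:{..<n}. {w. (v, w) \<in> P2}) = P2" by (auto simp: P2_def)
  also have "card P1 + card P2 = card (P1 \<union> P2)"
    by (rule card_Un_disjoint[symmetric]) (use fin in \<open>auto simp: P1_def P2_def\<close>)
  also have "\<dots> = card (move E F A)"
  proof (rule bij_betw_same_card[of "\<lambda>(u, v). {u, v}"], rule bij_betw_imageI)
    show "inj_on (\<lambda>(u, v). {u, v}) (P1 \<union> P2)"
    proof (rule inj_onI)
      fix p q assume p: "p \<in> P1 \<union> P2" and q: "q \<in> P1 \<union> P2" and eq: "(\<lambda>(u, v). {u, v}) p = (\<lambda>(u, v). {u, v}) q"
      obtain a b c d where pq: "p = (a, b)" "q = (c, d)" by (cases p, cases q)
      have "a = c \<and> b = d \<or> a = d \<and> b = c" using eq pq by (simp add: doubleton_eq_iff)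
      then show "p = q" using p q pq unfolding P1_def P2_def by (auto simp: insert_commute)
    qed
    show "(\<lambda>(u, v). {u, v}) ` (P1 \<union> P2) = move E F A"
    proof (intro equalityI subsetI)
      fix e assume "e \<in> (\<lambda>(u, v). {u, v}) ` (P1 \<union> P2)"
      then obtain a b where "(a, b) \<in> P1 \<union> P2" "e = {a, b}" by auto
      then show "e \<in> move E F A" using F by (auto simp: P1_def P2_def move_def bd_def)
    next
      fix e assume e: "e \<in> move E F A"
      then have "e \<in> E" using F by (auto simp: move_def bd_def)
      then obtain x y where xy: "e = {x, y}" "x \<noteq> y" "x < n" "y < n" by (rule edgeE) auto
      obtain a b where ab: "e = {a, b}" "a < n" "b < n" "a < b"
      proof (cases "x < y")
        case True
        then show ?thesis using that[of x y] xy by simp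
      next
        case False
        then show ?thesis using that[of y x] xy by (simp add: insert_commute)
      qed
      have "(a, b) \<in> P1 \<union> P2 \<or> (b, a) \<in> P1 \<union> P2"
      proof (cases "e \<in> F \<and> a \<notin> A")
        case True
        then show ?thesis using ab by (simp add: P2_def)
      next
        case False
        then have bd: "e \<in> bd E A" using e ab(1) by (auto simp: move_def)
        have "a \<in> A \<and> b \<notin> A \<or> b \<in> A \<and> a \<notin> A" using bd ab(1) by (auto simp: bd_def)
        then show ?thesis
        proof
          assume "a \<in> A \<and> b \<notin> A"
          then show ?thesis using ab \<open>e \<in> E\<close> by (simp add: P1_def)
        next
          assume 1: "b \<in> A \<and> a \<notin> A"
          have ba: "{b, a} = e" using ab(1) by auto
          have "e \<notin> F" using 1 False by simp
          then show ?thesis using 1 ab(2,3) \<open>e \<in> E\<close> by (simp add: P1_def ba)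
        qed
      qed
      then show "e \<in> (\<lambda>(u, v). {u, v}) ` (P1 \<union> P2)"
      proof
        assume "(a, b) \<in> P1 \<union> P2"
        then show ?thesis using ab(1) by (intro image_eqI[of _ _ "(a, b)"]) simp_all
      next
        assume "(b, a) \<in> P1 \<union> P2"
        then show ?thesis using ab(1) by (intro image_eqI[of _ _ "(b, a)"]) auto
      qed
    qed
  qed
  finally show ?thesis .
qed

text \<open>Vertex \<open>n\<close> is made an additional source that is never a sink. The feasible
  sides inside the network are thus \<open>insert n S\<close>, to which \<open>cut_cap\<close>
  applies. \<open>card E < rg t rOFF\<close> guarantees enough augmentations, because a move is a
  subset of \<open>E\<close>.\<close>

lemma run_mincut:
  assumes t: "dims n t" "matrix n t aADJ E" "matrix n t A F" "A \<notin> {aC, aSRC, aSNK, aRCH, aPAR}" and F: "F \<subseteq> E"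
    and src: "\<And>v. v < n \<Longrightarrow> ar t aSRC v 0 \<le> 1" and disj: "vset n t aSRC \<inter> vset n t aSNK = {}"
    and off: "card E < rg t rOFF"
  shows "let t' = run (mincut A) t; B = vset n t' aRCH in
     vset n t aSRC \<subseteq> B \<and> B \<subseteq> {..<n} - vset n t aSNK \<and> rg t' rVAL = card (move E F B) \<and>
     (\<forall>S. vset n t aSRC \<subseteq> S \<longrightarrow> S \<subseteq> {..<n} - vset n t aSNK \<longrightarrow> rg t' rVAL \<le> card (move E F S))"
proof -
  define t1 where "t1 = run (load A) t"
  define t2 where "t2 = seta aSNK n 0 0 (seta aSRC n 0 1 t1)"
  define t3 where "t3 = run flow t2"
  have d1: "dims n t1" unfolding t1_def by (rule dims_run[OF t(1)]) (simp_all add: load_frame)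
  have r1: "rg t1 rN = n" "rg t1 rN1 = Suc n" "min n (rg t1 rMM) = n" "rg t1 rOFF = rg t rOFF"
    using d1 by (simp_all add: dims_def t1_def rg_frame load_frame)
  have d2: "dims n t2" using d1 by (simp add: t2_def dims_def)
  have run: "run (mincut A) t = t3" by (simp add: mincut_def t1_def[symmetric] r1 t2_def t3_def)
  have a1: "ar t1 aSRC = ar t aSRC" "ar t1 aSNK = ar t aSNK" by (simp_all add: t1_def ar_frame load_frame)
  have C: "\<forall>u\<le>n. \<forall>v\<le>n. ar t1 aC u v = cap n E F u v"
    unfolding t1_def by (rule run_load) (use t F in auto)
  have C2: "cut n (ar t2 aC) S = cut n (cap n E F) S" for S
    unfolding cut_def using C by (intro sum.cong) (auto simp: t2_def)
  let ?S = "vset n t aSRC" and ?X = "vset n t aSNK"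
  have fe: "feasible n t2 S \<longleftrightarrow> n \<in> S \<and> ?S \<subseteq> S \<and> S \<inter> ?X = {}" for S
  proof -
    have 1: "ar t2 aSRC v 0 = (if v = n then 1 else ar t aSRC v 0)" "ar t2 aSNK v 0 = (if v = n then 0 else ar t aSNK v 0)" for v
      by (simp_all add: t2_def a1)
    have all: "(\<forall>v\<le>n. Q v) \<longleftrightarrow> Q n \<and> (\<forall>v<n. Q v)" for Q
      using le_eq_less_or_eq by blast
    have neq: "v < n \<Longrightarrow> v \<noteq> n" for v by simp
    have "(\<forall>v\<le>n. 0 < ar t2 aSRC v 0 \<longrightarrow> v \<in> S) \<longleftrightarrow> n \<in> S \<and> (\<forall>v<n. 0 < ar t aSRC v 0 \<longrightarrow> v \<in> S)"
      unfolding all 1 by (simp add: neq cong: conj_cong)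
    moreover have "(\<forall>v\<le>n. 0 < ar t2 aSNK v 0 \<longrightarrow> v \<notin> S) \<longleftrightarrow> (\<forall>v<n. 0 < ar t aSNK v 0 \<longrightarrow> v \<notin> S)"
      unfolding all 1 by (simp add: neq)
    ultimately show ?thesis unfolding feasible_def vset_def by blast
  qed
  have cutS: "cut n (ar t2 aC) (insert n S) = card (move E F S)" if "S \<subseteq> {..<n}" for S
    unfolding C2 using cut_cap[OF F that] .
  have Sn: "?S \<subseteq> {..<n}" by (auto simp: vset_def)
  have nX: "n \<notin> ?X" by (simp add: vset_def)
  have "feasible n t2 (insert n ?S)" unfolding fe using disj nX by auto
  moreover have "cut n (ar t2 aC) (insert n ?S) < rg t2 rOFF"
  proof -
    have "card (move E F ?S) \<le> card E" by (intro card_mono finite_E move_subset F)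
    moreover have "rg t2 rOFF = rg t rOFF" by (simp add: t2_def r1)
    ultimately show ?thesis using off unfolding cutS[OF Sn] by simp
  qed
  moreover have "ar t2 aSRC v 0 \<le> 1" if "v \<le> n" for v
    using src[of v] that a1 by (cases "v = n") (simp_all add: t2_def)
  ultimately have fl: "feasible n t2 (reached n t3)" "cut n (ar t2 aC) (reached n t3) = rg t3 rVAL"
      "\<And>S. feasible n t2 S \<Longrightarrow> rg t3 rVAL \<le> cut n (ar t2 aC) S"
    using run_flow[OF d2, of "insert n ?S"] unfolding Let_def t3_def[symmetric] by blast+
  let ?B = "vset n t3 aRCH"
  have B: "reached n t3 = insert n ?B"
    using fl(1)[unfolded fe] by (auto simp: reached_def vset_def)
  have B': "?B \<subseteq> {..<n}" by (auto simp: vset_def)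
  have "?S \<subseteq> ?B" using fl(1)[unfolded fe B] Sn by auto
  moreover have "?B \<inter> ?X = {}" using fl(1)[unfolded fe B] by auto
  moreover have "rg t3 rVAL = card (move E F ?B)" using fl(2) cutS[OF B'] unfolding B by simp
  moreover have "rg t3 rVAL \<le> card (move E F S)" if S: "?S \<subseteq> S" "S \<subseteq> {..<n} - ?X" for S
  proof -
    have "feasible n t2 (insert n S)" unfolding fe using S nX by auto
    moreover have "S \<subseteq> {..<n}" using S by auto
    ultimately show ?thesis using fl(3)[of "insert n S"] cutS[of S] by simp
  qed
  ultimately show ?thesis unfolding Let_def run using B' by blast
qed

definition ginv :: "hstate \<Rightarrow> bool" where
  "ginv t \<longleftrightarrow> dims n t \<and> matrix n t aADJ E \<and> vset n t aR = R \<and> matrix n t aZ {} \<and> card E < rg t rOFF"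

lemma ginv_dims: "ginv t \<Longrightarrow> dims n t"
  by (simp add: ginv_def)

lemma ginv_run:
  assumes "ginv t" "rN \<notin> writes p" "rN1 \<notin> writes p" "rMM \<notin> writes p" "rOFF \<notin> writes p"
    "aADJ \<notin> awrites p" "aR \<notin> awrites p" "aZ \<notin> awrites p"
  shows "ginv (run p t)"
  using assms unfolding ginv_def by (simp add: dims_run matrix_frame vset_frame rg_frame)

lemma ginv_setr: "ginv t \<Longrightarrow> x \<notin> {rN, rN1, rMM, rOFF} \<Longrightarrow> ginv (setr x c t)"
  by (simp add: ginv_def)

lemma ginv_seta: "ginv t \<Longrightarrow> A \<notin> {aADJ, aR, aZ} \<Longrightarrow> ginv (seta A u v c t)"
  by (auto simp: ginv_def dims_def matrix_def vset_def)

lemma ginv_agree: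
  assumes "ginv t" "\<And>x. x \<in> {rN, rN1, rMM, rOFF} \<Longrightarrow> rg t' x = rg t x" "\<And>A. A \<in> {aADJ, aR, aZ} \<Longrightarrow> ar t' A = ar t A"
  shows "ginv t'"
  using assms by (simp add: ginv_def dims_def matrix_def vset_def)

text \<open>With the empty edge set a move is just the boundary, so the same program, run on the
  zero matrix, also computes the cut values for the branching.\<close>

lemma run_mincut_mval:
  assumes t: "ginv t" and src: "\<And>v. v < n \<Longrightarrow> ar t aSRC v 0 \<le> 1" and disj: "vset n t aSRC \<inter> vset n t aSNK = {}"
  shows "rg (run (mincut aZ) t) rVAL = mval (vset n t aSRC) (vset n t aSNK)"
proof -
  let ?t = "run (mincut aZ) t"
  have mv: "card (move E {} S) = d S" for S by (simp add: move_def d_def)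
  have m: "vset n t aSRC \<subseteq> vset n ?t aRCH" "vset n ?t aRCH \<subseteq> {..<n} - vset n t aSNK"
      "rg ?t rVAL = d (vset n ?t aRCH)"
     "\<And>S. vset n t aSRC \<subseteq> S \<Longrightarrow> S \<subseteq> {..<n} - vset n t aSNK \<Longrightarrow> rg ?t rVAL \<le> d S"
    using run_mincut[of t aZ "{}"] t src disj unfolding ginv_def Let_def mv by auto
  have "vset n t aSRC \<subseteq> {..<n} - vset n t aSNK" using m(1,2) by auto
  then obtain A where A: "vset n t aSRC \<subseteq> A" "A \<subseteq> {..<n} - vset n t aSNK"
      "d A = mval (vset n t aSRC) (vset n t aSNK)"
    by (rule mval_attained)
  show ?thesis using mval_le[OF m(1,2)] m(3) m(4)[OF A(1,2)] A(3) by simp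
qed

end

section \<open>The branching step\<close>

text \<open>Register 24 holds the first component of \<open>pick\<close>, register 25 the vertex and
  register 26 the cut value to compare with. The code 3 is set by \<open>nbr_body\<close> for a
  neighbour that \<open>free_test\<close> has yet to classify as 1 or 2.\<close>

definition rule1_body :: prog where
  "rule1_body = iszero (Reg 24) (nz (at1 aR 27) (iszero (at1 aS 27) (iszero (at1 aX 27)
     (copy_sx ;; wr1 aSNK 27 (Num 1) ;; mincut aZ ;;
      less_then (Reg 26) (Reg rVAL) (Asg 24 (Num 1) ;; Asg 25 (Reg 27))))))"

definition nbr_body :: prog where
  "nbr_body = iszero (Reg 24) (nz (at1 aS 29) (nz (at2 aADJ 29 28) (iszero (at1 aS 28)
     (iszero (at1 aX 28) (Asg 24 (Num 3) ;; Asg 25 (Reg 28))))))"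

definition nbr_row :: prog where "nbr_row = For 29 rN nbr_body"

definition free_test :: prog where
  "free_test = less_then (Num 2) (Reg 24) (Asg 24 (Num 1) ;; iszero (at1 aR 25)
     (copy_sx ;; add_r ;; mincut aZ ;; Asg 26 (Reg rVAL) ;;
      copy_sx ;; add_r ;; wr1 aSRC 25 (Num 1) ;; mincut aZ ;;
      Cond (Reg 26) (Reg rVAL) Nop (Asg 24 (Num 2))))"

definition pick_init :: prog where
  "pick_init = Asg 24 (Num 0) ;; copy_sx ;; mincut aZ ;; Asg 26 (Reg rVAL)"

definition pick_prog :: prog where
  "pick_prog = pick_init ;; For 27 rN rule1_body ;; For 28 rN nbr_row ;; free_test"

lemma pick_frame:
  "writes rule1_body = {9, 10, 11, 12, 13, 14, 15, 16, 17, 18, 19, 20, 21, 22, 24, 25}"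
  "awrites rule1_body = {aC, aSRC, aSNK, aRCH, aPAR}"
  "writes nbr_body = {24, 25}" "awrites nbr_body = {}"
  "writes nbr_row = {24, 25, 29}" "awrites nbr_row = {}"
  "writes free_test = {9, 10, 11, 12, 13, 14, 15, 16, 17, 18, 19, 20, 21, 22, 23, 24, 26}"
  "awrites free_test = {aC, aSRC, aSNK, aRCH, aPAR}"
  "writes pick_init = {9, 10, 11, 12, 13, 14, 15, 16, 17, 18, 19, 20, 21, 22, 24, 26}"
  "awrites pick_init = {aC, aSRC, aSNK, aRCH, aPAR}"
  "writes pick_prog = {9, 10, 11, 12, 13, 14, 15, 16, 17, 18, 19, 20, 21, 22, 23, 24, 25, 26, 27, 28, 29}"
  "awrites pick_prog = {aC, aSRC, aSNK, aRCH, aPAR}"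
  by (auto simp: rule1_body_def nbr_body_def nbr_row_def free_test_def pick_init_def pick_prog_def
      mincut_frame copy_frame)

context graph_n begin

lemma ginv_min: "ginv t \<Longrightarrow> v \<le> n \<Longrightarrow> min v (rg t rMM) = v"
  by (auto dest!: ginv_dims simp: min_dims)

lemma ginv_copy: "ginv t \<Longrightarrow> ginv (run copy_sx t)" "ginv t \<Longrightarrow> ginv (run add_r t)"
  "ginv t \<Longrightarrow> ginv (run (mincut aZ) t)"
  by (rule ginv_run; simp add: copy_frame mincut_frame)+

lemma run_val_base:
  assumes t: "ginv t" and disj: "vset n t aS \<inter> vset n t aX = {}"
  shows "rg (run (mincut aZ) (run copy_sx t)) rVAL = mval (vset n t aS) (vset n t aX)"
proof -
  have c: "vset n (run copy_sx t) aSRC = vset n t aS" "vset n (run copy_sx t) aSNK = vset n t aX"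
    "\<And>v. v < n \<Longrightarrow> ar (run copy_sx t) aSRC v 0 \<le> 1"
    using run_copy_sx[OF ginv_dims[OF t]] by blast+
  show ?thesis using run_mincut_mval[OF ginv_copy(1)[OF t] c(3)] disj unfolding c(1,2) by simp
qed

lemma run_val_sink:
  assumes t: "ginv t" and disj: "vset n t aS \<inter> vset n t aX = {}" and v: "v < n" "v \<notin> vset n t aS"
  shows "rg (run (mincut aZ) (seta aSNK v 0 1 (run copy_sx t))) rVAL =
     mval (vset n t aS) (insert v (vset n t aX))"
proof -
  let ?t = "seta aSNK v 0 1 (run copy_sx t)"
  have c: "vset n (run copy_sx t) aSRC = vset n t aS" "vset n (run copy_sx t) aSNK = vset n t aX"
    "\<And>v. v < n \<Longrightarrow> ar (run copy_sx t) aSRC v 0 \<le> 1"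
    using run_copy_sx[OF ginv_dims[OF t]] by blast+
  have v': "vset n ?t aSRC = vset n t aS" "vset n ?t aSNK = insert v (vset n t aX)"
    using c v(1) by (simp_all add: vset_seta)
  have "ginv ?t" by (rule ginv_seta[OF ginv_copy(1)[OF t]]) simp
  moreover have "ar ?t aSRC w 0 \<le> 1" if "w < n" for w using c(3)[OF that] by simp
  moreover have "vset n ?t aSRC \<inter> vset n ?t aSNK = {}" unfolding v' using disj v(2) by simp
  ultimately have "rg (run (mincut aZ) ?t) rVAL = mval (vset n ?t aSRC) (vset n ?t aSNK)"
    by (rule run_mincut_mval)
  then show ?thesis by (simp only: v')
qed

lemma run_val_closed:
  assumes t: "ginv t" and disj: "vset n t aS \<inter> vset n t aX = {}"
  shows "rg (run (mincut aZ) (run add_r (run copy_sx t))) rVAL =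
     mval (vset n t aS) (vset n t aX \<union> (R - vset n t aS))"
    and "v < n \<Longrightarrow> v \<notin> R \<Longrightarrow> v \<notin> vset n t aX \<Longrightarrow> 
     rg (run (mincut aZ) (seta aSRC v 0 1 (run add_r (run copy_sx t)))) rVAL =
     mval (insert v (vset n t aS)) (vset n t aX \<union> (R - vset n t aS))"
proof -
  let ?t1 = "run copy_sx t" and ?t2 = "run add_r (run copy_sx t)"
  have c: "vset n ?t1 aSRC = vset n t aS" "vset n ?t1 aSNK = vset n t aX"
    "\<And>v. v < n \<Longrightarrow> ar ?t1 aSRC v 0 \<le> 1"
    using run_copy_sx[OF ginv_dims[OF t]] by blast+
  have g1: "ginv ?t1" by (rule ginv_copy(1)[OF t])
  have g2: "ginv ?t2" by (rule ginv_copy(2)[OF g1])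
  have "vset n ?t1 aR = R" using g1 by (simp add: ginv_def)
  moreover have "vset n ?t1 aS = vset n t aS" by (rule vset_frame) (simp add: copy_frame)
  ultimately have c2: "vset n ?t2 aSNK = vset n t aX \<union> (R - vset n t aS)"
    using run_add_r[OF ginv_dims[OF g1]] c(2) by simp
  have a2: "ar ?t2 aSRC = ar ?t1 aSRC" by (rule ar_frame) (simp add: copy_frame)
  then have c3: "vset n ?t2 aSRC = vset n t aS" using c(1) by (simp add: vset_def)
  have le2: "ar ?t2 aSRC w 0 \<le> 1" if "w < n" for w using c(3)[OF that] a2 by simp
  show "rg (run (mincut aZ) ?t2) rVAL = mval (vset n t aS) (vset n t aX \<union> (R - vset n t aS))"
    using run_mincut_mval[OF g2 le2] disj unfolding c2 c3 by blast
  assume v: "v < n" "v \<notin> R" "v \<notin> vset n t aX"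
  let ?t3 = "seta aSRC v 0 1 ?t2"
  have c4: "vset n ?t3 aSRC = insert v (vset n t aS)" "vset n ?t3 aSNK = vset n t aX \<union> (R - vset n t aS)"
    using c2 c3 v(1) by (simp_all add: vset_seta)
  have "ginv ?t3" by (rule ginv_seta[OF g2]) simp
  moreover have "ar ?t3 aSRC w 0 \<le> 1" if "w < n" for w using le2[OF that] by simp
  moreover have "vset n ?t3 aSRC \<inter> vset n ?t3 aSNK = {}" unfolding c4 using disj v(2,3) by auto
  ultimately have "rg (run (mincut aZ) ?t3) rVAL = mval (vset n ?t3 aSRC) (vset n ?t3 aSNK)"
    by (rule run_mincut_mval)
  then show "rg (run (mincut aZ) ?t3) rVAL = mval (insert v (vset n t aS)) (vset n t aX \<union> (R - vset n t aS))"
    by (simp only: c4)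
qed

lemma run_rule1_loop:
  assumes t: "ginv t" and S: "vset n t aS = S" "vset n t aX = X" "S \<inter> X = {}"
    and r: "rg t 24 = 0" "rg t 26 = mval S X"
  shows "let t' = run (For 27 rN rule1_body) t in
    rg t' 24 = 1 \<and> rule1 S X (rg t' 25) \<and> (\<forall>w<rg t' 25. \<not> rule1 S X w) \<or>
    rg t' 24 = 0 \<and> (\<forall>w. \<not> rule1 S X w)"
proof -
  define I where "I = (\<lambda>k (t'::hstate). rg t' 24 = 1 \<and> rule1 S X (rg t' 25) \<and> (\<forall>w<rg t' 25. \<not> rule1 S X w) \<or>
    rg t' 24 = 0 \<and> (\<forall>w<k. \<not> rule1 S X w))"
  have "I n (run (For 27 rN rule1_body) t)"
  proof (rule For_rule[where P = I], goal_cases)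
    case 1
    show ?case using r by (simp add: I_def)
  next
    case (2 v t1)
    define t2 where "t2 = setr 27 v t1"
    have g2: "ginv t2" unfolding t2_def
      by (rule ginv_setr, rule ginv_agree[OF t]) (use 2(3,4) in \<open>auto simp: pick_frame\<close>)
    have vn: "v < n" using 2(1) ginv_dims[OF t] by (simp add: dims_def)
    have S2: "vset n t2 aS = S" "vset n t2 aX = X" "vset n t2 aR = R"
      using S g2 2(4)[of aS] 2(4)[of aX] by (simp_all add: ginv_def vset_def t2_def pick_frame)
    have r2: "rg t2 27 = v" "rg t2 26 = mval S X" "rg t2 24 = rg t1 24" "rg t2 25 = rg t1 25"
      using 2(3)[of 26] r by (simp_all add: t2_def pick_frame)
    have m: "min v (rg t2 rMM) = v" using ginv_min[OF g2] vn by simp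
    have e: "0 < ar t2 aR v 0 \<longleftrightarrow> v \<in> R" "ar t2 aS v 0 = 0 \<longleftrightarrow> v \<notin> S" "ar t2 aX v 0 = 0 \<longleftrightarrow> v \<notin> X"
      using S2 vn by (auto simp: vset_def)
    show ?case
    proof (cases "rg t1 24 = 0 \<and> v \<in> R \<and> v \<notin> S \<and> v \<notin> X")
      case False
      then have "run rule1_body t2 = t2"
        using e r2 by (auto simp: rule1_body_def m)
      moreover have "rg t1 24 = 0 \<Longrightarrow> \<not> rule1 S X v" using False by (auto simp: rule1_def)
      ultimately show ?thesis using 2(2) r2 unfolding t2_def[symmetric] I_def by (auto simp: less_Suc_eq)
    next
      case True
      define t3 where "t3 = run (mincut aZ) (seta aSNK v 0 1 (run copy_sx t2))"
      have val: "rg t3 rVAL = mval S (insert v X)"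
        using run_val_sink[OF g2, of v] S2 S(3) vn True unfolding t3_def by simp
      have r3: "rg t3 26 = mval S X" "rg t3 27 = v" "rg t3 24 = 0"
        using r2 True by (simp_all add: t3_def rg_frame mincut_frame copy_frame)
      have rc: "rg (run copy_sx t2) rMM = rg t2 rMM" "rg (run copy_sx t2) 27 = v"
        using r2 by (simp_all add: rg_frame copy_frame)
      have run: "run rule1_body t2 = (if mval S X < mval S (insert v X) then setr 25 v (setr 24 1 t3) else t3)"
        using True e r2 val r3 by (simp add: rule1_body_def m rc t3_def[unfolded One_nat_def, symmetric])
      have "rule1 S X v \<longleftrightarrow> mval S X < mval S (insert v X)" using True by (simp add: rule1_def)
      then show ?thesis using 2(2) True r3 unfolding t2_def[symmetric] I_def run by (auto simp: less_Suc_eq)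
    qed
  next
    case (3 t1)
    then show ?case using ginv_dims[OF t] by (simp add: I_def dims_def)
  qed
  moreover have "\<not> rule1 S X w" if "\<not> w < n" for w
    using that terminals by (auto simp: rule1_def)
  ultimately show ?thesis unfolding I_def Let_def by blast
qed

lemma run_nbr_loop:
  assumes t: "ginv t" and S: "vset n t aS = S" "vset n t aX = X"
  shows "let t' = run (For 28 rN nbr_row) t in
    (if 0 < rg t 24 then rg t' 24 = rg t 24 \<and> rg t' 25 = rg t 25
     else rg t' 24 = 3 \<and> nbr S X (rg t' 25) \<and> (\<forall>w<rg t' 25. \<not> nbr S X w) \<or> rg t' 24 = 0 \<and> (\<forall>w. \<not> nbr S X w))"
proof -
  define I where "I = (\<lambda>k (t'::hstate). (if 0 < rg t 24 then rg t' 24 = rg t 24 \<and> rg t' 25 = rg t 25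
     else rg t' 24 = 3 \<and> nbr S X (rg t' 25) \<and> (\<forall>w<rg t' 25. \<not> nbr S X w) \<or> rg t' 24 = 0 \<and> (\<forall>w<k. \<not> nbr S X w)))"
  have "I n (run (For 28 rN nbr_row) t)"
  proof (rule For_rule[where P = I], goal_cases)
    case 1
    show ?case by (auto simp: I_def)
  next
    case (2 v t1)
    define t2 where "t2 = setr 28 v t1"
    have g2: "ginv t2" unfolding t2_def
      by (rule ginv_setr, rule ginv_agree[OF t]) (use 2(3,4) in \<open>auto simp: pick_frame\<close>)
    have a2: "ar t2 A = ar t A" for A using 2(4)[of A] by (simp add: t2_def pick_frame)
    have vn: "v < n" using 2(1) ginv_dims[OF t] by (simp add: dims_def)
    have I2: "I v t2" using 2(2) by (simp add: I_def t2_def)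
    define J where "J = (\<lambda>j (t'::hstate). (if 0 < rg t 24 then rg t' 24 = rg t 24 \<and> rg t' 25 = rg t 25
       else rg t' 24 = 3 \<and> nbr S X (rg t' 25) \<and> (\<forall>w<rg t' 25. \<not> nbr S X w) \<or>
         rg t' 24 = 0 \<and> (\<forall>w<v. \<not> nbr S X w) \<and> \<not> (v \<notin> S \<and> v \<notin> X \<and> (\<exists>u<j. u \<in> S \<and> {u, v} \<in> E))))"
    have "J n (run nbr_row t2)"
      unfolding nbr_row_def
    proof (rule For_rule[where P = J], goal_cases)
      case 1
      show ?case using I2 by (auto simp: I_def J_def)
    next
      case (2 u t3)
      define t4 where "t4 = setr 29 u t3"
      have un: "u < n" using 2(1) ginv_dims[OF g2] by (simp add: dims_def)
      have r4: "rg t4 29 = u" "rg t4 28 = v" "rg t4 24 = rg t3 24" "rg t4 25 = rg t3 25" "rg t4 rMM = rg t2 rMM"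
        using 2(3)[of 28] 2(3)[of rMM] by (simp_all add: t4_def pick_frame t2_def)
      have a4: "ar t4 A = ar t A" for A using 2(4)[of A] a2 by (simp add: t4_def pick_frame)
      have m: "min v (rg t2 rMM) = v" "min u (rg t2 rMM) = u" using ginv_min[OF g2] vn un by simp_all
      have e: "0 < ar t aS u 0 \<longleftrightarrow> u \<in> S" "ar t aS v 0 = 0 \<longleftrightarrow> v \<notin> S" "ar t aX v 0 = 0 \<longleftrightarrow> v \<notin> X"
        "0 < ar t aADJ u v \<longleftrightarrow> {u, v} \<in> E"
        using S t vn un by (auto simp: vset_def ginv_def matrix_def)
      have run: "run nbr_body t4 = (if rg t3 24 = 0 \<and> u \<in> S \<and> {u, v} \<in> E \<and> v \<notin> S \<and> v \<notin> X then
         setr 25 v (setr 24 3 t4) else t4)"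
        using e r4 by (auto simp: nbr_body_def m a4)
      show ?case
      proof (cases "rg t3 24 = 0 \<and> u \<in> S \<and> {u, v} \<in> E \<and> v \<notin> S \<and> v \<notin> X")
        case True
        then have "nbr S X v" by (auto simp: nbr_def)
        then show ?thesis using 2(2) True unfolding t4_def[symmetric] run J_def by (auto split: if_splits)
      next
        case False
        then show ?thesis using 2(2) r4 unfolding t4_def[symmetric] run J_def
          by (auto simp: less_Suc_eq split: if_splits)
      qed
    next
      case (3 t3)
      have "J n (setr 29 (rg t2 rN) t3) = J n t3" by (simp add: J_def)
      then show ?case using 3(1) dimsD(1)[OF ginv_dims[OF g2]] by simp
    qed
    moreover have "\<not> nbr S X v" if "\<not> (v \<notin> S \<and> v \<notin> X \<and> (\<exists>u<n. u \<in> S \<and> {u, v} \<in> E))"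
      using that S(1) by (auto simp: nbr_def vset_def)
    ultimately show ?case unfolding t2_def[symmetric] I_def J_def by (auto simp: less_Suc_eq)
  next
    case (3 t1)
    have "I n (setr 28 (rg t rN) t1) = I n t1" by (simp add: I_def)
    then show ?case using 3(1) dimsD(1)[OF ginv_dims[OF t]] by simp
  qed
  moreover have "\<not> nbr S X w" if "\<not> w < n" for w
    using that nbr_in_V[of S X w] by auto
  ultimately show ?thesis unfolding I_def Let_def by (auto split: if_splits)
qed

lemma run_pick:
  assumes t: "ginv t" and S: "vset n t aS = S" "vset n t aX = X" "S \<inter> X = {}"
  shows "let t' = run pick_prog t in rg t' 24 = fst (pick S X) \<and> (0 < rg t' 24 \<longrightarrow> rg t' 25 = snd (pick S X))"
proof -
  define t1 where "t1 = run pick_init t"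
  define t2 where "t2 = run (For 27 rN rule1_body) t1"
  define t3 where "t3 = run (For 28 rN nbr_row) t2"
  have g1: "ginv t1" unfolding t1_def by (rule ginv_run[OF t]) (simp_all add: pick_frame)
  have g2: "ginv t2" unfolding t2_def by (rule ginv_run[OF g1]) (simp_all add: pick_frame)
  have g3: "ginv t3" unfolding t3_def by (rule ginv_run[OF g2]) (simp_all add: pick_frame)
  have S1: "vset n t1 aS = S" "vset n t1 aX = X" unfolding t1_def using S by (simp_all add: vset_frame pick_frame)
  have S2: "vset n t2 aS = S" "vset n t2 aX = X" unfolding t2_def using S1 by (simp_all add: vset_frame pick_frame)
  have S3: "vset n t3 aS = S" "vset n t3 aX = X" unfolding t3_def using S2 by (simp_all add: vset_frame pick_frame)
  have gs: "ginv (setr 24 0 t)" by (rule ginv_setr[OF t]) simp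
  have r1: "rg t1 24 = 0" "rg t1 26 = mval S X"
    using run_val_base[OF gs] S by (simp_all add: t1_def pick_init_def rg_frame mincut_frame copy_frame)
  have run: "run pick_prog t = run free_test t3" by (simp add: pick_prog_def t1_def t2_def t3_def)
  note L1 = run_rule1_loop[OF g1 S1 S(3) r1, unfolded Let_def t2_def[symmetric]]
  note L2 = run_nbr_loop[OF g2 S2, unfolded Let_def t3_def[symmetric]]
  show ?thesis
  proof (cases "\<exists>w. rule1 S X w")
    case True
    then have k2: "rg t2 24 = 1" "rule1 S X (rg t2 25)" "\<forall>w<rg t2 25. \<not> rule1 S X w" using L1 by blast+
    have "(LEAST w. rule1 S X w) = rg t2 25"
      by (rule Least_equality) (use k2 not_le_imp_less in blast)+
    then have p: "pick S X = (1, rg t2 25)" using True by (simp add: pick_def)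
    have "rg t3 24 = 1" "rg t3 25 = rg t2 25" using L2 k2(1) by simp_all
    then show ?thesis unfolding run Let_def p by (simp add: free_test_def)
  next
    case no: False
    then have k2: "rg t2 24 = 0" using L1 by blast
    then have L3: "rg t3 24 = 3 \<and> nbr S X (rg t3 25) \<and> (\<forall>w<rg t3 25. \<not> nbr S X w) \<or> rg t3 24 = 0 \<and> (\<forall>w. \<not> nbr S X w)"
      using L2 by simp
    show ?thesis
    proof (cases "\<exists>w. nbr S X w")
      case False
      then have "rg t3 24 = 0" using L3 by blast
      moreover have "pick S X = (0, 0)" using no False by (simp add: pick_def)
      ultimately show ?thesis unfolding run Let_def by (simp add: free_test_def)
    next
      case True
      then have k3: "rg t3 24 = 3" "nbr S X (rg t3 25)" "\<forall>w<rg t3 25. \<not> nbr S X w" using L3 by blast+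
      let ?u = "rg t3 25"
      have "(LEAST w. nbr S X w) = ?u"
        by (rule Least_equality) (use k3 not_le_imp_less in blast)+
      then have p: "pick S X = (if free S X ?u then 2 else 1, ?u)" using True no by (simp add: pick_def)
      have un: "?u < n" using nbr_in_V[OF k3(2)] by simp
      define t4 where "t4 = setr 24 1 t3"
      have g4: "ginv t4" unfolding t4_def by (rule ginv_setr[OF g3]) simp
      have m: "min ?u (rg t3 rMM) = ?u" using ginv_min[OF g3] un by simp
      have eR: "ar t3 aR ?u 0 = 0 \<longleftrightarrow> ?u \<notin> R" using g3 un by (auto simp: ginv_def vset_def)
      show ?thesis
      proof (cases "?u \<in> R")
        case R: True
        have "run free_test t3 = t4" using k3(1) R eR by (simp add: free_test_def t4_def m)
        then show ?thesis unfolding run Let_def p using R by (simp add: t4_def free_def)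
      next
        case R: False
        have S4: "vset n t4 aS = S" "vset n t4 aX = X" using S3 by (simp_all add: t4_def)
        have uX: "?u \<notin> X" using k3(2) by (simp add: nbr_def)
        define t5 where "t5 = run (mincut aZ) (run add_r (run copy_sx t4))"
        have v5: "rg t5 rVAL = mval S (X \<union> (R - S))" unfolding t5_def
          using run_val_closed(1)[OF g4] S4 S(3) by simp
        define t6 where "t6 = setr 26 (rg t5 rVAL) t5"
        have g6: "ginv t6" unfolding t6_def t5_def
          by (rule ginv_setr[OF ginv_copy(3)[OF ginv_copy(2)[OF ginv_copy(1)[OF g4]]]]) simp
        have S6: "vset n t6 aS = S" "vset n t6 aX = X"
          using S4 by (simp_all add: t6_def t5_def vset_frame mincut_frame copy_frame)
        define t7 where "t7 = run (mincut aZ) (seta aSRC ?u 0 1 (run add_r (run copy_sx t6)))"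
        have v7: "rg t7 rVAL = mval (insert ?u S) (X \<union> (R - S))" unfolding t7_def
          using run_val_closed(2)[OF g6, of ?u] S6 S(3) un R uX by simp
        have r6: "rg t6 25 = ?u" "rg t6 26 = mval S (X \<union> (R - S))" "rg t6 24 = 1" "rg t6 rMM = rg t3 rMM"
          using v5 by (simp_all add: t6_def t5_def t4_def rg_frame mincut_frame copy_frame)
        then have r7: "rg t7 25 = ?u" "rg t7 26 = mval S (X \<union> (R - S))" "rg t7 24 = 1"
          by (simp_all add: t7_def rg_frame mincut_frame copy_frame)
        have rc: "rg (run add_r (run copy_sx t6)) 25 = ?u" "rg (run add_r (run copy_sx t6)) rMM = rg t3 rMM"
          using r6 by (simp_all add: rg_frame copy_frame)
        have r4: "rg t4 25 = ?u" "rg t4 rMM = rg t3 rMM" "ar t4 = ar t3" by (simp_all add: t4_def)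
        have "run free_test t3 = (if rg t7 26 < rg t7 rVAL then t7 else setr 24 2 t7)"
          using k3(1) R eR rc by (simp add: free_test_def m r4 t4_def[unfolded One_nat_def, symmetric]
            t5_def[symmetric] t6_def[symmetric] t7_def[unfolded One_nat_def, symmetric])
        moreover have "free S X ?u \<longleftrightarrow> \<not> rg t7 26 < rg t7 rVAL"
          using R v7 r7 by (simp add: free_def not_less)
        ultimately show ?thesis unfolding run Let_def p using r7 by simp
      qed
    qed
  qed
qed

end

text \<open>Register 31 is the flag that the branch has been made, register 32 the bit. The
  surrounding loop has \<open>n + 1\<close> rounds, in agreement with the \<open>card V + 1\<close>
  elementary steps of \<open>bstep\<close>.\<close>

definition bstep_body :: prog where
  "bstep_body = iszero (Reg 31) (pick_prog ;; nz (Reg 24) (Cond (Reg 24) (Num 2)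
     (Cond (Num 0) (Reg 32) (wr1 aS 25 (Num 1)) (wr1 aX 25 (Num 1)) ;; Asg 31 (Num 1))
     (wr1 aS 25 (Num 1))))"

definition bstep_prog :: prog where
  "bstep_prog = Asg 31 (Num 0) ;; For 30 rN1 bstep_body"

lemma bstep_frame:
  "writes bstep_body = {9, 10, 11, 12, 13, 14, 15, 16, 17, 18, 19, 20, 21, 22, 23, 24, 25, 26, 27, 28, 29, 31}"
  "awrites bstep_body = {aC, aSRC, aSNK, aRCH, aPAR, aS, aX}"
  "writes bstep_prog = {9, 10, 11, 12, 13, 14, 15, 16, 17, 18, 19, 20, 21, 22, 23, 24, 25, 26, 27, 28, 29, 30, 31}"
  "awrites bstep_prog = {aC, aSRC, aSNK, aRCH, aPAR, aS, aX}"
  by (auto simp: bstep_body_def bstep_prog_def pick_frame)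

context graph_n begin

lemma pick_vertex:
  assumes "0 < fst (pick S X)"
  shows "snd (pick S X) < n" "snd (pick S X) \<notin> S" "snd (pick S X) \<notin> X"
proof -
  have "nbr S X (snd (pick S X)) \<or> rule1 S X (snd (pick S X))"
    using assms by (cases rule: pick_cases[of S X]) simp_all
  then have "snd (pick S X) < n \<and> snd (pick S X) \<notin> S \<and> snd (pick S X) \<notin> X"
    using terminals nbr_in_V[of S X] by (auto simp: rule1_def nbr_def)
  then show "snd (pick S X) < n" "snd (pick S X) \<notin> S" "snd (pick S X) \<notin> X" by blast+
qed

lemma pick_le2: "fst (pick S X) \<le> 2"
  by (cases rule: pick_cases[of S X]) simp_all

definition tri :: "hstate \<Rightarrow> nat set \<times> nat set \<times> bool" where
  "tri t = (vset n t aS, vset n t aX, 0 < rg t 31)"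

lemma run_bstep_body:
  assumes t: "ginv t" and disj: "vset n t aS \<inter> vset n t aX = {}" and b: "0 < rg t 32 \<longleftrightarrow> b"
  shows "tri (run bstep_body t) = bstep1 b (tri t) \<and>
    vset n (run bstep_body t) aS \<inter> vset n (run bstep_body t) aX = {}"
proof (cases "0 < rg t 31")
  case True
  then show ?thesis using disj by (simp add: bstep_body_def bstep1_def tri_def)
next
  case False
  define S X where "S = vset n t aS" and "X = vset n t aX"
  define t1 where "t1 = run pick_prog t"
  have g1: "ginv t1" unfolding t1_def by (rule ginv_run[OF t]) (simp_all add: pick_frame)
  have S1: "vset n t1 aS = S" "vset n t1 aX = X" "rg t1 31 = 0" "rg t1 32 = rg t 32"
    using False by (simp_all add: t1_def S_def X_def vset_frame rg_frame pick_frame)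
  obtain k u where p: "pick S X = (k, u)" by force
  have r1: "rg t1 24 = k" "0 < k \<Longrightarrow> rg t1 25 = u"
    using run_pick[OF t S_def[symmetric] X_def[symmetric]] disj p by (simp_all add: t1_def Let_def S_def X_def)
  have tri: "tri t = (S, X, False)" using False by (simp add: tri_def S_def X_def)
  have body: "run bstep_body t = run (nz (Reg 24) (Cond (Reg 24) (Num 2)
     (Cond (Num 0) (Reg 32) (wr1 aS 25 (Num 1)) (wr1 aX 25 (Num 1)) ;; Asg 31 (Num 1))
     (wr1 aS 25 (Num 1)))) t1"
    using False by (simp add: bstep_body_def t1_def)
  show ?thesis
  proof (cases "k = 0")
    case True
    have "run bstep_body t = t1" unfolding body using r1 True by simp
    moreover have "tri t1 = (S, X, False)" using S1 by (simp add: tri_def)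
    ultimately show ?thesis using S1 disj tri bstep1_simps(4)[of S X b] p True by (simp add: S_def X_def)
  next
    case k: False
    have u: "u < n" "u \<notin> S" "u \<notin> X" using pick_vertex[of S X] p k by simp_all
    have m: "min u (rg t1 rMM) = u" using ginv_min[OF g1] u by simp
    have "k = 1 \<or> k = 2" using k pick_le2[of S X] p by auto
    then show ?thesis
    proof
      assume k: "k = 1"
      have "run bstep_body t = setr 31 1 (if b then seta aS u 0 1 t1 else seta aX u 0 1 t1)"
        unfolding body using r1 k m S1 b by simp
      then show ?thesis using S1 u disj tri bstep1_simps(2)[of S X u b] p k
        by (simp add: tri_def vset_seta S_def X_def)
    next
      assume k: "k = 2"
      have "run bstep_body t = seta aS u 0 1 t1"
        unfolding body using r1 k m S1 b by simp
      then show ?thesis using S1 u disj tri bstep1_simps(3)[of S X u b] p k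
        by (simp add: tri_def vset_seta S_def X_def)
    qed
  qed
qed

lemma run_bstep_prog:
  assumes t: "ginv t" and disj: "vset n t aS \<inter> vset n t aX = {}" and b: "0 < rg t 32 \<longleftrightarrow> b"
  shows "(vset n (run bstep_prog t) aS, vset n (run bstep_prog t) aX) = bstep b (vset n t aS, vset n t aX) \<and>
    vset n (run bstep_prog t) aS \<inter> vset n (run bstep_prog t) aX = {}"
proof -
  define s where "s = setr 31 0 t"
  have "tri (run (For 30 rN1 bstep_body) s) = (bstep1 b ^^ Suc n) (vset n t aS, vset n t aX, False) \<and>
    vset n (run (For 30 rN1 bstep_body) s) aS \<inter> vset n (run (For 30 rN1 bstep_body) s) aX = {}"
  proof (rule For_rule[where P = "\<lambda>k t'. tri t' = (bstep1 b ^^ k) (vset n t aS, vset n t aX, False) \<and>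
     vset n t' aS \<inter> vset n t' aX = {}"], goal_cases)
    case 1
    show ?case using disj by (simp add: tri_def s_def)
  next
    case (2 k t1)
    have g: "ginv (setr 30 k t1)"
      by (rule ginv_setr, rule ginv_agree[OF t]) (use 2(3,4) in \<open>auto simp: bstep_frame s_def\<close>)
    have "tri (setr 30 k t1) = tri t1" by (simp add: tri_def)
    moreover have "0 < rg (setr 30 k t1) 32 \<longleftrightarrow> b" using 2(3)[of 32] b by (simp add: bstep_frame s_def)
    ultimately show ?case using run_bstep_body[OF g] 2(2) by simp
  next
    case (3 t1)
    have "tri (setr 30 (rg s rN1) t1) = tri t1" by (simp add: tri_def)
    moreover have "rg s rN1 = Suc n" using dimsD(2)[OF ginv_dims[OF t]] by (simp add: s_def)
    ultimately show ?case using 3(1) by simp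
  qed
  moreover have "run bstep_prog t = run (For 30 rN1 bstep_body) s" by (simp add: bstep_prog_def s_def)
  moreover have "tri t' = (A, B, c) \<Longrightarrow> (vset n t' aS, vset n t' aX) = (A, B)" for t' A B c
    by (simp add: tri_def)
  ultimately show ?thesis unfolding bstep_def by (simp split: prod.split)
qed

end

section \<open>Local search\<close>

definition clear_sx :: prog where
  "clear_sx = For 35 rN (wr1 aS 35 (Num 0) ;; wr1 aX 35 (Num 0))"

text \<open>The loop goes through all \<open>i < q\<close> for a digit \<open>w\<close>: an
  exclusion for each \<open>i\<close> below \<open>w\<close>, possibly an inclusion at
  \<open>i = w\<close>, nothing afterwards. This reproduces \<open>expand\<close>.\<close>

definition digit_body :: prog where
  "digit_body = Cond (Reg 34) (at1 aDG 33) (Asg 32 (Num 0) ;; bstep_prog)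
     (less_then (Reg 34) (Plus1 (at1 aDG 33)) (Cond (Plus1 (Reg 34)) (Reg rQ)
        (Asg 32 (Num 1) ;; bstep_prog) (iszero (Reg 34) (Asg 32 (Num 1) ;; bstep_prog))))"

definition digit_loop :: prog where "digit_loop = For 34 rQ digit_body"

text \<open>A start vertex that is not a terminal is not inserted, so the branching starts from the
  empty set and ends at once. This is how the empty terminal set gets into the enumeration.\<close>

definition branch_decode :: prog where
  "branch_decode = clear_sx ;; nz (at1 aR 36) (wr1 aS 36 (Num 1)) ;; For 33 rL digit_loop"

definition subset_decode :: prog where
  "subset_decode = clear_sx ;; For 33 rL (Asg 34 (at1 aDG 33) ;; wr1 aS 34 (Num 1))"

lemma decode_frame:
  "writes clear_sx = {35}" "awrites clear_sx = {aS, aX}"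
  "writes digit_body = {9, 10, 11, 12, 13, 14, 15, 16, 17, 18, 19, 20, 21, 22, 23, 24, 25, 26, 27, 28, 29, 30, 31, 32}"
  "awrites digit_body = {aC, aSRC, aSNK, aRCH, aPAR, aS, aX}"
  "writes digit_loop = {9, 10, 11, 12, 13, 14, 15, 16, 17, 18, 19, 20, 21, 22, 23, 24, 25, 26, 27, 28, 29, 30, 31, 32, 34}"
  "awrites digit_loop = {aC, aSRC, aSNK, aRCH, aPAR, aS, aX}"
  "writes branch_decode = {9, 10, 11, 12, 13, 14, 15, 16, 17, 18, 19, 20, 21, 22, 23, 24, 25, 26, 27, 28, 29, 30, 31, 32, 33, 34, 35}"
  "awrites branch_decode = {aC, aSRC, aSNK, aRCH, aPAR, aS, aX}"
  "writes subset_decode = {33, 34, 35}"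
  "awrites subset_decode = {aS, aX}"
  by (auto simp: clear_sx_def digit_body_def digit_loop_def branch_decode_def subset_decode_def bstep_frame)

definition net_init :: prog where
  "net_init = Asg 38 (Num 0) ;; For 37 rN (wr1 aSRC 37 (Num 0) ;; wr1 aSNK 37 (Num 0) ;;
     nz (at1 aR 37) (Cond (Num 0) (at1 aS 37) (wr1 aSRC 37 (Num 1) ;; Asg 38 (Plus1 (Reg 38)))
       (wr1 aSNK 37 (Num 1))))"

definition count_row :: prog where
  "count_row = For 41 rN (less_then (Reg 40) (Reg 41) (nz (at2 aF 40 41) (Asg 39 (Plus1 (Reg 39)))))"

definition count_f :: prog where
  "count_f = Asg 39 (Num 0) ;; For 40 rN count_row"

definition update_cell :: prog where
  "update_cell = nz (at2 aADJ 40 41) (Cond (Num 0) (at1 aRCH 40)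
     (Cond (Num 0) (at1 aRCH 41) (wr2 aF 40 41 (Num 0)) (wr2 aF 40 41 (Num 1)))
     (nz (at1 aRCH 41) (wr2 aF 40 41 (Num 1))))"

definition update_row :: prog where "update_row = For 41 rN update_cell"

definition update :: prog where "update = For 40 rN update_row"

definition move_prog :: prog where
  "move_prog = net_init ;; mincut aF ;; count_f ;;
     Cond (Reg rK) (Reg 38) Nop (less_then (Reg rVAL) (Reg 39) update)"

lemma move_frame:
  "writes net_init = {37, 38}" "awrites net_init = {aSRC, aSNK}"
  "writes count_row = {39, 41}" "awrites count_row = {}"
  "writes count_f = {39, 40, 41}" "awrites count_f = {}"
  "writes update_cell = {}" "awrites update_cell = {aF}"
  "writes update_row = {41}" "awrites update_row = {aF}"
  "writes update = {40, 41}" "awrites update = {aF}"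
  "writes move_prog = {9, 10, 11, 12, 13, 14, 15, 16, 17, 18, 19, 20, 21, 37, 38, 39, 40, 41}"
  "awrites move_prog = {aC, aSRC, aSNK, aRCH, aPAR, aF}"
  by (auto simp: net_init_def count_row_def count_f_def update_cell_def update_row_def update_def
      move_prog_def mincut_frame)

lemma run_clear_sx:
  assumes "dims n t"
  shows "vset n (run clear_sx t) aS = {} \<and> vset n (run clear_sx t) aX = {}"
  unfolding clear_sx_def
proof (rule For_rule[where P = "\<lambda>k t'. \<forall>v<k. ar t' aS v 0 = 0 \<and> ar t' aX v 0 = 0"], goal_cases)
  case (2 k t1)
  have "min k (rg t1 rMM) = k" using 2(1) 2(3)[of rMM] assms by (simp add: dims_def)
  then show ?case using 2(2) by (simp add: less_Suc_eq)
next
  case (3 t1)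
  then show ?case using dimsD(1)[OF assms] by (auto simp: vset_def)
qed simp

context graph_n begin

definition pr :: "hstate \<Rightarrow> nat set \<times> nat set" where "pr t = (vset n t aS, vset n t aX)"

lemma pr_setr [simp]: "pr (setr x c t) = pr t"
  by (simp add: pr_def)

definition disj :: "hstate \<Rightarrow> bool" where "disj t \<longleftrightarrow> vset n t aS \<inter> vset n t aX = {}"

lemma disj_setr [simp]: "disj (setr x c t) = disj t"
  by (simp add: disj_def)

lemma run_bstep_bit:
  assumes "ginv t" "disj t"
  shows "pr (run bstep_prog (setr 32 c t)) = bstep (0 < c) (pr t)" "disj (run bstep_prog (setr 32 c t))"
  using run_bstep_prog[of "setr 32 c t" "0 < c"] assms by (simp_all add: pr_def disj_def ginv_setr)

lemma run_digit_loop: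
  assumes t: "ginv t" "disj t" and j: "rg t 33 = j" "j \<le> rg t rMM" and q: "rg t rQ = q"
    and w: "ar t aDG j 0 = w" "w < q"
  shows "pr (run digit_loop t) = run_bits (expand q w) (pr t) \<and> disj (run digit_loop t)"
proof -
  \<comment> \<open>The bits of \<open>expand q w\<close> that have been executed after
    \<open>i\<close> rounds.\<close>
  define pre where "pre = (\<lambda>i. replicate (min i w) False @ (if w < i \<and> (w = 0 \<or> Suc w < q) then [True] else []))"
  show ?thesis
    unfolding digit_loop_def
  proof (rule For_rule[where P = "\<lambda>i t'. pr t' = run_bits (pre i) (pr t) \<and> disj t'"], goal_cases)
    case 1
    show ?case using t by (simp add: pre_def)
  next
    case (2 i t1)
    define t2 where "t2 = setr 34 i t1"
    have g: "ginv t2" unfolding t2_def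
      by (rule ginv_setr, rule ginv_agree[OF t(1)]) (use 2(3,4) in \<open>auto simp: decode_frame\<close>)
    have d: "disj t2" "pr t2 = run_bits (pre i) (pr t)" using 2(2) by (simp_all add: t2_def)
    have r: "rg t2 34 = i" "rg t2 33 = j" "rg t2 rQ = q" "min j (rg t2 rMM) = j" "ar t2 aDG j 0 = w"
      using 2(3)[of 33] 2(3)[of rQ] 2(3)[of rMM] 2(4)[of aDG] j q w by (simp_all add: t2_def decode_frame)
    have body: "run digit_body t2 = (if i < w then run bstep_prog (setr 32 0 t2)
      else if i = w \<and> (w = 0 \<or> Suc w < q) then run bstep_prog (setr 32 1 t2) else t2)"
      unfolding digit_body_def by (auto simp: r)
    show ?case
    proof (cases "i < w")
      case True
      then have "pre (Suc i) = pre i @ [False]"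
        by (simp add: pre_def min_def replicate_append_same)
      then show ?thesis unfolding t2_def[symmetric] body using True run_bstep_bit[OF g d(1), of 0] d(2)
        by (simp add: run_bits_append)
    next
      case False
      show ?thesis
      proof (cases "i = w \<and> (w = 0 \<or> Suc w < q)")
        case True
        then have "pre (Suc i) = pre i @ [True]" by (auto simp: pre_def)
        then show ?thesis unfolding t2_def[symmetric] body using True run_bstep_bit[OF g d(1), of 1] d(2)
          by (simp add: run_bits_append)
      next
        case F2: False
        then have "pre (Suc i) = pre i" using False by (auto simp: pre_def min_def)
        then show ?thesis unfolding t2_def[symmetric] body if_not_P[OF False] if_not_P[OF F2] using d by simp
      qed
    qed
  next
    case (3 t1)
    have "pre q = expand q w" using w by (simp add: pre_def expand_def min_def)
    then show ?case using 3(1) q by simp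
  qed
qed

lemma run_branch_decode:
  assumes t: "ginv t" and L: "rg t rL = L" "L \<le> rg t rMM" and q: "rg t rQ = q" and r: "rg t 36 = r" "r < n"
    and w: "\<And>j. j < L \<Longrightarrow> ar t aDG j 0 < q"
  shows "vset n (run branch_decode t) aS =
    fst (run_bits (concat (map (expand q) (map (\<lambda>j. ar t aDG j 0) [0..<L]))) ({r} \<inter> R, {}))"
proof -
  define t1 where "t1 = run clear_sx t"
  define t2 where "t2 = (if r \<in> R then seta aS r 0 1 t1 else t1)"
  have g1: "ginv t1" unfolding t1_def by (rule ginv_run[OF t]) (simp_all add: decode_frame)
  have c: "vset n t1 aS = {}" "vset n t1 aX = {}" using run_clear_sx[OF ginv_dims[OF t]] by (simp_all add: t1_def)
  have m: "min r (rg t1 rMM) = r" "rg t1 36 = r" using ginv_min[OF g1] r by (simp_all add: t1_def rg_frame decode_frame)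
  have eR: "0 < ar t1 aR r 0 \<longleftrightarrow> r \<in> R" using g1 r(2) by (auto simp: ginv_def vset_def)
  have run: "run branch_decode t = run (For 33 rL digit_loop) t2"
    using eR by (simp add: branch_decode_def t1_def[symmetric] m t2_def)
  have g2: "ginv t2" unfolding t2_def using g1 ginv_seta[OF g1, of aS] by simp
  have p2: "pr t2 = ({r} \<inter> R, {})" unfolding t2_def pr_def using c r(2) by (auto simp: vset_seta)
  have d2: "disj t2" using p2 by (simp add: pr_def disj_def)
  have a2: "ar t2 aDG = ar t aDG" "rg t2 = rg t1" by (simp_all add: t2_def t1_def ar_frame decode_frame)
  have r2: "rg t2 rL = L" "rg t2 rQ = q" "rg t2 rMM = rg t rMM" using L q by (simp_all add: a2 t1_def rg_frame decode_frame)
  have "pr (run (For 33 rL digit_loop) t2) =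
    run_bits (concat (map (expand q) (map (\<lambda>j. ar t aDG j 0) [0..<L]))) ({r} \<inter> R, {})"
  proof (rule For_rule[where P = "\<lambda>i t'. pr t' =
    run_bits (concat (map (expand q) (map (\<lambda>j. ar t aDG j 0) [0..<i]))) ({r} \<inter> R, {}) \<and> disj t'"], goal_cases)
    case 1
    show ?case using p2 d2 by simp
  next
    case (2 j t3)
    define t4 where "t4 = setr 33 j t3"
    have jL: "j < L" using 2(1) r2 by simp
    have g: "ginv t4" unfolding t4_def
      by (rule ginv_setr, rule ginv_agree[OF g2]) (use 2(3,4) in \<open>auto simp: decode_frame\<close>)
    have d: "disj t4" "pr t4 = run_bits (concat (map (expand q) (map (\<lambda>j. ar t aDG j 0) [0..<j]))) ({r} \<inter> R, {})"
      using 2(2) by (simp_all add: t4_def)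
    have r4: "rg t4 33 = j" "j \<le> rg t4 rMM" "rg t4 rQ = q" "ar t4 aDG j 0 = ar t aDG j 0"
      using 2(3)[of rMM] 2(3)[of rQ] 2(4)[of aDG] r2 a2 jL L by (simp_all add: t4_def decode_frame)
    show ?case using run_digit_loop[OF g d(1) r4 w[OF jL]] d(2) unfolding t4_def[symmetric]
      by (simp add: run_bits_append)
  next
    case (3 t3)
    then show ?case using r2(1) by simp
  qed
  then have "pr (run branch_decode t) = run_bits (concat (map (expand q) (map (\<lambda>j. ar t aDG j 0) [0..<L]))) ({r} \<inter> R, {})"
    by (simp add: run)
  then show ?thesis unfolding pr_def by (metis fst_conv)
qed

lemma run_subset_decode:
  assumes t: "ginv t" and L: "rg t rL = L" "L \<le> rg t rMM" and w: "\<And>j. j < L \<Longrightarrow> ar t aDG j 0 < n"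
  shows "vset n (run subset_decode t) aS = (\<lambda>j. ar t aDG j 0) ` {..<L}"
proof -
  define t1 where "t1 = run clear_sx t"
  have g1: "ginv t1" unfolding t1_def by (rule ginv_run[OF t]) (simp_all add: decode_frame)
  have c: "vset n t1 aS = {}" using run_clear_sx[OF ginv_dims[OF t]] by (simp_all add: t1_def)
  have a1: "ar t1 aDG = ar t aDG" "rg t1 rL = L" "rg t1 rMM = rg t rMM"
    using L by (simp_all add: t1_def ar_frame rg_frame decode_frame)
  have "vset n (run (For 33 rL (Asg 34 (at1 aDG 33) ;; wr1 aS 34 (Num 1))) t1) aS = (\<lambda>j. ar t aDG j 0) ` {..<L}"
  proof (rule For_rule[where P = "\<lambda>i t'. vset n t' aS = (\<lambda>j. ar t aDG j 0) ` {..<i}"], goal_cases)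
    case 1
    show ?case using c by simp
  next
    case (2 j t2)
    have jL: "j < L" using 2(1) a1 by simp
    have r2: "rg t2 rMM = rg t rMM" "ar t2 aDG = ar t aDG" using 2(3)[of rMM] 2(4)[of aDG] a1 by simp_all
    have m: "min j (rg t rMM) = j" "min (ar t aDG j 0) (rg t rMM) = ar t aDG j 0"
      using jL L w[OF jL] ginv_min[OF t] by simp_all
    have "vset n (seta aS (ar t aDG j 0) 0 1 t2) aS = insert (ar t aDG j 0) (vset n t2 aS)"
      using w[OF jL] by (simp add: vset_seta)
    then show ?case using 2(2) by (simp add: r2 m vset_def lessThan_Suc)
  next
    case (3 t2)
    then show ?case using a1(2) by simp
  qed
  then show ?thesis by (simp add: subset_decode_def t1_def)
qed

lemma run_net_init:
  assumes t: "ginv t"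
  defines "t' \<equiv> run net_init t" and "T \<equiv> vset n t aS \<inter> R"
  shows "vset n t' aSRC = T" "vset n t' aSNK = R - T" "\<And>v. v < n \<Longrightarrow> ar t' aSRC v 0 \<le> 1" "rg t' 38 = card T"
proof -
  define t1 where "t1 = setr 38 0 t"
  have d: "dims n t1" using ginv_dims[OF t] by (simp add: t1_def)
  define I where "I = (\<lambda>k (t'::hstate). (\<forall>v<k. ar t' aSRC v 0 \<le> 1 \<and> (0 < ar t' aSRC v 0 \<longleftrightarrow> v \<in> T) \<and>
     (0 < ar t' aSNK v 0 \<longleftrightarrow> v \<in> R - T)) \<and> rg t' 38 = card {v. v < k \<and> v \<in> T})"
  have "I n t'"
    unfolding t'_def net_init_def run.simps(5) run.simps(2) ev.simps t1_def[symmetric]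
  proof (rule For_rule[where P = I], goal_cases)
    case 1
    show ?case by (simp add: I_def t1_def)
  next
    case (2 k t2)
    have kn: "k < n" using 2(1) d by (simp add: dims_def)
    have m: "min k (rg t2 rMM) = k" using 2(3)[of rMM] min_dims[OF d] kn by simp
    have a: "ar t2 aR = ar t aR" "ar t2 aS = ar t aS" using 2(4)[of aR] 2(4)[of aS] by (simp_all add: t1_def)
    have e: "0 < ar t aR k 0 \<longleftrightarrow> k \<in> R" "k \<in> R \<Longrightarrow> 0 < ar t aS k 0 \<longleftrightarrow> k \<in> T"
      using t kn by (auto simp: ginv_def vset_def T_def)
    have "{v. v < Suc k \<and> v \<in> T} = (if k \<in> T then insert k {v. v < k \<and> v \<in> T} else {v. v < k \<and> v \<in> T})"
      by (auto simp: less_Suc_eq)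
    then have cd: "card {v. v < Suc k \<and> v \<in> T} = card {v. v < k \<and> v \<in> T} + of_bool (k \<in> T)" by simp
    have TR: "k \<in> T \<Longrightarrow> k \<in> R" by (simp add: T_def)
    show ?case using 2(2) e TR unfolding I_def cd by (auto simp: m a less_Suc_eq)
  next
    case (3 t2)
    then show ?case using dimsD(1)[OF d] by (simp add: I_def)
  qed
  moreover have "T \<subseteq> {..<n}" using terminals by (auto simp: T_def)
  then have "{v. v < n \<and> v \<in> T} = T" by auto
  ultimately show "vset n t' aSRC = T" "vset n t' aSNK = R - T" "\<And>v. v < n \<Longrightarrow> ar t' aSRC v 0 \<le> 1" "rg t' 38 = card T"
    using \<open>T \<subseteq> {..<n}\<close> terminals unfolding I_def vset_def by auto
qed

lemma run_count_f:
  assumes t: "dims n t" "matrix n t aF F" "F \<subseteq> E"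
  shows "rg (run count_f t) 39 = card F"
proof -
  define c where "c = (\<lambda>u j. card {v. v < j \<and> u < v \<and> {u, v} \<in> F})"
  define t1 where "t1 = setr 39 0 t"
  have d: "dims n t1" "ar t1 aF = ar t aF" using t by (simp_all add: t1_def)
  have "rg (run (For 40 rN count_row) t1) 39 = (\<Sum>u<n. c u n)"
  proof (rule For_rule[where P = "\<lambda>k t'. rg t' 39 = (\<Sum>u<k. c u n)"], goal_cases)
    case 1
    show ?case by (simp add: t1_def)
  next
    case (2 u t2)
    define t3 where "t3 = setr 40 u t2"
    have un: "u < n" using 2(1) d by (simp add: dims_def)
    have r3: "rg t3 rN = n" "rg t3 rMM = rg t1 rMM" "rg t3 40 = u" "ar t3 aF = ar t aF" "rg t3 39 = (\<Sum>u<u. c u n)"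
      using 2(2) 2(3)[of rN] 2(3)[of rMM] 2(4)[of aF] d by (simp_all add: t3_def move_frame dims_def)
    have "rg (run count_row t3) 39 = (\<Sum>u<u. c u n) + c u n"
      unfolding count_row_def
    proof (rule For_rule[where P = "\<lambda>j t'. rg t' 39 = (\<Sum>u<u. c u n) + c u j"], goal_cases)
      case 1
      show ?case using r3 by (simp add: c_def)
    next
      case (2 j t4)
      have jn: "j < n" using 2(1) r3 by simp
      have r4: "rg t4 rMM = rg t1 rMM" "rg t4 40 = u" "ar t4 aF = ar t aF"
        using 2(3)[of rMM] 2(3)[of 40] 2(4)[of aF] r3 by simp_all
      have m: "min u (rg t1 rMM) = u" "min j (rg t1 rMM) = j" using min_dims[OF d(1)] un jn by simp_all
      have e: "0 < ar t aF u j \<longleftrightarrow> {u, j} \<in> F" by (rule matrixD[OF t(2) un jn])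
      have "{v. v < Suc j \<and> u < v \<and> {u, v} \<in> F} = (if u < j \<and> {u, j} \<in> F then insert j {v. v < j \<and> u < v \<and> {u, v} \<in> F}
         else {v. v < j \<and> u < v \<and> {u, v} \<in> F})" by (auto simp: less_Suc_eq)
      then have "c u (Suc j) = c u j + of_bool (u < j \<and> {u, j} \<in> F)" by (simp add: c_def)
      then show ?case using 2(2) e by (auto simp: r4 m)
    next
      case (3 t4)
      then show ?case using r3(1) by simp
    qed
    then show ?case unfolding t3_def by simp
  next
    case (3 t2)
    then show ?case using dimsD(1)[OF d(1)] by simp
  qed
  also have "(\<Sum>u<n. c u n) = card (SIGMA u:{..<n}. {v. v < n \<and> u < v \<and> {u, v} \<in> F})"
    unfolding c_def by (rule card_SigmaI[symmetric]) auto
  also have "\<dots> = card F"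
  proof (rule bij_betw_same_card[of "\<lambda>(u, v). {u, v}"], rule bij_betw_imageI)
    show "inj_on (\<lambda>(u, v). {u, v}) (SIGMA u:{..<n}. {v. v < n \<and> u < v \<and> {u, v} \<in> F})"
      by (rule inj_onI) (auto simp: doubleton_eq_iff)
    show "(\<lambda>(u, v). {u, v}) ` (SIGMA u:{..<n}. {v. v < n \<and> u < v \<and> {u, v} \<in> F}) = F"
    proof (intro equalityI subsetI)
      fix e assume e: "e \<in> F"
      then have "e \<in> E" using t(3) by auto
      then obtain x y where xy: "e = {x, y}" "x \<noteq> y" "x < n" "y < n" by (rule edgeE) auto
      show "e \<in> (\<lambda>(u, v). {u, v}) ` (SIGMA u:{..<n}. {v. v < n \<and> u < v \<and> {u, v} \<in> F})"
      proof (cases "x < y")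
        case True
        then show ?thesis using xy e by (intro image_eqI[of _ _ "(x, y)"]) auto
      next
        case False
        have "{y, x} = e" using xy(1) by auto
        then show ?thesis using xy e False by (intro image_eqI[of _ _ "(y, x)"]) auto
      qed
    qed auto
  qed
  finally show ?thesis by (simp add: count_f_def t1_def)
qed

lemma run_update:
  assumes t: "ginv t" "matrix n t aF F" "F \<subseteq> E" and A: "vset n t aRCH = A"
  shows "matrix n (run update t) aF (move E F A)"
proof -
  define I where "I = (\<lambda>k (t'::hstate). \<forall>u<n. \<forall>v<n. 0 < ar t' aF u v \<longleftrightarrow> {u, v} \<in> (if u < k then move E F A else F))"
  have "I n (run update t)"
    unfolding update_def
  proof (rule For_rule[where P = I], goal_cases)
    case 1
    show ?case using t(2) by (simp add: I_def matrix_def)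
  next
    case (2 k t1)
    define t2 where "t2 = setr 40 k t1"
    have kn: "k < n" using 2(1) ginv_dims[OF t(1)] by (simp add: dims_def)
    have r2: "rg t2 rN = n" "rg t2 rMM = rg t rMM" "rg t2 40 = k" "ar t2 aADJ = ar t aADJ" "ar t2 aRCH = ar t aRCH"
      using 2(3)[of rN] 2(3)[of rMM] 2(4)[of aADJ] 2(4)[of aRCH] ginv_dims[OF t(1)] by (simp_all add: t2_def move_frame dims_def)
    have I2: "I k t2" using 2(2) by (simp add: I_def t2_def)
    define J where "J = (\<lambda>j (t'::hstate). \<forall>u<n. \<forall>v<n. 0 < ar t' aF u v \<longleftrightarrow>
       {u, v} \<in> (if u < k \<or> u = k \<and> v < j then move E F A else F))"
    have "J n (run update_row t2)"
      unfolding update_row_def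
    proof (rule For_rule[where P = J], goal_cases)
      case 1
      show ?case using I2 by (simp add: I_def J_def)
    next
      case (2 j t3)
      define t4 where "t4 = setr 41 j t3"
      have jn: "j < n" using 2(1) r2 by simp
      have r4: "rg t4 rMM = rg t rMM" "rg t4 40 = k" "rg t4 41 = j" "ar t4 aADJ = ar t aADJ" "ar t4 aRCH = ar t aRCH" "ar t4 aF = ar t3 aF"
        using 2(3)[of rMM] 2(3)[of 40] 2(4)[of aADJ] 2(4)[of aRCH] r2 by (simp_all add: t4_def move_frame)
      have m: "min k (rg t rMM) = k" "min j (rg t rMM) = j" using ginv_min[OF t(1)] kn jn by simp_all
      have e: "0 < ar t aADJ k j \<longleftrightarrow> {k, j} \<in> E" "0 < ar t aRCH k 0 \<longleftrightarrow> k \<in> A" "0 < ar t aRCH j 0 \<longleftrightarrow> j \<in> A"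
        using t A kn jn by (auto simp: ginv_def matrix_def vset_def)
      have old: "0 < ar t3 aF k j \<longleftrightarrow> {k, j} \<in> F" using 2(2) kn jn by (simp add: J_def)
      have cellnew: "0 < ar (run update_cell t4) aF k j \<longleftrightarrow> {k, j} \<in> move E F A"
        unfolding update_cell_def using e old t(3) by (auto simp: r4 m move_def bd_def)
      have other: "ar (run update_cell t4) aF u v = ar t3 aF u v" if "u \<noteq> k \<or> v \<noteq> j" for u v
        unfolding update_cell_def using that by (auto simp: r4 m)
      show ?case unfolding t4_def[symmetric] J_def
      proof (intro allI impI)
        fix u v assume uv: "u < n" "v < n"
        show "(0 < ar (run update_cell t4) aF u v) = ({u, v} \<in> (if u < k \<or> u = k \<and> v < Suc j then move E F A else F))"
        proof (cases "u = k \<and> v = j")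
          case True
          then show ?thesis using cellnew by simp
        next
          case False
          then have "u < k \<or> u = k \<and> v < Suc j \<longleftrightarrow> u < k \<or> u = k \<and> v < j" by auto
          then show ?thesis using other[of u v] False 2(2) uv unfolding J_def by simp
        qed
      qed
    next
      case (3 t3)
      then show ?case using r2(1) by (simp add: J_def)
    qed
    then show ?case unfolding t2_def[symmetric] I_def J_def by (auto simp: less_Suc_eq)
  next
    case (3 t1)
    then show ?case using ginv_dims[OF t(1)] by (simp add: I_def dims_def)
  qed
  then show ?thesis by (simp add: I_def matrix_def)
qed

definition locopt :: "nat set set \<Rightarrow> nat set \<Rightarrow> bool" where
  "locopt F T \<longleftrightarrow> (\<forall>S. S \<subseteq> {..<n} \<longrightarrow> S \<inter> R = T \<longrightarrow> card F \<le> card (move E F S))"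

text \<open>With sources \<open>T\<close> and sinks \<open>R - T\<close>, the sides of a cut are
  exactly the vertex sets with terminal set \<open>T\<close>. A single minimum cut therefore finds
  the best move for \<open>T\<close> and decides \<open>locopt F T\<close>.\<close>

lemma run_move_prog:
  assumes t: "ginv t" "matrix n t aF F" "F \<subseteq> E" and T: "vset n t aS \<inter> R = T" and K: "rg t rK = K"
  shows "\<exists>F'. matrix n (run move_prog t) aF F' \<and> (if K < card T then F' = F else
     F' = F \<and> locopt F T \<or> (\<exists>A. A \<inter> R = T \<and> F' = move E F A) \<and> card F' < card F \<and> \<not> locopt F T)"
proof -
  define t1 where "t1 = run net_init t"
  define t2 where "t2 = run (mincut aF) t1"
  define t3 where "t3 = run count_f t2"
  note i1 = run_net_init[OF t(1), folded t1_def, unfolded T]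
  have g1: "ginv t1" unfolding t1_def by (rule ginv_run[OF t(1)]) (simp_all add: move_frame)
  have g2: "ginv t2" unfolding t2_def by (rule ginv_run[OF g1]) (simp_all add: mincut_frame)
  have g3: "ginv t3" unfolding t3_def by (rule ginv_run[OF g2]) (simp_all add: move_frame)
  have f1: "matrix n t1 aF F" unfolding t1_def using t by (simp add: matrix_frame move_frame)
  have f2: "matrix n t2 aF F" unfolding t2_def using f1 by (simp add: matrix_frame mincut_frame)
  have f3: "matrix n t3 aF F" unfolding t3_def using f2 by (simp add: matrix_frame move_frame)
  define A where "A = vset n t2 aRCH"
  have mc: "T \<subseteq> A" "A \<subseteq> {..<n} - (R - T)" "rg t2 rVAL = card (move E F A)"
     "\<And>S. T \<subseteq> S \<Longrightarrow> S \<subseteq> {..<n} - (R - T) \<Longrightarrow> rg t2 rVAL \<le> card (move E F S)"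
    using run_mincut[of t1 aF F] g1 f1 t(3) i1 unfolding ginv_def Let_def t2_def[symmetric] A_def[symmetric] by auto
  have TR: "T \<subseteq> R" using T by auto
  have AT: "A \<inter> R = T" using mc(1,2) TR by auto
  have A3: "vset n t3 aRCH = A" unfolding t3_def A_def by (simp add: vset_frame move_frame)
  have r3: "rg t3 39 = card F" "rg t3 rVAL = card (move E F A)" "rg t3 38 = card T" "rg t3 rK = K"
    using run_count_f[OF ginv_dims[OF g2] f2 t(3)] mc(3) i1(4) K
    by (simp_all add: t3_def t2_def t1_def rg_frame move_frame mincut_frame)
  have run: "run move_prog t = (if K < card T then t3 else if card (move E F A) < card F then run update t3 else t3)"
    by (simp add: move_prog_def t1_def[symmetric] t2_def[symmetric] t3_def[symmetric] r3)
  show ?thesis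
  proof (cases "K < card T")
    case True
    then show ?thesis using f3 unfolding run by auto
  next
    case False
    show ?thesis
    proof (cases "card (move E F A) < card F")
      case True
      have "A \<subseteq> {..<n}" using mc(2) by auto
      have "\<not> locopt F T"
      proof
        assume "locopt F T"
        then have "card F \<le> card (move E F A)" using \<open>A \<subseteq> {..<n}\<close> AT unfolding locopt_def by blast
        then show False using True by simp
      qed
      moreover have "matrix n (run update t3) aF (move E F A)" by (rule run_update[OF g3 f3 t(3) A3])
      ultimately show ?thesis using True False AT unfolding run by (intro exI[of _ "move E F A"]) auto
    next
      case nless: False
      have "locopt F T" unfolding locopt_def
      proof (intro allI impI)
        fix S assume S: "S \<subseteq> {..<n}" "S \<inter> R = T"
        then have "card (move E F A) \<le> card (move E F S)" using mc(3) mc(4)[of S] mc(1) TR by auto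
        then show "card F \<le> card (move E F S)" using nless by simp
      qed
      then show ?thesis using False nless f3 unfolding run by auto
    qed
  qed
qed

end

section \<open>Enumeration of digit strings and the local search loop\<close>

definition reset_digits :: prog where "reset_digits = For 42 rL (wr1 aDG 42 (Num 0))"

text \<open>One position of a counter in base \<open>q\<close>, least significant digit first;
  register 43 is the carry.\<close>

definition carry_body :: prog where
  "carry_body = nz (Reg 43) (Cond (Plus1 (at1 aDG 42)) (Reg rQ)
     (wr1 aDG 42 (Plus1 (at1 aDG 42)) ;; Asg 43 (Num 0)) (wr1 aDG 42 (Num 0)))"

definition next_digits :: prog where "next_digits = Asg 43 (Num 1) ;; For 42 rL carry_body"

definition step_prog :: "prog \<Rightarrow> prog" where
  "step_prog dec = dec ;; move_prog ;; next_digits"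

definition scan_prog :: "prog \<Rightarrow> prog" where
  "scan_prog dec = reset_digits ;; For 45 rBQ (step_prog dec)"

definition pass_prog :: "prog \<Rightarrow> prog" where "pass_prog dec = For 36 rN (scan_prog dec)"

definition search_prog :: "prog \<Rightarrow> prog" where "search_prog dec = For 44 rOFF (pass_prog dec)"

lemma digits_frame:
  "writes reset_digits = {42}" "awrites reset_digits = {aDG}"
  "writes carry_body = {43}" "awrites carry_body = {aDG}"
  "writes next_digits = {42, 43}" "awrites next_digits = {aDG}"
  by (auto simp: reset_digits_def carry_body_def next_digits_def)

definition dig :: "nat \<Rightarrow> nat \<Rightarrow> nat \<Rightarrow> nat" where "dig q x j = x div q ^ j mod q"

lemma dig_less: "1 \<le> q \<Longrightarrow> dig q x j < q"
  by (simp add: dig_def)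

lemma dig_surj:
  assumes "\<forall>w\<in>set ws. w < q"
  shows "\<exists>x<q ^ length ws. \<forall>j<length ws. dig q x j = ws ! j"
  using assms
proof (induction ws)
  case (Cons w ws)
  then obtain x where x: "x < q ^ length ws" "\<forall>j<length ws. dig q x j = ws ! j" by auto
  have w: "w < q" using Cons.prems by simp
  have d: "(w + q * x) div q = x" using w by simp
  have "w + q * x < q * Suc x" using w by simp
  also have "\<dots> \<le> q * q ^ length ws" using x(1) by (intro mult_le_mono) auto
  finally have "w + q * x < q ^ length (w # ws)" by simp
  moreover have "dig q (w + q * x) j = (w # ws) ! j" if "j < length (w # ws)" for j
  proof (cases j)
    case 0
    then show ?thesis using w by (simp add: dig_def)
  next
    case (Suc i)
    then have "dig q (w + q * x) j = dig q x i" unfolding dig_def by (simp add: div_mult2_eq d)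
    then show ?thesis using x(2) Suc that by simp
  qed
  ultimately show ?case by blast
qed simp

text \<open>The carry of the increment arrives at position \<open>j\<close> exactly if all lower
  digits are \<open>q - 1\<close>, that is, if \<open>q ^ j\<close> divides
  \<open>Suc x\<close>.\<close>

lemma dig_Suc:
  assumes "1 \<le> q"
  shows "dig q (Suc x) j = (if q ^ j dvd Suc x then if Suc (dig q x j) = q then 0 else Suc (dig q x j) else dig q x j)"
    and "q ^ Suc j dvd Suc x \<longleftrightarrow> q ^ j dvd Suc x \<and> Suc (dig q x j) = q"
proof -
  have 1: "Suc x div q ^ j = (if q ^ j dvd Suc x then Suc (x div q ^ j) else x div q ^ j)"
    by (simp add: div_Suc dvd_eq_mod_eq_0)
  show "dig q (Suc x) j = (if q ^ j dvd Suc x then if Suc (dig q x j) = q then 0 else Suc (dig q x j) else dig q x j)"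
    unfolding dig_def 1 by (simp add: mod_Suc)
  have 2: "q dvd Suc (x div q ^ j) \<longleftrightarrow> Suc (dig q x j) = q"
    unfolding dig_def dvd_eq_mod_eq_0 by (simp add: mod_Suc)
  show "q ^ Suc j dvd Suc x \<longleftrightarrow> q ^ j dvd Suc x \<and> Suc (dig q x j) = q"
  proof (cases "q ^ j dvd Suc x")
    case True
    then have "Suc x = q ^ j * Suc (x div q ^ j)" using 1 by (metis dvd_mult_div_cancel)
    then have "q ^ Suc j dvd Suc x \<longleftrightarrow> q ^ j * q dvd q ^ j * Suc (x div q ^ j)"
      by (metis power_Suc2)
    also have "\<dots> \<longleftrightarrow> q dvd Suc (x div q ^ j)"
      using assms by (intro dvd_times_left_cancel_iff) simp
    finally show ?thesis using True 2 by blast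
  next
    case False
    then show ?thesis by (meson dvd_trans le_imp_power_dvd le_SucI order_refl)
  qed
qed

lemma run_reset_digits:
  assumes "rg t rL = L" "L \<le> rg t rMM"
  shows "\<forall>j<L. ar (run reset_digits t) aDG j 0 = 0"
  unfolding reset_digits_def
proof (rule For_rule[where P = "\<lambda>k t'. \<forall>j<k. ar t' aDG j 0 = 0"], goal_cases)
  case (2 k t1)
  have "min k (rg t1 rMM) = k" using 2(1) 2(3)[of rMM] assms by simp
  then show ?case using 2(2) by (simp add: less_Suc_eq)
next
  case (3 t1)
  then show ?case using assms by simp
qed simp

lemma run_next_digits:
  assumes t: "rg t rL = L" "L \<le> rg t rMM" "rg t rQ = q" and q: "1 \<le> q" and x: "\<forall>j<L. ar t aDG j 0 = dig q x j"
  shows "\<forall>j<L. ar (run next_digits t) aDG j 0 = dig q (Suc x) j"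
proof -
  define t1 where "t1 = setr 43 1 t"
  define I where "I = (\<lambda>k (t'::hstate). (rg t' 43 = of_bool (q ^ k dvd Suc x)) \<and> 
     (\<forall>j<L. ar t' aDG j 0 = (if j < k then dig q (Suc x) j else dig q x j)))"
  have "I L (run (For 42 rL carry_body) t1)"
  proof (rule For_rule[where P = I], goal_cases)
    case 1
    show ?case using x by (simp add: I_def t1_def)
  next
    case (2 k t2)
    define t3 where "t3 = setr 42 k t2"
    have kL: "k < L" using 2(1) t(1) by (simp add: t1_def)
    have r3: "rg t3 rQ = q" "min k (rg t3 rMM) = k" "rg t3 42 = k" "rg t3 43 = rg t2 43" "ar t3 = ar t2"
      using 2(3)[of rQ] 2(3)[of rMM] t kL by (simp_all add: t3_def digits_frame t1_def)
    have D: "ar t2 aDG k 0 = dig q x k" using 2(2) kL by (simp add: I_def)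
    have old: "rg t2 43 = of_bool (q ^ k dvd Suc x)" using 2(2) by (simp add: I_def)
    have lt: "Suc (dig q x k) < q \<longleftrightarrow> Suc (dig q x k) \<noteq> q" using dig_less[OF q, of x k] by auto
    have body: "run carry_body t3 = (if q ^ k dvd Suc x then if Suc (dig q x k) \<noteq> q then setr 43 0 (seta aDG k 0 (Suc (dig q x k)) t3)
       else seta aDG k 0 0 t3 else t3)"
      unfolding carry_body_def by (simp add: r3 D old lt)
    have 43: "rg (run carry_body t3) 43 = of_bool (q ^ Suc k dvd Suc x)"
      unfolding body dig_Suc(2)[OF q] using old by (simp add: r3)
    have "ar (run carry_body t3) aDG k 0 = dig q (Suc x) k"
      unfolding body dig_Suc(1)[OF q] using D by (simp add: r3)
    moreover have "ar (run carry_body t3) aDG j 0 = ar t2 aDG j 0" if "j \<noteq> k" for j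
      unfolding body using that by (simp add: r3)
    ultimately have "\<forall>j<L. ar (run carry_body t3) aDG j 0 = (if j < Suc k then dig q (Suc x) j else dig q x j)"
      using 2(2) unfolding I_def by (metis less_Suc_eq)
    then show ?case unfolding t3_def[symmetric] using 43 by (simp only: I_def)
  next
    case (3 t2)
    have "I L (setr 42 (rg t1 rL) t2) = I L t2" by (simp add: I_def)
    then show ?case using 3(1) t(1) by (simp add: t1_def)
  qed
  then show ?thesis by (simp add: next_digits_def t1_def I_def)
qed

text \<open>The frame common to the three algorithms. A decoder turns the start vertex
  \<open>r\<close> and the digits of \<open>x\<close> into a set with terminals
  \<open>fam r x\<close>; the bounds on what it may write protect the loop counters, the digits and
  the current separator.\<close>

locale search_n = graph_n +
  fixes dec :: prog and fam :: "nat \<Rightarrow> nat \<Rightarrow> nat set" and L q K M :: nat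
  assumes dec_writes: "writes dec \<subseteq> {9..<36}" "awrites dec \<subseteq> {aC, aSRC, aSNK, aRCH, aPAR, aS, aX}"
    and q: "1 \<le> q"
    and dec: "\<And>t r x. \<lbrakk>ginv t; rg t rL = L; L \<le> rg t rMM; rg t rQ = q; rg t 36 = r; r < n;
        \<forall>j<L. ar t aDG j 0 = dig q x j\<rbrakk> \<Longrightarrow> vset n (run dec t) aS \<inter> R = fam r x"
begin

definition binv :: "hstate \<Rightarrow> bool" where
  "binv t \<longleftrightarrow> ginv t \<and> rg t rL = L \<and> L \<le> rg t rMM \<and> rg t rQ = q \<and> rg t rK = K \<and> rg t rBQ = M"

definition sol :: "hstate \<Rightarrow> nat set set \<Rightarrow> bool" where
  "sol t F \<longleftrightarrow> matrix n t aF F \<and> edge_separator {..<n} E R K F"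

lemma sol_subset: "sol t F \<Longrightarrow> F \<subseteq> E"
  by (simp add: sol_def edge_separator_def)

lemma binv_agree:
  assumes "binv t" "\<And>x. x < 9 \<Longrightarrow> rg t' x = rg t x" "\<And>A. A \<in> {aADJ, aR, aZ} \<Longrightarrow> ar t' A = ar t A"
  shows "binv t'"
proof -
  have "ginv t'" by (rule ginv_agree[of t]) (use assms in \<open>auto simp: binv_def\<close>)
  then show ?thesis using assms(1,2) by (simp add: binv_def)
qed

lemma sol_setr [simp]: "sol (setr x c t) F = sol t F"
  by (simp add: sol_def)

definition opt :: "nat set set \<Rightarrow> nat set \<Rightarrow> bool" where
  "opt F T \<longleftrightarrow> (card T \<le> K \<longrightarrow> locopt F T)"

lemma step_writes: "writes (step_prog dec) \<subseteq> {9..<36} \<union> {37..43}"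
  "awrites (step_prog dec) \<subseteq> {aC, aSRC, aSNK, aRCH, aPAR, aS, aX, aF, aDG}"
  using dec_writes by (auto simp: step_prog_def move_frame digits_frame)

lemma run_step_prog:
  assumes b: "binv t" and F: "sol t F" and r: "rg t 36 = r" "r < n" and x: "\<forall>j<L. ar t aDG j 0 = dig q x j"
  shows "(\<exists>F'. sol (run (step_prog dec) t) F' \<and> (F' = F \<and> opt F (fam r x) \<or> card F' < card F \<and> \<not> opt F (fam r x))) \<and>
     (\<forall>j<L. ar (run (step_prog dec) t) aDG j 0 = dig q (Suc x) j)"
proof -
  define t1 where "t1 = run dec t"
  define t2 where "t2 = run move_prog t1"
  have nw: "y \<notin> writes dec" if "y < 9" for y using that dec_writes(1) by auto
  have na: "aADJ \<notin> awrites dec" "aR \<notin> awrites dec" "aZ \<notin> awrites dec" "aF \<notin> awrites dec" "aDG \<notin> awrites dec"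
    using dec_writes(2) by auto
  have b1: "binv t1" unfolding t1_def by (rule binv_agree[OF b]) (use nw na in \<open>auto simp: rg_frame ar_frame\<close>)
  have b2: "binv t2" unfolding t2_def by (rule binv_agree[OF b1]) (auto simp: rg_frame ar_frame move_frame)
  have F1: "sol t1 F" using F na by (simp add: sol_def t1_def matrix_frame)
  have T: "vset n t1 aS \<inter> R = fam r x" unfolding t1_def by (rule dec) (use b r x in \<open>auto simp: binv_def\<close>)
  obtain F' where F': "matrix n t2 aF F'" "if K < card (fam r x) then F' = F else
     F' = F \<and> locopt F (fam r x) \<or> (\<exists>A. A \<inter> R = fam r x \<and> F' = move E F A) \<and> card F' < card F \<and> \<not> locopt F (fam r x)"
    using run_move_prog[of t1 F "fam r x" K] b1 F1 T sol_subset[OF F] unfolding binv_def sol_def t2_def[symmetric] by blast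
  have sep: "edge_separator {..<n} E R K F" using F by (simp add: sol_def)
  have "sol t2 F' \<and> (F' = F \<and> opt F (fam r x) \<or> card F' < card F \<and> \<not> opt F (fam r x))"
  proof (cases "K < card (fam r x)")
    case True
    then show ?thesis using F' sep by (simp add: sol_def opt_def)
  next
    case False
    then have "F' = F \<and> locopt F (fam r x) \<or> (\<exists>A. A \<inter> R = fam r x \<and> F' = move E F A) \<and> card F' < card F \<and> \<not> locopt F (fam r x)"
      using F'(2) by simp
    then show ?thesis
    proof
      assume "F' = F \<and> locopt F (fam r x)"
      then show ?thesis using F'(1) sep by (simp add: sol_def opt_def)
    next
      assume a: "(\<exists>A. A \<inter> R = fam r x \<and> F' = move E F A) \<and> card F' < card F \<and> \<not> locopt F (fam r x)"
      then obtain A where A: "A \<inter> R = fam r x" "F' = move E F A" by blast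
      have "edge_separator {..<n} E R K F'" unfolding A(2)
        by (rule separator_move[OF sep]) (use A(1) False in simp)
      then show ?thesis using a F'(1) False by (simp add: sol_def opt_def)
    qed
  qed
  moreover have "sol (run next_digits t2) F' = sol t2 F'" by (simp add: sol_def matrix_frame digits_frame)
  moreover have "\<forall>j<L. ar t2 aDG j 0 = dig q x j" using x na by (simp add: t2_def t1_def ar_frame move_frame)
  then have "\<forall>j<L. ar (run next_digits t2) aDG j 0 = dig q (Suc x) j"
    using b2 q unfolding binv_def by (intro run_next_digits) auto
  moreover have "run (step_prog dec) t = run next_digits t2" by (simp add: step_prog_def t1_def t2_def)
  ultimately show ?thesis by auto
qed

text \<open>Either nothing has changed and the pairs in \<open>D\<close> offer no improvement, or
  the separator has shrunk. In the second case the existence of a pair at which the initial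
  \<open>F\<close> was not optimal is recorded, which excludes that a pass alters an optimal
  separator.\<close>

definition progress :: "nat set set \<Rightarrow> nat set set \<Rightarrow> (nat \<times> nat) set \<Rightarrow> bool" where
  "progress F F' D \<longleftrightarrow> F' = F \<and> (\<forall>(r, x)\<in>D. opt F (fam r x)) \<or>
     card F' < card F \<and> (\<exists>r<n. \<exists>x<M. \<not> opt F (fam r x))"

lemma progress_empty: "progress F F {}"
  by (simp add: progress_def)

lemma progress_trans:
  assumes 1: "progress F F1 D" and 2: "F2 = F1 \<and> opt F1 (fam r x) \<or> card F2 < card F1 \<and> \<not> opt F1 (fam r x)"
    and rx: "r < n" "x < M"
  shows "progress F F2 (insert (r, x) D)"
  using assms unfolding progress_def by (auto 0 3)

lemma run_scan_prog:
  assumes b: "binv t" and F: "sol t F1" "progress F F1 D" and r: "rg t 36 = r" "r < n"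
  shows "\<exists>F2. sol (run (scan_prog dec) t) F2 \<and> progress F F2 (D \<union> {r} \<times> {..<M})"
proof -
  define t1 where "t1 = run reset_digits t"
  have b1: "binv t1" unfolding t1_def by (rule binv_agree[OF b]) (auto simp: rg_frame ar_frame digits_frame)
  have F1: "sol t1 F1" using F by (simp add: sol_def t1_def matrix_frame digits_frame)
  have r1: "rg t1 36 = r" using r by (simp add: t1_def rg_frame digits_frame)
  have D1: "\<forall>j<L. ar t1 aDG j 0 = dig q 0 j"
    using run_reset_digits[of t L] b by (simp add: t1_def binv_def dig_def)
  have "\<exists>F2. sol (run (For 45 rBQ (step_prog dec)) t1) F2 \<and> progress F F2 (D \<union> {r} \<times> {..<M})"
  proof (rule For_rule[where P = "\<lambda>x t'. (\<exists>F2. sol t' F2 \<and> progress F F2 (D \<union> {r} \<times> {..<x})) \<and>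
     (\<forall>j<L. ar t' aDG j 0 = dig q x j)"], goal_cases)
    case 1
    show ?case using F1 F(2) D1 by auto
  next
    case (2 x t2)
    have xM: "x < M" using 2(1) b1 by (simp add: binv_def)
    have same: "rg (setr 45 x t2) y = rg t1 y" if "y < 9 \<or> y = 36" for y
    proof -
      have "y \<notin> writes (step_prog dec)" using subsetD[OF step_writes(1), of y] that by auto
      then show ?thesis using 2(3)[of y] that by auto
    qed
    have sameA: "ar (setr 45 x t2) A = ar t1 A" if "A \<in> {aADJ, aR, aZ}" for A
    proof -
      have "A \<notin> awrites (step_prog dec)" using subsetD[OF step_writes(2), of A] that by auto
      then show ?thesis using 2(4)[of A] that by auto
    qed
    have b2: "binv (setr 45 x t2)" by (rule binv_agree[OF b1], erule same[OF disjI1], erule sameA)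
    obtain F2 where F2: "sol t2 F2" "progress F F2 (D \<union> {r} \<times> {..<x})" using 2(2) by blast
    have "\<forall>j<L. ar (setr 45 x t2) aDG j 0 = dig q x j" using 2(2) by simp
    from run_step_prog[OF b2 _ _ r(2) this, of F2] obtain F3 where F3: "sol (run (step_prog dec) (setr 45 x t2)) F3"
      "F3 = F2 \<and> opt F2 (fam r x) \<or> card F3 < card F2 \<and> \<not> opt F2 (fam r x)"
      "\<forall>j<L. ar (run (step_prog dec) (setr 45 x t2)) aDG j 0 = dig q (Suc x) j"
      using F2(1) same[of 36] r1 by auto
    have "D \<union> {r} \<times> {..<Suc x} = insert (r, x) (D \<union> {r} \<times> {..<x})" by (auto simp: lessThan_Suc)
    then show ?case using F3 progress_trans[OF F2(2) F3(2) r(2) xM] by auto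
  next
    case (3 t2)
    then show ?case using b1 by (simp add: binv_def)
  qed
  then show ?thesis by (simp add: scan_prog_def t1_def)
qed

lemma scan_writes: "writes (scan_prog dec) \<subseteq> {9..<36} \<union> {37..45}"
  "awrites (scan_prog dec) \<subseteq> {aC, aSRC, aSNK, aRCH, aPAR, aS, aX, aF, aDG}"
  using step_writes by (auto simp: scan_prog_def digits_frame)

lemma run_pass_prog:
  assumes b: "binv t" and F: "sol t F"
  shows "\<exists>F2. sol (run (pass_prog dec) t) F2 \<and> progress F F2 ({..<n} \<times> {..<M})"
  unfolding pass_prog_def
proof (rule For_rule[where P = "\<lambda>r t'. \<exists>F2. sol t' F2 \<and> progress F F2 ({..<r} \<times> {..<M})"], goal_cases)
  case 1
  show ?case using F progress_empty by auto
next
  case (2 r t2)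
  have rn: "r < n" using 2(1) b by (simp add: binv_def ginv_def dims_def)
  have same: "rg (setr 36 r t2) y = rg t y" if "y < 9" for y
  proof -
      have "y \<notin> writes (scan_prog dec)" using subsetD[OF scan_writes(1), of y] that by auto
      then show ?thesis using 2(3)[of y] that by auto
    qed
  have sameA: "ar (setr 36 r t2) A = ar t A" if "A \<in> {aADJ, aR, aZ}" for A
  proof -
      have "A \<notin> awrites (scan_prog dec)" using subsetD[OF scan_writes(2), of A] that by auto
      then show ?thesis using 2(4)[of A] that by auto
    qed
  have b2: "binv (setr 36 r t2)" by (rule binv_agree[OF b], erule same, erule sameA)
  obtain F2 where F2: "sol (setr 36 r t2) F2" "progress F F2 ({..<r} \<times> {..<M})" using 2(2) by auto
  have "{..<Suc r} \<times> {..<M} = {..<r} \<times> {..<M} \<union> {r} \<times> {..<M}" by (auto simp: lessThan_Suc)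
  then show ?case using run_scan_prog[OF b2 F2 _ rn] by simp
next
  case (3 t2)
  then show ?case using b by (simp add: binv_def ginv_def dims_def)
qed

lemma pass_writes: "writes (pass_prog dec) \<subseteq> {9..<36} \<union> {36..45}"
  "awrites (pass_prog dec) \<subseteq> {aC, aSRC, aSNK, aRCH, aPAR, aS, aX, aF, aDG}"
  using scan_writes by (auto simp: pass_prog_def)

text \<open>A pass over all pairs shrinks the separator unless it is already optimal for all of
  them, and then it stays unchanged. Starting from \<open>E\<close>, fewer than \<open>rOFF\<close>
  passes can shrink it.\<close>

lemma run_search_prog:
  assumes b: "binv t" and F: "sol t E"
  shows "\<exists>F. sol (run (search_prog dec) t) F \<and> (\<forall>r<n. \<forall>x<M. opt F (fam r x))"
  unfolding search_prog_def
proof (rule For_rule[where P = "\<lambda>p t'. \<exists>F. sol t' F \<and> ((\<forall>r<n. \<forall>x<M. opt F (fam r x)) \<or> card F + p \<le> card E)"], goal_cases)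
  case 1
  show ?case using F by auto
next
  case (2 p t2)
  have same: "rg (setr 44 p t2) y = rg t y" if "y < 9" for y
  proof -
      have "y \<notin> writes (pass_prog dec)" using subsetD[OF pass_writes(1), of y] that by auto
      then show ?thesis using 2(3)[of y] that by auto
    qed
  have sameA: "ar (setr 44 p t2) A = ar t A" if "A \<in> {aADJ, aR, aZ}" for A
  proof -
      have "A \<notin> awrites (pass_prog dec)" using subsetD[OF pass_writes(2), of A] that by auto
      then show ?thesis using 2(4)[of A] that by auto
    qed
  have b2: "binv (setr 44 p t2)" by (rule binv_agree[OF b], erule same, erule sameA)
  obtain F1 where F1: "sol (setr 44 p t2) F1" "(\<forall>r<n. \<forall>x<M. opt F1 (fam r x)) \<or> card F1 + p \<le> card E" using 2(2) by auto
  obtain F2 where F2: "sol (run (pass_prog dec) (setr 44 p t2)) F2" "progress F1 F2 ({..<n} \<times> {..<M})"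
    using run_pass_prog[OF b2 F1(1)] by blast
  have "(\<forall>r<n. \<forall>x<M. opt F2 (fam r x)) \<or> card F2 + Suc p \<le> card E"
    using F2(2) unfolding progress_def
  proof
    assume "card F2 < card F1 \<and> (\<exists>r<n. \<exists>x<M. \<not> opt F1 (fam r x))"
    then show ?thesis using F1(2) by auto
  qed auto
  then show ?case using F2(1) by blast
next
  case (3 t2)
  then obtain F1 where F1: "sol t2 F1" "(\<forall>r<n. \<forall>x<M. opt F1 (fam r x)) \<or> card F1 + rg t rOFF \<le> card E" by blast
  moreover have "card E < rg t rOFF" using b by (simp add: binv_def ginv_def)
  ultimately show ?case by auto
qed

end

section \<open>Running time\<close>

primrec bounds :: "prog \<Rightarrow> nat set" where
  "bounds Nop = {}"
| "bounds (Asg x e) = {}"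
| "bounds (Wr A e1 e2 e3) = {}"
| "bounds (Out e1 e2) = {}"
| "bounds (p ;; q) = bounds p \<union> bounds q"
| "bounds (Cond e1 e2 p q) = bounds p \<union> bounds q"
| "bounds (For i b p) = insert b (bounds p)"

primrec esize :: "exp \<Rightarrow> nat" where
  "esize (Num c) = 1"
| "esize (Reg x) = 1"
| "esize (Plus1 e) = esize e + 1"
| "esize (Minus1 e) = esize e + 1"
| "esize (Arr A e1 e2) = esize e1 + esize e2 + 51"
| "esize (Io e) = esize e + 2"

primrec psize :: "prog \<Rightarrow> nat" where
  "psize Nop = 1"
| "psize (Asg x e) = esize e + 1"
| "psize (Wr A e1 e2 e3) = esize e1 + esize e2 + esize e3 + 51"
| "psize (Out e1 e2) = esize e1 + esize e2 + 2"
| "psize (p ;; q) = psize p + psize q"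
| "psize (Cond e1 e2 p q) = esize e1 + esize e2 + 1 + psize p + psize q"
| "psize (For i b p) = psize p + 4"

text \<open>The exponent of the polynomial time bound: 2 for elementary commands, because of the
  quadratic address computation, and 1 more for each loop with a polynomial bound.\<close>

primrec depth :: "prog \<Rightarrow> nat" where
  "depth Nop = 2"
| "depth (Asg x e) = 2"
| "depth (Wr A e1 e2 e3) = 2"
| "depth (Out e1 e2) = 2"
| "depth (p ;; q) = max (depth p) (depth q)"
| "depth (Cond e1 e2 p q) = max (depth p) (depth q)"
| "depth (For i b p) = (if b = rBQ then depth p else Suc (depth p))"

text \<open>Register \<open>rBQ\<close> holds the number of digit strings, the only loop bound that is not polynomial.\<close>

primrec qdepth :: "prog \<Rightarrow> nat" where
  "qdepth Nop = 0"
| "qdepth (Asg x e) = 0"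
| "qdepth (Wr A e1 e2 e3) = 0"
| "qdepth (Out e1 e2) = 0"
| "qdepth (p ;; q) = max (qdepth p) (qdepth q)"
| "qdepth (Cond e1 e2 p q) = max (qdepth p) (qdepth q)"
| "qdepth (For i b p) = (if b = rBQ then Suc (qdepth p) else qdepth p)"

lemma qdepth_0: "rBQ \<notin> bounds p \<Longrightarrow> qdepth p = 0"
  by (induction p) auto

lemma ecost_le: "w < X \<Longrightarrow> ecost e w \<le> esize e * X\<^sup>2"
proof (induction e)
  case (Arr A e1 e2)
  have "(w + 1)\<^sup>2 \<le> X\<^sup>2" using Arr.prems by (intro power_mono) auto
  moreover have "ecost e1 w \<le> esize e1 * X\<^sup>2" "ecost e2 w \<le> esize e2 * X\<^sup>2" using Arr by simp_all
  ultimately show ?case unfolding ecost.simps esize.simps add_mult_distrib by linarith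
next
  case (Plus1 e)
  have "1 \<le> X\<^sup>2" using Plus1.prems by simp
  moreover have "ecost e w \<le> esize e * X\<^sup>2" using Plus1 by simp
  ultimately show ?case unfolding ecost.simps esize.simps add_mult_distrib by linarith
next
  case (Minus1 e)
  have "1 \<le> X\<^sup>2" using Minus1.prems by simp
  moreover have "ecost e w \<le> esize e * X\<^sup>2" using Minus1 by simp
  ultimately show ?case unfolding ecost.simps esize.simps add_mult_distrib by linarith
next
  case (Io e)
  have "1 \<le> X\<^sup>2" using Io.prems by simp
  moreover have "ecost e w \<le> esize e * X\<^sup>2" using Io by simp
  ultimately show ?case unfolding ecost.simps esize.simps add_mult_distrib by linarith
qed (simp_all add: Suc_le_eq)

text \<open>A purely syntactic time bound. It is sound because no register that bounds a loop is
  ever written, so the initial values bound the number of rounds at every nesting level.\<close>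

lemma cost_le:
  fixes X Y :: nat
  assumes "\<forall>b\<in>bounds p. rg s b \<le> (if b = rBQ then Y else X)" "rg s rMM < X" "1 \<le> Y"
    and "bounds p \<inter> writes p = {}" "rMM \<notin> writes p"
  shows "cost p s \<le> psize p * (X ^ depth p * Y ^ qdepth p)"
  using assms
proof (induction p arbitrary: s)
  case Nop
  then show ?case by (simp add: Suc_le_eq)
next
  case (Asg x e)
  have "1 \<le> X\<^sup>2" using Asg.prems(2) by simp
  then have "cost (Asg x e) s \<le> psize (Asg x e) * X\<^sup>2"
    using ecost_le[OF Asg.prems(2), of e] unfolding cost.simps psize.simps add_mult_distrib by linarith
  then show ?case by simp
next
  case (Wr A e1 e2 e3)
  have "(rg s rMM + 1)\<^sup>2 \<le> X\<^sup>2" using Wr.prems(2) by (intro power_mono) auto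
  then have "cost (Wr A e1 e2 e3) s \<le> psize (Wr A e1 e2 e3) * X\<^sup>2"
    using ecost_le[OF Wr.prems(2), of e1] ecost_le[OF Wr.prems(2), of e2] ecost_le[OF Wr.prems(2), of e3]
    unfolding cost.simps psize.simps add_mult_distrib by linarith
  then show ?case by simp
next
  case (Out e1 e2)
  have "1 \<le> X\<^sup>2" using Out.prems(2) by simp
  then have "cost (Out e1 e2) s \<le> psize (Out e1 e2) * X\<^sup>2"
    using ecost_le[OF Out.prems(2), of e1] ecost_le[OF Out.prems(2), of e2]
    unfolding cost.simps psize.simps add_mult_distrib by linarith
  then show ?case by simp
next
  case (Sq p q)
  have X: "1 \<le> X" using Sq.prems(2) by simp
  have p: "cost p s \<le> psize p * (X ^ depth p * Y ^ qdepth p)"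
    by (rule Sq.IH(1)) (use Sq.prems in auto)
  have fr: "rg (run p s) b = rg s b" if "b \<in> bounds q \<or> b = rMM" for b
    using that Sq.prems(4,5) by (intro rg_frame) auto
  have q: "cost q (run p s) \<le> psize q * (X ^ depth q * Y ^ qdepth q)"
    by (rule Sq.IH(2)) (use Sq.prems fr in auto)
  have "X ^ depth p * Y ^ qdepth p \<le> X ^ depth (p ;; q) * Y ^ qdepth (p ;; q)"
    "X ^ depth q * Y ^ qdepth q \<le> X ^ depth (p ;; q) * Y ^ qdepth (p ;; q)"
    using X Sq.prems(3) by (auto intro!: mult_le_mono power_increasing)
  then have "psize p * (X ^ depth p * Y ^ qdepth p) + psize q * (X ^ depth q * Y ^ qdepth q) \<le>
     psize p * (X ^ depth (p ;; q) * Y ^ qdepth (p ;; q)) + psize q * (X ^ depth (p ;; q) * Y ^ qdepth (p ;; q))"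
    by (intro add_mono mult_le_mono2)
  then show ?case using p q by (simp add: add_mult_distrib)
next
  case (Cond e1 e2 p q)
  have X: "1 \<le> X" using Cond.prems(2) by simp
  let ?Z = "X ^ depth (Cond e1 e2 p q) * Y ^ qdepth (Cond e1 e2 p q)"
  have p: "cost p s \<le> psize p * (X ^ depth p * Y ^ qdepth p)"
    by (rule Cond.IH(1)) (use Cond.prems in auto)
  have q: "cost q s \<le> psize q * (X ^ depth q * Y ^ qdepth q)"
    by (rule Cond.IH(2)) (use Cond.prems in auto)
  have Z: "X ^ depth p * Y ^ qdepth p \<le> ?Z" "X ^ depth q * Y ^ qdepth q \<le> ?Z"
    using X Cond.prems(3) by (auto intro!: mult_le_mono power_increasing)
  have d: "2 \<le> depth p" for p by (induction p) auto
  have "X ^ 2 * 1 \<le> ?Z" using X Cond.prems(3) d[of p] by (intro mult_le_mono power_increasing) auto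
  then have Z2: "X\<^sup>2 \<le> ?Z" by simp
  have "1 \<le> X\<^sup>2" using X by simp
  then have Z1: "1 \<le> ?Z" using Z2 by linarith
  have "cost p s \<le> psize p * ?Z" using p mult_le_mono2[OF Z(1), of "psize p"] by linarith
  moreover have "cost q s \<le> psize q * ?Z" using q mult_le_mono2[OF Z(2), of "psize q"] by linarith
  moreover have "ecost e1 (rg s rMM) \<le> esize e1 * ?Z"
    using ecost_le[OF Cond.prems(2), of e1] mult_le_mono2[OF Z2, of "esize e1"] by linarith
  moreover have "ecost e2 (rg s rMM) \<le> esize e2 * ?Z"
    using ecost_le[OF Cond.prems(2), of e2] mult_le_mono2[OF Z2, of "esize e2"] by linarith
  moreover have "psize (Cond e1 e2 p q) * ?Z = esize e1 * ?Z + esize e2 * ?Z + ?Z + psize p * ?Z + psize q * ?Z"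
    by (simp only: psize.simps add_mult_distrib mult_1)
  ultimately show ?case using Z1 by (simp only: cost.simps split: if_splits) linarith
next
  case (For i b p)
  have X: "1 \<le> X" using For.prems(2) by simp
  let ?Z = "X ^ depth p * Y ^ qdepth p" and ?N = "if b = rBQ then Y else X"
  have body: "cost p (setr i j (iter (\<lambda>j t. run p (setr i j t)) j s)) \<le> psize p * ?Z" for j
  proof -
    have "rg (iter (\<lambda>j t. run p (setr i j t)) m s) x = rg s x" if "x \<in> bounds p \<or> x = rMM" for x m
    proof -
      have "x \<notin> writes p" "x \<noteq> i" using that For.prems(4,5) by auto
      then show ?thesis by (induction m) (simp_all add: rg_frame)
    qed
    moreover have "i \<notin> bounds p" "rMM \<noteq> i" using For.prems(4,5) by auto
    ultimately show ?thesis using For.prems by (intro For.IH) auto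
  qed
  have "cost (For i b p) s \<le> 2 + (\<Sum>j<rg s b. psize p * ?Z + 2)"
    unfolding cost.simps by (intro add_mono sum_mono body order_refl)
  also have "\<dots> = 2 + rg s b * (psize p * ?Z + 2)" by simp
  also have "\<dots> \<le> 2 + ?N * (psize p * ?Z + 2)"
  proof -
    have "rg s b \<le> ?N" using For.prems(1) by auto
    then show ?thesis by (intro add_mono mult_le_mono1 order_refl)
  qed
  also have "\<dots> \<le> (psize p + 4) * (?N * ?Z)"
  proof -
    have N: "1 \<le> ?N" "1 \<le> ?Z" using X For.prems(3) by simp_all
    have "?N * 1 \<le> ?N * ?Z" using N by (intro mult_le_mono) auto
    then have "?N \<le> ?N * ?Z" "1 \<le> ?N * ?Z" using N by linarith+
    then have "2 + ?N * (psize p * ?Z + 2) \<le> 2 * (?N * ?Z) + psize p * (?N * ?Z) + 2 * (?N * ?Z)"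
      unfolding add_mult_distrib2 mult.left_commute[of ?N "psize p"] by linarith
    then show ?thesis unfolding add_mult_distrib by linarith
  qed
  also have "?N * ?Z = X ^ depth (For i b p) * Y ^ qdepth (For i b p)" by simp
  finally show ?case by simp
qed

text \<open>This serves the setup phase, in which loop bounds are themselves computed and
  \<open>cost_le\<close> does not apply.\<close>

lemma cost_For_inv:
  assumes "P 0 s"
    and "\<And>j t. \<lbrakk>j < rg s b; P j t; \<And>x. x \<notin> insert i (writes p) \<Longrightarrow> rg t x = rg s x\<rbrakk> \<Longrightarrow>
       P (Suc j) (run p (setr i j t)) \<and> cost p (setr i j t) \<le> c"
  shows "cost (For i b p) s \<le> 2 + rg s b * (c + 2)"
proof -
  let ?it = "\<lambda>m. iter (\<lambda>j t. run p (setr i j t)) m s"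
  have fr: "rg (?it m) x = rg s x" if "x \<notin> insert i (writes p)" for x m
    by (induction m) (use that in \<open>auto simp: rg_frame\<close>)
  have P: "P m (?it m)" if "m \<le> rg s b" for m
    using that by (induction m) (use assms(1) assms(2) fr in auto)
  have "cost (For i b p) s \<le> 2 + (\<Sum>j<rg s b. c + 2)"
    unfolding cost.simps
    by (intro add_mono sum_mono order_refl conjunct2[OF assms(2)] P fr) auto
  then show ?thesis by simp
qed

section \<open>Arithmetic, input and output\<close>

definition adds :: "nat \<Rightarrow> nat \<Rightarrow> nat \<Rightarrow> nat \<Rightarrow> prog" where
  "adds i b x k = For i b (Asg x ((Plus1 ^^ k) (Reg x)))"

definition muls :: "nat \<Rightarrow> nat \<Rightarrow> nat \<Rightarrow> nat \<Rightarrow> nat \<Rightarrow> prog" where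
  "muls i b j c x = For i b (adds j c x 1)"

lemma ev_Plus1_funpow: "ev ((Plus1 ^^ k) e) s = ev e s + k" "ecost ((Plus1 ^^ k) e) w = ecost e w + k"
   "ewf b ((Plus1 ^^ k) e) = ewf b e"
  by (induction k) simp_all

lemma adds_frame: "writes (adds i b x k) = {i, x}" "awrites (adds i b x k) = {}" "no_out (adds i b x k)"
    "writes (muls i b j c x) = {i, j, x}" "awrites (muls i b j c x) = {}" "no_out (muls i b j c x)"
  by (auto simp: adds_def muls_def)

lemma run_adds: "i \<noteq> x \<Longrightarrow> b \<noteq> x \<Longrightarrow> rg (run (adds i b x k) s) x = rg s x + rg s b * k"
  unfolding adds_def
  by (rule For_rule[where P = "\<lambda>j t. rg t x = rg s x + j * k"]) (auto simp: ev_Plus1_funpow)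

lemma run_muls:
  assumes "x \<notin> {i, j, b, c}" "c \<notin> {i, j}"
  shows "rg (run (muls i b j c x) s) x = rg s x + rg s b * rg s c"
  unfolding muls_def
proof (rule For_rule[where P = "\<lambda>m t. rg t x = rg s x + m * rg s c"], goal_cases)
  case (2 m t)
  have "rg t c = rg s c" using 2(3)[of c] assms by (simp add: adds_frame)
  then show ?case using 2(2) assms run_adds[of j x c 1 "setr i m t"] by simp
qed (use assms in auto)

lemma cost_adds: "cost (adds i b x k) s \<le> 2 + rg s b * (k + 4)"
  unfolding adds_def
  by (rule order_trans[OF cost_For_inv[where P = "\<lambda>_ _. True" and c = "k + 2"]]) (auto simp: ev_Plus1_funpow algebra_simps)

lemma cost_muls:
  assumes "c \<notin> {i, j, x}"
  shows "cost (muls i b j c x) s \<le> 2 + rg s b * (rg s c * 5 + 4)"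
proof -
  have "cost (muls i b j c x) s \<le> 2 + rg s b * ((2 + rg s c * 5) + 2)"
    unfolding muls_def
  proof (rule cost_For_inv[where P = "\<lambda>_ _. True"])
    fix m and t :: hstate assume "\<And>y. y \<notin> insert i (writes (adds j c x 1)) \<Longrightarrow> rg t y = rg s y"
    from this[of c] have "rg t c = rg s c" using assms by (simp add: adds_frame)
    then show "True \<and> cost (adds j c x 1) (setr i m t) \<le> 2 + rg s c * 5"
      using cost_adds[of j c x 1 "setr i m t"] assms by simp
  qed simp
  then show ?thesis by (simp add: algebra_simps)
qed

text \<open>The product is collected in register 74, because \<open>rBQ\<close> bounds the inner
  loop of \<open>muls\<close> and has to stay fixed meanwhile.\<close>

definition power_prog :: prog where
  "power_prog = Asg rBQ (Num 1) ;; For 73 rL (Asg 74 (Num 0) ;; muls 75 rQ 76 rBQ 74 ;; Asg rBQ (Reg 74))"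

lemma power_frame: "writes power_prog = {8, 73, 74, 75, 76}" "awrites power_prog = {}" "no_out power_prog"
  by (auto simp: power_prog_def adds_frame)

lemma run_power_body:
  "rg (run (Asg 74 (Num 0) ;; muls 75 rQ 76 rBQ 74 ;; Asg rBQ (Reg 74)) t) rBQ = rg t rQ * rg t rBQ"
  using run_muls[of 74 75 76 rQ rBQ "setr 74 0 t"] by simp

lemma run_power_prog: "rg (run power_prog s) rBQ = rg s rQ ^ rg s rL"
  unfolding power_prog_def run.simps(5) run.simps(2)
proof (rule For_rule[where P = "\<lambda>j t. rg t rBQ = rg s rQ ^ j"], goal_cases)
  case (2 j t)
  have "rg t rQ = rg s rQ" using 2(3)[of rQ] by (simp add: adds_frame)
  then show ?case unfolding run_power_body using 2(2) by simp
qed simp_all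

lemma cost_power_prog:
  assumes "1 \<le> rg s rQ"
  shows "cost power_prog s \<le> 4 + rg s rL * (17 * (rg s rQ * rg s rQ ^ rg s rL))"
proof -
  let ?q = "rg s rQ" and ?L = "rg s rL"
  define s1 where "s1 = setr rBQ 1 s"
  have "cost (For 73 rL (Asg 74 (Num 0) ;; muls 75 rQ 76 rBQ 74 ;; Asg rBQ (Reg 74))) s1 \<le>
     2 + rg s1 rL * (15 * (?q * ?q ^ ?L) + 2)"
  proof (rule cost_For_inv[where P = "\<lambda>j t. rg t rBQ = ?q ^ j"], goal_cases)
    case (2 j t)
    have q: "rg t rQ = ?q" using 2(3)[of rQ] by (simp add: adds_frame s1_def)
    have bq: "rg t rBQ = ?q ^ j" by (rule 2(2))
    have "?q ^ j \<le> ?q ^ ?L" using 2(1) assms by (intro power_increasing) (auto simp: s1_def)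
    then have 1: "?q * ?q ^ j \<le> ?q * ?q ^ ?L" by simp
    have "1 * 1 \<le> ?q * ?q ^ j" "?q * 1 \<le> ?q * ?q ^ j" using assms by (auto intro!: mult_le_mono simp: Suc_le_eq)
    then have 2: "1 \<le> ?q * ?q ^ j" "?q \<le> ?q * ?q ^ j" by simp_all
    have "cost (muls 75 rQ 76 rBQ 74) (setr 74 0 (setr 73 j t)) \<le> 2 + ?q * (?q ^ j * 5 + 4)"
      using cost_muls[of rBQ 75 76 74 rQ "setr 74 0 (setr 73 j t)"] by (simp add: q bq)
    also have "\<dots> = 2 + 5 * (?q * ?q ^ j) + 4 * ?q" by (simp add: algebra_simps)
    finally have "cost (muls 75 rQ 76 rBQ 74) (setr 74 0 (setr 73 j t)) \<le> 11 * (?q * ?q ^ j)" using 2 by linarith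
    moreover have "cost (Asg 74 (Num 0) ;; muls 75 rQ 76 rBQ 74 ;; Asg rBQ (Reg 74)) (setr 73 j t) =
      cost (muls 75 rQ 76 rBQ 74) (setr 74 0 (setr 73 j t)) + 4" by simp
    ultimately have "cost (Asg 74 (Num 0) ;; muls 75 rQ 76 rBQ 74 ;; Asg rBQ (Reg 74)) (setr 73 j t) \<le> 15 * (?q * ?q ^ ?L)"
      using 1 2 by linarith
    then show ?case unfolding run_power_body by (simp add: q bq)
  qed (simp add: s1_def)
  then have "cost power_prog s \<le> 4 + ?L * (15 * (?q * ?q ^ ?L) + 2)" by (simp add: power_prog_def s1_def)
  also have "\<dots> \<le> 4 + ?L * (17 * (?q * ?q ^ ?L))"
  proof -
    have "1 * 1 \<le> ?q * ?q ^ ?L" using assms by (intro mult_le_mono) (auto simp: Suc_le_eq)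
    then have "15 * (?q * ?q ^ ?L) + 2 \<le> 17 * (?q * ?q ^ ?L)" by linarith
    then show ?thesis by (intro add_mono mult_le_mono order_refl)
  qed
  finally show ?thesis .
qed

text \<open>\<open>aF\<close> receives the adjacency matrix as well: the local search starts from
  the separator \<open>E\<close>.\<close>

definition read_cell :: prog where
  "read_cell = wr2 aADJ 48 49 (Io (Reg 47)) ;; wr2 aF 48 49 (Io (Reg 47)) ;;
     wr2 aZ 48 49 (Num 0) ;; Asg 47 (Plus1 (Reg 47))"

definition read_row :: prog where "read_row = For 49 rN read_cell"

definition read_terminals :: prog where
  "read_terminals = For 48 rN (wr1 aR 48 (Io (Reg 47)) ;; Asg 47 (Plus1 (Reg 47)))"

definition read_prog :: prog where
  "read_prog = Asg 47 (Num 0) ;; read_terminals ;; For 48 rN read_row"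

definition write_cell :: prog where
  "write_cell = Out (Reg 47) (at2 aF 48 49) ;; Asg 47 (Plus1 (Reg 47))"

definition write_row :: prog where "write_row = For 49 rN write_cell"

definition write_prog :: prog where "write_prog = Asg 47 (Reg rN) ;; For 48 rN write_row"

lemma io_prog_frame:
  "writes read_cell = {47}" "awrites read_cell = {aADJ, aF, aZ}" "no_out read_cell"
  "writes read_row = {47, 49}" "awrites read_row = {aADJ, aF, aZ}" "no_out read_row"
  "writes read_terminals = {47, 48}" "awrites read_terminals = {aR}" "no_out read_terminals"
  "writes read_prog = {47, 48, 49}" "awrites read_prog = {aADJ, aF, aZ, aR}" "no_out read_prog"
  "writes write_cell = {47}" "awrites write_cell = {}"
  "writes write_row = {47, 49}" "awrites write_row = {}"
  "writes write_prog = {47, 48, 49}" "awrites write_prog = {}"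
  by (auto simp: read_cell_def read_row_def read_terminals_def read_prog_def write_cell_def write_row_def write_prog_def)

lemma run_read_prog:
  assumes t: "dims n t" "rg t rOFF = n + n * n"
  defines "t' \<equiv> run read_prog t"
  shows "\<forall>v<n. ar t' aR v 0 = io t v"
    "\<forall>u<n. \<forall>v<n. ar t' aADJ u v = io t (n + u * n + v) \<and> ar t' aF u v = io t (n + u * n + v) \<and> ar t' aZ u v = 0"
proof -
  define t0 where "t0 = setr 47 0 t"
  define t1 where "t1 = run read_terminals t0"
  have d0: "dims n t0" "rg t0 rOFF = n + n * n" "io t0 = io t" using t by (simp_all add: t0_def dims_def)
  have T: "(\<forall>v<n. ar t1 aR v 0 = io t v) \<and> rg t1 47 = n"
    unfolding t1_def read_terminals_def
  proof (rule For_rule[where P = "\<lambda>k t'. (\<forall>v<k. ar t' aR v 0 = io t v) \<and> rg t' 47 = k \<and> io t' = io t"], goal_cases)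
    case 1
    show ?case using d0 by (simp add: t0_def)
  next
    case (2 k t2)
    have k: "k < n" using 2(1) d0(1) by (simp add: dims_def)
    have "min k (rg t2 rMM) = k" "rg t2 rOFF = n + n * n"
      using 2(3)[of rMM] 2(3)[of rOFF] min_dims[OF d0(1)] d0 k by simp_all
    then show ?case using 2(2) k by (simp add: less_Suc_eq)
  next
    case (3 t2)
    then show ?case using dimsD(1)[OF d0(1)] by simp
  qed
  have d1: "dims n t1" "rg t1 rOFF = n + n * n" "io t1 = io t"
    using d0 by (simp_all add: t1_def dims_def rg_frame io_frame io_prog_frame)
  define G where "G = (\<lambda>(t'::hstate) u v. ar t' aADJ u v = io t (n + u * n + v) \<and> ar t' aF u v = io t (n + u * n + v) \<and> ar t' aZ u v = 0)"
  have "\<forall>u<n. \<forall>v<n. G (run (For 48 rN read_row) t1) u v"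
  proof (rule For_rule[where P = "\<lambda>k t'. (\<forall>u<k. \<forall>v<n. G t' u v) \<and> rg t' 47 = n + k * n \<and> io t' = io t"], goal_cases)
    case 1
    show ?case using T d1 by simp
  next
    case (2 k t2)
    define t3 where "t3 = setr 48 k t2"
    have k: "k < n" using 2(1) d1(1) by (simp add: dims_def)
    have d3: "dims n t3" "rg t3 rOFF = n + n * n" "rg t3 48 = k" "io t3 = io t"
      using 2(2) 2(3)[of rN] 2(3)[of rN1] 2(3)[of rMM] 2(3)[of rOFF] d1 by (simp_all add: t3_def dims_def io_prog_frame)
    have "(\<forall>u<k. \<forall>v<n. G (run read_row t3) u v) \<and> (\<forall>v<n. G (run read_row t3) k v) \<and>
       rg (run read_row t3) 47 = n + k * n + n \<and> io (run read_row t3) = io t"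
      unfolding read_row_def
    proof (rule For_rule[where P = "\<lambda>j t'. (\<forall>u<k. \<forall>v<n. G t' u v) \<and> (\<forall>v<j. G t' k v) \<and>
       rg t' 47 = n + k * n + j \<and> io t' = io t"], goal_cases)
      case 1
      show ?case using 2(2) by (simp add: t3_def G_def)
    next
      case (2 j t4)
      have j: "j < n" using 2(1) d3(1) by (simp add: dims_def)
      have m: "min k (rg t4 rMM) = k" "min j (rg t4 rMM) = j" "rg t4 rOFF = n + n * n" "rg t4 48 = k"
        using 2(3)[of rMM] 2(3)[of rOFF] 2(3)[of 48] min_dims[OF d3(1)] d3 k j by (simp_all add: io_prog_frame)
      have "k * n + j < k * n + n" using j by simp
      also have "\<dots> \<le> n * n" using k by (metis Suc_leI add.commute mult_Suc mult_le_mono1)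
      finally have "k * n + j < n * n" .
      then show ?case using 2(2) unfolding read_cell_def G_def by (auto simp: m less_Suc_eq)
    next
      case (3 t4)
      then show ?case using dimsD(1)[OF d3(1)] by (simp add: G_def)
    qed
    then show ?case unfolding t3_def by (auto simp: less_Suc_eq)
  next
    case (3 t2)
    then show ?case using dimsD(1)[OF d1(1)] by (simp add: G_def)
  qed
  moreover have "t' = run (For 48 rN read_row) t1" by (simp add: t'_def read_prog_def t0_def t1_def)
  moreover have "ar (run (For 48 rN read_row) t1) aR = ar t1 aR" by (rule ar_frame) (simp add: io_prog_frame)
  ultimately show "\<forall>v<n. ar t' aR v 0 = io t v"
    "\<forall>u<n. \<forall>v<n. ar t' aADJ u v = io t (n + u * n + v) \<and> ar t' aF u v = io t (n + u * n + v) \<and> ar t' aZ u v = 0"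
    using T by (simp_all add: G_def)
qed

lemma cell_index_inject:
  fixes u v u' v' n :: nat
  assumes "v < n" "v' < n"
  shows "u * n + v = u' * n + v' \<longleftrightarrow> u = u' \<and> v = v'"
proof
  assume eq: "u * n + v = u' * n + v'"
  have "(u * n + v) div n = u" "(u' * n + v') div n = u'" "(u * n + v) mod n = v" "(u' * n + v') mod n = v'"
    using assms by simp_all
  then show "u = u' \<and> v = v'" using eq by metis
qed simp

lemma run_write_prog:
  assumes t: "dims n t" "rg t rOFF = n + n * n"
  shows "\<forall>u<n. \<forall>v<n. io (run write_prog t) (n + u * n + v) = ar t aF u v"
proof -
  define t1 where "t1 = setr 47 (rg t rN) t"
  have d1: "dims n t1" "rg t1 rOFF = n + n * n" "ar t1 = ar t" "rg t1 47 = n" using t by (simp_all add: t1_def dims_def)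
  define G where "G = (\<lambda>(t'::hstate) u v. io t' (n + u * n + v) = ar t aF u v)"
  have "\<forall>u<n. \<forall>v<n. G (run (For 48 rN write_row) t1) u v"
  proof (rule For_rule[where P = "\<lambda>k t'. (\<forall>u<k. \<forall>v<n. G t' u v) \<and> rg t' 47 = n + k * n"], goal_cases)
    case 1
    show ?case using d1 by simp
  next
    case (2 k t2)
    define t3 where "t3 = setr 48 k t2"
    have k: "k < n" using 2(1) d1(1) by (simp add: dims_def)
    have d3: "dims n t3" "rg t3 rOFF = n + n * n" "rg t3 48 = k" "ar t3 aF = ar t aF"
      using 2(3)[of rN] 2(3)[of rN1] 2(3)[of rMM] 2(3)[of rOFF] 2(4)[of aF] d1 by (simp_all add: t3_def dims_def io_prog_frame)
    have "(\<forall>u<k. \<forall>v<n. G (run write_row t3) u v) \<and> (\<forall>v<n. G (run write_row t3) k v) \<and>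
       rg (run write_row t3) 47 = n + k * n + n"
      unfolding write_row_def
    proof (rule For_rule[where P = "\<lambda>j t'. (\<forall>u<k. \<forall>v<n. G t' u v) \<and> (\<forall>v<j. G t' k v) \<and> rg t' 47 = n + k * n + j"], goal_cases)
      case 1
      show ?case using 2(2) by (simp add: t3_def G_def)
    next
      case (2 j t4)
      have j: "j < n" using 2(1) d3(1) by (simp add: dims_def)
      have m: "min k (rg t4 rMM) = k" "min j (rg t4 rMM) = j" "rg t4 rOFF = n + n * n" "rg t4 48 = k" "ar t4 aF = ar t aF"
        using 2(3)[of rMM] 2(3)[of rOFF] 2(3)[of 48] 2(4)[of aF] min_dims[OF d3(1)] d3 k j by (simp_all add: io_prog_frame)
      have "k * n + j < k * n + n" using j by simp
      also have "\<dots> \<le> n * n" using k by (metis Suc_leI add.commute mult_Suc mult_le_mono1)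
      finally have less: "k * n + j < n * n" .
      have run: "run write_cell (setr 49 j t4) = setr 47 (Suc (n + k * n + j)) ((setr 49 j t4)\<lparr>io := (io t4)(n + k * n + j := ar t aF k j)\<rparr>)"
        using less 2(2) by (simp add: write_cell_def m)
      have other: "io (run write_cell (setr 49 j t4)) (n + u * n + v) = io t4 (n + u * n + v)" if "v < n" "u \<noteq> k \<or> v \<noteq> j" for u v
        unfolding run using that cell_index_inject[of v n j u k] j by (auto simp: add.assoc)
      have new: "io (run write_cell (setr 49 j t4)) (n + k * n + j) = ar t aF k j" unfolding run by simp
      have "G (run write_cell (setr 49 j t4)) u v" if "u < k" "v < n" for u v
        using 2(2) other[of v u] that by (simp add: G_def)
      moreover have "G (run write_cell (setr 49 j t4)) k v" if "v < Suc j" for v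
        using 2(2) other[of v k] new that j by (cases "v = j") (simp_all add: G_def)
      moreover have "rg (run write_cell (setr 49 j t4)) 47 = n + k * n + Suc j" unfolding run by simp
      ultimately show ?case by blast
    next
      case (3 t4)
      then show ?case using dimsD(1)[OF d3(1)] by (simp add: G_def)
    qed
    then show ?case unfolding t3_def by (auto simp: less_Suc_eq)
  next
    case (3 t2)
    then show ?case using dimsD(1)[OF d1(1)] by (simp add: G_def)
  qed
  then show ?thesis by (simp add: write_prog_def t1_def G_def)
qed

section \<open>The complete program\<close>

lemma bounds_of:
  "bounds search = {rN1}" "bounds flow = {rN1, rOFF}" "bounds (load A) = {rN, rN1}"
  "bounds (mincut A) = {rN, rN1, rOFF}" "bounds copy_sx = {rN}" "bounds add_r = {rN}"
  "bounds pick_prog = {rN, rN1, rOFF}" "bounds bstep_prog = {rN, rN1, rOFF}"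
  "bounds digit_loop = {rN, rN1, rOFF, rQ}" "bounds branch_decode = {rN, rN1, rOFF, rQ, rL}"
  "bounds subset_decode = {rN, rL}" "bounds move_prog = {rN, rN1, rOFF}"
  "bounds reset_digits = {rL}" "bounds next_digits = {rL}"
  "bounds read_prog = {rN}" "bounds write_prog = {rN}"
proof -
  show se: "bounds search = {rN1}" by (simp add: search_def round_def round_row_def round_body_def)
  show fl: "bounds flow = {rN1, rOFF}"
    by (auto simp: flow_def flow_body_def se find_sink_def augment_def augment_body_def)
  show lo: "bounds (load A) = {rN, rN1}" for A by (auto simp: load_def load_row_def load_cell_def)
  show mc: "bounds (mincut A) = {rN, rN1, rOFF}" for A by (auto simp: mincut_def fl lo)
  show cp: "bounds copy_sx = {rN}" "bounds add_r = {rN}" by (simp_all add: copy_sx_def add_r_def)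
  show pk: "bounds pick_prog = {rN, rN1, rOFF}"
    by (auto simp: pick_prog_def pick_init_def rule1_body_def nbr_row_def nbr_body_def free_test_def mc cp)
  show bs: "bounds bstep_prog = {rN, rN1, rOFF}" by (auto simp: bstep_prog_def bstep_body_def pk)
  show dl: "bounds digit_loop = {rN, rN1, rOFF, rQ}" by (auto simp: digit_loop_def digit_body_def bs)
  show "bounds branch_decode = {rN, rN1, rOFF, rQ, rL}" by (auto simp: branch_decode_def clear_sx_def dl)
  show "bounds subset_decode = {rN, rL}" by (auto simp: subset_decode_def clear_sx_def)
  show "bounds move_prog = {rN, rN1, rOFF}"
    by (auto simp: move_prog_def net_init_def mc count_f_def count_row_def update_def update_row_def update_cell_def)
  show "bounds reset_digits = {rL}" "bounds next_digits = {rL}"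
    by (simp_all add: reset_digits_def next_digits_def carry_body_def)
  show "bounds read_prog = {rN}" "bounds write_prog = {rN}"
    by (simp_all add: read_prog_def read_terminals_def read_row_def read_cell_def write_prog_def write_row_def write_cell_def)
qed

lemma wf_of:
  "wf True search" "wf True flow" "A < 16 \<Longrightarrow> wf True (load A)" "A < 16 \<Longrightarrow> wf True (mincut A)"
  "wf True copy_sx" "wf True add_r" "wf True pick_prog" "wf True bstep_prog" "wf True digit_loop"
  "wf True branch_decode" "wf True subset_decode" "wf True move_prog" "wf True reset_digits"
  "wf True next_digits" "wf True read_prog" "wf True write_prog"
proof -
  show se: "wf True search" by (simp add: search_def round_def round_row_def round_body_def)
  show fl: "wf True flow"
    by (simp add: flow_def flow_body_def se find_sink_def augment_def augment_body_def search_frame)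
  show lo: "wf True (load A)" if "A < 16" for A using that by (simp add: load_def load_row_def load_cell_def)
  show mc: "wf True (mincut A)" if "A < 16" for A using that by (simp add: mincut_def fl lo)
  show cp: "wf True copy_sx" "wf True add_r" by (simp_all add: copy_sx_def add_r_def)
  show pk: "wf True pick_prog"
    by (simp add: pick_prog_def pick_init_def rule1_body_def nbr_row_def nbr_body_def free_test_def mc cp
        mincut_frame copy_frame)
  show bs: "wf True bstep_prog" by (simp add: bstep_prog_def bstep_body_def pk pick_frame)
  show dl: "wf True digit_loop" by (simp add: digit_loop_def digit_body_def bs bstep_frame)
  show "wf True branch_decode" by (simp add: branch_decode_def clear_sx_def dl decode_frame)
  show "wf True subset_decode" by (simp add: subset_decode_def clear_sx_def)
  show "wf True move_prog"
    by (simp add: move_prog_def net_init_def mc count_f_def count_row_def update_def update_row_def update_cell_def)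
  show "wf True reset_digits" "wf True next_digits"
    by (simp_all add: reset_digits_def next_digits_def carry_body_def)
  show "wf True read_prog" "wf True write_prog"
    by (simp_all add: read_prog_def read_terminals_def read_row_def read_cell_def write_prog_def write_row_def write_cell_def)
qed

definition main_prog :: "prog \<Rightarrow> prog" where
  "main_prog dec = read_prog ;; search_prog dec ;; write_prog"

text \<open>\<open>rOFF\<close> becomes \<open>n + n * n\<close>, the end of the input. The bound
  \<open>k\<close> is cut down to \<open>min k n\<close>, which changes nothing for components with
  at most \<open>n\<close> terminals. Otherwise \<open>k\<close> would enter the polynomial factor
  of the time, and for \<open>n = 1\<close> the bound \<open>n ^ (k + c)\<close> could not absorb
  it.\<close>

definition pre_prog :: prog where
  "pre_prog = adds 50 rN rOFF 1 ;; muls 50 rN 51 rN rOFF ;; Asg rN1 (Plus1 (Reg rN)) ;;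
     Cond (Reg 1) (Reg rN) (Asg rK (Reg 1)) (Asg rK (Reg rN))"

text \<open>\<open>rMM\<close> becomes \<open>n + 1 + L\<close>, so that the vertices, the
  additional source \<open>n\<close> and the positions of the digits are all valid array
  indices.\<close>

definition post_prog :: prog where
  "post_prog = Asg 71 (Plus1 (Reg rN)) ;; adds 72 rL 71 1 ;; power_prog ;; Asg rMM (Reg 71)"

text \<open>The setup computes \<open>rMM\<close> and \<open>rOFF\<close>, on which the array layout
  depends; hence it is compiled separately, as a program without arrays.\<close>

definition full_prog :: "prog \<Rightarrow> prog \<Rightarrow> com" where
  "full_prog su dec = Seq (compile (pre_prog ;; su ;; post_prog)) (compile (main_prog dec))"

lemma prepost_frame:
  "writes pre_prog = {3, 4, 5, 50, 51}" "no_out pre_prog" "wf False pre_prog"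
  "writes post_prog = {2, 8, 71, 72, 73, 74, 75, 76}" "no_out post_prog" "wf False post_prog"
  by (auto simp: pre_prog_def post_prog_def adds_frame power_frame power_prog_def adds_def muls_def)

text \<open>The change of view between the two phases: the cells above the raw area are declared to
  be arrays, with whatever contents they happen to have.\<close>

lemma wf_run_no_arrays: "sim False s (r, m) \<Longrightarrow> \<exists>a. sim True (s\<lparr>ar := a\<rparr>) (r, m)"
  by (rule exI[of _ "\<lambda>A u v. m (cell (rg s rOFF) (rg s rMM) A u v)"]) (simp add: sim_def)

lemma cost_pre_prog: "cost pre_prog s \<le> 20 + 14 * rg s rN + 5 * (rg s rN * rg s rN)"
proof -
  have "cost (adds 50 rN rOFF 1) s \<le> 2 + rg s rN * 5" using cost_adds[of 50 rN rOFF 1 s] by simp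
  moreover have "cost (muls 50 rN 51 rN rOFF) (run (adds 50 rN rOFF 1) s) \<le> 2 + rg s rN * (rg s rN * 5 + 4)"
    using cost_muls[of rN 50 51 rOFF rN "run (adds 50 rN rOFF 1) s"] by (simp add: rg_frame adds_frame)
  moreover have "2 + rg s rN * (rg s rN * 5 + 4) = 2 + 5 * (rg s rN * rg s rN) + 4 * rg s rN"
    by (simp add: algebra_simps)
  moreover have "cost (Asg rN1 (Plus1 (Reg rN)) ;; Cond (Reg 1) (Reg rN) (Asg rK (Reg 1)) (Asg rK (Reg rN)))
      (run (muls 50 rN 51 rN rOFF) (run (adds 50 rN rOFF 1) s)) \<le> 3 + (3 + 2)" by simp
  moreover have "cost pre_prog s = cost (adds 50 rN rOFF 1) s + (cost (muls 50 rN 51 rN rOFF) (run (adds 50 rN rOFF 1) s) +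
      cost (Asg rN1 (Plus1 (Reg rN)) ;; Cond (Reg 1) (Reg rN) (Asg rK (Reg 1)) (Asg rK (Reg rN)))
      (run (muls 50 rN 51 rN rOFF) (run (adds 50 rN rOFF 1) s)))"
    unfolding pre_prog_def cost.simps(5)[of "adds 50 rN rOFF 1"] cost.simps(5)[of "muls 50 rN 51 rN rOFF"] ..
  ultimately show ?thesis by linarith
qed

lemma cost_post_prog:
  assumes "1 \<le> rg s rQ"
  shows "cost post_prog s \<le> 11 + 5 * rg s rL + 17 * (rg s rL * (rg s rQ * rg s rQ ^ rg s rL))"
proof -
  define s1 where "s1 = run (adds 72 rL 71 1) (setr 71 (Suc (rg s rN)) s)"
  have r: "rg s1 rQ = rg s rQ" "rg s1 rL = rg s rL" by (simp_all add: s1_def rg_frame adds_frame)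
  have "cost (adds 72 rL 71 1) (setr 71 (Suc (rg s rN)) s) \<le> 2 + rg s rL * 5"
    using cost_adds[of 72 rL 71 1 "setr 71 (Suc (rg s rN)) s"] by simp
  moreover have "cost power_prog s1 \<le> 4 + rg s rL * (17 * (rg s rQ * rg s rQ ^ rg s rL))"
    using cost_power_prog[of s1] assms r by simp
  moreover have "cost post_prog s = 3 + (cost (adds 72 rL 71 1) (setr 71 (Suc (rg s rN)) s) + (cost power_prog s1 + 2))"
    by (simp add: post_prog_def s1_def)
  ultimately show ?thesis by (simp add: algebra_simps)
qed

section \<open>Composition of setup, search and output\<close>

definition setup_pre :: "nat \<Rightarrow> nat set set \<Rightarrow> nat set \<Rightarrow> nat \<Rightarrow> hstate \<Rightarrow> bool" where
  "setup_pre n E R k s \<longleftrightarrow> rg s rN = n \<and> rg s rOFF = n + n * n \<and> rg s rK = min k n \<and>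
     (\<forall>x\<ge>6. x \<notin> {50, 51} \<longrightarrow> rg s x = 0) \<and> io s = snd (input_state n E R k)"

lemma run_pre_prog:
  assumes "rg s = fst (input_state n E R k)" "io s = snd (input_state n E R k)"
  shows "setup_pre n E R k (run pre_prog s)" "rg (run pre_prog s) rN1 = Suc n"
proof -
  define s1 where "s1 = run (adds 50 rN rOFF 1) s"
  define s2 where "s2 = run (muls 50 rN 51 rN rOFF) s1"
  have r0: "rg s 0 = n" "rg s 1 = k" "\<And>x. x \<ge> 2 \<Longrightarrow> rg s x = 0" using assms by (simp_all add: input_state_def)
  have r1: "rg s1 0 = n" "rg s1 1 = k" "rg s1 3 = n" "\<And>x. x \<ge> 4 \<Longrightarrow> x \<noteq> 50 \<Longrightarrow> rg s1 x = 0"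
    using r0 run_adds[of 50 3 0 1 s] by (simp_all add: s1_def rg_frame adds_frame)
  have r2: "rg s2 0 = n" "rg s2 1 = k" "rg s2 3 = n + n * n" "\<And>x. x \<ge> 4 \<Longrightarrow> x \<notin> {50, 51} \<Longrightarrow> rg s2 x = 0"
    using r1 run_muls[of 3 50 51 0 0 s1] by (simp_all add: s2_def rg_frame adds_frame)
  have "io (run pre_prog s) = io s" by (rule io_frame) (rule prepost_frame)
  moreover have "run pre_prog s = run (Asg rN1 (Plus1 (Reg rN)) ;;
      Cond (Reg 1) (Reg rN) (Asg rK (Reg 1)) (Asg rK (Reg rN))) s2"
    by (simp only: pre_prog_def s1_def s2_def run.simps(5))
  then have "rg (run pre_prog s) = (rg s2)(4 := Suc n, 5 := min k n)"
    by (simp add: r2(1) r2(2)[unfolded One_nat_def] fun_eq_iff)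
  ultimately show "setup_pre n E R k (run pre_prog s)" "rg (run pre_prog s) rN1 = Suc n"
    using r2 assms(2) by (auto simp: setup_pre_def)
qed

lemma (in graph_n) card_E: "1 \<le> n \<Longrightarrow> card E < n + n * n"
proof -
  assume n: "1 \<le> n"
  have "E \<subseteq> (\<lambda>(u, v). {u, v}) ` ({..<n} \<times> {..<n})"
  proof
    fix e assume "e \<in> E"
    then obtain a b where "e = {a, b}" "a < n" "b < n" by (rule edgeE) auto
    then show "e \<in> (\<lambda>(u, v). {u, v}) ` ({..<n} \<times> {..<n})" by (intro image_eqI[of _ _ "(a, b)"]) auto
  qed
  then have "card E \<le> card ({..<n} \<times> {..<n})"
    by (meson card_image_le card_mono finite_SigmaI finite_imageI finite_lessThan le_trans)
  then show ?thesis using n by simp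
qed

lemma (in fgraph) separator_E: "1 \<le> K \<Longrightarrow> edge_separator V E R K E"
proof -
  assume K: "1 \<le> K"
  have "card (C \<inter> R) \<le> K" if C: "C \<in> components V (E - E)" for C
  proof -
    have "{(x, y). {x, y} \<in> E - E} = {}" by simp
    obtain v where v: "C = {u \<in> V. (v, u) \<in> {(x, y). {x, y} \<in> E - E}\<^sup>*}"
      using C unfolding components_def by (rule imageE)
    have "C \<subseteq> {v}" unfolding v \<open>{(x, y). {x, y} \<in> E - E} = {}\<close> by auto
    then have "card (C \<inter> R) \<le> card {v}" by (intro card_mono) auto
    then show ?thesis using K by simp
  qed
  then show ?thesis by (simp add: edge_separator_def)
qed

context search_n begin

lemma main_prog_ok:
  assumes "wf True dec" "bounds dec \<subseteq> {0, 3, 4, 6, 7}"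
  shows "wf True (main_prog dec)" "bounds (main_prog dec) \<subseteq> {0, 3, 4, 6, 7, 8}"
    "bounds (main_prog dec) \<inter> writes (main_prog dec) = {}" "rMM \<notin> writes (main_prog dec)"
    "qdepth (main_prog dec) \<le> 1"
proof -
  have sw: "x \<notin> writes (step_prog dec)" if "x < 9 \<or> x = 36 \<or> x \<ge> 44" for x
    using subsetD[OF step_writes(1), of x] that by auto
  have cw: "x \<notin> writes (scan_prog dec)" if "x < 9 \<or> x = 36" for x
    using subsetD[OF scan_writes(1), of x] that by auto
  have pw: "x \<notin> writes (pass_prog dec)" if "x < 9 \<or> x = 44" for x
    using cw sw[of x] that by (auto simp: pass_prog_def scan_prog_def digits_frame)
  have st: "wf True (step_prog dec)" using assms(1) by (simp add: step_prog_def wf_of)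
  have sc: "wf True (scan_prog dec)" using st sw[of 45] sw[of 8] by (simp add: scan_prog_def wf_of)
  have ps: "wf True (pass_prog dec)" using sc cw[of 36] cw[of 0] by (simp add: pass_prog_def)
  have se: "wf True (search_prog dec)" using ps pw[of 44] pw[of 3] by (simp add: search_prog_def)
  then show "wf True (main_prog dec)" by (simp add: main_prog_def wf_of)
  show b: "bounds (main_prog dec) \<subseteq> {0, 3, 4, 6, 7, 8}"
    using assms(2) by (auto simp: main_prog_def search_prog_def pass_prog_def scan_prog_def step_prog_def bounds_of)
  have mw: "x \<notin> writes (main_prog dec)" if "x < 9" for x
    using pw[of x] that by (auto simp: main_prog_def search_prog_def io_prog_frame)
  show "bounds (main_prog dec) \<inter> writes (main_prog dec) = {}"
    using subsetD[OF b] mw by fastforce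
  show "rMM \<notin> writes (main_prog dec)" using mw[of 2] by simp
  have "rBQ \<notin> bounds dec" using assms(2) by auto
  then show "qdepth (main_prog dec) \<le> 1"
    by (simp add: main_prog_def search_prog_def pass_prog_def scan_prog_def step_prog_def qdepth_0 bounds_of)
qed

text \<open>The common result behind the three algorithms. All loop bounds except the number of
  strings are at most the square of \<open>n + q + L + 2\<close>, and the loop over the strings
  occurs only once on any nesting path, so \<open>q ^ L\<close> enters the time to the first
  power.\<close>

lemma assemble:
  assumes n: "1 \<le> n" and k: "1 \<le> k" and K: "K = min k n" and M: "M = q ^ L"
    and dec2: "wf True dec" "bounds dec \<subseteq> {0, 3, 4, 6, 7}"
    and su: "wf False su" "no_out su" "writes su \<inter> {0, 1, 2, 3, 4, 5} = {}"
    and su_run: "\<And>s. setup_pre n E R k s \<Longrightarrow> rg (run su s) rQ = q \<and> rg (run su s) rL = L \<and> cost su s \<le> c"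
  shows "\<exists>t st. exec (full_prog su dec) (input_state n E R k) t st \<and>
     t \<le> c + (psize (main_prog dec) + 100) * ((n + q + L + 2) ^ (2 * depth (main_prog dec) + 2) * q ^ L) \<and>
     edge_separator {..<n} E R K (output_edges n st) \<and> (\<forall>r<n. \<forall>x<M. opt (output_edges n st) (fam r x))"
proof -
  let ?in = "input_state n E R k"
  define s0 where "s0 = \<lparr>rg = fst ?in, ar = (\<lambda>_ _ _. 0), io = snd ?in\<rparr>"
  define s1 where "s1 = run pre_prog s0"
  define s2 where "s2 = run su s1"
  define s3 where "s3 = run post_prog s2"
  have pre: "setup_pre n E R k s1" "rg s1 rN1 = Suc n"
    using run_pre_prog[of s0] by (simp_all add: s0_def s1_def)
  have r1: "rg s1 rN = n" "rg s1 rOFF = n + n * n" "rg s1 rK = K" "io s1 = snd ?in"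
    using pre(1) by (simp_all add: setup_pre_def K)
  have su': "rg s2 rQ = q" "rg s2 rL = L" "cost su s1 \<le> c" using su_run[OF pre(1)] by (simp_all add: s2_def)
  have r2: "rg s2 rN = n" "rg s2 rOFF = n + n * n" "rg s2 rK = K" "rg s2 rN1 = Suc n" "io s2 = snd ?in"
    using r1 pre(2) su by (auto simp: s2_def rg_frame io_frame)
  have r3: "rg s3 rN = n" "rg s3 rOFF = n + n * n" "rg s3 rK = K" "rg s3 rN1 = Suc n" "io s3 = snd ?in" "rg s3 rQ = q" "rg s3 rL = L"
    using r2 su' by (simp_all add: s3_def rg_frame io_frame prepost_frame)
  have BQ: "rg s3 rBQ = q ^ L"
    using run_power_prog[of "run (adds 72 rL 71 1) (setr 71 (Suc (rg s2 rN)) s2)"] su'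
    by (simp add: s3_def post_prog_def rg_frame adds_frame)
  have MM: "rg s3 rMM = Suc (n + L)"
    using run_adds[of 72 71 rL 1 "setr 71 (Suc (rg s2 rN)) s2"] su' r2
    by (simp add: s3_def post_prog_def rg_frame power_frame)
  have "wf False (pre_prog ;; su ;; post_prog)" using su(1) by (simp add: prepost_frame)
  moreover have "sim False s0 ?in" by (simp add: sim_def s0_def split: prod.split)
  ultimately have h1: "halts (compile (pre_prog ;; su ;; post_prog)) ?in (cost (pre_prog ;; su ;; post_prog) s0) (sim False s3)"
    using halts_compile[of False "pre_prog ;; su ;; post_prog" s0 ?in] by (simp add: s1_def s2_def s3_def)
  let ?W = "n + q + L + 2" and ?D = "depth (main_prog dec)" and ?P = "psize (main_prog dec)"
  have sq: "a * b \<le> ?W\<^sup>2" if "a \<le> ?W" "b \<le> ?W" for a b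
    unfolding power2_eq_square using that by (rule mult_le_mono)
  have Q1: "1 \<le> q ^ L" using q by simp
  have W1: "1 \<le> ?W ^ m" for m by simp
  have cost1: "cost (pre_prog ;; su ;; post_prog) s0 \<le> c + 100 * (?W ^ (2 * ?D + 2) * q ^ L)"
  proof -
    have "cost pre_prog s0 \<le> 20 + 14 * n + 5 * (n * n)"
      using cost_pre_prog[of s0] by (simp add: s0_def input_state_def)
    moreover have "n \<le> ?W * ?W" "n * n \<le> ?W * ?W" "1 \<le> ?W * ?W"
      using sq[of n 1] sq[of n n] sq[of 1 1] by (simp_all add: power2_eq_square)
    moreover have "cost post_prog s2 \<le> 11 + 5 * L + 17 * (L * (q * q ^ L))"
      using cost_post_prog[of s2] su' q by simp
    moreover have "L * (q * q ^ L) \<le> ?W\<^sup>2 * q ^ L"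
      unfolding mult.assoc[symmetric] by (intro mult_le_mono1 sq) auto
    moreover have "L \<le> ?W\<^sup>2" using sq[of L 1] by simp
    moreover have "?W\<^sup>2 * 1 \<le> ?W\<^sup>2 * q ^ L" using Q1 by (intro mult_le_mono2)
    ultimately have "cost pre_prog s0 + cost post_prog s2 \<le> 100 * (?W\<^sup>2 * q ^ L)"
      unfolding power2_eq_square by linarith
    also have "\<dots> \<le> 100 * (?W ^ (2 * ?D + 2) * q ^ L)"
      by (intro mult_le_mono order_refl power_increasing) auto
    finally have "cost pre_prog s0 + cost post_prog s2 \<le> 100 * (?W ^ (2 * ?D + 2) * q ^ L)" .
    moreover have "cost (pre_prog ;; su ;; post_prog) s0 = cost pre_prog s0 + (cost su s1 + cost post_prog s2)"
      by (simp add: s1_def s2_def)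
    ultimately show ?thesis using su'(3) by linarith
  qed
  have h2: "halts (compile (main_prog dec)) st (?P * (?W ^ (2 * ?D + 2) * q ^ L))
     (\<lambda>st'. edge_separator {..<n} E R K (output_edges n st') \<and> (\<forall>r<n. \<forall>x<M. opt (output_edges n st') (fam r x)))"
    if s3: "sim False s3 st" for st
  proof -
    obtain r m where st: "st = (r, m)" by force
    from wf_run_no_arrays[OF s3[unfolded st]] obtain a where a: "sim True (s3\<lparr>ar := a\<rparr>) st"
      unfolding st by (rule exE)
    define s4 where "s4 = s3\<lparr>ar := a\<rparr>"
    have r4: "rg s4 = rg s3" "io s4 = io s3" by (simp_all add: s4_def)
    define s5 where "s5 = run read_prog s4"
    define s6 where "s6 = run (search_prog dec) s5"
    define s7 where "s7 = run write_prog s6"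
    have run: "run (main_prog dec) s4 = s7" by (simp add: main_prog_def s5_def s6_def s7_def)
    have d4: "dims n s4" using r3 MM by (simp add: dims_def r4)
    have d5: "dims n s5" unfolding s5_def by (rule dims_run[OF d4]) (simp_all add: io_prog_frame)
    have off4: "rg s4 rOFF = n + n * n" using r3 by (simp add: r4)
    note rd = run_read_prog[OF d4 off4, folded s5_def]
    have io: "io s4 = snd ?in" using r3 by (simp add: r4)
    have ioE: "snd ?in (n + u * n + v) = of_bool ({u, v} \<in> E)" if "u < n" "v < n" for u v
    proof -
      have "u * n + v < n * n"
      proof -
        have "u * n + v < u * n + n" using that by simp
        also have "\<dots> \<le> n * n" using that by (metis Suc_leI add.commute mult_Suc mult_le_mono1)
        finally show ?thesis .
      qed
      moreover have "(u * n + v) div n = u" "(u * n + v) mod n = v" using that by simp_all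
      ultimately show ?thesis by (simp add: input_state_def add.assoc)
    qed
    have "ginv s5" unfolding ginv_def
    proof (intro conjI)
      show "dims n s5" by (rule d5)
      show "matrix n s5 aADJ E" "matrix n s5 aZ {}" using rd(2) ioE by (simp_all add: matrix_def io)
      show "vset n s5 aR = R" using rd(1) terminals by (auto simp: vset_def io input_state_def)
      show "card E < rg s5 rOFF" using card_E[OF n] off4 by (simp add: s5_def rg_frame io_prog_frame)
    qed
    moreover have "rg s5 rL = L" "L \<le> rg s5 rMM" "rg s5 rQ = q" "rg s5 rK = K" "rg s5 rBQ = M"
      using r3 BQ MM M by (simp_all add: s5_def rg_frame io_prog_frame r4)
    ultimately have "binv s5" unfolding binv_def by blast
    moreover have "1 \<le> K" using k n K by simp
    then have "sol s5 E" using rd(2) ioE separator_E by (simp add: sol_def matrix_def io)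
    ultimately obtain F where F: "sol s6 F" "\<forall>r<n. \<forall>x<M. opt F (fam r x)"
      using run_search_prog[of s5] unfolding s6_def by blast
    have sw: "x \<notin> writes (search_prog dec)" if "x < 9" for x
      using subsetD[OF pass_writes(1), of x] that by (auto simp: search_prog_def)
    have d6: "dims n s6" unfolding s6_def by (rule dims_run[OF d5]; rule sw; simp)
    have off6: "rg s6 rOFF = n + n * n" using off4 sw[of 3] by (simp add: s6_def s5_def rg_frame io_prog_frame)
    note wr = run_write_prog[OF d6 off6, folded s7_def]
    have FE: "F \<subseteq> E" using sol_subset[OF F(1)] .
    have out: "output_edges n st' = F" if "sim True s7 st'" for st'
    proof -
      obtain r' m' where st': "st' = (r', m')" by force
      have "rg s7 rOFF = n + n * n" using off6 by (simp add: s7_def rg_frame io_prog_frame)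
      then have m': "m' i = io s7 i" if "i < n + n * n" for i
        using \<open>sim True s7 st'\<close> that unfolding st' sim_def by simp
      have mem: "snd st' (n + u * n + v) \<noteq> 0 \<longleftrightarrow> {u, v} \<in> F" if "u < n" "v < n" for u v
      proof -
        have "u * n + v < u * n + n" using that by simp
        also have "\<dots> \<le> n * n" using that by (metis Suc_leI add.commute mult_Suc mult_le_mono1)
        finally have "n + u * n + v < n + n * n" by simp
        then have "snd st' (n + u * n + v) = ar s6 aF u v" using m' wr that by (simp add: st')
        then show ?thesis using F(1) that by (simp add: sol_def matrix_def)
      qed
      show ?thesis
      proof (intro equalityI subsetI)
        fix e assume "e \<in> output_edges n st'"
        then show "e \<in> F" using mem by (auto simp: output_edges_def)
      next
        fix e assume e: "e \<in> F"
        then have "e \<in> E" using FE by auto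
        then obtain x y where "e = {x, y}" "x < n" "y < n" by (rule edgeE) auto
        then show "e \<in> output_edges n st'" using e mem unfolding output_edges_def by blast
      qed
    qed
    have cost2: "cost (main_prog dec) s4 \<le> ?P * (?W ^ (2 * ?D + 2) * q ^ L)"
    proof -
      have "cost (main_prog dec) s4 \<le> ?P * ((?W\<^sup>2) ^ ?D * (q ^ L) ^ qdepth (main_prog dec))"
      proof (rule cost_le)
        \<comment> \<open>\<open>rOFF\<close> holds this value; it is the reason why
          \<open>?W\<^sup>2\<close> instead of \<open>?W\<close> bounds the loops.\<close>
        have "n + n * n \<le> ?W\<^sup>2"
          using sq[of n "Suc n"] by simp
        moreover have "n \<le> ?W\<^sup>2" "Suc n \<le> ?W\<^sup>2" "L \<le> ?W\<^sup>2" "q \<le> ?W\<^sup>2"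
          using sq[of n 1] sq[of "Suc n" 1] sq[of L 1] sq[of q 1] by simp_all
        ultimately show "\<forall>b\<in>bounds (main_prog dec). rg s4 b \<le> (if b = rBQ then q ^ L else ?W\<^sup>2)"
          using r3 BQ subsetD[OF main_prog_ok(2)[OF dec2]] by (fastforce simp: r4)
        show "rg s4 rMM < ?W\<^sup>2" using MM sq[of "Suc (Suc (n + L))" 1] by (simp add: r4)
      qed (use Q1 main_prog_ok[OF dec2] in auto)
      also have "(?W\<^sup>2) ^ ?D * (q ^ L) ^ qdepth (main_prog dec) \<le> ?W ^ (2 * ?D + 2) * q ^ L"
      proof (rule mult_le_mono)
        show "(?W\<^sup>2) ^ ?D \<le> ?W ^ (2 * ?D + 2)"
          unfolding power_mult[symmetric] by (intro power_increasing) auto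
        have "(q ^ L) ^ qdepth (main_prog dec) \<le> (q ^ L) ^ 1"
          using main_prog_ok(5)[OF dec2] Q1 by (intro power_increasing)
        then show "(q ^ L) ^ qdepth (main_prog dec) \<le> q ^ L" by simp
      qed
      finally show ?thesis by simp
    qed
    have "halts (compile (main_prog dec)) st (cost (main_prog dec) s4) (sim True s7)"
      using halts_compile[OF main_prog_ok(1)[OF dec2], of s4 st] a run by (simp add: s4_def)
    then show ?thesis
    proof (rule halts_weaken[OF _ _ cost2])
      fix st' assume "sim True s7 st'"
      then show "edge_separator {..<n} E R K (output_edges n st') \<and> (\<forall>r<n. \<forall>x<M. opt (output_edges n st') (fam r x))"
        using out F by (simp add: sol_def)
    qed
  qed
  have "halts (full_prog su dec) ?in (c + (?P + 100) * (?W ^ (2 * ?D + 2) * q ^ L))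
     (\<lambda>st'. edge_separator {..<n} E R K (output_edges n st') \<and> (\<forall>r<n. \<forall>x<M. opt (output_edges n st') (fam r x)))"
    unfolding full_prog_def
    by (rule halts_Seq[OF h1 h2]) (use cost1 in \<open>simp_all only: add_mult_distrib\<close>)
  then show ?thesis unfolding halts_def by blast
qed

end

section \<open>Parameters of the three algorithms\<close>

declare cost.simps(7) [simp del]

text \<open>Division by counting: register 66 is the remainder, which wraps around at the divisor,
  and register 67 the quotient.\<close>

definition divide :: prog where
  "divide = For 65 64 (Asg 66 (Plus1 (Reg 66)) ;; Cond (Reg 66) (Reg 61) Nop
     (Asg 66 (Num 0) ;; Asg 67 (Plus1 (Reg 67))))"

definition ratio :: "nat \<Rightarrow> nat \<Rightarrow> prog" where
  "ratio a b = Asg 60 (Num a) ;; Asg 61 (Num b) ;; muls 62 57 63 60 64 ;; divide"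

lemma ratio_frame: "writes (ratio a b) = {60, 61, 62, 63, 64, 65, 66, 67}" "no_out (ratio a b)" "wf False (ratio a b)"
  by (auto simp: ratio_def divide_def adds_frame muls_def adds_def)

lemma run_divide:
  assumes "rg s 66 = 0" "rg s 67 = 0" "1 \<le> rg s 61"
  shows "rg (run divide s) 67 = rg s 64 div rg s 61"
  unfolding divide_def
proof (rule For_rule[where P = "\<lambda>j t. rg t 67 = j div rg s 61 \<and> rg t 66 = j mod rg s 61"], goal_cases)
  case 1
  show ?case using assms by simp
next
  case (2 j t)
  have b: "rg t 61 = rg s 61" using 2(3)[of 61] by simp
  have lt: "j mod rg s 61 < rg s 61" using assms(3) by simp
  show ?case
  proof (cases "Suc (j mod rg s 61) = rg s 61")
    case True
    then have "Suc j div rg s 61 = Suc (j div rg s 61)" "Suc j mod rg s 61 = 0"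
      by (simp_all add: div_Suc mod_Suc)
    then show ?thesis using 2(2) True b by simp
  next
    case False
    then have "Suc j div rg s 61 = j div rg s 61" "Suc j mod rg s 61 = Suc (j mod rg s 61)"
      by (simp_all add: div_Suc mod_Suc)
    moreover have "Suc (j mod rg s 61) < rg s 61" using False lt by simp
    ultimately show ?thesis using 2(2) b by simp
  qed
qed simp

lemma run_ratio:
  assumes "rg s 64 = 0" "rg s 66 = 0" "rg s 67 = 0" "1 \<le> b"
  shows "rg (run (ratio a b) s) 67 = a * rg s 57 div b"
proof -
  define s1 where "s1 = run (muls 62 57 63 60 64) (setr 61 b (setr 60 a s))"
  have "rg s1 64 = rg s 57 * a" using run_muls[of 64 62 63 57 60 "setr 61 b (setr 60 a s)"] assms by (simp add: s1_def)
  moreover have "rg s1 61 = b" "rg s1 66 = 0" "rg s1 67 = 0" using assms by (simp_all add: s1_def rg_frame adds_frame)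
  moreover have "run (ratio a b) s = run divide s1" by (simp add: ratio_def s1_def)
  ultimately show ?thesis using run_divide[of s1] assms(4) by (simp add: mult.commute)
qed

lemma cost_ratio:
  assumes "rg s 64 = 0"
  shows "cost (ratio a b) s \<le> 8 + 4 * rg s 57 + 18 * (a * rg s 57)"
proof -
  define s0 where "s0 = setr 61 b (setr 60 a s)"
  define s1 where "s1 = run (muls 62 57 63 60 64) s0"
  have "rg s1 64 = rg s 57 * a" using run_muls[of 64 62 63 57 60 s0] assms by (simp add: s1_def s0_def)
  moreover have "cost divide s1 \<le> 2 + rg s1 64 * (11 + 2)"
    unfolding divide_def by (rule cost_For_inv[where P = "\<lambda>_ _. True"]) auto
  moreover have "cost (muls 62 57 63 60 64) s0 \<le> 2 + rg s 57 * (a * 5 + 4)"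
    using cost_muls[of 60 62 63 64 57 s0] by (simp add: s0_def)
  moreover have "cost (ratio a b) s = 4 + (cost (muls 62 57 63 60 64) s0 + cost divide s1)"
    by (simp add: ratio_def s0_def s1_def)
  ultimately show ?thesis by (simp add: algebra_simps)
qed

text \<open>With \<open>H = a * K div b\<close>, a boundary of at most
  \<open>a * K * K div b\<close> edges is below \<open>(H + 1) * K\<close>, or equal to it, and
  allows twice as many exclusions. The base \<open>3 + 2 * H\<close> lets a largest digit carry
  \<open>2 * (H + 1)\<close> exclusions, so \<open>K\<close> such digits suffice; another
  \<open>K\<close> digits carry the inclusions.\<close>

definition setup_small :: "nat \<Rightarrow> nat \<Rightarrow> prog" where
  "setup_small a b = Asg 57 (Reg rK) ;; ratio a b ;; Asg rQ (Num 3) ;; adds 68 67 rQ 2 ;; adds 69 rK rL 2"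

lemma setup_small_frame: "wf False (setup_small a b)" "no_out (setup_small a b)"
   "writes (setup_small a b) \<inter> {0, 1, 2, 3, 4, 5} = {}"
  by (auto simp: setup_small_def ratio_frame adds_frame) (simp_all add: adds_def ev_Plus1_funpow)

lemma run_setup_small:
  fixes a b n k :: nat
  assumes s: "setup_pre n E R k s" and b: "1 \<le> b"
  defines "K \<equiv> min k n" and "H \<equiv> a * min k n div b"
  shows "rg (run (setup_small a b) s) rQ = 3 + 2 * H \<and> rg (run (setup_small a b) s) rL = 2 * K \<and>
    cost (setup_small a b) s \<le> 16 + 10 * K + 18 * (a * K) + 6 * H"
proof -
  have r: "rg s rK = K" "\<And>x. x \<ge> 6 \<Longrightarrow> x \<notin> {50, 51} \<Longrightarrow> rg s x = 0" using s by (simp_all add: setup_pre_def K_def)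
  define s0 where "s0 = setr 57 K s"
  define s1 where "s1 = setr rQ 3 (run (ratio a b) s0)"
  define s2 where "s2 = run (adds 68 67 rQ 2) s1"
  have r0: "rg s0 57 = K" "rg s0 64 = 0" "rg s0 66 = 0" "rg s0 67 = 0" "rg s0 rL = 0" "rg s0 rK = K" using r by (simp_all add: s0_def)
  have r1: "rg s1 67 = H" "rg s1 rQ = 3" "rg s1 rL = 0" "rg s1 rK = K"
    using run_ratio[of s0 b a] r0 b by (simp_all add: s1_def H_def K_def rg_frame ratio_frame)
  have r2: "rg s2 rQ = 3 + 2 * H" "rg s2 rL = 0" "rg s2 rK = K"
    using run_adds[of 68 rQ 67 2 s1] r1 by (simp_all add: s2_def rg_frame adds_frame)
  have run: "run (setup_small a b) s = run (adds 69 rK rL 2) s2" using r by (simp add: setup_small_def s0_def s1_def s2_def)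
  have "cost (setup_small a b) s = 2 + (cost (ratio a b) s0 + (2 + (cost (adds 68 67 rQ 2) s1 + cost (adds 69 rK rL 2) s2)))"
    using r by (simp add: setup_small_def s0_def s1_def s2_def)
  moreover have "cost (ratio a b) s0 \<le> 8 + 4 * K + 18 * (a * K)" using cost_ratio[of s0 a b] r0 by simp
  moreover have "cost (adds 68 67 rQ 2) s1 \<le> 2 + H * 6" using cost_adds[of 68 67 rQ 2 s1] r1 by simp
  moreover have "cost (adds 69 rK rL 2) s2 \<le> 2 + K * 6" using cost_adds[of 69 rK rL 2 s2] r2 by simp
  ultimately have "cost (setup_small a b) s \<le> 16 + 10 * K + 18 * (a * K) + 6 * H" by linarith
  then show ?thesis unfolding run using run_adds[of 69 rL rK 2 s2] r2 by (simp add: rg_frame adds_frame)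
qed

definition degree_row :: prog where
  "degree_row = For 56 rN (nz (Io (Reg 53)) (Asg 55 (Plus1 (Reg 55))) ;; Asg 53 (Plus1 (Reg 53)))"

definition degree_body :: prog where
  "degree_body = Asg 55 (Num 0) ;; degree_row ;; Cond (Reg 52) (Reg 55) (Asg 52 (Reg 55)) Nop"

definition degree_prog :: prog where
  "degree_prog = Asg 53 (Reg rN) ;; For 54 rN degree_body"

lemma degree_frame:
  "writes degree_row = {53, 55, 56}" "no_out degree_row" "writes degree_body = {52, 53, 55, 56}" "no_out degree_body"
  "writes degree_prog = {52, 53, 54, 55, 56}" "no_out degree_prog" "wf False degree_prog"
  by (auto simp: degree_row_def degree_body_def degree_prog_def)

lemma input_matrix:
  assumes "u < n" "v < n"
  shows "n + u * n + v < n + n * n" "snd (input_state n E R k) (n + u * n + v) = of_bool ({u, v} \<in> E)"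
proof -
  have "u * n + v < u * n + n" using assms by simp
  also have "\<dots> \<le> n * n" using assms by (metis Suc_leI add.commute mult_Suc mult_le_mono1)
  finally show 1: "n + u * n + v < n + n * n" by simp
  have "(u * n + v) div n = u" "(u * n + v) mod n = v" using assms by simp_all
  then show "snd (input_state n E R k) (n + u * n + v) = of_bool ({u, v} \<in> E)"
    using 1 by (simp add: input_state_def add.assoc)
qed

lemma (in graph_n) degree_eq:
  assumes "u < n"
  shows "card {v. v < n \<and> {u, v} \<in> E} = card {e \<in> E. u \<in> e}"
proof (rule bij_betw_same_card[of "\<lambda>v. {u, v}"], rule bij_betw_imageI)
  show "inj_on (\<lambda>v. {u, v}) {v. v < n \<and> {u, v} \<in> E}" by (rule inj_onI) (auto simp: doubleton_eq_iff)
  show "(\<lambda>v. {u, v}) ` {v. v < n \<and> {u, v} \<in> E} = {e \<in> E. u \<in> e}"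
  proof (intro equalityI subsetI)
    fix e assume e: "e \<in> {e \<in> E. u \<in> e}"
    then have "e \<in> E" by simp
    then obtain x y where xy: "e = {x, y}" "x < n" "y < n" by (rule edgeE) auto
    then have "u = x \<or> u = y" using e by auto
    then show "e \<in> (\<lambda>v. {u, v}) ` {v. v < n \<and> {u, v} \<in> E}"
    proof
      assume "u = x"
      then show ?thesis using xy e by (intro image_eqI[of _ _ y]) auto
    next
      assume u: "u = y"
      have "{y, x} = e" using xy(1) by auto
      then show ?thesis using xy e u by (intro image_eqI[of _ _ x]) auto
    qed
  qed auto
qed

lemma (in graph_n) run_degree_prog:
  assumes s: "setup_pre n E R k s" and n: "1 \<le> n"
  shows "rg (run degree_prog s) 52 = max_degree {..<n} E" "cost degree_prog s \<le> 4 + n * (13 * n + 12)"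
proof -
  define s1 where "s1 = setr 53 n s"
  have r: "rg s rN = n" "rg s rOFF = n + n * n" "io s = snd (input_state n E R k)" "\<And>x. x \<ge> 6 \<Longrightarrow> x \<notin> {50, 51} \<Longrightarrow> rg s x = 0"
    using s by (simp_all add: setup_pre_def)
  have r1: "rg s1 rN = n" "rg s1 rOFF = n + n * n" "rg s1 53 = n" "rg s1 52 = 0" "io s1 = snd (input_state n E R k)"
    using r by (simp_all add: s1_def)
  define deg where "deg = (\<lambda>u. card {e \<in> E. u \<in> e})"
  have run: "run degree_prog s = run (For 54 rN degree_body) s1" using r by (simp add: degree_prog_def s1_def)
  have row: "rg (run degree_row t) 55 = deg u \<and> rg (run degree_row t) 53 = n + u * n + n"
    if t: "rg t rN = n" "rg t rOFF = n + n * n" "io t = snd (input_state n E R k)" "rg t 55 = 0" "rg t 53 = n + u * n" "u < n" for t u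
    unfolding degree_row_def
  proof (rule For_rule[where P = "\<lambda>j t'. rg t' 55 = card {v. v < j \<and> {u, v} \<in> E} \<and> rg t' 53 = n + u * n + j \<and> io t' = io t"], goal_cases)
    case 1
    show ?case using t by simp
  next
    case (2 j t1)
    have j: "j < n" using 2(1) t by simp
    have off: "rg t1 rOFF = n + n * n" using 2(3)[of rOFF] t by simp
    note im = input_matrix[OF t(6) j]
    have "{v. v < Suc j \<and> {u, v} \<in> E} = (if {u, j} \<in> E then insert j {v. v < j \<and> {u, v} \<in> E} else {v. v < j \<and> {u, v} \<in> E})"
      by (auto simp: less_Suc_eq)
    then have "card {v. v < Suc j \<and> {u, v} \<in> E} = card {v. v < j \<and> {u, v} \<in> E} + of_bool ({u, j} \<in> E)" by simp
    then show ?case using 2(2) im(1) im(2)[of E R k] off t(3) by simp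
  next
    case (3 t1)
    then show ?case using t degree_eq[OF t(6)] by (simp add: deg_def)
  qed
  have "rg (run (For 54 rN degree_body) s1) 52 = Max (insert 0 (deg ` {..<n}))"
  proof (rule For_rule[where P = "\<lambda>u t'. rg t' 52 = Max (insert 0 (deg ` {..<u})) \<and> rg t' 53 = n + u * n \<and> io t' = io s1"], goal_cases)
    case 1
    show ?case using r1 by simp
  next
    case (2 u t)
    define t1 where "t1 = setr 55 0 (setr 54 u t)"
    have u: "u < n" using 2(1) r1 by simp
    have t1: "rg t1 rN = n" "rg t1 rOFF = n + n * n" "io t1 = snd (input_state n E R k)" "rg t1 55 = 0" "rg t1 53 = n + u * n"
      "rg t1 52 = Max (insert 0 (deg ` {..<u}))"
      using 2(2) 2(3)[of rN] 2(3)[of rOFF] r1 by (simp_all add: t1_def degree_frame)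
    note rw = row[OF t1(1-5) u]
    define M where "M = Max (insert 0 (deg ` {..<u}))"
    have 52: "rg (run degree_row t1) 52 = M" "io (run degree_row t1) = io s1"
      using t1 r1 unfolding M_def by (simp_all add: rg_frame io_frame degree_frame)
    have "insert 0 (deg ` {..<Suc u}) = insert (deg u) (insert 0 (deg ` {..<u}))" by (auto simp: lessThan_Suc)
    then have mx: "Max (insert 0 (deg ` {..<Suc u})) = max (deg u) M" unfolding M_def by simp
    show ?case unfolding mx using rw 52 by (simp add: degree_body_def t1_def[symmetric] max_def)
  next
    case (3 t)
    then show ?case using r1 by simp
  qed
  also have "\<dots> = Max (deg ` {..<n})"
  proof -
    have "{..<n} \<noteq> {}" using n by (metis lessThan_empty_iff not_one_le_zero)
    then have "Max (insert 0 (deg ` {..<n})) = max 0 (Max (deg ` {..<n}))" by (intro Max_insert) auto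
    then show ?thesis by simp
  qed
  finally show "rg (run degree_prog s) 52 = max_degree {..<n} E" by (simp add: run max_degree_def deg_def)
  have "cost (For 54 rN degree_body) s1 \<le> 2 + rg s1 rN * ((13 * n + 10) + 2)"
  proof (rule cost_For_inv[where P = "\<lambda>_ _. True"], goal_cases)
    case (2 j t)
    define t1 where "t1 = setr 55 0 (setr 54 j t)"
    have "rg t1 rN = n" using 2(3)[of rN] r1 by (simp add: t1_def degree_frame)
    moreover have "cost degree_row t1 \<le> 2 + rg t1 rN * (11 + 2)"
      unfolding degree_row_def by (rule cost_For_inv[where P = "\<lambda>_ _. True"]) auto
    ultimately show ?case by (simp add: degree_body_def t1_def[symmetric])
  qed simp
  then show "cost degree_prog s \<le> 4 + n * (13 * n + 12)" using r1 r by (simp add: degree_prog_def s1_def add.commute)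
qed

definition setup_degree :: "nat \<Rightarrow> nat \<Rightarrow> prog" where
  "setup_degree a b = degree_prog ;; muls 58 rK 59 52 57 ;; ratio a b ;;
     Cond (Num 0) (Reg 67) (Asg rQ (Num 2)) (Asg rQ (Num 1)) ;;
     adds 69 rK rL 2 ;; adds 70 67 rL 6 ;; Asg rL (Plus1 (Reg rL))"

lemma setup_degree_frame: "wf False (setup_degree a b)" "no_out (setup_degree a b)"
   "writes (setup_degree a b) \<inter> {0, 1, 2, 3, 4, 5} = {}"
  by (auto simp: setup_degree_def ratio_frame adds_frame degree_frame)
    (simp_all add: adds_def muls_def ev_Plus1_funpow)

lemma (in graph_n) run_setup_degree:
  fixes a b k :: nat
  assumes s: "setup_pre n E R k s" and b: "1 \<le> b" and n: "1 \<le> n"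
  defines "K \<equiv> min k n" and "D \<equiv> max_degree {..<n} E" and "H \<equiv> a * (min k n * max_degree {..<n} E) div b"
  shows "rg (run (setup_degree a b) s) rQ = (if H = 0 then 1 else 2) \<and>
    rg (run (setup_degree a b) s) rL = 2 * K + 6 * H + 1 \<and>
    cost (setup_degree a b) s \<le> 30 + n * (13 * n + 12) + 10 * K + 9 * (K * D) + 18 * (a * (K * D)) + 10 * H"
proof -
  have r: "rg s rK = K" "\<And>x. x \<ge> 6 \<Longrightarrow> x \<notin> {50, 51} \<Longrightarrow> rg s x = 0" using s by (simp_all add: setup_pre_def K_def)
  define s0 where "s0 = run degree_prog s"
  define s1 where "s1 = run (muls 58 rK 59 52 57) s0"
  define s2 where "s2 = run (ratio a b) s1"
  define s3 where "s3 = setr rQ (if H = 0 then 1 else 2) s2"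
  define s4 where "s4 = run (adds 69 rK rL 2) s3"
  define s5 where "s5 = run (adds 70 67 rL 6) s4"
  have r0: "rg s0 52 = D" "rg s0 rK = K" "rg s0 57 = 0" "rg s0 64 = 0" "rg s0 66 = 0" "rg s0 67 = 0" "rg s0 rL = 0"
    using run_degree_prog(1)[OF s n] r by (simp_all add: s0_def D_def rg_frame degree_frame)
  have r1: "rg s1 57 = K * D" "rg s1 rK = K" "rg s1 64 = 0" "rg s1 66 = 0" "rg s1 67 = 0" "rg s1 rL = 0"
    using run_muls[of 57 58 59 rK 52 s0] r0 by (simp_all add: s1_def rg_frame adds_frame)
  have r2: "rg s2 67 = H" "rg s2 rK = K" "rg s2 rL = 0"
    using run_ratio[of s1 b a] r1 b by (simp_all add: s2_def rg_frame ratio_frame H_def K_def D_def)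
  have r3: "rg s3 67 = H" "rg s3 rK = K" "rg s3 rL = 0" "rg s3 rQ = (if H = 0 then 1 else 2)" using r2 by (simp_all add: s3_def)
  have r4: "rg s4 rL = 2 * K" "rg s4 67 = H" "rg s4 rQ = (if H = 0 then 1 else 2)"
    using run_adds[of 69 rL rK 2 s3] r3 by (simp_all add: s4_def rg_frame adds_frame)
  have r5: "rg s5 rL = 2 * K + 6 * H" "rg s5 rQ = (if H = 0 then 1 else 2)"
    using run_adds[of 70 rL 67 6 s4] r4 by (simp_all add: s5_def rg_frame adds_frame)
  have c3: "run (Cond (Num 0) (Reg 67) (Asg rQ (Num 2)) (Asg rQ (Num 1))) s2 = s3" using r2 by (simp add: s3_def)
  have run: "run (setup_degree a b) s = setr rL (Suc (rg s5 rL)) s5"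
    unfolding setup_degree_def run.simps(5) s0_def[symmetric] s1_def[symmetric] s2_def[symmetric] c3 s4_def[symmetric] s5_def[symmetric]
    by simp
  have "cost (setup_degree a b) s = cost degree_prog s + (cost (muls 58 rK 59 52 57) s0 + (cost (ratio a b) s1 +
     (cost (Cond (Num 0) (Reg 67) (Asg rQ (Num 2)) (Asg rQ (Num 1))) s2 + (cost (adds 69 rK rL 2) s3 + (cost (adds 70 67 rL 6) s4 + 3)))))"
    unfolding setup_degree_def cost.simps(5) s0_def[symmetric] s1_def[symmetric] s2_def[symmetric] c3 s4_def[symmetric] s5_def[symmetric]
    by simp
  moreover have "cost degree_prog s \<le> 4 + n * (13 * n + 12)" by (rule run_degree_prog(2)[OF s n])
  moreover have "cost (muls 58 rK 59 52 57) s0 \<le> 2 + K * (D * 5 + 4)"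
    using cost_muls[of 52 58 59 57 rK s0] r0 by simp
  moreover have "2 + K * (D * 5 + 4) = 2 + 5 * (K * D) + 4 * K" by (simp add: algebra_simps)
  moreover have "cost (ratio a b) s1 \<le> 8 + 4 * (K * D) + 18 * (a * (K * D))" using cost_ratio[of s1 a b] r1 by simp
  moreover have "cost (Cond (Num 0) (Reg 67) (Asg rQ (Num 2)) (Asg rQ (Num 1))) s2 \<le> 5" by simp
  moreover have "cost (adds 69 rK rL 2) s3 \<le> 2 + K * 6" using cost_adds[of 69 rK rL 2 s3] r3 by simp
  moreover have "cost (adds 70 67 rL 6) s4 \<le> 2 + H * 10" using cost_adds[of 70 67 rL 6 s4] r4 by simp
  ultimately have "cost (setup_degree a b) s \<le> 30 + n * (13 * n + 12) + 10 * K + 9 * (K * D) + 18 * (a * (K * D)) + 10 * H" by linarith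
  then show ?thesis unfolding run using r5 by simp
qed

definition setup_subset :: prog where
  "setup_subset = Asg rQ (Reg rN) ;; Asg rL (Reg rK)"

lemma setup_subset_frame: "wf False setup_subset" "no_out setup_subset"
   "writes setup_subset \<inter> {0, 1, 2, 3, 4, 5} = {}"
  by (simp_all add: setup_subset_def)

lemma run_setup_subset:
  "setup_pre n E R k s \<Longrightarrow> rg (run setup_subset s) rQ = n \<and> rg (run setup_subset s) rL = min k n \<and> cost setup_subset s \<le> 4"
  by (simp add: setup_subset_def setup_pre_def)

context graph_n begin

definition branch_fam :: "nat \<Rightarrow> nat \<Rightarrow> nat \<Rightarrow> nat \<Rightarrow> nat set" where
  "branch_fam q L r x = fst (run_bits (concat (map (expand q) (map (dig q x) [0..<L]))) ({r} \<inter> R, {})) \<inter> R"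

definition subset_fam :: "nat \<Rightarrow> nat \<Rightarrow> nat \<Rightarrow> nat \<Rightarrow> nat set" where
  "subset_fam q L r x = dig q x ` {..<L} \<inter> R"

lemma branch_search: "1 \<le> q \<Longrightarrow> search_n n E R branch_decode (branch_fam q L) L q"
proof
  fix t r x
  assume q: "1 \<le> q" and a: "ginv t" "rg t rL = L" "L \<le> rg t rMM" "rg t rQ = q" "rg t 36 = r" "r < n" "\<forall>j<L. ar t aDG j 0 = dig q x j"
  have eq: "map (\<lambda>j. ar t aDG j 0) [0..<L] = map (dig q x) [0..<L]" using a(7) by simp
  have "ar t aDG j 0 < q" if "j < L" for j using a(7) that dig_less[OF q] by simp
  from run_branch_decode[OF a(1-6) this]
  show "vset n (run branch_decode t) aS \<inter> R = branch_fam q L r x"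
    unfolding eq branch_fam_def by simp
qed (auto simp: decode_frame)

lemma subset_search: "1 \<le> n \<Longrightarrow> search_n n E R subset_decode (subset_fam n L) L n"
proof
  fix t r x
  assume q: "1 \<le> n" and a: "ginv t" "rg t rL = L" "L \<le> rg t rMM" "rg t rQ = n" "rg t 36 = r" "r < n" "\<forall>j<L. ar t aDG j 0 = dig n x j"
  have eq: "(\<lambda>j. ar t aDG j 0) ` {..<L} = dig n x ` {..<L}" using a(7) by (intro image_cong) auto
  have "ar t aDG j 0 < n" if "j < L" for j using a(7) that dig_less[OF q] by simp
  from run_subset_decode[OF a(1-3) this]
  show "vset n (run subset_decode t) aS \<inter> R = subset_fam n L r x"
    unfolding eq subset_fam_def by simp
qed (auto simp: decode_frame)

text \<open>\<open>F\<close> and its move by \<open>C\<close> share the edges of \<open>F\<close>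
  that avoid \<open>C\<close>; what remains to compare is \<open>touch F C\<close> with
  \<open>bd E C\<close>.\<close>

lemma locopt_touch:
  assumes "F \<subseteq> E" "locopt F (C \<inter> R)" "C \<subseteq> {..<n}"
  shows "card (touch F C) \<le> card (bd E C)"
proof -
  have "card F \<le> card (move E F C)" using assms(2,3) unfolding locopt_def by blast
  then show ?thesis using card_touch[OF assms(1), of C] card_move[OF assms(1), of C] by linarith
qed

lemma separator_mono: "edge_separator {..<n} E R K F \<Longrightarrow> K \<le> k \<Longrightarrow> edge_separator {..<n} E R k F"
  unfolding edge_separator_def using le_trans by blast

lemma component_card:
  assumes "edge_separator {..<n} E R k Q" "C \<in> components {..<n} (E - Q)"
  shows "card (C \<inter> R) \<le> min k n" "C \<subseteq> {..<n}" "C \<noteq> {}"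
proof -
  show C: "C \<subseteq> {..<n}" using components_subset[OF assms(2)] .
  have "card (C \<inter> R) \<le> card {..<n}" using C by (intro card_mono) auto
  then show "card (C \<inter> R) \<le> min k n" using assms by (auto simp: edge_separator_def)
  show "C \<noteq> {}" using assms(2) by (auto simp: components_def)
qed

lemma ratio_bound:
  assumes F: "F \<subseteq> E" and k: "1 \<le> k" and eps: "\<epsilon> \<ge> 0"
    and loc: "\<And>Q C. edge_separator {..<n} E R k Q \<Longrightarrow> C \<in> components {..<n} (E - Q) \<Longrightarrow>
       real (card (touch F C)) \<le> (1 + \<epsilon> / 2) * real (card (bd E C))"
  shows "real (card F) \<le> (2 + \<epsilon>) * real (opt_separator {..<n} E R k)"
proof -
  let ?S = "{Q. edge_separator {..<n} E R k Q}"
  have "finite ?S" by (rule finite_subset[of _ "Pow E"]) (use finite_E in \<open>auto simp: edge_separator_def\<close>)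
  moreover have "E \<in> ?S" using separator_E[OF k] by simp
  ultimately have "opt_separator {..<n} E R k \<in> card ` ?S"
    unfolding opt_separator_def by (intro Min_in) auto
  then obtain Q where Q: "edge_separator {..<n} E R k Q" "opt_separator {..<n} E R k = card Q" by auto
  have "Q \<subseteq> E" using Q(1) by (simp add: edge_separator_def)
  from local_search_ratio[OF F this loc[OF Q(1)] eps] show ?thesis by (simp add: Q(2))
qed

end

section \<open>Correctness of the three algorithms\<close>

lemma less_div_Suc_mult: "1 \<le> b \<Longrightarrow> m < (m div b + 1) * (b::nat)"
  using dividend_less_times_div[of b m] by (simp add: algebra_simps)

context graph_n begin

lemma subset_fam_complete:
  assumes T: "T \<subseteq> R" "card T \<le> L" "T \<noteq> {} \<or> R \<noteq> {..<n}"
  shows "\<exists>x<n ^ L. subset_fam n L r x = T"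
proof -
  have fT: "finite T" using T(1) finite_R finite_subset by blast
  obtain xs where xs: "set xs = T" "length xs = card T" "distinct xs"
    using finite_distinct_list[OF fT] distinct_card by metis
  obtain y where y: "y < n" "y \<in> T \<or> y \<notin> R"
  proof (cases "T = {}")
    case True
    then have "R \<noteq> {..<n}" using T(3) by simp
    then obtain y where "y < n" "y \<notin> R" using terminals by auto
    then show ?thesis using that by blast
  next
    case False
    then obtain y where "y \<in> T" by blast
    then show ?thesis using that T(1) terminals by blast
  qed
  define ws where "ws = xs @ replicate (L - card T) y"
  have len: "length ws = L" using xs(2) T(2) by (simp add: ws_def)
  have "\<forall>w\<in>set ws. w < n" using xs(1) T(1) terminals y(1) by (auto simp: ws_def)
  then obtain x where x: "x < n ^ L" "\<forall>j<L. dig n x j = ws ! j" using dig_surj len by metis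
  have "dig n x ` {..<L} = set ws"
  proof -
    have "dig n x ` {..<L} = (\<lambda>j. ws ! j) ` {..<L}" using x(2) by (intro image_cong) auto
    then show ?thesis using len by (simp add: set_conv_nth image_def lessThan_def) auto
  qed
  moreover have "set ws \<inter> R = T" using xs(1) T(1) y(2) by (auto simp: ws_def)
  ultimately show ?thesis using x(1) by (auto simp: subset_fam_def)
qed

lemma subset_algorithm:
  assumes n: "1 \<le> n" and k: "1 \<le> k"
  shows "\<exists>t st. exec (full_prog setup_subset subset_decode) (input_state n E R k) t st \<and>
     t \<le> 4 + (psize (main_prog subset_decode) + 100) *
        ((n + n + min k n + 2) ^ (2 * depth (main_prog subset_decode) + 2) * n ^ min k n) \<and>
     edge_separator {..<n} E R k (output_edges n st) \<and>
     real (card (output_edges n st)) \<le> 2 * real (opt_separator {..<n} E R k)"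
proof -
  let ?K = "min k n"
  interpret search_n n E R subset_decode "subset_fam n ?K" ?K n ?K "n ^ ?K"
    by (rule subset_search[OF n])
  obtain t st where st: "exec (full_prog setup_subset subset_decode) (input_state n E R k) t st"
     "t \<le> 4 + (psize (main_prog subset_decode) + 100) *
        ((n + n + ?K + 2) ^ (2 * depth (main_prog subset_decode) + 2) * n ^ ?K)"
     "edge_separator {..<n} E R ?K (output_edges n st)"
     "\<forall>r<n. \<forall>x<n ^ ?K. opt (output_edges n st) (subset_fam n ?K r x)"
    using assemble[OF n k refl refl, of setup_subset 4] wf_of(11) bounds_of(11) setup_subset_frame run_setup_subset
    by fastforce
  define F where "F = output_edges n st"
  have FE: "F \<subseteq> E" using st(3) by (simp add: edge_separator_def F_def)
  have "real (card F) \<le> (2 + 0) * real (opt_separator {..<n} E R k)"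
  proof (rule ratio_bound[OF FE k])
    fix Q C assume Q: "edge_separator {..<n} E R k Q" "C \<in> components {..<n} (E - Q)"
    note C = component_card[OF Q]
    have "C \<inter> R \<noteq> {} \<or> R \<noteq> {..<n}" using C(2,3) by blast
    then obtain x where x: "x < n ^ ?K" "subset_fam n ?K 0 x = C \<inter> R"
      using subset_fam_complete[of "C \<inter> R" ?K 0] C(1) by auto
    have "opt F (subset_fam n ?K 0 x)" using st(4) x(1) n unfolding F_def by auto
    then have "locopt F (C \<inter> R)" using x(2) C(1) by (simp add: opt_def)
    from locopt_touch[OF FE this C(2)] show "real (card (touch F C)) \<le> (1 + 0 / 2) * real (card (bd E C))" by simp
  qed simp
  then show ?thesis using st(1,2) separator_mono[OF st(3)] unfolding F_def by (intro exI conjI) auto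
qed

lemma branch_fam_complete:
  assumes Q: "Q \<subseteq> E" and C: "C \<in> components {..<n} (E - Q)" and r: "r \<in> C \<inter> R"
    and b: "d C \<le> b" and q: "1 \<le> q" "2 * b \<le> (q - 1) * c"
    and L: "(if {..<n} \<subseteq> R then card (C \<inter> R) else 2 * (card (C \<inter> R) + 2 * b) + 1) + c \<le> L"
  shows "\<exists>x<q ^ L. branch_fam q L r x = C \<inter> R"
proof -
  have EQ: "E - Q \<subseteq> E" by blast
  obtain ws where ws: "length ws = L" "\<forall>w\<in>set ws. w < q"
    "fst (run_bits (concat (map (expand q) ws)) ({r}, {})) \<inter> R = C \<inter> R"
    using advice_complete[OF C EQ _ b q L, of r] r by blast
  obtain x where x: "x < q ^ L" "\<forall>j<L. dig q x j = ws ! j" using dig_surj[OF ws(2)] ws(1) by blast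
  have "map (dig q x) [0..<L] = ws" by (rule nth_equalityI) (use ws(1) x(2) in auto)
  moreover have "{r} \<inter> R = {r}" using r by blast
  ultimately have "branch_fam q L r x = C \<inter> R" using ws(3) by (simp add: branch_fam_def)
  then show ?thesis using x(1) by blast
qed

text \<open>From the empty set nothing can be done: all its cut values are 0 and it has no
  neighbours.\<close>

lemma branch_fam_empty:
  assumes "r \<notin> R" shows "branch_fam q L r x = {}"
proof -
  have "mval {} X = 0" for X
  proof -
    have "mval {} X \<le> d {}" by (rule mval_le) auto
    then show ?thesis by (simp add: d_def bd_def)
  qed
  then have "\<not> rule1 {} {} t" for t by (simp add: rule1_def)
  moreover have "\<not> nbr {} {} u" for u by (simp add: nbr_def)
  ultimately have "fst (pick {} {}) = 0" by (simp add: pick_def)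
  from run_bits_stuck[OF this] show ?thesis using assms by (simp add: branch_fam_def)
qed

lemma small_algorithm:
  fixes a b :: nat
  assumes n: "1 \<le> n" and k: "1 \<le> k" and R: "R = {..<n}" and b: "1 \<le> b" and eps: "\<epsilon> > 0"
    and ab: "4 / \<epsilon> \<le> real a / real b"
  defines "K \<equiv> min k n" and "H \<equiv> a * min k n div b"
  shows "\<exists>t st. exec (full_prog (setup_small a b) branch_decode) (input_state n E R k) t st \<and>
     t \<le> 16 + 10 * K + 18 * (a * K) + 6 * H + (psize (main_prog branch_decode) + 100) *
        ((n + (3 + 2 * H) + 2 * K + 2) ^ (2 * depth (main_prog branch_decode) + 2) * (3 + 2 * H) ^ (2 * K)) \<and>
     edge_separator {..<n} E R k (output_edges n st) \<and>
     real (card (output_edges n st)) \<le> (2 + \<epsilon>) * real (opt_separator {..<n} E R k)"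
proof -
  let ?q = "3 + 2 * H" and ?L = "2 * K"
  interpret search_n n E R branch_decode "branch_fam ?q ?L" ?L ?q K "?q ^ ?L"
    by (rule branch_search) simp
  have dec: "wf True branch_decode" "bounds branch_decode \<subseteq> {0, 3, 4, 6, 7}" by (auto simp: wf_of bounds_of)
  obtain t st where st: "exec (full_prog (setup_small a b) branch_decode) (input_state n E R k) t st"
     "t \<le> 16 + 10 * K + 18 * (a * K) + 6 * H + (psize (main_prog branch_decode) + 100) *
        ((n + ?q + ?L + 2) ^ (2 * depth (main_prog branch_decode) + 2) * ?q ^ ?L)"
     "edge_separator {..<n} E R K (output_edges n st)"
     "\<forall>r<n. \<forall>x<?q ^ ?L. opt (output_edges n st) (branch_fam ?q ?L r x)"
    using assemble[OF n k K_def[THEN meta_eq_to_obj_eq] refl dec setup_small_frame[of a b]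
        run_setup_small[OF _ b, of n E R k _ a, folded H_def, folded K_def]] by blast
  define F where "F = output_edges n st"
  have FE: "F \<subseteq> E" using st(3) by (simp add: edge_separator_def F_def)
  \<comment> \<open>The threshold on the boundary, up to rounding \<open>a / b\<close> times
    \<open>K\<^sup>2\<close> and thus at least \<open>4 / \<epsilon>\<close> times
    \<open>K\<^sup>2\<close>.\<close>
  define B where "B = a * K * K div b"
  have "real (card F) \<le> (2 + \<epsilon>) * real (opt_separator {..<n} E R k)"
  proof (rule ratio_bound[OF FE k])
    fix Q C assume Q: "edge_separator {..<n} E R k Q" "C \<in> components {..<n} (E - Q)"
    note C = component_card[OF Q, folded K_def]
    have QE: "Q \<subseteq> E" using Q(1) by (simp add: edge_separator_def)
    show "real (card (touch F C)) \<le> (1 + \<epsilon> / 2) * real (card (bd E C))"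
    proof (cases "d C \<le> B")
      case True
      obtain r where r: "r \<in> C \<inter> R" using C(2,3) R by blast
      have "a * K < (H + 1) * b"
        unfolding H_def K_def by (rule less_div_Suc_mult[OF b])
      then have "a * K * K \<le> (H + 1) * K * b"
        by (metis less_imp_le_nat mult.assoc mult.commute mult_le_mono1)
      then have "B \<le> (H + 1) * K" unfolding B_def using b
        by (metis div_le_mono div_mult_self_is_m less_le_trans zero_less_one)
      then have "2 * B \<le> (?q - 1) * K" by simp
      moreover have "(if {..<n} \<subseteq> R then card (C \<inter> R) else 2 * (card (C \<inter> R) + 2 * B) + 1) + K \<le> ?L"
        using C(1) R by simp
      ultimately obtain x where x: "x < ?q ^ ?L" "branch_fam ?q ?L r x = C \<inter> R"
        using branch_fam_complete[OF QE Q(2) r True, of ?q K ?L] by auto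
      have "r < n" using r C(2) by auto
      then have "opt F (branch_fam ?q ?L r x)" using st(4) x(1) unfolding F_def by blast
      then have "locopt F (C \<inter> R)" using x(2) C(1) by (simp add: opt_def)
      from locopt_touch[OF FE this C(2)] have "real (card (touch F C)) \<le> real (card (bd E C))" by simp
      also have "\<dots> \<le> (1 + \<epsilon> / 2) * real (card (bd E C))" using eps by (simp add: mult_le_cancel_right1)
      finally show ?thesis .
    next
      case False
      \<comment> \<open>A large boundary. Apart from boundary edges, \<open>F\<close> touches
        \<open>C\<close> only in edges inside \<open>C\<close>, which are at most
        \<open>K * K\<close>; as \<open>d C\<close> exceeds \<open>B\<close>, they fit into the
        slack.\<close>
      have CR: "C \<inter> R = C" using C(2) R by blast
      have fC: "finite C" using C(2) finite_subset by blast
      have "touch F C \<subseteq> bd E C \<union> (\<lambda>(u, v). {u, v}) ` (C \<times> C)"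
      proof
        fix e assume e: "e \<in> touch F C"
        then have eE: "e \<in> E" using FE by (auto simp: touch_def)
        then obtain u v where uv: "e = {u, v}" by (rule edgeE)
        show "e \<in> bd E C \<union> (\<lambda>(u, v). {u, v}) ` (C \<times> C)"
        proof (cases "e \<subseteq> C")
          case True
          then show ?thesis using uv by (intro UnI2 image_eqI[of _ _ "(u, v)"]) auto
        next
          case False
          then show ?thesis using e eE by (auto simp: touch_def bd_def)
        qed
      qed
      then have "card (touch F C) \<le> card (bd E C \<union> (\<lambda>(u, v). {u, v}) ` (C \<times> C))"
        using fC finite_E by (intro card_mono) (auto simp: bd_def)
      also have "\<dots> \<le> card (bd E C) + card ((\<lambda>(u, v). {u, v}) ` (C \<times> C))" by (rule card_Un_le)
      also have "card ((\<lambda>(u, v). {u, v}) ` (C \<times> C)) \<le> card (C \<times> C)" using fC by (intro card_image_le) simp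
      also have "card (C \<times> C) \<le> K * K" unfolding card_cartesian_product using C(1) CR by (simp add: mult_le_mono)
      finally have le: "real (card (touch F C)) \<le> real (card (bd E C)) + real K * real K"
        by (metis (mono_tags) add_left_mono of_nat_add of_nat_le_iff of_nat_mult)
      have "a * K * K < (B + 1) * b"
        unfolding B_def by (rule less_div_Suc_mult[OF b])
      also have "\<dots> \<le> d C * b" using False by (intro mult_le_mono1) simp
      finally have "real a * (real K * real K) \<le> real (card (bd E C)) * real b"
        unfolding d_def by (metis less_imp_le_nat mult.assoc of_nat_le_iff of_nat_mult)
      then have "(real a / real b) * (real K * real K) \<le> real (card (bd E C))"
        using b by (simp add: field_simps)
      moreover have "(4 / \<epsilon>) * (real K * real K) \<le> (real a / real b) * (real K * real K)"
        using ab by (intro mult_right_mono) auto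
      ultimately have "(4 / \<epsilon>) * (real K * real K) \<le> real (card (bd E C))" by linarith
      then have "4 * (real K * real K) \<le> \<epsilon> * real (card (bd E C))" using eps by (simp add: field_simps)
      moreover have "0 \<le> real K * real K" by simp
      ultimately have "2 * (real K * real K) \<le> \<epsilon> * real (card (bd E C))" by linarith
      then have "real K * real K \<le> \<epsilon> / 2 * real (card (bd E C))" by simp
      then show ?thesis using le by (simp add: algebra_simps)
    qed
  qed (use eps in simp)
  moreover have "K \<le> k" by (simp add: K_def)
  ultimately show ?thesis using st(1,2) separator_mono[OF st(3)] unfolding F_def by blast
qed

lemma card_touch_degree:
  assumes "T \<subseteq> {..<n}"
  shows "card (touch E T) \<le> card T * max_degree {..<n} E"
proof -
  have fT: "finite T" using assms finite_subset by blast
  have "touch E T = (\<Union>t\<in>T. {e \<in> E. t \<in> e})" by (auto simp: touch_def)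
  then have "card (touch E T) \<le> (\<Sum>t\<in>T. card {e \<in> E. t \<in> e})" using fT by (simp add: card_UN_le)
  also have "\<dots> \<le> (\<Sum>t\<in>T. max_degree {..<n} E)"
    unfolding max_degree_def using assms by (intro sum_mono Max_ge) auto
  finally show ?thesis by simp
qed

lemma degree_algorithm:
  fixes a b :: nat
  assumes n: "1 \<le> n" and k: "1 \<le> k" and b: "1 \<le> b" and eps: "\<epsilon> > 0"
    and ab: "4 / \<epsilon> \<le> real a / real b"
  defines "K \<equiv> min k n" and "D \<equiv> max_degree {..<n} E" and "H \<equiv> a * (min k n * max_degree {..<n} E) div b"
  defines "q \<equiv> if H = 0 then 1 else 2"
  shows "\<exists>t st. exec (full_prog (setup_degree a b) branch_decode) (input_state n E R k) t st \<and>
     t \<le> 30 + n * (13 * n + 12) + 10 * K + 9 * (K * D) + 18 * (a * (K * D)) + 10 * H +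
        (psize (main_prog branch_decode) + 100) *
        ((n + q + (2 * K + 6 * H + 1) + 2) ^ (2 * depth (main_prog branch_decode) + 2) * q ^ (2 * K + 6 * H + 1)) \<and>
     edge_separator {..<n} E R k (output_edges n st) \<and>
     real (card (output_edges n st)) \<le> (2 + \<epsilon>) * real (opt_separator {..<n} E R k)"
proof -
  let ?L = "2 * K + 6 * H + 1"
  have q1: "1 \<le> q" by (simp add: q_def)
  interpret search_n n E R branch_decode "branch_fam q ?L" ?L q K "q ^ ?L"
    by (rule branch_search[OF q1])
  have dec: "wf True branch_decode" "bounds branch_decode \<subseteq> {0, 3, 4, 6, 7}" by (auto simp: wf_of bounds_of)
  obtain t st where st: "exec (full_prog (setup_degree a b) branch_decode) (input_state n E R k) t st"
     "t \<le> 30 + n * (13 * n + 12) + 10 * K + 9 * (K * D) + 18 * (a * (K * D)) + 10 * H +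
        (psize (main_prog branch_decode) + 100) *
        ((n + q + ?L + 2) ^ (2 * depth (main_prog branch_decode) + 2) * q ^ ?L)"
     "edge_separator {..<n} E R K (output_edges n st)"
     "\<forall>r<n. \<forall>x<q ^ ?L. opt (output_edges n st) (branch_fam q ?L r x)"
    using assemble[OF n k K_def[THEN meta_eq_to_obj_eq] refl dec setup_degree_frame[of a b]
        run_setup_degree[OF _ b n, of k _ a, folded H_def, folded K_def D_def, folded q_def]] by blast
  define F where "F = output_edges n st"
  have FE: "F \<subseteq> E" using st(3) by (simp add: edge_separator_def F_def)
  \<comment> \<open>Local optimality for the empty terminal set is used twice: for components
    without terminals, and for the nonterminal part of a component with a large boundary.\<close>
  have empty: "locopt F {}" if "r < n" "r \<notin> R" for r
  proof -
    have "0 < q ^ ?L" using q1 by simp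
    then have "opt F (branch_fam q ?L r 0)" using st(4) that(1) unfolding F_def by blast
    then show ?thesis unfolding branch_fam_empty[OF that(2)] by (simp add: opt_def)
  qed
  have "real (card F) \<le> (2 + \<epsilon>) * real (opt_separator {..<n} E R k)"
  proof (rule ratio_bound[OF FE k])
    fix Q C assume Q: "edge_separator {..<n} E R k Q" "C \<in> components {..<n} (E - Q)"
    note C = component_card[OF Q, folded K_def]
    have QE: "Q \<subseteq> E" using Q(1) by (simp add: edge_separator_def)
    have slack: "real (card (bd E C)) \<le> (1 + \<epsilon> / 2) * real (card (bd E C))"
      using eps by (simp add: mult_le_cancel_right1)
    show "real (card (touch F C)) \<le> (1 + \<epsilon> / 2) * real (card (bd E C))"
    proof (cases "d C \<le> H")
      case True
      have "locopt F (C \<inter> R)"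
      proof (cases "C \<inter> R = {}")
        case True
        then show ?thesis using empty C(2,3) by auto
      next
        case ne: False
        then obtain r where r: "r \<in> C \<inter> R" by blast
        have "2 * H \<le> (q - 1) * (2 * H)" by (simp add: q_def)
        moreover have "(if {..<n} \<subseteq> R then card (C \<inter> R) else 2 * (card (C \<inter> R) + 2 * H) + 1) + 2 * H \<le> ?L"
          using C(1) by auto
        ultimately obtain x where x: "x < q ^ ?L" "branch_fam q ?L r x = C \<inter> R"
          using branch_fam_complete[OF QE Q(2) r True q1, of "2 * H" ?L] by auto
        have "r < n" using r C(2) by auto
        then have "opt F (branch_fam q ?L r x)" using st(4) x(1) unfolding F_def by blast
        then show ?thesis using x(2) C(1) by (simp add: opt_def)
      qed
      from locopt_touch[OF FE this C(2)] show ?thesis using slack by linarith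
    next
      case False
      \<comment> \<open>A large boundary. The move by the nonterminal part \<open>?Z\<close> is
        available and does not improve \<open>F\<close>. Removing the terminals from
        \<open>C\<close> enlarges the boundary by at most the \<open>K * D\<close> edges at
        terminals, and the edges of \<open>F\<close> at these terminals cost another
        \<open>K * D\<close>.\<close>
      let ?T = "C \<inter> R" and ?Z = "C - R"
      have fin: "finite (touch E X)" "finite (bd E X)" "finite (touch F X)" for X
        using finite_E finite_subset[OF FE] by (auto simp: touch_def bd_def)
      have tT: "card (touch E ?T) \<le> K * D"
      proof -
        have "card (touch E ?T) \<le> card ?T * D" unfolding D_def by (rule card_touch_degree) (use C(2) in blast)
        then show ?thesis using mult_le_mono1[OF C(1), of D] by linarith
      qed
      have tZ: "card (touch F ?Z) \<le> card (bd E C) + K * D"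
      proof (cases "?Z = {}")
        case True
        have "touch F ?Z = {}" unfolding True by (simp add: touch_def)
        then show ?thesis by (simp only: card.empty)
      next
        case ne: False
        then obtain r where "r < n" "r \<notin> R" using C(2) by auto
        then have "locopt F {}" by (rule empty)
        moreover have "?Z \<inter> R = {}" by blast
        ultimately have "card (touch F ?Z) \<le> card (bd E ?Z)" using C(2) by (intro locopt_touch FE) auto
        also have "bd E ?Z \<subseteq> bd E C \<union> touch E ?T" by (auto simp: bd_def touch_def)
        then have "card (bd E ?Z) \<le> card (bd E C \<union> touch E ?T)" using fin by (intro card_mono) auto
        also have "\<dots> \<le> card (bd E C) + card (touch E ?T)" by (rule card_Un_le)
        finally show ?thesis using tT by linarith
      qed
      have "touch F C \<subseteq> touch F ?Z \<union> touch E ?T" using FE by (auto simp: touch_def)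
      then have "card (touch F C) \<le> card (touch F ?Z \<union> touch E ?T)" using fin by (intro card_mono) auto
      also have "\<dots> \<le> card (touch F ?Z) + card (touch E ?T)" by (rule card_Un_le)
      finally have "card (touch F C) \<le> card (bd E C) + 2 * (K * D)" using tT tZ by linarith
      then have le: "real (card (touch F C)) \<le> real (card (bd E C)) + 2 * real (K * D)" by linarith
      \<comment> \<open>The loss \<open>2 * (K * D)\<close> has to be at most
        \<open>\<epsilon> / 2\<close> times the boundary, so the boundary must be at least
        \<open>4 / \<epsilon>\<close> times \<open>K * D\<close>; this is why \<open>a / b\<close>
        is required to be at least \<open>4 / \<epsilon>\<close>.\<close>
      have "a * (K * D) < (H + 1) * b"
        unfolding H_def K_def D_def by (rule less_div_Suc_mult[OF b])
      also have "\<dots> \<le> d C * b" using False by (intro mult_le_mono1) simp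
      finally have "real a * real (K * D) \<le> real (card (bd E C)) * real b"
        unfolding d_def by (metis less_imp_le_nat of_nat_le_iff of_nat_mult)
      then have "(real a / real b) * real (K * D) \<le> real (card (bd E C))"
        using b by (simp add: field_simps)
      moreover have "(4 / \<epsilon>) * real (K * D) \<le> (real a / real b) * real (K * D)"
        using ab by (intro mult_right_mono) auto
      ultimately have "(4 / \<epsilon>) * real (K * D) \<le> real (card (bd E C))" by linarith
      then have "4 * real (K * D) \<le> \<epsilon> * real (card (bd E C))" using eps by (simp add: field_simps)
      then have "2 * real (K * D) \<le> \<epsilon> / 2 * real (card (bd E C))" by simp
      then show ?thesis using le by (simp add: algebra_simps)
    qed
  qed (use eps in simp)
  moreover have "K \<le> k" by (simp add: K_def)
  ultimately show ?thesis using st(1,2) separator_mono[OF st(3)] unfolding F_def by blast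
qed

end

section \<open>Running times\<close>

text \<open>Programs compute with natural numbers, so \<open>4 / \<epsilon>\<close> is rounded up to
  a fraction, by at most a factor of 2. One of \<open>a\<close> and \<open>b\<close> is 1, which
  keeps the product with \<open>a\<close> that the setup forms before dividing small: it is the
  undivided product itself or already the quotient.\<close>

lemma rational_between:
  fixes \<epsilon> :: real
  assumes "\<epsilon> > 0"
  obtains a b :: nat where "1 \<le> a" "1 \<le> b" "a = 1 \<or> b = 1" "4 / \<epsilon> \<le> real a / real b" "real a / real b \<le> 8 / \<epsilon>"
proof (cases "\<epsilon> \<le> 4")
  case True
  define a where "a = nat \<lceil>4 / \<epsilon>\<rceil>"
  have ge: "1 \<le> 4 / \<epsilon>" using True assms by (simp add: field_simps)
  have a: "real a = of_int \<lceil>4 / \<epsilon>\<rceil>" using ge unfolding a_def by simp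
  have lo: "4 / \<epsilon> \<le> real a" unfolding a by (rule le_of_int_ceiling)
  have "real a < 4 / \<epsilon> + 1" unfolding a using ceiling_correct[of "4 / \<epsilon>"] by linarith
  then have "real a \<le> 8 / \<epsilon>" using ge by simp
  moreover have "1 \<le> a" using lo ge by linarith
  ultimately show ?thesis using that[of a 1] lo by simp
next
  case False
  define b where "b = nat \<lfloor>\<epsilon> / 4\<rfloor>"
  have ge: "1 \<le> \<epsilon> / 4" using False by simp
  have b: "real b = of_int \<lfloor>\<epsilon> / 4\<rfloor>" using ge unfolding b_def by simp
  have hi: "real b \<le> \<epsilon> / 4" unfolding b by (rule of_int_floor_le)
  have "\<epsilon> / 4 < real b + 1" unfolding b using floor_correct[of "\<epsilon> / 4"] by linarith
  moreover have b1: "1 \<le> b" unfolding b_def using ge by linarith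
  ultimately have lo: "\<epsilon> / 8 \<le> real b" by linarith
  have "4 / \<epsilon> \<le> 1 / real b" using hi b1 assms by (simp add: field_simps)
  moreover have "1 / real b \<le> 8 / \<epsilon>" using lo b1 assms by (simp add: field_simps)
  ultimately show ?thesis using that[of 1 b] b1 by simp
qed

lemma powr_nat: "(2 powr (x::real)) ^ m = 2 powr (x * real m)"
  by (simp add: powr_realpow[symmetric] powr_powr)

lemma fin_graph_n: "fin_graph {..<(n::nat)} E \<Longrightarrow> 1 \<le> n"
  by (cases n) (auto simp: fin_graph_def)

lemma subset_case:
  "\<exists>c::nat. \<exists>A. approx_algorithm A 2 (\<lambda>n E R k. True) (\<lambda>n E R k. real c * real n ^ (k + c))"
proof -
  define P where "P = psize (main_prog subset_decode) + 100"
  define D where "D = 2 * depth (main_prog subset_decode) + 2"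
  define c where "c = max (4 + P * 5 ^ D) D"
  have "approx_algorithm (full_prog setup_subset subset_decode) 2 (\<lambda>n E R k. True) (\<lambda>n E R k. real c * real n ^ (k + c))"
    unfolding approx_algorithm_def
  proof (intro allI impI)
    fix n :: nat and E :: "nat set set" and R :: "nat set" and k :: nat
    assume a: "fin_graph {..<n} E \<and> R \<subseteq> {..<n} \<and> 1 \<le> k \<and> True"
    then interpret graph_n n E R by unfold_locales auto
    have n: "1 \<le> n" using a fin_graph_n by blast
    obtain t st where st: "exec (full_prog setup_subset subset_decode) (input_state n E R k) t st"
      "t \<le> 4 + P * ((n + n + min k n + 2) ^ D * n ^ min k n)"
      "edge_separator {..<n} E R k (output_edges n st)"
      "real (card (output_edges n st)) \<le> 2 * real (opt_separator {..<n} E R k)"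
      using subset_algorithm[OF n, of k] a unfolding P_def D_def by blast
    have "(n + n + min k n + 2) ^ D \<le> (5 * n) ^ D" using n by (intro power_mono) auto
    moreover have "n ^ min k n \<le> n ^ k" using n by (intro power_increasing) auto
    ultimately have "(n + n + min k n + 2) ^ D * n ^ min k n \<le> (5 * n) ^ D * n ^ k" by (rule mult_le_mono)
    also have "\<dots> = 5 ^ D * n ^ (k + D)" by (simp add: power_mult_distrib power_add mult_ac)
    finally have "P * ((n + n + min k n + 2) ^ D * n ^ min k n) \<le> P * (5 ^ D * n ^ (k + D))" by (rule mult_le_mono2)
    moreover have "1 \<le> n ^ (k + D)" using n by simp
    ultimately have "t \<le> 4 * n ^ (k + D) + P * (5 ^ D * n ^ (k + D))" using st(2) by linarith
    also have "\<dots> = (4 + P * 5 ^ D) * n ^ (k + D)" by (simp add: algebra_simps)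
    also have "\<dots> \<le> c * n ^ (k + c)" using n unfolding c_def by (intro mult_le_mono power_increasing) auto
    finally have "real t \<le> real (c * n ^ (k + c))" by linarith
    then have "real t \<le> real c * real n ^ (k + c)" by simp
    then show "\<exists>t s. exec (full_prog setup_subset subset_decode) (input_state n E R k) t s \<and> real t \<le> real c * real n ^ (k + c) \<and>
        edge_separator {..<n} E R k (output_edges n s) \<and> real (card (output_edges n s)) \<le> 2 * real (opt_separator {..<n} E R k)"
      using st by blast
  qed
  then show ?thesis by blast
qed

lemma small_case:
  "\<exists>c::nat. \<forall>\<epsilon>::real. \<epsilon> > 0 \<longrightarrow>
      (\<exists>A. approx_algorithm A (2 + \<epsilon>) (\<lambda>n E R k. R = {..<n})
             (\<lambda>n E R k. real c * 2 powr (real c * (real k * max 1 (log 2 (real k / \<epsilon>)))) * real n ^ c))"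
proof -
  define P where "P = psize (main_prog branch_decode) + 100"
  define D where "D = 2 * depth (main_prog branch_decode) + 2"
  define c1 where "c1 = 50 + P * 6 ^ D"
  define c where "c = c1 + 6 * D + 12"
  have D1: "1 \<le> D" by (simp add: D_def)
  have "\<exists>A. approx_algorithm A (2 + \<epsilon>) (\<lambda>n E R k. R = {..<n})
      (\<lambda>n E R k. real c * 2 powr (real c * (real k * max 1 (log 2 (real k / \<epsilon>)))) * real n ^ c)"
    if eps: "\<epsilon> > 0" for \<epsilon> :: real
  proof -
    obtain a b where ab: "1 \<le> a" "1 \<le> b" "a = 1 \<or> b = 1" "4 / \<epsilon> \<le> real a / real b" "real a / real b \<le> 8 / \<epsilon>"
      using rational_between[OF eps] .
    have "approx_algorithm (full_prog (setup_small a b) branch_decode) (2 + \<epsilon>) (\<lambda>n E R k. R = {..<n})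
      (\<lambda>n E R k. real c * 2 powr (real c * (real k * max 1 (log 2 (real k / \<epsilon>)))) * real n ^ c)"
      unfolding approx_algorithm_def
    proof (intro allI impI)
      fix n :: nat and E :: "nat set set" and R :: "nat set" and k :: nat
      assume asm: "fin_graph {..<n} E \<and> R \<subseteq> {..<n} \<and> 1 \<le> k \<and> R = {..<n}"
      then interpret graph_n n E R by unfold_locales auto
      have n: "1 \<le> n" and k: "1 \<le> k" and R: "R = {..<n}" using asm fin_graph_n by blast+
      define K where "K = min k n"
      define H where "H = a * K div b"
      define q where "q = 3 + 2 * H"
      obtain t st where st: "exec (full_prog (setup_small a b) branch_decode) (input_state n E R k) t st"
        "t \<le> 16 + 10 * K + 18 * (a * K) + 6 * H + P * ((n + q + 2 * K + 2) ^ D * q ^ (2 * K))"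
        "edge_separator {..<n} E R k (output_edges n st)"
        "real (card (output_edges n st)) \<le> (2 + \<epsilon>) * real (opt_separator {..<n} E R k)"
        using small_algorithm[OF n k R ab(2) eps ab(4)] unfolding P_def D_def K_def H_def q_def by blast
      let ?x = "n * q"
      have q1: "1 \<le> q" by (simp add: q_def)
      have x: "n \<le> ?x" "q \<le> ?x" "1 \<le> ?x" using n q1 by (auto simp: Suc_le_eq)
      have Kn: "K \<le> n" "K \<le> k" by (simp_all add: K_def)
      have Hq: "H \<le> q" by (simp add: q_def)
      have aK: "a * K \<le> ?x"
        using ab(3)
      proof
        assume "a = 1" then show ?thesis using le_trans[OF Kn(1) x(1)] by simp
      next
        assume "b = 1" then have "a * K = H" by (simp add: H_def)
        then show ?thesis using le_trans[OF Hq x(2)] by simp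
      qed
      have W: "(n + q + 2 * K + 2) ^ D \<le> (6 * ?x) ^ D" by (rule power_mono) (use x Kn in linarith)+
      have "P * ((n + q + 2 * K + 2) ^ D * q ^ (2 * K)) \<le> P * ((6 * ?x) ^ D * q ^ (2 * K))"
        by (intro mult_le_mono2 mult_le_mono1 W)
      also have "\<dots> = P * 6 ^ D * (?x ^ D * q ^ (2 * K))" by (simp add: power_mult_distrib mult_ac)
      finally have 1: "P * ((n + q + 2 * K + 2) ^ D * q ^ (2 * K)) \<le> P * 6 ^ D * (?x ^ D * q ^ (2 * K))" .
      have "?x ^ 1 * 1 \<le> ?x ^ D * q ^ (2 * K)" using D1 x q1 by (intro mult_le_mono power_increasing) auto
      then have 2: "?x \<le> ?x ^ D * q ^ (2 * K)" by simp
      have "t \<le> 50 * ?x + P * 6 ^ D * (?x ^ D * q ^ (2 * K))" using st(2) 1 x aK Kn Hq by linarith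
      also have "\<dots> \<le> 50 * (?x ^ D * q ^ (2 * K)) + P * 6 ^ D * (?x ^ D * q ^ (2 * K))" using 2 by linarith
      also have "\<dots> = c1 * (n ^ D * q ^ (D + 2 * K))"
        by (simp add: c1_def power_mult_distrib power_add algebra_simps)
      finally have "real t \<le> real (c1 * (n ^ D * q ^ (D + 2 * K)))" by linarith
      then have tb: "real t \<le> real c1 * (real n ^ D * real q ^ (D + 2 * K))" by simp
      \<comment> \<open>The time bound is expressed through \<open>M\<close>, which dominates both 2
        and \<open>k / \<epsilon>\<close>. The maximum with 1 is needed because
        \<open>k / \<epsilon>\<close> may be small while the base \<open>q\<close> is at least
        3.\<close>
      define lam where "lam = max 1 (log 2 (real k / \<epsilon>))"
      define M where "M = 2 powr lam"
      have M2: "2 \<le> M"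
      proof -
        have "2 powr 1 \<le> (2::real) powr lam" unfolding lam_def by (intro powr_mono) auto
        then show ?thesis by (simp add: M_def)
      qed
      have kM: "real k / \<epsilon> \<le> M"
      proof -
        have "real k / \<epsilon> = 2 powr (log 2 (real k / \<epsilon>))" using k eps by simp
        also have "\<dots> \<le> M" unfolding M_def lam_def by (intro powr_mono) auto
        finally show ?thesis .
      qed
      have "real H \<le> real (a * K) / real b" unfolding H_def by (rule of_nat_div_le_of_nat)
      also have "\<dots> = real a / real b * real K" by simp
      also have "\<dots> \<le> 8 / \<epsilon> * real k" using ab(5) Kn eps by (intro mult_mono) auto
      also have "\<dots> = 8 * (real k / \<epsilon>)" by simp
      finally have "real H \<le> 8 * M" using kM by linarith
      \<comment> \<open>The constant 32 is the fifth power of 2, so it is absorbed by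
        \<open>M ^ 5\<close> and leaves \<open>q \<le> M ^ 6\<close>.\<close>
      then have "real q \<le> 32 * M" using M2 unfolding q_def by simp
      also have "32 * M \<le> M ^ 5 * M"
      proof -
        have "(2::real) ^ 5 \<le> M ^ 5" using M2 by (intro power_mono) auto
        then show ?thesis using M2 by (intro mult_right_mono) auto
      qed
      also have "\<dots> = M ^ 6" by (simp add: numeral_eq_Suc)
      finally have qM: "real q \<le> M ^ 6" .
      have "real q ^ (D + 2 * K) \<le> (M ^ 6) ^ (D + 2 * K)" using qM by (intro power_mono) auto
      also have "\<dots> = M ^ (6 * (D + 2 * K))" by (rule power_mult[symmetric])
      also have "\<dots> \<le> M ^ ((6 * D + 12) * k)"
      proof (rule power_increasing)
        have "D \<le> D * k" using k by simp
        then have "6 * D + 12 * K \<le> 6 * (D * k) + 12 * k" using Kn(2) by (intro add_mono mult_le_mono2)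
        also have "\<dots> = (6 * D + 12) * k" by (simp add: algebra_simps)
        finally show "6 * (D + 2 * K) \<le> (6 * D + 12) * k" by simp
      qed (use M2 in simp)
      also have "\<dots> = 2 powr (lam * real ((6 * D + 12) * k))" unfolding M_def by (rule powr_nat)
      also have "\<dots> \<le> 2 powr (real c * (real k * lam))"
      proof (rule powr_mono)
        have "0 \<le> lam" by (simp add: lam_def)
        then have "real (6 * D + 12) * (real k * lam) \<le> real c * (real k * lam)"
          by (intro mult_right_mono) (auto simp: c_def)
        then show "lam * real ((6 * D + 12) * k) \<le> real c * (real k * lam)" by (simp add: mult_ac)
      qed simp
      finally have qb: "real q ^ (D + 2 * K) \<le> 2 powr (real c * (real k * lam))" .
      have nb: "real n ^ D \<le> real n ^ c" using n by (intro power_increasing) (auto simp: c_def)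
      have "real c1 * (real n ^ D * real q ^ (D + 2 * K)) \<le> real c * (real n ^ c * 2 powr (real c * (real k * lam)))"
        using nb qb by (intro mult_mono) (auto simp: c_def)
      then have "real t \<le> real c * 2 powr (real c * (real k * max 1 (log 2 (real k / \<epsilon>)))) * real n ^ c"
        using tb by (simp add: lam_def mult_ac)
      then show "\<exists>t s. exec (full_prog (setup_small a b) branch_decode) (input_state n E R k) t s \<and>
          real t \<le> real c * 2 powr (real c * (real k * max 1 (log 2 (real k / \<epsilon>)))) * real n ^ c \<and>
          edge_separator {..<n} E R k (output_edges n s) \<and>
          real (card (output_edges n s)) \<le> (2 + \<epsilon>) * real (opt_separator {..<n} E R k)"
        using st by blast
    qed
    then show ?thesis by blast
  qed
  then show ?thesis by blast
qed

lemma (in graph_n) max_degree_le: "1 \<le> n \<Longrightarrow> max_degree {..<n} E \<le> card E"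
proof -
  assume n: "1 \<le> n"
  have "{..<n} \<noteq> {}" using n by (metis lessThan_empty_iff not_one_le_zero)
  then show ?thesis unfolding max_degree_def
    using finite_E by (subst Max_le_iff) (auto intro!: card_mono)
qed

lemma degree_case:
  "\<exists>c::nat. \<forall>\<epsilon>::real. \<epsilon> > 0 \<longrightarrow>
      (\<exists>A. approx_algorithm A (2 + \<epsilon>) (\<lambda>n E R k. True)
             (\<lambda>n E R k. real c * 2 powr (real c * (real k ^ 2 * real (max_degree {..<n} E) / \<epsilon>)) * real n ^ c))"
proof -
  define P where "P = psize (main_prog branch_decode) + 100"
  define e where "e = 2 * depth (main_prog branch_decode) + 2"
  define c1 where "c1 = 147 + P * 14 ^ e"
  define c where "c = c1 + (8 * e + 72) + (e + 3)"
  have e1: "1 \<le> e" by (simp add: e_def)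
  have "\<exists>A. approx_algorithm A (2 + \<epsilon>) (\<lambda>n E R k. True)
      (\<lambda>n E R k. real c * 2 powr (real c * (real k ^ 2 * real (max_degree {..<n} E) / \<epsilon>)) * real n ^ c)"
    if eps: "\<epsilon> > 0" for \<epsilon> :: real
  proof -
    obtain a b where ab: "1 \<le> a" "1 \<le> b" "a = 1 \<or> b = 1" "4 / \<epsilon> \<le> real a / real b" "real a / real b \<le> 8 / \<epsilon>"
      using rational_between[OF eps] .
    have "approx_algorithm (full_prog (setup_degree a b) branch_decode) (2 + \<epsilon>) (\<lambda>n E R k. True)
      (\<lambda>n E R k. real c * 2 powr (real c * (real k ^ 2 * real (max_degree {..<n} E) / \<epsilon>)) * real n ^ c)"
      unfolding approx_algorithm_def
    proof (intro allI impI)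
      fix n :: nat and E :: "nat set set" and R :: "nat set" and k :: nat
      assume asm: "fin_graph {..<n} E \<and> R \<subseteq> {..<n} \<and> 1 \<le> k \<and> True"
      then interpret graph_n n E R by unfold_locales auto
      have n: "1 \<le> n" and k: "1 \<le> k" using asm fin_graph_n by blast+
      define K where "K = min k n"
      define D where "D = max_degree {..<n} E"
      define H where "H = a * (K * D) div b"
      define q where "q = (if H = 0 then 1 else 2 :: nat)"
      define L where "L = 2 * K + 6 * H + 1"
      obtain t st where st: "exec (full_prog (setup_degree a b) branch_decode) (input_state n E R k) t st"
        "t \<le> 30 + n * (13 * n + 12) + 10 * K + 9 * (K * D) + 18 * (a * (K * D)) + 10 * H + P * ((n + q + L + 2) ^ e * q ^ L)"
        "edge_separator {..<n} E R k (output_edges n st)"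
        "real (card (output_edges n st)) \<le> (2 + \<epsilon>) * real (opt_separator {..<n} E R k)"
        using degree_algorithm[OF n k ab(2) eps ab(4)] unfolding P_def e_def K_def D_def H_def q_def L_def by blast
      have Kn: "K \<le> n" "K \<le> k" "1 \<le> K" using n k by (simp_all add: K_def)
      have q12: "1 \<le> q" "q \<le> 2" by (simp_all add: q_def)
      let ?x = "n * (H + 1)" and ?N = "n ^ 3"
      have n3: "n \<le> ?N" "n * n \<le> ?N" "1 \<le> ?N"
        using n by (simp_all add: power3_eq_cube Suc_le_eq)
      have "D < n + n * n" using max_degree_le[OF n] card_E[OF n] unfolding D_def by linarith
      moreover have "n \<le> n * n" using n by (simp add: Suc_le_eq)
      ultimately have "D \<le> 2 * (n * n)" by linarith
      then have "K * D \<le> n * (2 * (n * n))" using Kn by (intro mult_le_mono) auto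
      also have "\<dots> = 2 * ?N" by (simp add: power3_eq_cube)
      finally have KD: "K * D \<le> 2 * ?N" .
      have aKD: "a * (K * D) \<le> 2 * ?N + H"
        using ab(3)
      proof
        assume "a = 1" then show ?thesis using KD by simp
      next
        assume "b = 1" then show ?thesis by (simp add: H_def)
      qed
      have n13: "n * (13 * n + 12) \<le> 25 * ?N"
      proof -
        have "n * (13 * n + 12) = 13 * (n * n) + 12 * n" by (simp add: algebra_simps)
        then show ?thesis using n3 by linarith
      qed
      have HN: "H \<le> ?N * H" using n3(3) by simp
      have "30 + n * (13 * n + 12) + 10 * K + 9 * (K * D) + 18 * (a * (K * D)) + 10 * H \<le> 147 * ?N + 28 * H"
        using n13 n3 KD aKD Kn by linarith
      also have "\<dots> \<le> 147 * (?N * (H + 1))" using HN unfolding add_mult_distrib2 by linarith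
      finally have cost: "30 + n * (13 * n + 12) + 10 * K + 9 * (K * D) + 18 * (a * (K * D)) + 10 * H \<le> 147 * (?N * (H + 1))" .
      let ?B = "n ^ (e + 3) * ((H + 1) ^ e * q ^ L)"
      have "?N * (H + 1) ^ 1 * 1 \<le> n ^ (e + 3) * (H + 1) ^ e * q ^ L"
        using e1 n q12 by (intro mult_le_mono power_increasing) auto
      then have 1: "?N * (H + 1) \<le> ?B" by (simp add: mult.assoc)
      have "H \<le> n * H" using n by simp
      then have W: "n + q + L + 2 \<le> 14 * ?x" using Kn q12 n unfolding L_def add_mult_distrib2 by linarith
      have "(n + q + L + 2) ^ e * q ^ L \<le> (14 * ?x) ^ e * q ^ L" by (intro mult_le_mono1 power_mono W) simp
      also have "\<dots> = 14 ^ e * (n ^ e * ((H + 1) ^ e * q ^ L))" by (simp only: power_mult_distrib mult_ac)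
      also have "\<dots> \<le> 14 ^ e * ?B" using n by (intro mult_le_mono2 mult_le_mono1 power_increasing) auto
      finally have "P * ((n + q + L + 2) ^ e * q ^ L) \<le> P * (14 ^ e * ?B)" by (rule mult_le_mono2)
      then have "t \<le> 147 * ?B + P * (14 ^ e * ?B)" using st(2) cost 1 by linarith
      also have "\<dots> = c1 * ?B" by (simp add: c1_def algebra_simps)
      finally have "real t \<le> real (c1 * ?B)" by linarith
      then have tb: "real t \<le> real c1 * (real n ^ (e + 3) * ((real H + 1) ^ e * real q ^ L))" by (simp add: add.commute)
      define y where "y = real k ^ 2 * real D / \<epsilon>"
      have y0: "0 \<le> y" using eps by (simp add: y_def)
      have "real H \<le> real (a * (K * D)) / real b" unfolding H_def by (rule of_nat_div_le_of_nat)
      also have "\<dots> = real a / real b * real (K * D)" by simp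
      also have "\<dots> \<le> 8 / \<epsilon> * real (K * D)" using ab(5) by (intro mult_right_mono) auto
      finally have H8: "real H \<le> 8 * (real K * real D / \<epsilon>)" by simp
      have sq: "real K * real K * real D / \<epsilon> \<le> y"
        unfolding y_def power2_eq_square using Kn eps by (intro divide_right_mono mult_right_mono mult_mono) auto
      have KKK: "real K * real D / \<epsilon> \<le> real K * real K * real D / \<epsilon>"
        using Kn(3) eps by (intro divide_right_mono mult_right_mono) auto
      have Hy: "real H \<le> 8 * y" using H8 KKK sq by linarith
      \<comment> \<open>A polynomial in \<open>H\<close>, which may be large for small
        \<open>\<epsilon>\<close>, is absorbed by the exponential factor.\<close>
      have "real H + 1 \<le> 2 ^ H" using of_nat_mono[OF Suc_leI[OF less_exp[of H]], where 'a = real] by simp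
      also have "\<dots> = 2 powr (real H)" by (simp add: powr_realpow)
      also have "\<dots> \<le> 2 powr (8 * y)" using Hy by (intro powr_mono) auto
      finally have "(real H + 1) ^ e \<le> (2 powr (8 * y)) ^ e" by (intro power_mono) auto
      then have Hb: "(real H + 1) ^ e \<le> 2 powr (8 * y * real e)" by (simp only: powr_nat)
      \<comment> \<open>For \<open>H = 0\<close> there is one string. Otherwise
        \<open>K * D / \<epsilon>\<close> is at least 1/8, so \<open>K \<le> 8 * y\<close>; here the
        exponent uses the square of \<open>k\<close>. Then \<open>2 * K\<close>,
        \<open>6 * H\<close> and 1 are at most \<open>16 * y\<close>, \<open>48 * y\<close> and
        \<open>8 * y\<close>, together \<open>72 * y\<close>.\<close>
      have qb: "real q ^ L \<le> 2 powr (72 * y)"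
      proof (cases "H = 0")
        case True
        have "(2::real) powr 0 \<le> 2 powr (72 * y)" using y0 by (intro powr_mono) auto
        then show ?thesis using True by (simp add: q_def)
      next
        case False
        then have H1: "1 \<le> real H" by simp
        then have "1 \<le> 8 * (real K * real D / \<epsilon>)" using H8 by linarith
        then have "real K * 1 \<le> real K * (8 * (real K * real D / \<epsilon>))" by (intro mult_left_mono) auto
        also have "\<dots> = 8 * (real K * real K * real D / \<epsilon>)" by simp
        finally have "real K \<le> 8 * y" using sq by linarith
        then have "real L \<le> 72 * y" using Hy H1 unfolding L_def by simp
        then have "2 powr (real L) \<le> (2::real) powr (72 * y)" by (intro powr_mono) auto
        then show ?thesis using False by (simp add: q_def powr_realpow)
      qed
      have "(real H + 1) ^ e * real q ^ L \<le> 2 powr (8 * y * real e) * 2 powr (72 * y)"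
        using Hb qb by (intro mult_mono) auto
      also have "\<dots> = 2 powr ((8 * real e + 72) * y)" by (simp add: powr_add[symmetric] algebra_simps)
      also have "\<dots> \<le> 2 powr (real c * y)"
        using y0 by (intro powr_mono mult_right_mono) (auto simp: c_def)
      finally have eb: "(real H + 1) ^ e * real q ^ L \<le> 2 powr (real c * y)" .
      have nb: "real n ^ (e + 3) \<le> real n ^ c" using n by (intro power_increasing) (auto simp: c_def)
      have "real c1 * (real n ^ (e + 3) * ((real H + 1) ^ e * real q ^ L)) \<le> real c * (real n ^ c * 2 powr (real c * y))"
        using nb eb by (intro mult_mono) (auto simp: c_def)
      then have "real t \<le> real c * 2 powr (real c * (real k ^ 2 * real (max_degree {..<n} E) / \<epsilon>)) * real n ^ c"
        using tb by (simp add: y_def D_def mult_ac)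
      then show "\<exists>t s. exec (full_prog (setup_degree a b) branch_decode) (input_state n E R k) t s \<and>
          real t \<le> real c * 2 powr (real c * (real k ^ 2 * real (max_degree {..<n} E) / \<epsilon>)) * real n ^ c \<and>
          edge_separator {..<n} E R k (output_edges n s) \<and>
          real (card (output_edges n s)) \<le> (2 + \<epsilon>) * real (opt_separator {..<n} E R k)"
        using st by blast
    qed
    then show ?thesis by blast
  qed
  then show ?thesis by blast
qed

theorem theorem1p6:
  "(\<exists>c::nat. \<forall>\<epsilon>::real. \<epsilon> > 0 \<longrightarrow>
      (\<exists>A. approx_algorithm A (2 + \<epsilon>) (\<lambda>n E R k. R = {..<n})
             (\<lambda>n E R k. real c * 2 powr (real c * (real k * max 1 (log 2 (real k / \<epsilon>)))) * real n ^ c)))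
   \<and> (\<exists>c::nat. \<exists>A. approx_algorithm A 2 (\<lambda>n E R k. True)
             (\<lambda>n E R k. real c * real n ^ (k + c)))
   \<and> (\<exists>c::nat. \<forall>\<epsilon>::real. \<epsilon> > 0 \<longrightarrow>
      (\<exists>A. approx_algorithm A (2 + \<epsilon>) (\<lambda>n E R k. True)
             (\<lambda>n E R k. real c * 2 powr (real c * (real k ^ 2 * real (max_degree {..<n} E) / \<epsilon>)) * real n ^ c)))"
  using small_case subset_case degree_case by blast

end
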